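(* Let $k\ge2$ (possibly $k=\infty$) and let $(X,\hat g)$ be a generalized pseudo-Riemannian manifold with $\hat g_{ab}\approx_k g_{ab}$, where $g_{ab}$ is a classical $C^k$ pseudo-Riemannian metric on $X$. Then the generalized Riemannian curvature tensor $\hat R_{abc}{}^d$, the generalized Ricci tensor $\hat R_{ab}$, the generalized curvature scalar $\hat R$ and the generalized Einstein tensor $\hat G_{ab}$ of $\hat g$ are $C^{k-2}$-associated with their classical counterparts, i.e. $$\hat R_{abc}{}^d\approx_{k-2}R_{abc}{}^d,\quad\hat R_{ab}\approx_{k-2}R_{ab},\quad\hat R\approx_{k-2}R,\quad\hat G_{ab}\approx_{k-2}G_{ab},$$ where $R_{abc}{}^d,R_{ab},R,G_{ab}$ are the corresponding curvature quantities of $g$.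
   Context: $X$ is a paracompact smooth Hausdorff manifold; all functions and tensor fields are real. $\mathcal G(X):=\mathcal E_M(X)/\mathcal N(X)$, where $\mathcal E_M(X)$ is the set of nets $(u_\varepsilon)_{\varepsilon\in(0,1]}$ in $C^\infty(X)$ such that for every compact $K\subset X$ and every linear differential operator $P$ there is $N\in\mathbb N$ with $\sup_K|Pu_\varepsilon|=O(\varepsilon^{-N})$ as $\varepsilon\to0$; $\mathcal N(X)$ consists of those with $\sup_K|u_\varepsilon|=O(\varepsilon^m)$ for all compact $K$ and all $m\in\mathbb N_0$. $\mathcal R$ denotes the ring of generalized real numbers (real nets with $|r_\varepsilon|=O(\varepsilon^{-N})$ for some $N$, modulo nets with $|r_\varepsilon|=O(\varepsilon^m)$ for all $m$). The $\mathcal G(X)$-module $\mathcal G^r_s(X)$ (generalized $(r,s)$-tensor fields) is defined analogously to $\mathcal G(X)$: nets $(s_\varepsilon)_\varepsilon$ of smooth $(r,s)$-tensor fields with $\sup_K\|Ps_\varepsilon\|=O(\varepsilon^{-N})$ for each compact $K$ and linear differential operator $P$ on $(r,s)$-tensor fields (some $N$), modulo those with $\sup_K\|s_\varepsilon\|=O(\varepsilon^m)$ for all $K$, $m$. Operations (contraction, action of vector fields on functions, Lie bracket) are $\varepsilon$-wise on representatives. $\hat g\in\mathcal G^0_2(X)$ is a generalized pseudo-Riemannian metric, and $(X,\hat g)$ a generalized pseudo-Riemannian manifold, if (1) in every chart the determinant of the matrix of components of $\hat g$ is invertible in the Colombeau algebra over the chart domain, (2) for each relatively compact open $V\subseteq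 X$ there are a representative $(\hat g_\varepsilon)_\varepsilon$ of $\hat g$ and $\varepsilon_0>0$ such that $\hat g_\varepsilon|_V$ is a smooth pseudo-Riemannian metric for all $\varepsilon<\varepsilon_0$, and (3) $\hat g$ possesses an index $j$, different from $0$: the representatives in (2) can be chosen so that $\hat g_\varepsilon|_V$ has index $j$, with the same $j$ for all $V$. The inverse metric $\hat g^{ab}\in\mathcal G^2_0(X)$ is given locally by the classes of the pointwise inverse matrices of $\hat g_{ij\,\varepsilon}$ ($\varepsilon$ small). The generalized Levi-Civita connection of $(X,\hat g)$ is the unique map $\hat D:\mathcal G^1_0(X)^2\to\mathcal G^1_0(X)$ with $\hat D_\xi\eta$ $\mathcal R$-linear in $\eta$, $\mathcal G(X)$-linear in $\xi$, $\hat D_\xi(u\eta)=u\hat D_\xi\eta+\xi(u)\eta$ for $u\in\mathcal G(X)$, $[\xi,\eta]=\hat D_\xi\eta-\hat D_\eta\xi$ and $\xi\,\hat g(\eta,\zeta)=\hat g(\hat D_\xi\eta,\zeta)+\hat g(\eta,\hat D_\xi\zeta)$. Curvature quantities: $\hat R_{abc}{}^d\in\mathcal G^1_3(X)$ is the tensor given by $\hat R_{\xi,\eta}\zeta:=\hat D_{[\xi,\eta]}\zeta-[\hat D_\xi,\hat D_\eta]\zeta$, with $(\hat R_{\xi,\eta}\zeta)^d=\hat R_{abc}{}^d\xi^a\eta^b\zeta^c$; $\hat R_{ab}:=\hat R_{cab}{}^c\in\mathcal G^0_2(X)$; $\hat R:=\hat g^{ab}\hat R_{ab}\in\mathcal G(X)$;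 $\hat G_{ab}:=\hat R_{ab}-\frac12\hat R\,\hat g_{ab}\in\mathcal G^0_2(X)$. The classical counterparts for $g$ are defined by the same formulas (same conventions) from the Levi-Civita connection of $g$. $C^l$-association ($0\le l\le\infty$): for a generalized tensor field (or function) $s$ and a $C^l$ tensor field $t$ of the same type, $s\approx_l t$ means that for one (hence every) representative, in every chart all components of $s_\varepsilon$ converge as $\varepsilon\to0$ to those of $t$ uniformly on compact sets in all derivatives of order $\le l$ (all finite orders if $l=\infty$). *)

theory Defs
  imports "HOL-Analysis.Analysis"
begin

section \<open>Calculus on open subsets of \<open>real ^ 'n\<close>\<close>

definition partial :: "'n::finite \<Rightarrow> (real^'n \<Rightarrow> real) \<Rightarrow> real^'n \<Rightarrow> real" where
  "partial i f x = frechet_derivative f (at x) (axis i 1)"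

text \<open>Multi-indices are lists of coordinate directions; the order of a derivative is the length
  of the list.\<close>

definition partials :: "'n::finite list \<Rightarrow> (real^'n \<Rightarrow> real) \<Rightarrow> real^'n \<Rightarrow> real" where
  "partials \<alpha> f = foldr partial \<alpha> f"

text \<open>\<open>S\<close> is an open set in all uses; \<open>l = \<infinity>\<close> means smooth.\<close>

definition Ck_on :: "enat \<Rightarrow> (real^'n::finite \<Rightarrow> real) \<Rightarrow> (real^'n) set \<Rightarrow> bool" where
  "Ck_on l f S \<longleftrightarrow>
     (\<forall>\<alpha>. enat (length \<alpha>) \<le> l \<longrightarrow> continuous_on S (partials \<alpha> f)) \<and>
     (\<forall>\<alpha>. enat (length \<alpha>) < l \<longrightarrow> partials \<alpha> f differentiable_on S)"


section \<open>Smooth manifolds\<close>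

definition paracompact_space :: "'a topology \<Rightarrow> bool" where
  "paracompact_space T \<longleftrightarrow>
     (\<forall>\<U>. (\<forall>U\<in>\<U>. openin T U) \<and> \<Union>\<U> = topspace T \<longrightarrow>
        (\<exists>\<V>. (\<forall>V\<in>\<V>. openin T V) \<and> \<Union>\<V> = topspace T \<and>
             (\<forall>V\<in>\<V>. \<exists>U\<in>\<U>. V \<subseteq> U) \<and> locally_finite_in T \<V>))"

text \<open>A chart is a pair of its domain and its coordinate map; the values of the coordinate map
  outside the domain are irrelevant.\<close>

type_synonym ('a, 'n) chart = "'a set \<times> ('a \<Rightarrow> real^'n)"

definition is_chart :: "'a topology \<Rightarrow> ('a, 'n::finite) chart \<Rightarrow> bool" where
  "is_chart T c \<longleftrightarrow> openin T (fst c) \<and> open (snd c ` fst c) \<and>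
     homeomorphic_map (subtopology T (fst c)) (top_of_set (snd c ` fst c)) (snd c)"

definition chart_inv :: "('a, 'n::finite) chart \<Rightarrow> real^'n \<Rightarrow> 'a" where
  "chart_inv c = inv_into (fst c) (snd c)"

definition smooth_transition :: "('a, 'n::finite) chart \<Rightarrow> ('a, 'n) chart \<Rightarrow> bool" where
  "smooth_transition c c' \<longleftrightarrow>
     (\<forall>i. Ck_on \<infinity> (\<lambda>x. snd c' (chart_inv c x) $ i) (snd c ` (fst c \<inter> fst c')))"

record ('a, 'n) mfd =
  mtop :: "'a topology"
  atlas :: "('a set \<times> ('a \<Rightarrow> real^'n)) set"

text \<open>The atlas is required to be maximal, so that \<open>c \<in> atlas M\<close> ranges over all charts of the
  smooth structure. The dimension is \<open>CARD('n)\<close>.\<close>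

definition smooth_manifold :: "('a, 'n::finite) mfd \<Rightarrow> bool" where
  "smooth_manifold M \<longleftrightarrow>
     Hausdorff_space (mtop M) \<and> paracompact_space (mtop M) \<and>
     (\<forall>c\<in>atlas M. is_chart (mtop M) c) \<and>
     (\<Union>c\<in>atlas M. fst c) = topspace (mtop M) \<and>
     (\<forall>c\<in>atlas M. \<forall>c'\<in>atlas M. smooth_transition c c') \<and>
     (\<forall>c. is_chart (mtop M) c \<and>
          (\<forall>c'\<in>atlas M. smooth_transition c c' \<and> smooth_transition c' c) \<longrightarrow> c \<in> atlas M)"

definition restrict_mfd :: "('a, 'n::finite) mfd \<Rightarrow> 'a set \<Rightarrow> ('a, 'n) mfd" where
  "restrict_mfd M U = \<lparr>mtop = subtopology (mtop M) U, atlas = {c \<in> atlas M. fst c \<subseteq> U}\<rparr>"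


section \<open>Tensor fields\<close>

text \<open>An \<open>(r,s)\<close>-tensor field is given by its components in all charts: \<open>t c p I J\<close> is the
  component at the point \<open>p\<close> in the chart \<open>c\<close> with upper (contravariant) indices \<open>I\<close>, a list of
  length \<open>r\<close>, and lower (covariant) indices \<open>J\<close>, a list of length \<open>s\<close>; different charts are related
  by the tensor transformation law. The value is \<open>0\<close> wherever this makes no sense, so that
  equality of tensor fields is equality of functions. Functions on the manifold are the
  \<open>(0,0)\<close>-tensor fields.\<close>

type_synonym ('a, 'n) tfield = "('a, 'n) chart \<Rightarrow> 'a \<Rightarrow> 'n list \<Rightarrow> 'n list \<Rightarrow> real"

text \<open>\<open>jac c c' p i j\<close> is the derivative of the \<open>i\<close>-th coordinate of \<open>c'\<close> with respect to the
  \<open>j\<close>-th coordinate of \<open>c\<close>.\<close>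

definition jac :: "('a, 'n::finite) chart \<Rightarrow> ('a, 'n) chart \<Rightarrow> 'a \<Rightarrow> 'n \<Rightarrow> 'n \<Rightarrow> real" where
  "jac c c' p i j = partial j (\<lambda>x. snd c' (chart_inv c x) $ i) (snd c p)"

definition is_tensor :: "('a, 'n::finite) mfd \<Rightarrow> nat \<Rightarrow> nat \<Rightarrow> ('a, 'n) tfield \<Rightarrow> bool" where
  "is_tensor M r s t \<longleftrightarrow>
     (\<forall>c p I J. \<not> (c \<in> atlas M \<and> p \<in> fst c \<and> length I = r \<and> length J = s) \<longrightarrow> t c p I J = 0) \<and>
     (\<forall>c\<in>atlas M. \<forall>c'\<in>atlas M. \<forall>p\<in>fst c \<inter> fst c'. \<forall>I' J'. length I' = r \<and> length J' = s \<longrightarrow>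
        t c' p I' J' =
          (\<Sum>I | length I = r. \<Sum>J | length J = s.
             (\<Prod>m<r. jac c c' p (I' ! m) (I ! m)) * (\<Prod>m<s. jac c' c p (J ! m) (J' ! m)) *
             t c p I J))"

definition comp_in :: "('a, 'n::finite) chart \<Rightarrow> ('a, 'n) tfield \<Rightarrow> 'n list \<Rightarrow> 'n list \<Rightarrow> real^'n \<Rightarrow> real" where
  "comp_in c t I J = (\<lambda>x. t c (chart_inv c x) I J)"

definition Ck_tensor :: "('a, 'n::finite) mfd \<Rightarrow> enat \<Rightarrow> nat \<Rightarrow> nat \<Rightarrow> ('a, 'n) tfield \<Rightarrow> bool" where
  "Ck_tensor M l r s t \<longleftrightarrow> is_tensor M r s t \<and>
     (\<forall>c\<in>atlas M. \<forall>I J. Ck_on l (comp_in c t I J) (snd c ` fst c))"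

definition lin_diff_op ::
    "('a, 'n::finite) mfd \<Rightarrow> nat \<Rightarrow> nat \<Rightarrow> (('a, 'n) tfield \<Rightarrow> ('a, 'n) tfield) \<Rightarrow> bool" where
  "lin_diff_op M r s P \<longleftrightarrow>
     (\<forall>t. Ck_tensor M \<infinity> r s t \<longrightarrow> Ck_tensor M \<infinity> r s (P t)) \<and>
     (\<exists>m::nat. \<forall>c\<in>atlas M. \<exists>a.
        (\<forall>\<alpha> I J I' J'. Ck_on \<infinity> (a \<alpha> I J I' J') (snd c ` fst c)) \<and>
        (\<forall>t. Ck_tensor M \<infinity> r s t \<longrightarrow>
          (\<forall>p\<in>fst c. \<forall>I J. length I = r \<and> length J = s \<longrightarrow>
             P t c p I J =
               (\<Sum>\<alpha> | length \<alpha> \<le> m. \<Sum>I' | length I' = r. \<Sum>J' | length J' = s.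
                  a \<alpha> I J I' J' (snd c p) * partials \<alpha> (comp_in c t I' J') (snd c p)))))"


section \<open>Operations on tensor fields\<close>

text \<open>\<open>fld M r s f\<close> has the components \<open>f\<close>, cut off to \<open>0\<close> where components make no sense.\<close>

definition fld :: "('a, 'n::finite) mfd \<Rightarrow> nat \<Rightarrow> nat \<Rightarrow> ('a, 'n) tfield \<Rightarrow> ('a, 'n) tfield" where
  "fld M r s f = (\<lambda>c p I J.
     if c \<in> atlas M \<and> p \<in> fst c \<and> length I = r \<and> length J = s then f c p I J else 0)"

definition tadd :: "('a, 'n) tfield \<Rightarrow> ('a, 'n) tfield \<Rightarrow> ('a, 'n) tfield" where
  "tadd t u = (\<lambda>c p I J. t c p I J + u c p I J)"

definition tsub :: "('a, 'n) tfield \<Rightarrow> ('a, 'n) tfield \<Rightarrow> ('a, 'n) tfield" where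
  "tsub t u = (\<lambda>c p I J. t c p I J - u c p I J)"

definition tscale :: "real \<Rightarrow> ('a, 'n) tfield \<Rightarrow> ('a, 'n) tfield" where
  "tscale a t = (\<lambda>c p I J. a * t c p I J)"

definition fmul :: "('a, 'n) tfield \<Rightarrow> ('a, 'n) tfield \<Rightarrow> ('a, 'n) tfield" where
  "fmul f t = (\<lambda>c p I J. f c p [] [] * t c p I J)"

definition coord_deriv ::
    "('a, 'n::finite) chart \<Rightarrow> 'n \<Rightarrow> ('a, 'n) tfield \<Rightarrow> 'a \<Rightarrow> 'n list \<Rightarrow> 'n list \<Rightarrow> real" where
  "coord_deriv c i t p I J = partial i (comp_in c t I J) (snd c p)"

definition vaction ::
    "('a, 'n::finite) mfd \<Rightarrow> ('a, 'n) tfield \<Rightarrow> ('a, 'n) tfield \<Rightarrow> ('a, 'n) tfield" where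
  "vaction M \<xi> f = fld M 0 0 (\<lambda>c p I J. \<Sum>i\<in>UNIV. \<xi> c p [i] [] * coord_deriv c i f p [] [])"

definition bracket ::
    "('a, 'n::finite) mfd \<Rightarrow> ('a, 'n) tfield \<Rightarrow> ('a, 'n) tfield \<Rightarrow> ('a, 'n) tfield" where
  "bracket M \<xi> \<eta> = fld M 1 0 (\<lambda>c p I J.
     \<Sum>j\<in>UNIV. \<xi> c p [j] [] * coord_deriv c j \<eta> p I [] - \<eta> c p [j] [] * coord_deriv c j \<xi> p I [])"

definition metric_app ::
    "('a, 'n::finite) mfd \<Rightarrow> ('a, 'n) tfield \<Rightarrow> ('a, 'n) tfield \<Rightarrow> ('a, 'n) tfield \<Rightarrow> ('a, 'n) tfield" where
  "metric_app M g \<eta> \<zeta> = fld M 0 0 (\<lambda>c p I J.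
     \<Sum>i\<in>UNIV. \<Sum>j\<in>UNIV. g c p [] [i, j] * \<eta> c p [i] [] * \<zeta> c p [j] [])"

text \<open>The component $R_{abc}{}^d$ of a \<open>(1,3)\<close>-tensor field is \<open>R c p [d] [a, b, c]\<close>.\<close>

definition curv_app ::
    "('a, 'n::finite) mfd \<Rightarrow> ('a, 'n) tfield \<Rightarrow> ('a, 'n) tfield \<Rightarrow> ('a, 'n) tfield \<Rightarrow> ('a, 'n) tfield
      \<Rightarrow> ('a, 'n) tfield" where
  "curv_app M R \<xi> \<eta> \<zeta> = fld M 1 0 (\<lambda>q p I J.
     \<Sum>a\<in>UNIV. \<Sum>b\<in>UNIV. \<Sum>c\<in>UNIV. R q p I [a, b, c] * \<xi> q p [a] [] * \<eta> q p [b] [] * \<zeta> q p [c] [])"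

text \<open>$R_{ab} = R_{cab}{}^c$.\<close>

definition ricci :: "('a, 'n::finite) mfd \<Rightarrow> ('a, 'n) tfield \<Rightarrow> ('a, 'n) tfield" where
  "ricci M R = fld M 0 2 (\<lambda>q p I J. \<Sum>c\<in>UNIV. R q p [c] (c # J))"

text \<open>$h^{ab} R_{ab}$ and $R_{ab} - \frac12 S g_{ab}$.\<close>

definition full_contract ::
    "('a, 'n::finite) mfd \<Rightarrow> ('a, 'n) tfield \<Rightarrow> ('a, 'n) tfield \<Rightarrow> ('a, 'n) tfield" where
  "full_contract M h Ric = fld M 0 0 (\<lambda>q p I J. \<Sum>a\<in>UNIV. \<Sum>b\<in>UNIV. h q p [a, b] [] * Ric q p [] [a, b])"

definition einstein :: "('a, 'n) tfield \<Rightarrow> ('a, 'n) tfield \<Rightarrow> ('a, 'n) tfield \<Rightarrow> ('a, 'n) tfield" where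
  "einstein Ric S g = tsub Ric (tscale (1/2) (fmul S g))"

definition gmat :: "('a, 'n::finite) tfield \<Rightarrow> ('a, 'n) chart \<Rightarrow> 'a \<Rightarrow> real^'n^'n" where
  "gmat g c p = (\<chi> i j. g c p [] [i, j])"


section \<open>Classical metrics, connections and curvature\<close>

definition pseudo_metric_on :: "('a, 'n::finite) mfd \<Rightarrow> 'a set \<Rightarrow> ('a, 'n) tfield \<Rightarrow> bool" where
  "pseudo_metric_on M V g \<longleftrightarrow>
     (\<forall>c\<in>atlas M. \<forall>p\<in>fst c \<inter> V.
        (\<forall>i j. g c p [] [i, j] = g c p [] [j, i]) \<and>
        (\<forall>v. (\<forall>w. v \<bullet> (gmat g c p *v w) = 0) \<longrightarrow> v = 0))"

text \<open>The index of a symmetric bilinear form: the maximal dimension of a subspace on which it is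
  negative definite.\<close>

definition form_index :: "real^'n^'n::finite \<Rightarrow> nat" where
  "form_index B = Max {dim S | S. subspace S \<and> (\<forall>v\<in>S. v \<noteq> 0 \<longrightarrow> v \<bullet> (B *v v) < 0)}"

definition has_index_on :: "('a, 'n::finite) mfd \<Rightarrow> 'a set \<Rightarrow> ('a, 'n) tfield \<Rightarrow> nat \<Rightarrow> bool" where
  "has_index_on M V g j \<longleftrightarrow> (\<forall>c\<in>atlas M. \<forall>p\<in>fst c \<inter> V. form_index (gmat g c p) = j)"

definition Ck_metric :: "('a, 'n::finite) mfd \<Rightarrow> enat \<Rightarrow> ('a, 'n) tfield \<Rightarrow> bool" where
  "Ck_metric M k g \<longleftrightarrow> Ck_tensor M k 0 2 g \<and> pseudo_metric_on M (topspace (mtop M)) g"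

definition inv_metric :: "('a, 'n::finite) mfd \<Rightarrow> ('a, 'n) tfield \<Rightarrow> ('a, 'n) tfield" where
  "inv_metric M g = fld M 2 0 (\<lambda>c p I J. matrix_inv (gmat g c p) $ (I ! 0) $ (I ! 1))"

text \<open>For a metric of finite differentiability the Levi-Civita connection does not preserve
  smoothness, and the curvature requires covariant derivatives of fields that are themselves
  covariant derivatives. Hence the connection acts on pairs of $C^1$ vector fields, with continuous
  values; this determines it uniquely.\<close>

definition levi_civita ::
    "('a, 'n::finite) mfd \<Rightarrow> ('a, 'n) tfield \<Rightarrow>
      (('a, 'n) tfield \<Rightarrow> ('a, 'n) tfield \<Rightarrow> ('a, 'n) tfield) \<Rightarrow> bool" where
  "levi_civita M g D \<longleftrightarrow>
     (let V = {\<xi>. Ck_tensor M 1 1 0 \<xi>}; F = {u. Ck_tensor M 1 0 0 u} in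
       (\<forall>\<xi>\<in>V. \<forall>\<eta>\<in>V. Ck_tensor M 0 1 0 (D \<xi> \<eta>)) \<and>
       (\<forall>\<xi>\<in>V. \<forall>\<eta>\<in>V. \<forall>\<zeta>\<in>V. D \<xi> (tadd \<eta> \<zeta>) = tadd (D \<xi> \<eta>) (D \<xi> \<zeta>)) \<and>
       (\<forall>\<xi>\<in>V. \<forall>\<eta>\<in>V. \<forall>a. D \<xi> (tscale a \<eta>) = tscale a (D \<xi> \<eta>)) \<and>
       (\<forall>\<xi>\<in>V. \<forall>\<eta>\<in>V. \<forall>\<zeta>\<in>V. D (tadd \<xi> \<eta>) \<zeta> = tadd (D \<xi> \<zeta>) (D \<eta> \<zeta>)) \<and>
       (\<forall>u\<in>F. \<forall>\<xi>\<in>V. \<forall>\<eta>\<in>V. D (fmul u \<xi>) \<eta> = fmul u (D \<xi> \<eta>)) \<and>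
       (\<forall>u\<in>F. \<forall>\<xi>\<in>V. \<forall>\<eta>\<in>V. D \<xi> (fmul u \<eta>) = tadd (fmul u (D \<xi> \<eta>)) (fmul (vaction M \<xi> u) \<eta>)) \<and>
       (\<forall>\<xi>\<in>V. \<forall>\<eta>\<in>V. bracket M \<xi> \<eta> = tsub (D \<xi> \<eta>) (D \<eta> \<xi>)) \<and>
       (\<forall>\<xi>\<in>V. \<forall>\<eta>\<in>V. \<forall>\<zeta>\<in>V. vaction M \<xi> (metric_app M g \<eta> \<zeta>) =
          tadd (metric_app M g (D \<xi> \<eta>) \<zeta>) (metric_app M g \<eta> (D \<xi> \<zeta>))))"

definition curvature_tensor ::
    "('a, 'n::finite) mfd \<Rightarrow> (('a, 'n) tfield \<Rightarrow> ('a, 'n) tfield \<Rightarrow> ('a, 'n) tfield) \<Rightarrow>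
      ('a, 'n) tfield \<Rightarrow> bool" where
  "curvature_tensor M D R \<longleftrightarrow> is_tensor M 1 3 R \<and>
     (\<forall>\<xi> \<eta> \<zeta>. Ck_tensor M \<infinity> 1 0 \<xi> \<and> Ck_tensor M \<infinity> 1 0 \<eta> \<and> Ck_tensor M \<infinity> 1 0 \<zeta> \<longrightarrow>
        curv_app M R \<xi> \<eta> \<zeta> =
          tsub (D (bracket M \<xi> \<eta>) \<zeta>) (tsub (D \<xi> (D \<eta> \<zeta>)) (D \<eta> (D \<xi> \<zeta>))))"


definition scalar_curvature ::
    "('a, 'n::finite) mfd \<Rightarrow> ('a, 'n) tfield \<Rightarrow> ('a, 'n) tfield \<Rightarrow> ('a, 'n) tfield" where
  "scalar_curvature M g R = full_contract M (inv_metric M g) (ricci M R)"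

definition einstein_tensor ::
    "('a, 'n::finite) mfd \<Rightarrow> ('a, 'n) tfield \<Rightarrow> ('a, 'n) tfield \<Rightarrow> ('a, 'n) tfield" where
  "einstein_tensor M g R = einstein (ricci M R) (scalar_curvature M g R) g"


section \<open>Generalized numbers and generalized tensor fields\<close>

text \<open>Only the values of a net at parameters in \<open>{0<..1}\<close> matter.\<close>

type_synonym ('a, 'n) tnet = "real \<Rightarrow> ('a, 'n) tfield"

definition mod_real :: "(real \<Rightarrow> real) set" where
  "mod_real = {x. \<exists>N::nat. \<exists>C. \<forall>\<^sub>F \<epsilon> in at_right 0. \<bar>x \<epsilon>\<bar> \<le> C * (1 / \<epsilon>) ^ N}"

definition negl_real :: "(real \<Rightarrow> real) set" where
  "negl_real = {x. \<forall>m::nat. \<exists>C. \<forall>\<^sub>F \<epsilon> in at_right 0. \<bar>x \<epsilon>\<bar> \<le> C * \<epsilon> ^ m}"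

definition gen_reals :: "(real \<Rightarrow> real) set set" where
  "gen_reals = mod_real // {(x, y). x \<in> mod_real \<and> y \<in> mod_real \<and> (\<lambda>\<epsilon>. x \<epsilon> - y \<epsilon>) \<in> negl_real}"

text \<open>\<open>sup\<^sub>K \<parallel>u\<^sub>\<epsilon>\<parallel> = O(q \<epsilon>)\<close> for a compact set \<open>K\<close> contained in the domain of the chart \<open>c\<close>, with the
  maximum norm of the components in \<open>c\<close>. All continuous fibre norms are equivalent over compact
  sets, and every compact subset of the manifold is a finite union of compact subsets of chart
  domains, so it suffices to let \<open>c\<close> and \<open>K\<close> vary below.\<close>

definition bigO_on ::
    "('a, 'n) chart \<Rightarrow> 'a set \<Rightarrow> ('a, 'n) tnet \<Rightarrow> (real \<Rightarrow> real) \<Rightarrow> bool" where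
  "bigO_on c K u q \<longleftrightarrow>
     (\<exists>C. \<forall>\<^sub>F \<epsilon> in at_right 0. \<forall>p\<in>K. \<forall>I J. \<bar>u \<epsilon> c p I J\<bar> \<le> C * q \<epsilon>)"

definition mod_nets :: "('a, 'n::finite) mfd \<Rightarrow> nat \<Rightarrow> nat \<Rightarrow> ('a, 'n) tnet set" where
  "mod_nets M r s = {u.
     (\<forall>\<epsilon>\<in>{0<..1}. Ck_tensor M \<infinity> r s (u \<epsilon>)) \<and>
     (\<forall>P c K. lin_diff_op M r s P \<and> c \<in> atlas M \<and> compactin (mtop M) K \<and> K \<subseteq> fst c \<longrightarrow>
        (\<exists>N::nat. bigO_on c K (\<lambda>\<epsilon>. P (u \<epsilon>)) (\<lambda>\<epsilon>. (1 / \<epsilon>) ^ N)))}"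

definition negl_nets :: "('a, 'n::finite) mfd \<Rightarrow> nat \<Rightarrow> nat \<Rightarrow> ('a, 'n) tnet set" where
  "negl_nets M r s = {u \<in> mod_nets M r s.
     \<forall>c K. c \<in> atlas M \<and> compactin (mtop M) K \<and> K \<subseteq> fst c \<longrightarrow>
       (\<forall>m::nat. bigO_on c K u (\<lambda>\<epsilon>. \<epsilon> ^ m))}"

definition net_rel :: "('a, 'n::finite) mfd \<Rightarrow> nat \<Rightarrow> nat \<Rightarrow> (('a, 'n) tnet \<times> ('a, 'n) tnet) set" where
  "net_rel M r s = {(u, v). u \<in> mod_nets M r s \<and> v \<in> mod_nets M r s \<and>
     (\<lambda>\<epsilon>. tsub (u \<epsilon>) (v \<epsilon>)) \<in> negl_nets M r s}"

definition net_class :: "('a, 'n::finite) mfd \<Rightarrow> nat \<Rightarrow> nat \<Rightarrow> ('a, 'n) tnet \<Rightarrow> ('a, 'n) tnet set" where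
  "net_class M r s u = net_rel M r s `` {u}"

text \<open>The algebra of generalized functions is \<open>gen_tensors M 0 0\<close>.\<close>

definition gen_tensors :: "('a, 'n::finite) mfd \<Rightarrow> nat \<Rightarrow> nat \<Rightarrow> ('a, 'n) tnet set set" where
  "gen_tensors M r s = mod_nets M r s // net_rel M r s"

text \<open>Operations on classes, acting for each parameter separately on representatives. The
  arguments \<open>r\<close>, \<open>s\<close> give the type of the result.\<close>

definition glift1 ::
    "('a, 'n::finite) mfd \<Rightarrow> nat \<Rightarrow> nat \<Rightarrow> (('a, 'n) tfield \<Rightarrow> ('a, 'n) tfield) \<Rightarrow>
      ('a, 'n) tnet set \<Rightarrow> ('a, 'n) tnet set" where
  "glift1 M r s F A = (\<Union>u\<in>A. net_class M r s (\<lambda>\<epsilon>. F (u \<epsilon>)))"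

definition glift2 ::
    "('a, 'n::finite) mfd \<Rightarrow> nat \<Rightarrow> nat \<Rightarrow> (('a, 'n) tfield \<Rightarrow> ('a, 'n) tfield \<Rightarrow> ('a, 'n) tfield) \<Rightarrow>
      ('a, 'n) tnet set \<Rightarrow> ('a, 'n) tnet set \<Rightarrow> ('a, 'n) tnet set" where
  "glift2 M r s F A B = (\<Union>u\<in>A. \<Union>v\<in>B. net_class M r s (\<lambda>\<epsilon>. F (u \<epsilon>) (v \<epsilon>)))"

definition glift3 ::
    "('a, 'n::finite) mfd \<Rightarrow> nat \<Rightarrow> nat \<Rightarrow>
      (('a, 'n) tfield \<Rightarrow> ('a, 'n) tfield \<Rightarrow> ('a, 'n) tfield \<Rightarrow> ('a, 'n) tfield) \<Rightarrow>
      ('a, 'n) tnet set \<Rightarrow> ('a, 'n) tnet set \<Rightarrow> ('a, 'n) tnet set \<Rightarrow> ('a, 'n) tnet set" where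
  "glift3 M r s F A B E =
     (\<Union>u\<in>A. \<Union>v\<in>B. \<Union>w\<in>E. net_class M r s (\<lambda>\<epsilon>. F (u \<epsilon>) (v \<epsilon>) (w \<epsilon>)))"

definition gcurv_app ::
    "('a, 'n::finite) mfd \<Rightarrow> ('a, 'n) tnet set \<Rightarrow> ('a, 'n) tnet set \<Rightarrow> ('a, 'n) tnet set \<Rightarrow>
      ('a, 'n) tnet set \<Rightarrow> ('a, 'n) tnet set" where
  "gcurv_app M A X Y Z =
     (\<Union>R\<in>A. \<Union>\<xi>\<in>X. \<Union>\<eta>\<in>Y. \<Union>\<zeta>\<in>Z.
        net_class M 1 0 (\<lambda>\<epsilon>. curv_app M (R \<epsilon>) (\<xi> \<epsilon>) (\<eta> \<epsilon>) (\<zeta> \<epsilon>)))"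

definition gscale ::
    "('a, 'n::finite) mfd \<Rightarrow> nat \<Rightarrow> nat \<Rightarrow> (real \<Rightarrow> real) set \<Rightarrow> ('a, 'n) tnet set \<Rightarrow> ('a, 'n) tnet set" where
  "gscale M r s X A = (\<Union>x\<in>X. \<Union>u\<in>A. net_class M r s (\<lambda>\<epsilon>. tscale (x \<epsilon>) (u \<epsilon>)))"

definition gone :: "('a, 'n::finite) mfd \<Rightarrow> ('a, 'n) tnet set" where
  "gone M = net_class M 0 0 (\<lambda>\<epsilon>. fld M 0 0 (\<lambda>c p I J. 1))"


section \<open>Generalized metrics, connections and curvature\<close>

text \<open>The determinant of the components of a generalized \<open>(0,2)\<close>-tensor field in the chart \<open>c\<close>, a
  generalized function on the domain of \<open>c\<close>. The inner \<open>c'\<close> is only the chart of the domain in which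
  this function is expressed, the matrix always being taken in \<open>c\<close>.\<close>

definition gdet ::
    "('a, 'n::finite) mfd \<Rightarrow> ('a, 'n) chart \<Rightarrow> ('a, 'n) tnet set \<Rightarrow> ('a, 'n) tnet set" where
  "gdet M c A = glift1 (restrict_mfd M (fst c)) 0 0
     (\<lambda>g. fld (restrict_mfd M (fst c)) 0 0 (\<lambda>c' p I J. det (gmat g c p))) A"

definition ginvertible :: "('a, 'n::finite) mfd \<Rightarrow> ('a, 'n) tnet set \<Rightarrow> bool" where
  "ginvertible M A \<longleftrightarrow> (\<exists>B\<in>gen_tensors M 0 0. glift2 M 0 0 fmul A B = gone M)"

definition relatively_compact_open :: "'a topology \<Rightarrow> 'a set \<Rightarrow> bool" where
  "relatively_compact_open T V \<longleftrightarrow> openin T V \<and> compactin T (T closure_of V)"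

definition gen_metric :: "('a, 'n::finite) mfd \<Rightarrow> ('a, 'n) tnet set \<Rightarrow> bool" where
  "gen_metric M gh \<longleftrightarrow>
     gh \<in> gen_tensors M 0 2 \<and>
     (\<forall>c\<in>atlas M. ginvertible (restrict_mfd M (fst c)) (gdet M c gh)) \<and>
     (\<forall>V. relatively_compact_open (mtop M) V \<longrightarrow>
        (\<exists>u\<in>gh. \<exists>\<epsilon>0>0. \<forall>\<epsilon>. 0 < \<epsilon> \<and> \<epsilon> \<le> 1 \<and> \<epsilon> < \<epsilon>0 \<longrightarrow> pseudo_metric_on M V (u \<epsilon>))) \<and>
     (\<exists>j. j \<noteq> 0 \<and> (\<forall>V. relatively_compact_open (mtop M) V \<longrightarrow>
        (\<exists>u\<in>gh. \<exists>\<epsilon>0>0. \<forall>\<epsilon>. 0 < \<epsilon> \<and> \<epsilon> \<le> 1 \<and> \<epsilon> < \<epsilon>0 \<longrightarrow>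
           pseudo_metric_on M V (u \<epsilon>) \<and> has_index_on M V (u \<epsilon>) j)))"

text \<open>The inverse matrices exist on a given compact set for small parameters only, so they do not
  form a net of tensor fields; the condition says that over compact sets their difference to a
  representative of \<open>hh\<close> is negligible.\<close>

definition gen_inv_metric ::
    "('a, 'n::finite) mfd \<Rightarrow> ('a, 'n) tnet set \<Rightarrow> ('a, 'n) tnet set \<Rightarrow> bool" where
  "gen_inv_metric M gh hh \<longleftrightarrow>
     hh \<in> gen_tensors M 2 0 \<and>
     (\<exists>u\<in>gh. \<exists>v\<in>hh. \<forall>c K. c \<in> atlas M \<and> compactin (mtop M) K \<and> K \<subseteq> fst c \<longrightarrow>
        (\<forall>m::nat. \<exists>C. \<forall>\<^sub>F \<epsilon> in at_right 0. \<forall>p\<in>K. invertible (gmat (u \<epsilon>) c p) \<and>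
           (\<forall>i j. \<bar>v \<epsilon> c p [i, j] [] - matrix_inv (gmat (u \<epsilon>) c p) $ i $ j\<bar> \<le> C * \<epsilon> ^ m)))"

definition gen_levi_civita ::
    "('a, 'n::finite) mfd \<Rightarrow> ('a, 'n) tnet set \<Rightarrow>
      (('a, 'n) tnet set \<Rightarrow> ('a, 'n) tnet set \<Rightarrow> ('a, 'n) tnet set) \<Rightarrow> bool" where
  "gen_levi_civita M gh D \<longleftrightarrow>
     (let V = gen_tensors M 1 0; F = gen_tensors M 0 0;
          add = glift2 M 1 0 tadd; mult = glift2 M 1 0 fmul;
          act = glift2 M 0 0 (vaction M); met = glift3 M 0 0 (metric_app M) gh in
       (\<forall>\<xi>\<in>V. \<forall>\<eta>\<in>V. D \<xi> \<eta> \<in> V) \<and>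
       (\<forall>\<xi>\<in>V. \<forall>\<eta>\<in>V. \<forall>\<zeta>\<in>V. D \<xi> (add \<eta> \<zeta>) = add (D \<xi> \<eta>) (D \<xi> \<zeta>)) \<and>
       (\<forall>\<xi>\<in>V. \<forall>\<eta>\<in>V. \<forall>a\<in>gen_reals. D \<xi> (gscale M 1 0 a \<eta>) = gscale M 1 0 a (D \<xi> \<eta>)) \<and>
       (\<forall>\<xi>\<in>V. \<forall>\<eta>\<in>V. \<forall>\<zeta>\<in>V. D (add \<xi> \<eta>) \<zeta> = add (D \<xi> \<zeta>) (D \<eta> \<zeta>)) \<and>
       (\<forall>u\<in>F. \<forall>\<xi>\<in>V. \<forall>\<eta>\<in>V. D (mult u \<xi>) \<eta> = mult u (D \<xi> \<eta>)) \<and>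
       (\<forall>u\<in>F. \<forall>\<xi>\<in>V. \<forall>\<eta>\<in>V. D \<xi> (mult u \<eta>) = add (mult u (D \<xi> \<eta>)) (mult (act \<xi> u) \<eta>)) \<and>
       (\<forall>\<xi>\<in>V. \<forall>\<eta>\<in>V. glift2 M 1 0 (bracket M) \<xi> \<eta> = glift2 M 1 0 tsub (D \<xi> \<eta>) (D \<eta> \<xi>)) \<and>
       (\<forall>\<xi>\<in>V. \<forall>\<eta>\<in>V. \<forall>\<zeta>\<in>V. act \<xi> (met \<eta> \<zeta>) =
          glift2 M 0 0 tadd (met (D \<xi> \<eta>) \<zeta>) (met \<eta> (D \<xi> \<zeta>))))"

definition gen_curvature_tensor ::
    "('a, 'n::finite) mfd \<Rightarrow> (('a, 'n) tnet set \<Rightarrow> ('a, 'n) tnet set \<Rightarrow> ('a, 'n) tnet set) \<Rightarrow>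
      ('a, 'n) tnet set \<Rightarrow> bool" where
  "gen_curvature_tensor M D Rh \<longleftrightarrow>
     Rh \<in> gen_tensors M 1 3 \<and>
     (\<forall>\<xi>\<in>gen_tensors M 1 0. \<forall>\<eta>\<in>gen_tensors M 1 0. \<forall>\<zeta>\<in>gen_tensors M 1 0.
        gcurv_app M Rh \<xi> \<eta> \<zeta> =
          glift2 M 1 0 tsub (D (glift2 M 1 0 (bracket M) \<xi> \<eta>) \<zeta>)
            (glift2 M 1 0 tsub (D \<xi> (D \<eta> \<zeta>)) (D \<eta> (D \<xi> \<zeta>))))"


definition gen_ricci :: "('a, 'n::finite) mfd \<Rightarrow> ('a, 'n) tnet set \<Rightarrow> ('a, 'n) tnet set" where
  "gen_ricci M Rh = glift1 M 0 2 (ricci M) Rh"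

definition gen_scalar_curvature ::
    "('a, 'n::finite) mfd \<Rightarrow> ('a, 'n) tnet set \<Rightarrow> ('a, 'n) tnet set \<Rightarrow> ('a, 'n) tnet set" where
  "gen_scalar_curvature M hh Rh = glift2 M 0 0 (full_contract M) hh (gen_ricci M Rh)"

definition gen_einstein ::
    "('a, 'n::finite) mfd \<Rightarrow> ('a, 'n) tnet set \<Rightarrow> ('a, 'n) tnet set \<Rightarrow> ('a, 'n) tnet set \<Rightarrow>
      ('a, 'n) tnet set" where
  "gen_einstein M gh hh Rh =
     glift3 M 0 2 einstein (gen_ricci M Rh) (gen_scalar_curvature M hh Rh) gh"


section \<open>Association\<close>

definition associated ::
    "('a, 'n::finite) mfd \<Rightarrow> enat \<Rightarrow> nat \<Rightarrow> nat \<Rightarrow> ('a, 'n) tnet set \<Rightarrow> ('a, 'n) tfield \<Rightarrow> bool" where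
  "associated M l r s A t \<longleftrightarrow>
     A \<in> gen_tensors M r s \<and> Ck_tensor M l r s t \<and>
     (\<exists>u\<in>A. \<forall>c\<in>atlas M. \<forall>\<alpha> I J K.
        enat (length \<alpha>) \<le> l \<and> length I = r \<and> length J = s \<and>
        compactin (mtop M) K \<and> K \<subseteq> fst c \<longrightarrow>
        uniform_limit (snd c ` K) (\<lambda>\<epsilon>. partials \<alpha> (comp_in c (u \<epsilon>) I J))
          (partials \<alpha> (comp_in c t I J)) (at_right 0))"

end

theory Submission
  imports Defs
begin

text \<open>Why the theorem holds. In a chart the curvature of a metric is a polynomial in the metric, its
  inverse, and their derivatives, where the metric is differentiated at most twice. If the nets
  \<open>g\<^sub>\<epsilon>\<close> converge to \<open>g\<close> with \<open>k\<close> derivatives, then so do the inverse matrices, and the curvature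
  expression converges with \<open>k - 2\<close> derivatives. What has to be shown is that this familiar formula
  is the one that is described by the axioms of the two connections, in the generalized case up
  to negligible nets.

  Moderate and negligible nets. Membership in the spaces of moderate and negligible nets is first
  translated into statements about components in charts (\<open>mod_nets_modnet\<close>, \<open>mod_netsI\<close>,
  \<open>negl_nets_neglnet\<close>, \<open>negl_netsI\<close>). Since moderateness refers to global differential operators,
  this needs operators that single out one derivative of one component near a given compact set,
  and they are built with cutoff functions (\<open>lin_diff_op_cutoff\<close>). In a chart the negligible nets
  form an ideal in the moderate nets that is stable under partial derivatives
  (\<open>neglnet_partial\<close>), so that one can calculate modulo negligible nets (\<open>negl_eq\<close>).

  The connection. Torsion-freeness and compatibility with the metric alone give the Koszul formula.
  Tested with global vector fields that coincide with coordinate fields near a given compact set,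
  it determines the components of \<open>D\<^sub>\<xi> \<eta>\<close> by Christoffel symbols. The algebra is carried out once at a point, as an identity
  that records the defects of the axioms (\<open>koszul_pointwise\<close>). The defects vanish for a classical
  connection (\<open>classical_connection\<close>) and are negligible for the generalized one
  (\<open>gen_connection\<close>). Two applications to coordinate fields give the coordinate formula of the
  curvature tensor (\<open>classical_curvature\<close>, \<open>gen_curvature\<close>).

  Convergence. The inverse metric converges locally uniformly by a perturbation argument
  (\<open>unif_conv_inverse\<close>); the order of convergence is then raised step by step, because up to
  negligible nets the derivative of the inverse is a polynomial in the inverse and in the
  derivative of the metric (\<open>conv_inv_metric\<close>). That the limits are again tensor fields of class
  \<open>C\<^bsup>k-2\<^esup>\<close> follows from the convergence (\<open>associatedI\<close>).\<close>

section \<open>Functions of class \<open>C\<^sup>k\<close> on open sets\<close>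

lemma partials_Nil [simp]: "partials [] f = f"
  and partials_Cons: "partials (i # \<alpha>) f = partial i (partials \<alpha> f)"
  and partials_append: "partials (\<alpha> @ \<beta>) f = partials \<alpha> (partials \<beta> f)"
  by (simp_all add: partials_def)

lemma partial_cong:
  assumes "open S" "x \<in> S" "\<And>y. y \<in> S \<Longrightarrow> f y = g y"
  shows "partial i f x = partial i g x"
proof -
  have "(f has_derivative D) (at x) \<longleftrightarrow> (g has_derivative D) (at x)" for D
    using has_derivative_transform_within_open[of f D x UNIV S g]
      has_derivative_transform_within_open[of g D x UNIV S f] assms by auto
  then show ?thesis by (simp add: partial_def frechet_derivative_def)
qed

lemma partials_cong:
  assumes "open S" "x \<in> S" "\<And>y. y \<in> S \<Longrightarrow> f y = g y"
  shows "partials \<alpha> f x = partials \<alpha> g x"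
  using assms(2)
proof (induction \<alpha> arbitrary: x)
  case (Cons i \<alpha>)
  then show ?case
    unfolding partials_Cons by (intro partial_cong[OF assms(1) Cons.prems]) (rule Cons.IH)
qed (simp add: assms)

lemma partial_eqI: "(f has_derivative D) (at x) \<Longrightarrow> partial i f x = D (axis i 1)"
  by (metis frechet_derivative_at partial_def)

lemma has_derivative_partial:
  assumes "f differentiable (at x)"
  shows "(f has_derivative (\<lambda>h. \<Sum>i\<in>UNIV. h $ i * partial i f x)) (at x)"
proof -
  have D: "(f has_derivative frechet_derivative f (at x)) (at x)"
    using assms frechet_derivative_works by blast
  then have L: "linear (frechet_derivative f (at x))"
    by (simp add: has_derivative_linear)
  have "frechet_derivative f (at x) h = (\<Sum>i\<in>UNIV. h $ i * partial i f x)" for h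
  proof -
    have "h = (\<Sum>i\<in>UNIV. h $ i *\<^sub>R axis i 1)"
      using basis_expansion[of h] by (simp add: scalar_mult_eq_scaleR)
    then have "frechet_derivative f (at x) h = frechet_derivative f (at x) (\<Sum>i\<in>UNIV. h $ i *\<^sub>R axis i 1)"
      by simp
    then show ?thesis
      by (simp add: linear_sum[OF L] linear_scale[OF L] partial_def)
  qed
  then have "frechet_derivative f (at x) = (\<lambda>h. \<Sum>i\<in>UNIV. h $ i * partial i f x)" by blast
  with D show ?thesis by simp
qed

lemma partial_const: "partial i (\<lambda>x. a) = (\<lambda>x. 0)"
  by (rule ext) (simp add: partial_def)

lemma partial_add:
  assumes "f differentiable (at x)" "g differentiable (at x)"
  shows "partial i (\<lambda>x. f x + g x) x = partial i f x + partial i g x"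
  using partial_eqI[OF has_derivative_add[OF assms[unfolded frechet_derivative_works]]]
  by (simp add: partial_def)

lemma partial_mult:
  assumes "f differentiable (at x)" "g differentiable (at x)"
  shows "partial i (\<lambda>x. f x * g x) x = partial i f x * g x + f x * partial i g x"
proof -
  have "((\<lambda>x. f x * g x) has_derivative
     (\<lambda>h. f x * frechet_derivative g (at x) h + frechet_derivative f (at x) h * g x)) (at x)"
    using assms by (intro has_derivative_mult) (simp_all add: frechet_derivative_works)
  from partial_eqI[OF this] show ?thesis by (simp add: partial_def)
qed

lemma partial_diff:
  assumes "f differentiable (at x)" "g differentiable (at x)"
  shows "partial i (\<lambda>x. f x - g x) x = partial i f x - partial i g x"
proof -
  show ?thesis
    using partial_eqI[OF has_derivative_diff[OF assms[unfolded frechet_derivative_works]]]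
    by (simp add: partial_def)
qed

lemma partial_sum:
  assumes "finite A" "\<And>a. a \<in> A \<Longrightarrow> f a differentiable (at x)"
  shows "partial i (\<lambda>x. \<Sum>a\<in>A. f a x) x = (\<Sum>a\<in>A. partial i (f a) x)"
  using assms
proof (induction A rule: finite_induct)
  case (insert a A)
  then show ?case by (simp add: partial_add differentiable_sum)
qed (simp add: partial_const)

lemma partial_component: "partial i (\<lambda>x::real^'n::finite. x $ j) = (\<lambda>x. if i = j then 1 else 0)"
proof
  fix x :: "real^'n"
  have "((\<lambda>x::real^'n. x $ j) has_derivative (\<lambda>h. h $ j)) (at x)"
    by (rule bounded_linear.has_derivative) (auto intro: bounded_linear_vec_nth)
  from partial_eqI[OF this] show "partial i (\<lambda>x. x $ j) x = (if i = j then 1 else 0)"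
    by (auto simp: axis_def)
qed

lemma differentiable_onD_open:
  "f differentiable_on S \<Longrightarrow> open S \<Longrightarrow> x \<in> S \<Longrightarrow> f differentiable (at x)"
  by (simp add: differentiable_on_eq_differentiable_at)

text \<open>The recursion through which all closure properties of \<open>Ck_on\<close> are proved.\<close>

lemma Ck_on_0: "Ck_on 0 f S \<longleftrightarrow> continuous_on S f"
  by (auto simp: Ck_on_def zero_enat_def)

lemma Ck_on_Suc:
  assumes "open S"
  shows "Ck_on (enat (Suc n)) f S \<longleftrightarrow> f differentiable_on S \<and> (\<forall>i. Ck_on (enat n) (partial i f) S)"
    (is "?L \<longleftrightarrow> ?R")
proof
  assume L: ?L
  have "f differentiable_on S"
    using L[unfolded Ck_on_def, THEN conjunct2, rule_format, of "[]"] by simp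
  moreover have "Ck_on (enat n) (partial i f) S" for i
  proof -
    have eq: "partials \<alpha> (partial i f) = partials (\<alpha> @ [i]) f" for \<alpha>
      by (simp add: partials_append partials_Cons)
    show ?thesis using L unfolding Ck_on_def eq by (auto simp del: partials_append)
  qed
  ultimately show ?R by blast
next
  assume R: ?R
  have c: "continuous_on S (partials \<alpha> f)" if "enat (length \<alpha>) \<le> enat (Suc n)" for \<alpha>
  proof (cases \<alpha> rule: rev_cases)
    case Nil then show ?thesis using R differentiable_imp_continuous_on by auto
  next
    case (snoc \<beta> i)
    then show ?thesis using R that unfolding Ck_on_def
      by (auto simp: partials_append partials_Cons)
  qed
  have d: "partials \<alpha> f differentiable_on S" if "enat (length \<alpha>) < enat (Suc n)" for \<alpha>
  proof (cases \<alpha> rule: rev_cases)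
    case Nil then show ?thesis using R by auto
  next
    case (snoc \<beta> i)
    then show ?thesis using R that unfolding Ck_on_def
      by (auto simp: partials_append partials_Cons)
  qed
  from c d show ?L unfolding Ck_on_def by blast
qed

lemma Ck_on_mono: "Ck_on l f S \<Longrightarrow> l' \<le> l \<Longrightarrow> Ck_on l' f S"
  unfolding Ck_on_def by (meson order_trans less_le_trans)

lemma Ck_on_iff_nat: "Ck_on l f S \<longleftrightarrow> (\<forall>n. enat n \<le> l \<longrightarrow> Ck_on (enat n) f S)"
proof
  assume R: "\<forall>n. enat n \<le> l \<longrightarrow> Ck_on (enat n) f S"
  show "Ck_on l f S" unfolding Ck_on_def
  proof (intro conjI allI impI)
    fix \<alpha> :: "'a list" assume "enat (length \<alpha>) \<le> l"
    with R show "continuous_on S (partials \<alpha> f)" unfolding Ck_on_def by blast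
  next
    fix \<alpha> :: "'a list" assume "enat (length \<alpha>) < l"
    then have "enat (Suc (length \<alpha>)) \<le> l" by (simp add: Suc_ile_eq)
    with R show "partials \<alpha> f differentiable_on S" unfolding Ck_on_def by force
  qed
qed (blast intro: Ck_on_mono)

lemma Ck_on_infinity: "Ck_on \<infinity> f S \<longleftrightarrow> (\<forall>n. Ck_on (enat n) f S)"
  by (subst Ck_on_iff_nat) simp

lemma Ck_on_infinity_le: "Ck_on \<infinity> f S \<Longrightarrow> Ck_on l f S"
  by (rule Ck_on_mono) auto

lemma Ck_on_imp_continuous: "Ck_on l f S \<Longrightarrow> continuous_on S f"
  unfolding Ck_on_def by (metis partials_Nil list.size(3) i0_lb zero_enat_def)

lemma Ck_on_imp_differentiable:
  assumes "Ck_on l f S" "1 \<le> l" "open S" "x \<in> S"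
  shows "f differentiable (at x)"
proof -
  have "partials [] f differentiable_on S" using assms unfolding Ck_on_def
    by (metis (full_types) list.size(3) one_enat_def zero_enat_def order.strict_trans2 enat_ord_simps(2) zero_less_one)
  then show ?thesis using assms differentiable_onD_open by auto
qed

lemma smooth_imp_differentiable:
  "Ck_on \<infinity> f S \<Longrightarrow> open S \<Longrightarrow> x \<in> S \<Longrightarrow> f differentiable (at x)"
  by (rule Ck_on_imp_differentiable) auto

lemma smooth_partial: "Ck_on \<infinity> f S \<Longrightarrow> open S \<Longrightarrow> Ck_on \<infinity> (partial i f) S"
  by (meson Ck_on_Suc Ck_on_infinity)

lemma smooth_partials: "Ck_on \<infinity> f S \<Longrightarrow> open S \<Longrightarrow> Ck_on \<infinity> (partials \<alpha> f) S"
  by (induction \<alpha>) (auto simp: partials_Cons smooth_partial)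

lemma Ck_on_subset: "Ck_on l f S \<Longrightarrow> T \<subseteq> S \<Longrightarrow> Ck_on l f T"
  unfolding Ck_on_def by (meson continuous_on_subset differentiable_on_subset)

lemma Ck_on_cong:
  assumes "open S" "\<And>y. y \<in> S \<Longrightarrow> f y = g y"
  shows "Ck_on l f S \<longleftrightarrow> Ck_on l g S"
proof -
  have "Ck_on l g S" if "Ck_on l f S" "\<And>y. y \<in> S \<Longrightarrow> f y = g y" for f g
  proof -
    have eq: "partials \<alpha> f x = partials \<alpha> g x" if "x \<in> S" for \<alpha> x
      using partials_cong[OF assms(1) that, of f g] \<open>\<And>y. y \<in> S \<Longrightarrow> f y = g y\<close> by blast
    have "continuous_on S (partials \<alpha> g)" if "continuous_on S (partials \<alpha> f)" for \<alpha>
      using that eq by (metis (no_types, lifting) continuous_on_cong)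
    moreover have "partials \<alpha> g differentiable_on S" if "partials \<alpha> f differentiable_on S" for \<alpha>
      using that eq unfolding differentiable_on_def
      by (metis (no_types, lifting) differentiable_transform_within zero_less_one)
    ultimately show ?thesis using \<open>Ck_on l f S\<close> unfolding Ck_on_def by blast
  qed
  from this[of f g] this[of g f] show ?thesis using assms(2) by (metis (no_types, lifting))
qed

lemma Ck_on_congI:
  assumes "open S" "Ck_on l f S" "\<And>y. y \<in> S \<Longrightarrow> f y = g y" shows "Ck_on l g S"
  using Ck_on_cong[OF assms(1), of f g] assms(2,3) by blast

lemma Ck_on_local:
  assumes "\<And>x. x \<in> S \<Longrightarrow> \<exists>U. open U \<and> x \<in> U \<and> Ck_on l f U"
  shows "Ck_on l f S"
  unfolding Ck_on_def
proof (intro conjI allI impI)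
  fix \<alpha> :: "'a list" assume l: "enat (length \<alpha>) \<le> l"
  have "isCont (partials \<alpha> f) x" if x: "x \<in> S" for x
  proof -
    from assms[OF x] obtain U where U: "open U" "x \<in> U" "Ck_on l f U" by blast
    then show ?thesis using l unfolding Ck_on_def by (meson continuous_on_eq_continuous_at)
  qed
  then show "continuous_on S (partials \<alpha> f)" by (simp add: continuous_at_imp_continuous_on)
next
  fix \<alpha> :: "'a list" assume l: "enat (length \<alpha>) < l"
  have "partials \<alpha> f differentiable (at x)" if x: "x \<in> S" for x
  proof -
    from assms[OF x] obtain U where U: "open U" "x \<in> U" "Ck_on l f U" by blast
    then show ?thesis using l unfolding Ck_on_def by (meson differentiable_onD_open)
  qed
  then show "partials \<alpha> f differentiable_on S"
    by (simp add: differentiable_at_imp_differentiable_on)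
qed

lemma Ck_on_const: "Ck_on l (\<lambda>x. a) S"
proof -
  have "partials \<alpha> (\<lambda>x. a) = (if \<alpha> = [] then (\<lambda>x. a) else (\<lambda>x. 0))" for \<alpha> :: "'a list"
    by (induction \<alpha>) (simp_all add: partials_Cons partial_const)
  then show ?thesis by (simp add: Ck_on_def)
qed

lemma Ck_on_component: "open S \<Longrightarrow> Ck_on l (\<lambda>x. x $ j) S"
proof (rule Ck_on_infinity_le, unfold Ck_on_infinity, rule allI)
  fix n assume "open S"
  show "Ck_on (enat n) (\<lambda>x. x $ j) S"
  proof (cases n)
    case 0 then show ?thesis
      by (simp add: zero_enat_def[symmetric] Ck_on_0 continuous_on_component)
  next
    case (Suc m)
    have "(\<lambda>x::real^'a. x $ j) differentiable_on S"
      by (rule bounded_linear_imp_differentiable_on) (rule bounded_linear_vec_nth)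
    then show ?thesis unfolding Suc Ck_on_Suc[OF \<open>open S\<close>] by (simp add: partial_component Ck_on_const)
  qed
qed

lemma Ck_on_add_nat:
  assumes "open S"
  shows "Ck_on (enat n) f S \<Longrightarrow> Ck_on (enat n) g S \<Longrightarrow> Ck_on (enat n) (\<lambda>x. f x + g x) S"
proof (induction n arbitrary: f g)
  case 0 then show ?case by (auto simp: zero_enat_def[symmetric] Ck_on_0 intro: continuous_on_add)
next
  case (Suc n)
  have d: "f differentiable_on S" "g differentiable_on S"
    using Suc.prems by (auto simp: Ck_on_Suc[OF assms])
  have "Ck_on (enat n) (\<lambda>x. partial i f x + partial i g x) S" for i
    using Suc by (auto simp: Ck_on_Suc[OF assms])
  then have "Ck_on (enat n) (partial i (\<lambda>x. f x + g x)) S" for i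
    by (subst Ck_on_cong[OF assms partial_add]) (auto intro: d[THEN differentiable_onD_open] assms)
  then show ?case using d by (simp add: Ck_on_Suc[OF assms] differentiable_on_add)
qed

lemma Ck_on_mult_nat:
  assumes "open S"
  shows "Ck_on (enat n) f S \<Longrightarrow> Ck_on (enat n) g S \<Longrightarrow> Ck_on (enat n) (\<lambda>x. f x * g x) S"
proof (induction n arbitrary: f g)
  case 0 then show ?case by (auto simp: zero_enat_def[symmetric] Ck_on_0 intro: continuous_on_mult)
next
  case (Suc n)
  have d: "f differentiable_on S" "g differentiable_on S"
    using Suc.prems by (auto simp: Ck_on_Suc[OF assms])
  have m: "Ck_on (enat n) f S" "Ck_on (enat n) g S"
    using Suc.prems by (auto intro: Ck_on_mono)
  have "Ck_on (enat n) (\<lambda>x. partial i f x * g x + f x * partial i g x) S" for i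
    using Suc m by (intro Ck_on_add_nat[OF assms] Suc.IH) (auto simp: Ck_on_Suc[OF assms])
  then have "Ck_on (enat n) (partial i (\<lambda>x. f x * g x)) S" for i
    by (subst Ck_on_cong[OF assms partial_mult]) (auto intro: d[THEN differentiable_onD_open] assms)
  then show ?case using d by (simp add: Ck_on_Suc[OF assms] differentiable_on_mult)
qed

lemma Ck_on_add: "open S \<Longrightarrow> Ck_on l f S \<Longrightarrow> Ck_on l g S \<Longrightarrow> Ck_on l (\<lambda>x. f x + g x) S"
  unfolding Ck_on_iff_nat[of l] by (simp add: Ck_on_add_nat)

lemma Ck_on_mult: "open S \<Longrightarrow> Ck_on l f S \<Longrightarrow> Ck_on l g S \<Longrightarrow> Ck_on l (\<lambda>x. f x * g x) S"
  unfolding Ck_on_iff_nat[of l] by (simp add: Ck_on_mult_nat)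

lemma Ck_on_cmult: "open S \<Longrightarrow> Ck_on l f S \<Longrightarrow> Ck_on l (\<lambda>x. a * f x) S"
  by (simp add: Ck_on_mult Ck_on_const)

lemma Ck_on_diff:
  assumes "open S" "Ck_on l f S" "Ck_on l g S" shows "Ck_on l (\<lambda>x. f x - g x) S"
  using Ck_on_add[OF assms(1,2) Ck_on_cmult[OF assms(1,3), of "-1"]] by simp

lemma Ck_on_sum:
  assumes "open S" "\<And>a. a \<in> A \<Longrightarrow> Ck_on l (f a) S"
  shows "Ck_on l (\<lambda>x. \<Sum>a\<in>A. f a x) S"
  using assms(2)
  by (induction A rule: infinite_finite_induct) (auto intro: Ck_on_const Ck_on_add assms(1))

lemma Ck_on_prod:
  assumes "open S" "\<And>a. a \<in> A \<Longrightarrow> Ck_on l (f a) S"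
  shows "Ck_on l (\<lambda>x. \<Prod>a\<in>A. f a x) S"
  using assms(2)
  by (induction A rule: infinite_finite_induct) (auto intro: Ck_on_const Ck_on_mult assms(1))

lemmas Ck_on_intros = Ck_on_const Ck_on_component Ck_on_add Ck_on_mult Ck_on_diff Ck_on_sum
  Ck_on_prod

lemma partial_compose:
  fixes T :: "real^'m::finite \<Rightarrow> real^'n::finite"
  assumes "\<And>k. (\<lambda>y. T y $ k) differentiable (at x)" "f differentiable (at (T x))"
  shows "partial j (\<lambda>y. f (T y)) x = (\<Sum>k\<in>UNIV. partial k f (T x) * partial j (\<lambda>y. T y $ k) x)"
proof -
  have "(T has_derivative (\<lambda>h. \<chi> k. frechet_derivative (\<lambda>y. T y $ k) (at x) h)) (at x)"
    using assms(1) unfolding has_derivative_componentwise_within[of T]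
    by (auto simp: Basis_vec_def inner_axis frechet_derivative_works)
  from has_derivative_compose[OF this has_derivative_partial[OF assms(2)]]
  have "((\<lambda>y. f (T y)) has_derivative (\<lambda>h. \<Sum>k\<in>UNIV. frechet_derivative (\<lambda>y. T y $ k) (at x) h * partial k f (T x))) (at x)"
    by simp
  from partial_eqI[OF this] show ?thesis by (simp add: partial_def mult.commute)
qed

lemma differentiable_compose_vec:
  fixes T :: "real^'m::finite \<Rightarrow> real^'n::finite"
  assumes "\<And>k. (\<lambda>y. T y $ k) differentiable (at x)" "f differentiable (at (T x))"
  shows "(\<lambda>y. f (T y)) differentiable (at x)"
proof -
  have "T differentiable (at x)"
    using assms(1) unfolding differentiable_componentwise_within[of T]
    by (auto simp: Basis_vec_def inner_axis)
  then show ?thesis using assms(2) differentiable_chain_at[of T x f] by (simp add: o_def)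
qed

lemma smooth_compose:
  fixes T :: "real^'m::finite \<Rightarrow> real^'n::finite"
  assumes "open S" "open S'" "\<And>k. Ck_on \<infinity> (\<lambda>y. T y $ k) S" "T ` S \<subseteq> S'" "Ck_on \<infinity> f S'"
  shows "Ck_on \<infinity> (\<lambda>y. f (T y)) S"
proof -
  have cT: "continuous_on S T"
    using assms(3) Ck_on_imp_continuous by (subst continuous_on_componentwise) (auto simp: Basis_vec_def inner_axis)
  have "Ck_on (enat n) (\<lambda>y. f (T y)) S" if "Ck_on \<infinity> f S'" for n f
    using that
  proof (induction n arbitrary: f)
    case 0
    have "continuous_on S (\<lambda>y. f (T y))"
      using Ck_on_imp_continuous[OF 0] assms(4) cT continuous_on_compose2 by blast
    then show ?case by (simp add: zero_enat_def[symmetric] Ck_on_0)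
  next
    case (Suc n)
    have dT: "(\<lambda>y. T y $ k) differentiable (at x)" if "x \<in> S" for k x
      using smooth_imp_differentiable[OF assms(3,1) that] .
    have df: "f differentiable (at (T x))" if "x \<in> S" for x
      using smooth_imp_differentiable[OF Suc.prems assms(2)] assms(4) that by blast
    have "Ck_on (enat n) (partial k f \<circ> T) S" for k
      using Suc.IH[OF smooth_partial[OF Suc.prems assms(2)]] by (simp add: o_def)
    then have "Ck_on (enat n) (\<lambda>x. \<Sum>k\<in>UNIV. partial k f (T x) * partial j (\<lambda>y. T y $ k) x) S" for j
      using assms(1,3) by (intro Ck_on_sum Ck_on_mult) (auto simp: o_def intro: Ck_on_infinity_le smooth_partial)
    then have "Ck_on (enat n) (partial j (\<lambda>y. f (T y))) S" for j
      using Ck_on_cong[OF assms(1), of "partial j (\<lambda>y. f (T y))" "\<lambda>x. \<Sum>k\<in>UNIV. partial k f (T x) * partial j (\<lambda>y. T y $ k) x"]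
        partial_compose dT df by blast
    moreover have "(\<lambda>y. f (T y)) differentiable_on S"
      using differentiable_compose_vec[OF dT df] by (simp add: differentiable_on_eq_differentiable_at[OF assms(1)])
    ultimately show ?case by (simp add: Ck_on_Suc[OF assms(1)])
  qed
  then show ?thesis using assms(5) by (simp add: Ck_on_infinity)
qed

text \<open>Composition with a function of one real variable, which comes with the sequence \<open>\<phi>\<close> of
  its iterated derivatives.\<close>

lemma smooth_compose_real:
  fixes f :: "real^'n::finite \<Rightarrow> real"
  assumes "open S" "\<And>n t. t \<in> T \<Longrightarrow> (\<phi> n has_real_derivative \<phi> (Suc n) t) (at t)"
    "f ` S \<subseteq> T" "Ck_on \<infinity> f S"
  shows "Ck_on \<infinity> (\<lambda>y. \<phi> m (f y)) S"
proof -
  have "Ck_on (enat n) (\<lambda>y. \<phi> m (f y)) S" for n m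
  proof (induction n arbitrary: m)
    case 0
    have "isCont (\<phi> m) t" if "t \<in> T" for t using assms(2)[OF that] DERIV_isCont by blast
    then have "continuous_on T (\<phi> m)" by (simp add: continuous_at_imp_continuous_on)
    then have "continuous_on S (\<lambda>y. \<phi> m (f y))"
      using Ck_on_imp_continuous[OF assms(4)] assms(3) continuous_on_compose2 by blast
    then show ?case by (simp add: zero_enat_def[symmetric] Ck_on_0)
  next
    case (Suc n)
    have D: "((\<lambda>y. \<phi> m (f y)) has_derivative (\<lambda>h. \<phi> (Suc m) (f x) * (frechet_derivative f (at x) h))) (at x)"
      if x: "x \<in> S" for x
    proof -
      have "(f has_derivative frechet_derivative f (at x)) (at x)"
        using smooth_imp_differentiable[OF assms(4,1) x] frechet_derivative_works by blast
      from has_derivative_compose[OF this] assms(2)[of "f x" m] assms(3) x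
      show ?thesis unfolding has_field_derivative_def by (auto simp: mult.commute)
    qed
    have "Ck_on (enat n) (\<lambda>x. \<phi> (Suc m) (f x) * partial j f x) S" for j
      using assms(1,4) Suc.IH by (intro Ck_on_mult) (auto intro: Ck_on_infinity_le smooth_partial)
    then have "Ck_on (enat n) (partial j (\<lambda>y. \<phi> m (f y))) S" for j
      using Ck_on_cong[OF assms(1), of "partial j (\<lambda>y. \<phi> m (f y))" "\<lambda>x. \<phi> (Suc m) (f x) * partial j f x"]
        partial_eqI[OF D, of _ j] by (simp add: partial_def)
    moreover have "(\<lambda>y. \<phi> m (f y)) differentiable_on S"
      using D by (auto simp: differentiable_on_eq_differentiable_at[OF assms(1)] differentiable_def)
    ultimately show ?case by (simp add: Ck_on_Suc[OF assms(1)])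
  qed
  then show ?thesis by (simp add: Ck_on_infinity)
qed

section \<open>Moderate and negligible nets of functions\<close>

definition sup_mod :: "(real^'n::finite) set \<Rightarrow> (real \<Rightarrow> real^'n \<Rightarrow> real) \<Rightarrow> bool" where
  "sup_mod S u \<longleftrightarrow> (\<forall>K. compact K \<and> K \<subseteq> S \<longrightarrow>
     (\<exists>N::nat. \<exists>C. \<forall>\<^sub>F \<epsilon> in at_right 0. \<forall>x\<in>K. \<bar>u \<epsilon> x\<bar> \<le> C * (1 / \<epsilon>) ^ N))"

definition sup_negl :: "(real^'n::finite) set \<Rightarrow> (real \<Rightarrow> real^'n \<Rightarrow> real) \<Rightarrow> bool" where
  "sup_negl S u \<longleftrightarrow> (\<forall>K. compact K \<and> K \<subseteq> S \<longrightarrow>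
     (\<forall>m::nat. \<exists>C. \<forall>\<^sub>F \<epsilon> in at_right 0. \<forall>x\<in>K. \<bar>u \<epsilon> x\<bar> \<le> C * \<epsilon> ^ m))"

lemma eventually_small: "\<delta> > 0 \<Longrightarrow> \<forall>\<^sub>F \<epsilon> in at_right (0::real). 0 < \<epsilon> \<and> \<epsilon> \<le> 1 \<and> \<epsilon> < \<delta>"
  unfolding eventually_at_right_field by (intro exI[of _ "min 1 \<delta>"]) auto

lemma eventually_unit: "\<forall>\<^sub>F \<epsilon> in at_right (0::real). 0 < \<epsilon> \<and> \<epsilon> \<le> 1"
  using eventually_small[of 1] by (rule eventually_mono) auto

lemma eventually_on_unit:
  "(\<And>\<epsilon>. \<epsilon> \<in> {0<..1} \<Longrightarrow> P \<epsilon>) \<Longrightarrow> \<forall>\<^sub>F \<epsilon> in at_right (0::real). P \<epsilon>"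
  by (rule eventually_mono[OF eventually_unit]) auto

lemma sup_mod_cong:
  assumes "\<forall>\<^sub>F \<epsilon> in at_right 0. \<forall>x\<in>S. u \<epsilon> x = v \<epsilon> x" "sup_mod S u"
  shows "sup_mod S v"
  unfolding sup_mod_def
proof (intro allI impI)
  fix K assume K: "compact K \<and> K \<subseteq> S"
  with assms(2) obtain N C where "\<forall>\<^sub>F \<epsilon> in at_right 0. \<forall>x\<in>K. \<bar>u \<epsilon> x\<bar> \<le> C * (1 / \<epsilon>) ^ N"
    unfolding sup_mod_def by blast
  with assms(1) have "\<forall>\<^sub>F \<epsilon> in at_right 0. \<forall>x\<in>K. \<bar>v \<epsilon> x\<bar> \<le> C * (1 / \<epsilon>) ^ N"
    by eventually_elim (use K in \<open>metis subsetD\<close>)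
  then show "\<exists>N C. \<forall>\<^sub>F \<epsilon> in at_right 0. \<forall>x\<in>K. \<bar>v \<epsilon> x\<bar> \<le> C * (1 / \<epsilon>) ^ N" by blast
qed

lemma sup_negl_cong:
  assumes "\<forall>\<^sub>F \<epsilon> in at_right 0. \<forall>x\<in>S. u \<epsilon> x = v \<epsilon> x" "sup_negl S u"
  shows "sup_negl S v"
  unfolding sup_negl_def
proof (intro allI impI)
  fix K and m :: nat assume K: "compact K \<and> K \<subseteq> S"
  with assms(2) obtain C where "\<forall>\<^sub>F \<epsilon> in at_right 0. \<forall>x\<in>K. \<bar>u \<epsilon> x\<bar> \<le> C * \<epsilon> ^ m"
    unfolding sup_negl_def by blast
  with assms(1) have "\<forall>\<^sub>F \<epsilon> in at_right 0. \<forall>x\<in>K. \<bar>v \<epsilon> x\<bar> \<le> C * \<epsilon> ^ m"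
    by eventually_elim (use K in \<open>metis subsetD\<close>)
  then show "\<exists>C. \<forall>\<^sub>F \<epsilon> in at_right 0. \<forall>x\<in>K. \<bar>v \<epsilon> x\<bar> \<le> C * \<epsilon> ^ m" by blast
qed

lemma sup_mod_add:
  assumes "sup_mod S u" "sup_mod S v" shows "sup_mod S (\<lambda>\<epsilon> x. u \<epsilon> x + v \<epsilon> x)"
  unfolding sup_mod_def
proof (intro allI impI)
  fix K assume K: "compact K \<and> K \<subseteq> S"
  with assms obtain N1 C1 N2 C2
    where 1: "\<forall>\<^sub>F \<epsilon> in at_right 0. \<forall>x\<in>K. \<bar>u \<epsilon> x\<bar> \<le> C1 * (1 / \<epsilon>) ^ N1"
      and 2: "\<forall>\<^sub>F \<epsilon> in at_right 0. \<forall>x\<in>K. \<bar>v \<epsilon> x\<bar> \<le> C2 * (1 / \<epsilon>) ^ N2"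
    unfolding sup_mod_def by meson
  have "\<forall>\<^sub>F \<epsilon> in at_right 0. \<forall>x\<in>K. \<bar>u \<epsilon> x + v \<epsilon> x\<bar> \<le> (\<bar>C1\<bar> + \<bar>C2\<bar>) * (1 / \<epsilon>) ^ (N1 + N2)"
    using 1 2 eventually_unit
  proof eventually_elim
    case (elim \<epsilon>)
    have "C1 * (1 / \<epsilon>) ^ N1 \<le> \<bar>C1\<bar> * (1 / \<epsilon>) ^ (N1 + N2)" "C2 * (1 / \<epsilon>) ^ N2 \<le> \<bar>C2\<bar> * (1 / \<epsilon>) ^ (N1 + N2)"
      using elim(3) by (auto intro!: mult_mono power_increasing)
    then show ?case using elim(1,2) by (fastforce simp: distrib_right)
  qed
  then show "\<exists>N C. \<forall>\<^sub>F \<epsilon> in at_right 0. \<forall>x\<in>K. \<bar>u \<epsilon> x + v \<epsilon> x\<bar> \<le> C * (1 / \<epsilon>) ^ N" by blast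
qed

lemma sup_mod_mult:
  assumes "sup_mod S u" "sup_mod S v" shows "sup_mod S (\<lambda>\<epsilon> x. u \<epsilon> x * v \<epsilon> x)"
  unfolding sup_mod_def
proof (intro allI impI)
  fix K assume K: "compact K \<and> K \<subseteq> S"
  with assms obtain N1 C1 N2 C2
    where 1: "\<forall>\<^sub>F \<epsilon> in at_right 0. \<forall>x\<in>K. \<bar>u \<epsilon> x\<bar> \<le> C1 * (1 / \<epsilon>) ^ N1"
      and 2: "\<forall>\<^sub>F \<epsilon> in at_right 0. \<forall>x\<in>K. \<bar>v \<epsilon> x\<bar> \<le> C2 * (1 / \<epsilon>) ^ N2"
    unfolding sup_mod_def by meson
  have "\<forall>\<^sub>F \<epsilon> in at_right 0. \<forall>x\<in>K. \<bar>u \<epsilon> x * v \<epsilon> x\<bar> \<le> (C1 * C2) * (1 / \<epsilon>) ^ (N1 + N2)"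
    using 1 2
  proof eventually_elim
    case (elim \<epsilon>)
    show ?case
    proof
      fix x assume "x \<in> K"
      then have "\<bar>u \<epsilon> x\<bar> * \<bar>v \<epsilon> x\<bar> \<le> (C1 * (1 / \<epsilon>) ^ N1) * (C2 * (1 / \<epsilon>) ^ N2)"
        using elim by (intro mult_mono) (auto intro: order_trans[OF abs_ge_zero])
      then show "\<bar>u \<epsilon> x * v \<epsilon> x\<bar> \<le> (C1 * C2) * (1 / \<epsilon>) ^ (N1 + N2)"
        by (simp only: abs_mult power_add mult.assoc mult.left_commute)
    qed
  qed
  then show "\<exists>N C. \<forall>\<^sub>F \<epsilon> in at_right 0. \<forall>x\<in>K. \<bar>u \<epsilon> x * v \<epsilon> x\<bar> \<le> C * (1 / \<epsilon>) ^ N" by blast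
qed

lemma sup_negl_add:
  assumes "sup_negl S u" "sup_negl S v" shows "sup_negl S (\<lambda>\<epsilon> x. u \<epsilon> x + v \<epsilon> x)"
  unfolding sup_negl_def
proof (intro allI impI)
  fix K and m :: nat assume K: "compact K \<and> K \<subseteq> S"
  with assms obtain C1 C2
    where 1: "\<forall>\<^sub>F \<epsilon> in at_right 0. \<forall>x\<in>K. \<bar>u \<epsilon> x\<bar> \<le> C1 * \<epsilon> ^ m"
      and 2: "\<forall>\<^sub>F \<epsilon> in at_right 0. \<forall>x\<in>K. \<bar>v \<epsilon> x\<bar> \<le> C2 * \<epsilon> ^ m"
    unfolding sup_negl_def by meson
  have "\<forall>\<^sub>F \<epsilon> in at_right 0. \<forall>x\<in>K. \<bar>u \<epsilon> x + v \<epsilon> x\<bar> \<le> (C1 + C2) * \<epsilon> ^ m"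
    using 1 2 by eventually_elim (fastforce simp: distrib_right)
  then show "\<exists>C. \<forall>\<^sub>F \<epsilon> in at_right 0. \<forall>x\<in>K. \<bar>u \<epsilon> x + v \<epsilon> x\<bar> \<le> C * \<epsilon> ^ m" by blast
qed

lemma sup_negl_mult:
  assumes "sup_negl S u" "sup_mod S v" shows "sup_negl S (\<lambda>\<epsilon> x. u \<epsilon> x * v \<epsilon> x)"
  unfolding sup_negl_def
proof (intro allI impI)
  fix K and m :: nat assume K: "compact K \<and> K \<subseteq> S"
  with assms(2) obtain N C2 where 2: "\<forall>\<^sub>F \<epsilon> in at_right 0. \<forall>x\<in>K. \<bar>v \<epsilon> x\<bar> \<le> C2 * (1 / \<epsilon>) ^ N"
    unfolding sup_mod_def by meson
  from K assms(1) obtain C1 where 1: "\<forall>\<^sub>F \<epsilon> in at_right 0. \<forall>x\<in>K. \<bar>u \<epsilon> x\<bar> \<le> C1 * \<epsilon> ^ (m + N)"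
    unfolding sup_negl_def by meson
  have "\<forall>\<^sub>F \<epsilon> in at_right 0. \<forall>x\<in>K. \<bar>u \<epsilon> x * v \<epsilon> x\<bar> \<le> (C1 * C2) * \<epsilon> ^ m"
    using 1 2 eventually_unit
  proof eventually_elim
    case (elim \<epsilon>)
    show ?case
    proof
      fix x assume "x \<in> K"
      then have "\<bar>u \<epsilon> x\<bar> * \<bar>v \<epsilon> x\<bar> \<le> (C1 * \<epsilon> ^ (m + N)) * (C2 * (1 / \<epsilon>) ^ N)"
        using elim by (intro mult_mono) (auto intro: order_trans[OF abs_ge_zero])
      also have "\<dots> = (C1 * C2) * \<epsilon> ^ m"
        using elim(3) by (simp add: power_add power_one_over field_simps)
      finally show "\<bar>u \<epsilon> x * v \<epsilon> x\<bar> \<le> (C1 * C2) * \<epsilon> ^ m" by (simp add: abs_mult)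
    qed
  qed
  then show "\<exists>C. \<forall>\<^sub>F \<epsilon> in at_right 0. \<forall>x\<in>K. \<bar>u \<epsilon> x * v \<epsilon> x\<bar> \<le> C * \<epsilon> ^ m" by blast
qed

lemma sup_mod_fixed: "continuous_on S f \<Longrightarrow> sup_mod S (\<lambda>\<epsilon>. f)"
  unfolding sup_mod_def
proof (intro allI impI)
  fix K assume f: "continuous_on S f" and K: "compact K \<and> K \<subseteq> S"
  then have "bounded (f ` K)"
    by (meson compact_continuous_image compact_imp_bounded continuous_on_subset)
  then obtain C where "\<forall>x\<in>K. \<bar>f x\<bar> \<le> C" unfolding bounded_iff by auto
  then show "\<exists>N C. \<forall>\<^sub>F \<epsilon> in at_right 0. \<forall>x\<in>K. \<bar>f x\<bar> \<le> C * (1 / \<epsilon>) ^ N"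
    by (intro exI[of _ 0] exI[of _ C]) auto
qed

lemma sup_negl_zero: "sup_negl S (\<lambda>\<epsilon> x. 0)"
  unfolding sup_negl_def by (auto intro!: exI[of _ 0])

lemma sup_mod_subset: "sup_mod S u \<Longrightarrow> T \<subseteq> S \<Longrightarrow> sup_mod T u"
  unfolding sup_mod_def by (meson order_trans)

lemma sup_negl_subset: "sup_negl S u \<Longrightarrow> T \<subseteq> S \<Longrightarrow> sup_negl T u"
  unfolding sup_negl_def by (meson order_trans)

definition smoothnet :: "(real^'n::finite) set \<Rightarrow> (real \<Rightarrow> real^'n \<Rightarrow> real) \<Rightarrow> bool" where
  "smoothnet S u \<longleftrightarrow> (\<forall>\<epsilon>\<in>{0<..1}. Ck_on \<infinity> (u \<epsilon>) S)"

text \<open>Moderateness concerns all derivatives. For negligibility of a moderate net it is enough to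
  estimate the values; the derivatives are covered by \<open>neglnet_partial\<close> below.\<close>

definition modnet :: "(real^'n::finite) set \<Rightarrow> (real \<Rightarrow> real^'n \<Rightarrow> real) \<Rightarrow> bool" where
  "modnet S u \<longleftrightarrow> smoothnet S u \<and> (\<forall>\<alpha>. sup_mod S (\<lambda>\<epsilon>. partials \<alpha> (u \<epsilon>)))"

definition neglnet :: "(real^'n::finite) set \<Rightarrow> (real \<Rightarrow> real^'n \<Rightarrow> real) \<Rightarrow> bool" where
  "neglnet S u \<longleftrightarrow> modnet S u \<and> sup_negl S u"

lemma smoothnet_cong:
  assumes "open S" "\<And>\<epsilon> x. \<epsilon> \<in> {0<..1} \<Longrightarrow> x \<in> S \<Longrightarrow> u \<epsilon> x = v \<epsilon> x" "smoothnet S u"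
  shows "smoothnet S v"
  using assms Ck_on_cong[OF assms(1)] unfolding smoothnet_def by blast

lemma modnet_smoothnet: "modnet S u \<Longrightarrow> smoothnet S u" by (simp add: modnet_def)

lemma neglnet_modnet: "neglnet S u \<Longrightarrow> modnet S u" by (simp add: neglnet_def)

lemma neglnet_sup: "neglnet S u \<Longrightarrow> sup_negl S u" by (simp add: neglnet_def)

lemma modnet_sup: "modnet S u \<Longrightarrow> sup_mod S u"
proof -
  assume "modnet S u"
  then have "sup_mod S (\<lambda>\<epsilon>. partials [] (u \<epsilon>))" unfolding modnet_def by blast
  then show ?thesis by simp
qed

lemma modnet_cong:
  assumes "open S" "\<And>\<epsilon> x. \<epsilon> \<in> {0<..1} \<Longrightarrow> x \<in> S \<Longrightarrow> u \<epsilon> x = v \<epsilon> x" "modnet S u"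
  shows "modnet S v"
proof -
  have "sup_mod S (\<lambda>\<epsilon>. partials \<alpha> (v \<epsilon>))" for \<alpha>
    by (rule sup_mod_cong[of _ "\<lambda>\<epsilon>. partials \<alpha> (u \<epsilon>)"])
      (use assms in \<open>auto intro!: eventually_on_unit partials_cong simp: modnet_def\<close>)
  then show ?thesis using assms smoothnet_cong unfolding modnet_def by blast
qed

lemma neglnet_cong:
  assumes "open S" "\<And>\<epsilon> x. \<epsilon> \<in> {0<..1} \<Longrightarrow> x \<in> S \<Longrightarrow> u \<epsilon> x = v \<epsilon> x" "neglnet S u"
  shows "neglnet S v"
proof -
  have "sup_negl S v"
    by (rule sup_negl_cong[of _ u]) (use assms in \<open>auto intro!: eventually_on_unit simp: neglnet_def\<close>)
  then show ?thesis using assms modnet_cong unfolding neglnet_def by blast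
qed

lemma modnet_subset: "modnet S u \<Longrightarrow> T \<subseteq> S \<Longrightarrow> modnet T u"
  unfolding modnet_def smoothnet_def by (meson Ck_on_subset sup_mod_subset)

lemma neglnet_subset: "neglnet S u \<Longrightarrow> T \<subseteq> S \<Longrightarrow> neglnet T u"
  unfolding neglnet_def by (meson modnet_subset sup_negl_subset)

lemma smoothnet_partial: "open S \<Longrightarrow> smoothnet S u \<Longrightarrow> smoothnet S (\<lambda>\<epsilon>. partial i (u \<epsilon>))"
  by (simp add: smoothnet_def smooth_partial)

lemma modnet_partial:
  assumes "open S" "modnet S u" shows "modnet S (\<lambda>\<epsilon>. partial i (u \<epsilon>))"
proof -
  have "sup_mod S (\<lambda>\<epsilon>. partials (\<alpha> @ [i]) (u \<epsilon>))" for \<alpha> using assms unfolding modnet_def by blast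
  then show ?thesis using assms smoothnet_partial[OF assms(1)] unfolding modnet_def
    by (simp add: partials_append partials_Cons)
qed

lemma partials_add:
  assumes "open S" "Ck_on \<infinity> f S" "Ck_on \<infinity> g S" "x \<in> S"
  shows "partials \<alpha> (\<lambda>x. f x + g x) x = partials \<alpha> f x + partials \<alpha> g x"
  using assms(4)
proof (induction \<alpha> arbitrary: x)
  case (Cons i \<alpha>)
  have "partial i (partials \<alpha> (\<lambda>x. f x + g x)) x = partial i (\<lambda>x. partials \<alpha> f x + partials \<alpha> g x) x"
    by (rule partial_cong[OF assms(1) Cons.prems]) (rule Cons.IH)
  also have "\<dots> = partial i (partials \<alpha> f) x + partial i (partials \<alpha> g) x"
    by (intro partial_add smooth_imp_differentiable[OF _ assms(1) Cons.prems] smooth_partials assms)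
  finally show ?case by (simp add: partials_Cons)
qed simp

lemma modnet_add:
  assumes "open S" "modnet S u" "modnet S v" shows "modnet S (\<lambda>\<epsilon> x. u \<epsilon> x + v \<epsilon> x)"
proof -
  have "sup_mod S (\<lambda>\<epsilon>. partials \<alpha> (\<lambda>x. u \<epsilon> x + v \<epsilon> x))" for \<alpha>
  proof (rule sup_mod_cong)
    show "sup_mod S (\<lambda>\<epsilon> x. partials \<alpha> (u \<epsilon>) x + partials \<alpha> (v \<epsilon>) x)"
      using assms by (intro sup_mod_add) (auto simp: modnet_def)
    show "\<forall>\<^sub>F \<epsilon> in at_right 0. \<forall>x\<in>S. partials \<alpha> (u \<epsilon>) x + partials \<alpha> (v \<epsilon>) x = partials \<alpha> (\<lambda>x. u \<epsilon> x + v \<epsilon> x) x"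
      using assms by (intro eventually_on_unit) (auto simp: modnet_def smoothnet_def partials_add[OF assms(1)])
  qed
  then show ?thesis using assms unfolding modnet_def smoothnet_def by (auto intro: Ck_on_add)
qed

text \<open>Induction on the order of the derivative, where the innermost derivative is treated first: it
  turns a product of moderate nets into a sum of two such products.\<close>

lemma modnet_mult:
  assumes "open S" "modnet S u" "modnet S v" shows "modnet S (\<lambda>\<epsilon> x. u \<epsilon> x * v \<epsilon> x)"
proof -
  have "sup_mod S (\<lambda>\<epsilon>. partials \<alpha> (\<lambda>x. u \<epsilon> x * v \<epsilon> x))" if "modnet S u" "modnet S v" for u v \<alpha>
    using that
  proof (induction \<alpha> arbitrary: u v rule: rev_induct)
    case Nil then show ?case by (simp add: sup_mod_mult modnet_sup)
  next
    case (snoc i \<alpha>)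
    show ?case
    proof (rule sup_mod_cong)
      show "sup_mod S (\<lambda>\<epsilon> x. partials \<alpha> (\<lambda>x. partial i (u \<epsilon>) x * v \<epsilon> x) x + partials \<alpha> (\<lambda>x. u \<epsilon> x * partial i (v \<epsilon>) x) x)"
        using snoc modnet_partial[OF assms(1)] by (intro sup_mod_add) auto
      show "\<forall>\<^sub>F \<epsilon> in at_right 0. \<forall>x\<in>S. partials \<alpha> (\<lambda>x. partial i (u \<epsilon>) x * v \<epsilon> x) x + partials \<alpha> (\<lambda>x. u \<epsilon> x * partial i (v \<epsilon>) x) x
          = partials (\<alpha> @ [i]) (\<lambda>x. u \<epsilon> x * v \<epsilon> x) x"
      proof (intro eventually_on_unit ballI)
        fix \<epsilon> :: real and x assume e: "\<epsilon> \<in> {0<..1}" and x: "x \<in> S"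
        have s: "Ck_on \<infinity> (u \<epsilon>) S" "Ck_on \<infinity> (v \<epsilon>) S"
          using e snoc.prems by (auto simp: modnet_def smoothnet_def)
        have "partials \<alpha> (partial i (\<lambda>x. u \<epsilon> x * v \<epsilon> x)) x
           = partials \<alpha> (\<lambda>x. partial i (u \<epsilon>) x * v \<epsilon> x + u \<epsilon> x * partial i (v \<epsilon>) x) x"
          by (rule partials_cong[OF assms(1) x], rule partial_mult; rule smooth_imp_differentiable[OF _ assms(1)])
            (use s in auto)
        also have "\<dots> = partials \<alpha> (\<lambda>x. partial i (u \<epsilon>) x * v \<epsilon> x) x + partials \<alpha> (\<lambda>x. u \<epsilon> x * partial i (v \<epsilon>) x) x"
          by (rule partials_add[OF assms(1) _ _ x]) (intro Ck_on_mult smooth_partial s assms(1))+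
        finally show "partials \<alpha> (\<lambda>x. partial i (u \<epsilon>) x * v \<epsilon> x) x + partials \<alpha> (\<lambda>x. u \<epsilon> x * partial i (v \<epsilon>) x) x
          = partials (\<alpha> @ [i]) (\<lambda>x. u \<epsilon> x * v \<epsilon> x) x"
          by (simp add: partials_append partials_Cons)
      qed
    qed
  qed
  then show ?thesis using assms unfolding modnet_def smoothnet_def by (auto intro: Ck_on_mult)
qed

lemma modnet_fixed: "open S \<Longrightarrow> Ck_on \<infinity> f S \<Longrightarrow> modnet S (\<lambda>\<epsilon>. f)"
  unfolding modnet_def smoothnet_def
  by (auto intro: sup_mod_fixed Ck_on_imp_continuous smooth_partials)

lemma modnet_const: "open S \<Longrightarrow> modnet S (\<lambda>\<epsilon> x. a)"
  by (simp add: modnet_fixed Ck_on_const)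

lemma modnet_cmult: "open S \<Longrightarrow> modnet S u \<Longrightarrow> modnet S (\<lambda>\<epsilon> x. a * u \<epsilon> x)"
  by (simp add: modnet_mult modnet_const)

lemma modnet_diff:
  assumes "open S" "modnet S u" "modnet S v" shows "modnet S (\<lambda>\<epsilon> x. u \<epsilon> x - v \<epsilon> x)"
  using modnet_add[OF assms(1,2) modnet_cmult[OF assms(1,3), of "-1"]] by simp

lemma modnet_sum:
  assumes "open S" "\<And>a. a \<in> A \<Longrightarrow> modnet S (\<lambda>\<epsilon>. f a \<epsilon>)"
  shows "modnet S (\<lambda>\<epsilon> x. \<Sum>a\<in>A. f a \<epsilon> x)"
  using assms(2)
  by (induction A rule: infinite_finite_induct) (auto intro: modnet_const modnet_add assms(1))

lemma neglnet_zero: "open S \<Longrightarrow> neglnet S (\<lambda>\<epsilon> x. 0)"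
  by (simp add: neglnet_def modnet_const sup_negl_zero)

lemma neglnet_add:
  "open S \<Longrightarrow> neglnet S u \<Longrightarrow> neglnet S v \<Longrightarrow> neglnet S (\<lambda>\<epsilon> x. u \<epsilon> x + v \<epsilon> x)"
  by (simp add: neglnet_def modnet_add sup_negl_add)

lemma neglnet_mult:
  "open S \<Longrightarrow> neglnet S u \<Longrightarrow> modnet S v \<Longrightarrow> neglnet S (\<lambda>\<epsilon> x. u \<epsilon> x * v \<epsilon> x)"
  by (simp add: neglnet_def modnet_mult sup_negl_mult modnet_sup)

lemma neglnet_mult2:
  "open S \<Longrightarrow> modnet S u \<Longrightarrow> neglnet S v \<Longrightarrow> neglnet S (\<lambda>\<epsilon> x. u \<epsilon> x * v \<epsilon> x)"
  using neglnet_mult[of S v u] by (simp add: mult.commute)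

lemma neglnet_cmult: "open S \<Longrightarrow> neglnet S u \<Longrightarrow> neglnet S (\<lambda>\<epsilon> x. a * u \<epsilon> x)"
  by (simp add: neglnet_mult2 modnet_const)

lemma neglnet_diff:
  assumes "open S" "neglnet S u" "neglnet S v" shows "neglnet S (\<lambda>\<epsilon> x. u \<epsilon> x - v \<epsilon> x)"
  using neglnet_add[OF assms(1,2) neglnet_cmult[OF assms(1,3), of "-1"]] by simp

lemma neglnet_sum:
  assumes "open S" "\<And>a. a \<in> A \<Longrightarrow> neglnet S (\<lambda>\<epsilon>. f a \<epsilon>)"
  shows "neglnet S (\<lambda>\<epsilon> x. \<Sum>a\<in>A. f a \<epsilon> x)"
  using assms(2)
  by (induction A rule: infinite_finite_induct) (auto intro: neglnet_zero neglnet_add assms(1))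

lemma DERIV_along_axis:
  assumes "f differentiable (at (x + s *\<^sub>R axis i 1))"
  shows "((\<lambda>s. f (x + s *\<^sub>R axis i 1)) has_real_derivative partial i f (x + s *\<^sub>R axis i 1)) (at s)"
proof -
  have "((\<lambda>s. x + s *\<^sub>R axis i (1::real)) has_derivative (\<lambda>h. h *\<^sub>R axis i 1)) (at s)"
    by (auto intro!: derivative_eq_intros)
  from has_derivative_compose[OF this has_derivative_partial[OF assms]]
  have "((\<lambda>s. f (x + s *\<^sub>R axis i 1)) has_derivative
     (\<lambda>h. \<Sum>k\<in>UNIV. (h *\<^sub>R axis i 1) $ k * partial k f (x + s *\<^sub>R axis i 1))) (at s)" .
  moreover have "(\<lambda>h. \<Sum>k\<in>UNIV. (h *\<^sub>R axis i (1::real)) $ k * partial k f (x + s *\<^sub>R axis i 1))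
     = (*) (partial i f (x + s *\<^sub>R axis i 1))"
    by (rule ext) (auto simp: axis_def if_distrib if_distribR cong: if_cong)
  ultimately show ?thesis by (simp add: has_field_derivative_def)
qed

text \<open>The interpolation inequality behind the fact that negligibility of a moderate net needs to
  be tested on the values only: the derivative is bounded by a difference quotient of step \<open>t\<close> up
  to an error of order \<open>t\<close> times the second derivative.\<close>

lemma partial_interpolation:
  assumes S: "open S" and f: "Ck_on \<infinity> f S" and t: "t > 0" and K: "cball x t \<subseteq> S"
    and A: "\<And>y. y \<in> cball x t \<Longrightarrow> \<bar>f y\<bar> \<le> A"
    and B: "\<And>y. y \<in> cball x t \<Longrightarrow> \<bar>partial i (partial i f) y\<bar> \<le> B"
  shows "\<bar>partial i f x\<bar> \<le> 2 * A / t + t * B"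
proof -
  define p where "p s = x + s *\<^sub>R axis i (1::real)" for s
  have pc: "p s \<in> cball x t" if "0 \<le> s" "s \<le> t" for s
    using that by (simp add: p_def dist_norm)
  have pS: "p s \<in> S" if "0 \<le> s" "s \<le> t" for s using pc[OF that] K by blast
  have "\<exists>z>0. z < t \<and> f (p t) - f (p 0) = (t - 0) * partial i f (p z)"
    unfolding p_def by (rule MVT2[OF t], rule DERIV_along_axis,
        rule smooth_imp_differentiable[OF f S pS[unfolded p_def]]) auto
  then obtain z where z: "0 < z" "z < t" "f (p t) - f (p 0) = t * partial i f (p z)" by auto
  have "\<exists>y>0. y < z \<and> partial i f (p z) - partial i f (p 0) = (z - 0) * partial i (partial i f) (p y)"
    unfolding p_def by (rule MVT2[OF z(1)], rule DERIV_along_axis,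
        rule smooth_imp_differentiable[OF smooth_partial[OF f S] S pS[unfolded p_def]]) (use z in auto)
  then obtain y where y: "0 < y" "y < z" "partial i f (p z) - partial i f (p 0) = z * partial i (partial i f) (p y)"
    by auto
  have 1: "\<bar>partial i f (p z)\<bar> \<le> 2 * A / t"
  proof -
    have "\<bar>t * partial i f (p z)\<bar> \<le> 2 * A"
      using A[OF pc[of t]] A[OF pc[of 0]] t unfolding z(3)[symmetric] by simp
    then show ?thesis using t by (simp add: abs_mult field_simps)
  qed
  have "\<bar>z * partial i (partial i f) (p y)\<bar> \<le> t * B"
    using B[OF pc[of y]] y z by (auto simp: abs_mult intro!: mult_mono)
  with 1 y(3) show ?thesis by (simp add: p_def)
qed

lemma sup_negl_partial:
  assumes S: "open S" and u: "neglnet S u" shows "sup_negl S (\<lambda>\<epsilon>. partial i (u \<epsilon>))"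
  unfolding sup_negl_def
proof (intro allI impI)
  fix K and m :: nat assume K: "compact K \<and> K \<subseteq> S"
  show "\<exists>C. \<forall>\<^sub>F \<epsilon> in at_right 0. \<forall>x\<in>K. \<bar>partial i (u \<epsilon>) x\<bar> \<le> C * \<epsilon> ^ m"
  proof (cases "K = {}")
    case False
    then obtain d where d: "d > 0" "{x. infdist x K \<le> d} \<subseteq> S"
      using compact_in_open_separated[of K S] K S by metis
    define K' where "K' = {x. infdist x K \<le> d}"
    have K': "compact K'" "K' \<subseteq> S" using d False K compact_infdist_le[of K d] by (auto simp: K'_def)
    have cb: "cball x d \<subseteq> K'" if "x \<in> K" for x
      using that infdist_le2[OF that] by (auto simp: K'_def dist_commute)
    have "sup_mod S (\<lambda>\<epsilon>. partials [i, i] (u \<epsilon>))" using u unfolding neglnet_def modnet_def by blast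
    then obtain N B where B: "\<forall>\<^sub>F \<epsilon> in at_right 0. \<forall>x\<in>K'. \<bar>partial i (partial i (u \<epsilon>)) x\<bar> \<le> B * (1 / \<epsilon>) ^ N"
      using K' unfolding sup_mod_def by (auto simp: partials_Cons)
    obtain A where A: "\<forall>\<^sub>F \<epsilon> in at_right 0. \<forall>x\<in>K'. \<bar>u \<epsilon> x\<bar> \<le> A * \<epsilon> ^ (2 * m + N + 1)"
      using u K' unfolding neglnet_def sup_negl_def by meson
    \<comment> \<open>The step \<open>\<epsilon> ^ (m + N + 1)\<close> is small enough to absorb the growth of the second derivative,
      and division by it costs fewer powers than the values of the net provide.\<close>
    have "\<forall>\<^sub>F \<epsilon> in at_right 0. \<forall>x\<in>K. \<bar>partial i (u \<epsilon>) x\<bar> \<le> (2 * A + \<bar>B\<bar>) * \<epsilon> ^ m"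
      using A B eventually_small[OF d(1)]
    proof eventually_elim
      case (elim \<epsilon>)
      define t where "t = \<epsilon> ^ (m + N + 1)"
      have "t \<le> \<epsilon> ^ 1" unfolding t_def using elim(3) by (intro power_decreasing) auto
      then have "t \<le> d" unfolding power_one_right using elim(3) by linarith
      moreover have "0 < t" unfolding t_def using elim(3) by (intro zero_less_power) blast
      ultimately have t: "0 < t" "t \<le> d" by blast+
      have s: "Ck_on \<infinity> (u \<epsilon>) S" using u elim(3) by (auto simp: neglnet_def modnet_def smoothnet_def)
      show ?case
      proof
        fix x assume x: "x \<in> K"
        have cs: "cball x t \<subseteq> K'" using cb[OF x] t by (meson order_trans subset_cball)
        have "\<bar>partial i (u \<epsilon>) x\<bar> \<le> 2 * (A * \<epsilon> ^ (2 * m + N + 1)) / t + t * (B * (1 / \<epsilon>) ^ N)"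
          using elim(1,2) cs K'(2) by (intro partial_interpolation[OF S s t(1)]) auto
        also have "2 * (A * \<epsilon> ^ (2 * m + N + 1)) / t = 2 * A * \<epsilon> ^ m"
        proof -
          have "\<epsilon> ^ (2 * m + N + 1) = \<epsilon> ^ m * t"
            unfolding t_def power_add[symmetric] by (simp add: mult_2 add.assoc)
          then show ?thesis using t(1) by simp
        qed
        also have "t * (B * (1 / \<epsilon>) ^ N) = B * (\<epsilon> ^ m * \<epsilon>)"
        proof -
          have "t = \<epsilon> ^ m * \<epsilon> * \<epsilon> ^ N" by (simp add: t_def power_add)
          moreover have "\<epsilon> ^ N * (1 / \<epsilon>) ^ N = 1" using elim(3) by (simp add: power_mult_distrib[symmetric])
          ultimately show ?thesis by (simp add: mult.assoc mult.left_commute)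
        qed
        also have "B * (\<epsilon> ^ m * \<epsilon>) \<le> \<bar>B\<bar> * \<epsilon> ^ m"
          using elim(3) by (intro mult_mono) (auto simp: mult_left_le)
        finally show "\<bar>partial i (u \<epsilon>) x\<bar> \<le> (2 * A + \<bar>B\<bar>) * \<epsilon> ^ m" by (simp add: distrib_right)
      qed
    qed
    then show ?thesis by blast
  qed auto
qed

lemma neglnet_partial: "open S \<Longrightarrow> neglnet S u \<Longrightarrow> neglnet S (\<lambda>\<epsilon>. partial i (u \<epsilon>))"
  using sup_negl_partial modnet_partial unfolding neglnet_def by blast

lemma neglnet_partials: "open S \<Longrightarrow> neglnet S u \<Longrightarrow> neglnet S (\<lambda>\<epsilon>. partials \<alpha> (u \<epsilon>))"
  by (induction \<alpha>) (auto simp: partials_Cons neglnet_partial)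

section \<open>Convergence of nets with derivatives\<close>

definition unif_conv :: "(real^'n::finite) set \<Rightarrow> (real \<Rightarrow> real^'n \<Rightarrow> real) \<Rightarrow> (real^'n \<Rightarrow> real) \<Rightarrow> bool" where
  "unif_conv S u f \<longleftrightarrow> (\<forall>K. compact K \<and> K \<subseteq> S \<longrightarrow> uniform_limit K u f (at_right 0))"

text \<open>Convergence in \<open>C\<^sup>n\<close>, uniformly on compact sets. The limit is required to be of class \<open>C\<^sup>n\<close>,
  because \<open>partials\<close> has arbitrary values at points where a function is not differentiable.\<close>

definition conv :: "nat \<Rightarrow> (real^'n::finite) set \<Rightarrow> (real \<Rightarrow> real^'n \<Rightarrow> real) \<Rightarrow> (real^'n \<Rightarrow> real) \<Rightarrow> bool" where
  "conv n S u f \<longleftrightarrow> Ck_on (enat n) f S \<and>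
     (\<forall>\<alpha>. length \<alpha> \<le> n \<longrightarrow> unif_conv S (\<lambda>\<epsilon>. partials \<alpha> (u \<epsilon>)) (partials \<alpha> f))"

lemma unif_conv_cong:
  assumes "\<And>\<epsilon> x. \<epsilon> \<in> {0<..1} \<Longrightarrow> x \<in> S \<Longrightarrow> u \<epsilon> x = v \<epsilon> x" "\<And>x. x \<in> S \<Longrightarrow> f x = g x" "unif_conv S u f"
  shows "unif_conv S v g"
  unfolding unif_conv_def
proof (intro allI impI)
  fix K assume K: "compact K \<and> K \<subseteq> S"
  have "uniform_limit K u f (at_right 0) \<longleftrightarrow> uniform_limit K v g (at_right 0)"
    by (rule uniform_limit_cong) (use K assms(1,2) in \<open>auto intro!: eventually_on_unit\<close>)
  with K assms(3) show "uniform_limit K v g (at_right 0)" unfolding unif_conv_def by blast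
qed

lemma conv_cong:
  assumes "open S" "\<And>\<epsilon> x. \<epsilon> \<in> {0<..1} \<Longrightarrow> x \<in> S \<Longrightarrow> u \<epsilon> x = v \<epsilon> x" "\<And>x. x \<in> S \<Longrightarrow> f x = g x" "conv n S u f"
  shows "conv n S v g"
proof -
  have "unif_conv S (\<lambda>\<epsilon>. partials \<alpha> (v \<epsilon>)) (partials \<alpha> g)" if "length \<alpha> \<le> n" for \<alpha>
    by (rule unif_conv_cong[of _ "\<lambda>\<epsilon>. partials \<alpha> (u \<epsilon>)" _ "partials \<alpha> f"])
      (use that assms in \<open>auto intro!: partials_cong simp: conv_def\<close>)
  moreover have "Ck_on (enat n) g S"
    using assms(4) Ck_on_cong[OF assms(1), of f g] assms(3) unfolding conv_def by blast
  ultimately show ?thesis unfolding conv_def by blast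
qed

lemma conv_unif_conv: "conv n S u f \<Longrightarrow> unif_conv S u f"
proof -
  assume "conv n S u f"
  then have "unif_conv S (\<lambda>\<epsilon>. partials [] (u \<epsilon>)) (partials [] f)"
    unfolding conv_def by (metis le0 list.size(3))
  then show ?thesis by simp
qed

lemma conv_Ck_on: "conv n S u f \<Longrightarrow> Ck_on (enat n) f S" by (simp add: conv_def)

lemma conv_mono: "conv n S u f \<Longrightarrow> m \<le> n \<Longrightarrow> conv m S u f"
  unfolding conv_def by (auto intro: Ck_on_mono)

lemma conv_0: "conv 0 S u f \<longleftrightarrow> continuous_on S f \<and> unif_conv S u f"
  by (auto simp: conv_def zero_enat_def[symmetric] Ck_on_0)

lemma conv_Suc:
  assumes "open S"
  shows "conv (Suc n) S u f \<longleftrightarrow> f differentiable_on S \<and> unif_conv S u f \<and>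
    (\<forall>i. conv n S (\<lambda>\<epsilon>. partial i (u \<epsilon>)) (partial i f))" (is "?L \<longleftrightarrow> ?R")
proof
  assume L: ?L
  have "unif_conv S (\<lambda>\<epsilon>. partials (\<alpha> @ [i]) (u \<epsilon>)) (partials (\<alpha> @ [i]) f)" if "length \<alpha> \<le> n" for \<alpha> i
    using L that unfolding conv_def by simp
  then show ?R using L conv_unif_conv[OF L] unfolding conv_def Ck_on_Suc[OF assms]
    by (simp add: partials_append partials_Cons)
next
  assume R: ?R
  have "unif_conv S (\<lambda>\<epsilon>. partials \<alpha> (u \<epsilon>)) (partials \<alpha> f)" if "length \<alpha> \<le> Suc n" for \<alpha>
    using R that by (cases \<alpha> rule: rev_cases) (auto simp: conv_def partials_append partials_Cons)
  then show ?L using R unfolding conv_def Ck_on_Suc[OF assms] by blast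
qed

lemma conv_partial: "open S \<Longrightarrow> conv (Suc n) S u f \<Longrightarrow> conv n S (\<lambda>\<epsilon>. partial i (u \<epsilon>)) (partial i f)"
  by (simp add: conv_Suc)

lemma unif_conv_add: "unif_conv S u f \<Longrightarrow> unif_conv S v g \<Longrightarrow> unif_conv S (\<lambda>\<epsilon> x. u \<epsilon> x + v \<epsilon> x) (\<lambda>x. f x + g x)"
  unfolding unif_conv_def by (auto intro: uniform_limit_add)

lemma unif_conv_mult:
  assumes "unif_conv S u f" "unif_conv S v g" "continuous_on S f" "continuous_on S g"
  shows "unif_conv S (\<lambda>\<epsilon> x. u \<epsilon> x * v \<epsilon> x) (\<lambda>x. f x * g x)"
  unfolding unif_conv_def
proof (intro allI impI)
  fix K assume K: "compact K \<and> K \<subseteq> S"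
  then have "bounded (f ` K)" "bounded (g ` K)"
    using assms(3,4) by (meson compact_continuous_image compact_imp_bounded continuous_on_subset)+
  then show "uniform_limit K (\<lambda>\<epsilon> x. u \<epsilon> x * v \<epsilon> x) (\<lambda>x. f x * g x) (at_right 0)"
    using K assms(1,2) unfolding unif_conv_def by (intro uniform_lim_mult) auto
qed

lemma conv_add:
  assumes "open S"
  shows "smoothnet S u \<Longrightarrow> smoothnet S v \<Longrightarrow> conv n S u f \<Longrightarrow> conv n S v g \<Longrightarrow>
    conv n S (\<lambda>\<epsilon> x. u \<epsilon> x + v \<epsilon> x) (\<lambda>x. f x + g x)"
proof (induction n arbitrary: u v f g)
  case 0 then show ?case by (auto simp: conv_0 intro: unif_conv_add continuous_on_add)
next
  case (Suc n)
  have d: "f differentiable_on S" "g differentiable_on S" using Suc.prems by (auto simp: conv_Suc[OF assms])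
  have "conv n S (\<lambda>\<epsilon>. partial i (\<lambda>x. u \<epsilon> x + v \<epsilon> x)) (partial i (\<lambda>x. f x + g x))" for i
  proof (rule conv_cong[OF assms])
    show "conv n S (\<lambda>\<epsilon> x. partial i (u \<epsilon>) x + partial i (v \<epsilon>) x) (\<lambda>x. partial i f x + partial i g x)"
      using Suc by (auto simp: conv_Suc[OF assms] smoothnet_partial[OF assms])
    show "partial i f x + partial i g x = partial i (\<lambda>x. f x + g x) x" if "x \<in> S" for x
      using partial_add[OF d[THEN differentiable_onD_open[OF _ assms that]], of i] by simp
    show "partial i (u \<epsilon>) x + partial i (v \<epsilon>) x = partial i (\<lambda>x. u \<epsilon> x + v \<epsilon> x) x"
      if "\<epsilon> \<in> {0<..1}" "x \<in> S" for \<epsilon> x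
      using partial_add[OF smooth_imp_differentiable[OF _ assms that(2)] smooth_imp_differentiable[OF _ assms that(2)], of "u \<epsilon>" "v \<epsilon>" i]
        Suc.prems(1,2) that(1) unfolding smoothnet_def by simp
  qed
  moreover have "unif_conv S (\<lambda>\<epsilon> x. u \<epsilon> x + v \<epsilon> x) (\<lambda>x. f x + g x)"
    using Suc.prems by (intro unif_conv_add) (auto dest: conv_unif_conv)
  ultimately show ?case using d by (simp add: conv_Suc[OF assms] differentiable_on_add)
qed

lemma conv_mult:
  assumes "open S"
  shows "smoothnet S u \<Longrightarrow> smoothnet S v \<Longrightarrow> conv n S u f \<Longrightarrow> conv n S v g \<Longrightarrow>
    conv n S (\<lambda>\<epsilon> x. u \<epsilon> x * v \<epsilon> x) (\<lambda>x. f x * g x)"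
proof (induction n arbitrary: u v f g)
  case 0 then show ?case by (auto simp: conv_0 intro: unif_conv_mult continuous_on_mult)
next
  case (Suc n)
  have d: "f differentiable_on S" "g differentiable_on S" using Suc.prems by (auto simp: conv_Suc[OF assms])
  have m: "conv n S u f" "conv n S v g" using Suc.prems by (auto intro: conv_mono)
  have sm: "smoothnet S (\<lambda>\<epsilon> x. partial i (u \<epsilon>) x * v \<epsilon> x)" "smoothnet S (\<lambda>\<epsilon> x. u \<epsilon> x * partial i (v \<epsilon>) x)" for i
    using Suc.prems(1,2) assms unfolding smoothnet_def by (auto intro!: Ck_on_mult smooth_partial)
  have "conv n S (\<lambda>\<epsilon>. partial i (\<lambda>x. u \<epsilon> x * v \<epsilon> x)) (partial i (\<lambda>x. f x * g x))" for i
  proof (rule conv_cong[OF assms])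
    show "conv n S (\<lambda>\<epsilon> x. partial i (u \<epsilon>) x * v \<epsilon> x + u \<epsilon> x * partial i (v \<epsilon>) x) (\<lambda>x. partial i f x * g x + f x * partial i g x)"
      using Suc m sm by (intro conv_add[OF assms] Suc.IH) (auto simp: conv_Suc[OF assms] smoothnet_partial[OF assms])
    show "partial i f x * g x + f x * partial i g x = partial i (\<lambda>x. f x * g x) x" if "x \<in> S" for x
      using partial_mult[OF d[THEN differentiable_onD_open[OF _ assms that]], of i] by simp
    show "partial i (u \<epsilon>) x * v \<epsilon> x + u \<epsilon> x * partial i (v \<epsilon>) x = partial i (\<lambda>x. u \<epsilon> x * v \<epsilon> x) x"
      if "\<epsilon> \<in> {0<..1}" "x \<in> S" for \<epsilon> x
      using partial_mult[OF smooth_imp_differentiable[OF _ assms that(2)] smooth_imp_differentiable[OF _ assms that(2)], of "u \<epsilon>" "v \<epsilon>" i]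
        Suc.prems(1,2) that(1) unfolding smoothnet_def by simp
  qed
  moreover have "unif_conv S (\<lambda>\<epsilon> x. u \<epsilon> x * v \<epsilon> x) (\<lambda>x. f x * g x)"
    using Suc.prems d by (intro unif_conv_mult) (auto dest: conv_unif_conv intro: differentiable_imp_continuous_on)
  ultimately show ?case using d by (simp add: conv_Suc[OF assms] differentiable_on_mult)
qed

lemma conv_fixed: "Ck_on (enat n) f S \<Longrightarrow> conv n S (\<lambda>\<epsilon>. f) f"
  unfolding conv_def unif_conv_def by (auto intro: uniform_limit_const)

lemma smoothnet_const: "smoothnet S (\<lambda>\<epsilon> x. a)" by (simp add: smoothnet_def Ck_on_const)

lemma conv_const: "conv n S (\<lambda>\<epsilon> x. a) (\<lambda>x. a)" by (simp add: conv_fixed Ck_on_const)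

lemma smoothnet_diff: "open S \<Longrightarrow> smoothnet S u \<Longrightarrow> smoothnet S v \<Longrightarrow> smoothnet S (\<lambda>\<epsilon> x. u \<epsilon> x - v \<epsilon> x)"
  by (simp add: smoothnet_def Ck_on_diff)

lemma smoothnet_mult: "open S \<Longrightarrow> smoothnet S u \<Longrightarrow> smoothnet S v \<Longrightarrow> smoothnet S (\<lambda>\<epsilon> x. u \<epsilon> x * v \<epsilon> x)"
  by (simp add: smoothnet_def Ck_on_mult)

lemma smoothnet_sum:
  "open S \<Longrightarrow> (\<And>a. a \<in> A \<Longrightarrow> smoothnet S (\<lambda>\<epsilon>. f a \<epsilon>)) \<Longrightarrow> smoothnet S (\<lambda>\<epsilon> x. \<Sum>a\<in>A. f a \<epsilon> x)"
  unfolding smoothnet_def by (auto intro: Ck_on_sum)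

lemma conv_cmult:
  assumes "open S" "smoothnet S u" "conv n S u f" shows "conv n S (\<lambda>\<epsilon> x. a * u \<epsilon> x) (\<lambda>x. a * f x)"
  using assms by (intro conv_mult conv_const smoothnet_const)

lemma conv_diff:
  assumes "open S" "smoothnet S u" "smoothnet S v" "conv n S u f" "conv n S v g"
  shows "conv n S (\<lambda>\<epsilon> x. u \<epsilon> x - v \<epsilon> x) (\<lambda>x. f x - g x)"
proof -
  have "conv n S (\<lambda>\<epsilon> x. u \<epsilon> x + (-1) * v \<epsilon> x) (\<lambda>x. f x + (-1) * g x)"
    by (intro conv_add conv_cmult assms smoothnet_mult smoothnet_const)
  then show ?thesis by simp
qed

lemma conv_sum:
  assumes "open S" "\<And>a. a \<in> A \<Longrightarrow> smoothnet S (\<lambda>\<epsilon>. u a \<epsilon>)" "\<And>a. a \<in> A \<Longrightarrow> conv n S (\<lambda>\<epsilon>. u a \<epsilon>) (f a)"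
  shows "conv n S (\<lambda>\<epsilon> x. \<Sum>a\<in>A. u a \<epsilon> x) (\<lambda>x. \<Sum>a\<in>A. f a x)"
  using assms(2,3)
  by (induction A rule: infinite_finite_induct)
    (simp_all add: conv_const, intro conv_add smoothnet_sum assms(1), auto)

lemma unif_conv_negl: "sup_negl S u \<Longrightarrow> unif_conv S u (\<lambda>x. 0)"
  unfolding unif_conv_def
proof (intro allI impI)
  fix K assume u: "sup_negl S u" and K: "compact K \<and> K \<subseteq> S"
  then obtain C where C: "\<forall>\<^sub>F \<epsilon> in at_right 0. \<forall>x\<in>K. \<bar>u \<epsilon> x\<bar> \<le> C * \<epsilon> ^ 1" unfolding sup_negl_def by blast
  have "((\<lambda>\<epsilon>. C * \<epsilon>) \<longlongrightarrow> C * 0) (at_right 0)"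
    by (intro tendsto_intros)
  then have "uniform_limit K (\<lambda>\<epsilon> x. C * \<epsilon>) (\<lambda>x. 0) (at_right 0)"
    by (auto simp: uniform_limit_iff tendsto_iff elim!: eventually_mono)
  moreover have "\<forall>\<^sub>F \<epsilon> in at_right 0. \<forall>x\<in>K. norm (u \<epsilon> x) \<le> C * \<epsilon>"
    using C by eventually_elim simp
  ultimately show "uniform_limit K u (\<lambda>x. 0) (at_right 0)"
    by (rule uniform_limit_null_comparison[rotated])
qed

lemma conv_negl:
  assumes "open S" "neglnet S u" shows "conv n S u (\<lambda>x. 0)"
proof -
  have z: "partials \<alpha> (\<lambda>x. 0) = (\<lambda>x. 0)" for \<alpha> :: "'a list"
    by (induction \<alpha>) (simp_all add: partials_Cons partial_const)
  show ?thesis unfolding conv_def z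
    using assms by (auto simp: Ck_on_const intro!: unif_conv_negl neglnet_sup neglnet_partials)
qed

text \<open>The reason why representatives do not matter for association.\<close>

lemma conv_negl_diff:
  assumes "open S" "smoothnet S u" "smoothnet S v" "neglnet S (\<lambda>\<epsilon> x. u \<epsilon> x - v \<epsilon> x)" "conv n S v f"
  shows "conv n S u f"
proof -
  have "conv n S (\<lambda>\<epsilon> x. (u \<epsilon> x - v \<epsilon> x) + v \<epsilon> x) (\<lambda>x. 0 + f x)"
    using assms by (intro conv_add conv_negl smoothnet_diff) auto
  then show ?thesis by simp
qed

text \<open>The theorem on the differentiation of uniformly convergent sequences, applied to the parameters
  \<open>1 / (n + 1)\<close> on a ball.\<close>

lemma unif_conv_differentiable:
  assumes S: "open S" and u: "smoothnet S u" and f: "unif_conv S u f"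
    and d: "\<And>i. unif_conv S (\<lambda>\<epsilon>. partial i (u \<epsilon>)) (d i)" and x: "x \<in> S"
  shows "(f has_derivative (\<lambda>h. \<Sum>i\<in>UNIV. h $ i * d i x)) (at x)"
proof -
  obtain r where r: "r > 0" "cball x r \<subseteq> S" using S x open_contains_cball by blast
  define e where "e n = inverse (real (Suc n))" for n
  have e01: "e n \<in> {0<..1}" for n by (auto simp: e_def field_simps)
  have elim: "filterlim e (at_right 0) sequentially"
    unfolding filterlim_at using LIMSEQ_inverse_real_of_nat by (auto simp: e_def[abs_def])
  have "\<exists>g. \<forall>y\<in>ball x r. (\<lambda>n. u (e n) y) \<longlonglongrightarrow> g y \<and>
      (g has_derivative (\<lambda>h. \<Sum>i\<in>UNIV. h $ i * d i y)) (at y within ball x r)"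
  proof (rule has_derivative_sequence)
    show "(u (e n) has_derivative (\<lambda>h. \<Sum>i\<in>UNIV. h $ i * partial i (u (e n)) y)) (at y within ball x r)"
      if y: "y \<in> ball x r" for n y
    proof -
      have "y \<in> S" using r(2) y ball_subset_cball by blast
      moreover have "Ck_on \<infinity> (u (e n)) S" using u e01 unfolding smoothnet_def by blast
      ultimately have "u (e n) differentiable (at y)" by (intro smooth_imp_differentiable[OF _ S])
      from has_derivative_partial[OF this] show ?thesis by (rule has_derivative_at_withinI)
    qed
    show "x \<in> ball x r" using r by simp
    have "uniform_limit {x} u f (at_right 0)" using f[unfolded unif_conv_def, rule_format, of "{x}"] x by simp
    then have "((\<lambda>\<epsilon>. u \<epsilon> x) \<longlongrightarrow> f x) (at_right 0)" by simp
    then show "(\<lambda>n. u (e n) x) \<longlonglongrightarrow> f x" by (rule filterlim_compose[OF _ elim])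
    fix a :: real assume a: "a > 0"
    define b where "b = a / real CARD('a)"
    have b: "b > 0" using a by (simp add: b_def)
    have "\<forall>\<^sub>F \<epsilon> in at_right 0. \<forall>i. \<forall>y\<in>cball x r. dist (partial i (u \<epsilon>) y) (d i y) < b"
    proof (rule eventually_all_finite)
      fix i
      have "uniform_limit (cball x r) (\<lambda>\<epsilon>. partial i (u \<epsilon>)) (d i) (at_right 0)"
        using d[of i] r(2) compact_cball unfolding unif_conv_def by blast
      then show "\<forall>\<^sub>F \<epsilon> in at_right 0. \<forall>y\<in>cball x r. dist (partial i (u \<epsilon>) y) (d i y) < b"
        using b by (rule uniform_limitD)
    qed
    then have "\<forall>\<^sub>F n in sequentially. \<forall>i. \<forall>y\<in>cball x r. dist (partial i (u (e n)) y) (d i y) < b"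
      by (rule eventually_compose_filterlim[OF _ elim])
    then show "\<forall>\<^sub>F n in sequentially. \<forall>y\<in>ball x r. \<forall>h. norm ((\<Sum>i\<in>UNIV. h $ i * partial i (u (e n)) y) -
        (\<Sum>i\<in>UNIV. h $ i * d i y)) \<le> a * norm h"
    proof eventually_elim
      case (elim n)
      show ?case
      proof (intro ballI allI)
        fix y and h :: "real^'a" assume y: "y \<in> ball x r"
        have "norm ((\<Sum>i\<in>UNIV. h $ i * partial i (u (e n)) y) - (\<Sum>i\<in>UNIV. h $ i * d i y))
          = \<bar>\<Sum>i\<in>UNIV. h $ i * (partial i (u (e n)) y - d i y)\<bar>"
          by (simp add: sum_subtractf right_diff_distrib)
        also have "\<dots> \<le> (\<Sum>i\<in>UNIV. \<bar>h $ i * (partial i (u (e n)) y - d i y)\<bar>)" by (rule sum_abs)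
        also have "\<dots> \<le> (\<Sum>i::'a\<in>UNIV. norm h * b)"
        proof (rule sum_mono)
          fix i
          have "\<bar>partial i (u (e n)) y - d i y\<bar> \<le> b"
            using elim y by (auto simp: dist_real_def intro: less_imp_le)
          then show "\<bar>h $ i * (partial i (u (e n)) y - d i y)\<bar> \<le> norm h * b"
            unfolding abs_mult by (intro mult_mono component_le_norm_cart) auto
        qed
        also have "\<dots> = a * norm h" by (simp add: b_def)
        finally show "norm ((\<Sum>i\<in>UNIV. h $ i * partial i (u (e n)) y) - (\<Sum>i\<in>UNIV. h $ i * d i y)) \<le> a * norm h" .
      qed
    qed
  qed auto
  then obtain g where g: "\<And>y. y \<in> ball x r \<Longrightarrow> (\<lambda>n. u (e n) y) \<longlonglongrightarrow> g y"
    and D: "\<And>y. y \<in> ball x r \<Longrightarrow> (g has_derivative (\<lambda>h. \<Sum>i\<in>UNIV. h $ i * d i y)) (at y within ball x r)"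
    by blast
  have "g y = f y" if y: "y \<in> ball x r" for y
  proof -
    have "y \<in> S" using y r by auto
    then have "uniform_limit {y} u f (at_right 0)" using f[unfolded unif_conv_def, rule_format, of "{y}"] by simp
    then have "((\<lambda>\<epsilon>. u \<epsilon> y) \<longlongrightarrow> f y) (at_right 0)" by simp
    then have "(\<lambda>n. u (e n) y) \<longlonglongrightarrow> f y" by (rule filterlim_compose[OF _ elim])
    with g[OF y] show ?thesis using LIMSEQ_unique by blast
  qed
  moreover have "(g has_derivative (\<lambda>h. \<Sum>i\<in>UNIV. h $ i * d i x)) (at x)"
    using D[of x] r by (simp add: at_within_open[of x "ball x r"])
  ultimately show ?thesis using r
    by (intro has_derivative_transform_within_open[of g _ x UNIV "ball x r" f]) auto
qed

lemma conv_SucI: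
  assumes S: "open S" and u: "smoothnet S u" and f: "unif_conv S u f"
    and d: "\<And>i. conv n S (\<lambda>\<epsilon>. partial i (u \<epsilon>)) (d i)"
  shows "conv (Suc n) S u f"
proof -
  have D: "(f has_derivative (\<lambda>h. \<Sum>i\<in>UNIV. h $ i * d i x)) (at x)" if "x \<in> S" for x
    using unif_conv_differentiable[OF S u f] d conv_unif_conv that by blast
  have dd: "d j x = partial j f x" if "x \<in> S" for x j
    using partial_eqI[OF D[OF that], of j] by (simp add: axis_def if_distrib if_distribR cong: if_cong)
  have "conv n S (\<lambda>\<epsilon>. partial i (u \<epsilon>)) (partial i f)" for i
    by (rule conv_cong[OF S _ _ d[of i]]) (use dd in auto)
  moreover have "f differentiable_on S"
    using D by (auto simp: differentiable_on_eq_differentiable_at[OF S] differentiable_def)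
  ultimately show ?thesis using f by (simp add: conv_Suc[OF S])
qed

section \<open>Smooth cutoff functions\<close>

text \<open>The iterated derivatives of \<open>exp (- 1 / t)\<close> (for \<open>t > 0\<close>, continued by \<open>0\<close>) are of the form
  \<open>p (1 / t) * exp (- 1 / t)\<close> with a polynomial \<open>p\<close>.\<close>

primrec flat_poly :: "nat \<Rightarrow> real poly" where
  "flat_poly 0 = 1"
| "flat_poly (Suc n) = [:0, 0, 1:] * (flat_poly n - pderiv (flat_poly n))"

definition flat :: "nat \<Rightarrow> real \<Rightarrow> real" where
  "flat n t = (if t > 0 then poly (flat_poly n) (1 / t) * exp (- (1 / t)) else 0)"

lemma poly_over_exp: "((\<lambda>x. poly p x / exp x) \<longlongrightarrow> (0::real)) at_top"
proof -
  have "((\<lambda>x. \<Sum>i\<le>degree p. coeff p i * (x ^ i / exp x)) \<longlongrightarrow> (\<Sum>i\<le>degree p. coeff p i * 0)) at_top"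
    by (intro tendsto_sum tendsto_mult tendsto_const tendsto_power_div_exp_0)
  then show ?thesis by (simp add: poly_altdef sum_divide_distrib)
qed

lemma flat_deriv: "(flat n has_real_derivative flat (Suc n) t) (at t)"
proof -
  consider "t > 0" | "t < 0" | "t = 0" by linarith
  then show ?thesis
  proof cases
    case 1
    have "((\<lambda>t. poly (flat_poly n) (1 / t) * exp (- (1 / t))) has_real_derivative flat (Suc n) t) (at t)"
      using 1 by (auto intro!: derivative_eq_intros simp: flat_def field_simps power2_eq_square)
    then show ?thesis
      by (rule has_field_derivative_transform_within_open[of _ _ _ "{0<..}"]) (use 1 in \<open>auto simp: flat_def\<close>)
  next
    case 2
    have "((\<lambda>t. 0) has_real_derivative flat (Suc n) t) (at t)" using 2 by (simp add: flat_def)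
    then show ?thesis
      by (rule has_field_derivative_transform_within_open[of _ _ _ "{..<0}"]) (use 2 in \<open>auto simp: flat_def\<close>)
  next
    case 3
    have "((\<lambda>h. flat n h / h) \<longlongrightarrow> 0) (at_right 0)"
      unfolding filterlim_at_right_to_top
    proof (rule Lim_transform_eventually[OF poly_over_exp[of "[:0, 1:] * flat_poly n"]])
      show "\<forall>\<^sub>F x in at_top. poly ([:0, 1:] * flat_poly n) x / exp x = flat n (inverse x) / inverse x"
        using eventually_gt_at_top[of 0]
        by eventually_elim (simp add: flat_def exp_minus divide_simps)
    qed
    moreover have "((\<lambda>h. flat n h / h) \<longlongrightarrow> 0) (at_left 0)"
      by (rule Lim_transform_eventually[of "\<lambda>_. 0"])
        (auto simp: eventually_at_filter flat_def)
    ultimately have "((\<lambda>h. flat n h / h) \<longlongrightarrow> 0) (at 0)" by (simp add: filterlim_split_at)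
    then show ?thesis using 3 by (simp add: DERIV_def flat_def)
  qed
qed

lemma flat_pos: "flat 0 t \<ge> 0" "t > 0 \<Longrightarrow> flat 0 t > 0" "t \<le> 0 \<Longrightarrow> flat 0 t = 0"
  by (auto simp: flat_def)

definition inverse_deriv :: "nat \<Rightarrow> real \<Rightarrow> real" where
  "inverse_deriv n t = (- 1) ^ n * fact n * inverse t ^ Suc n"

lemma inverse_deriv_deriv:
  assumes "t > 0" shows "(inverse_deriv n has_real_derivative inverse_deriv (Suc n) t) (at t)"
proof -
  have "((\<lambda>t. (- 1) ^ n * fact n * inverse t ^ Suc n) has_real_derivative
     (- 1) ^ n * fact n * (real (Suc n) * (- (inverse t * 1 * inverse t)) * inverse t ^ n)) (at t)"
    using assms by (intro derivative_eq_intros) auto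
  also have "(- 1) ^ n * fact n * (real (Suc n) * (- (inverse t * 1 * inverse t)) * inverse t ^ n) = inverse_deriv (Suc n) t"
    by (simp add: inverse_deriv_def algebra_simps)
  finally show ?thesis unfolding inverse_deriv_def .
qed

lemma smooth_inverse:
  assumes "open S" "Ck_on \<infinity> f S" "\<And>x. x \<in> S \<Longrightarrow> f x > 0"
  shows "Ck_on \<infinity> (\<lambda>x. inverse (f x)) S"
  using smooth_compose_real[of S "{0<..}" inverse_deriv f 0] assms inverse_deriv_deriv
  by (auto simp: inverse_deriv_def)

lemma smooth_flat: "open S \<Longrightarrow> Ck_on \<infinity> f S \<Longrightarrow> Ck_on \<infinity> (\<lambda>x. flat 0 (f x)) S"
  using smooth_compose_real[of S UNIV flat f 0] flat_deriv by auto

text \<open>The quotient \<open>a / (a + b)\<close> of two functions without common zeros, where \<open>a\<close> vanishes outside the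
  larger ball and \<open>b\<close> inside the smaller one.\<close>

lemma bump_ball:
  fixes z :: "real^'n::finite"
  assumes "r > 0"
  obtains \<phi> where "Ck_on \<infinity> \<phi> UNIV" "\<And>x. x \<in> ball z r \<Longrightarrow> \<phi> x = 1" "\<And>x. x \<notin> cball z (2 * r) \<Longrightarrow> \<phi> x = 0"
proof -
  define q where "q x = (\<Sum>i\<in>UNIV. (x $ i - z $ i) * (x $ i - z $ i))" for x
  have qd: "q x = (dist z x)\<^sup>2" for x
    unfolding dist_norm power2_norm_eq_inner by (simp add: q_def inner_vec_def algebra_simps)
  have q: "Ck_on \<infinity> q UNIV" unfolding q_def by (intro Ck_on_intros open_UNIV)
  define a where "a x = flat 0 ((2 * r)\<^sup>2 - q x)" for x
  define b where "b x = flat 0 (q x - r\<^sup>2)" for x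
  have ab: "Ck_on \<infinity> a UNIV" "Ck_on \<infinity> b UNIV" unfolding a_def b_def
    by (intro smooth_flat Ck_on_intros open_UNIV q)+
  have pos: "a x + b x > 0" for x
  proof (cases "q x < (2 * r)\<^sup>2")
    case True
    then show ?thesis using flat_pos(2)[of "(2 * r)\<^sup>2 - q x"] flat_pos(1)[of "q x - r\<^sup>2"] by (simp add: a_def b_def)
  next
    case False
    have "r\<^sup>2 < (2 * r)\<^sup>2" using assms by (simp add: power2_eq_square)
    then have "0 < q x - r\<^sup>2" using False by linarith
    then show ?thesis using flat_pos(2)[of "q x - r\<^sup>2"] flat_pos(1)[of "(2 * r)\<^sup>2 - q x"] unfolding a_def b_def by linarith
  qed
  define \<phi> where "\<phi> x = a x * inverse (a x + b x)" for x
  have "Ck_on \<infinity> \<phi> UNIV" unfolding \<phi>_def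
    by (intro Ck_on_mult smooth_inverse Ck_on_add open_UNIV ab pos)
  moreover have "\<phi> x = 1" if "x \<in> ball z r" for x
  proof -
    have "q x \<le> r\<^sup>2" using that by (simp add: qd power_mono)
    then have "b x = 0" by (simp add: b_def flat_pos)
    then show ?thesis using pos[of x] by (simp add: \<phi>_def)
  qed
  moreover have "\<phi> x = 0" if "x \<notin> cball z (2 * r)" for x
  proof -
    have "(2 * r)\<^sup>2 \<le> q x" unfolding qd using that assms by (intro power_mono) auto
    then have "a x = 0" by (simp add: a_def flat_pos)
    then show ?thesis by (simp add: \<phi>_def)
  qed
  ultimately show thesis by (rule that)
qed

text \<open>Finitely many cutoff functions \<open>h\<close> of balls are combined to \<open>1 - \<Prod> (1 - h)\<close>, which is \<open>1\<close>
  where one of them is \<open>1\<close> and \<open>0\<close> where all of them vanish.\<close>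

lemma bump_compact:
  fixes S :: "(real^'n::finite) set"
  assumes "open S" "compact K" "K \<subseteq> S"
  obtains \<phi> U L where "Ck_on \<infinity> \<phi> UNIV" "open U" "K \<subseteq> U" "U \<subseteq> L" "compact L" "L \<subseteq> S"
    "\<And>x. x \<in> U \<Longrightarrow> \<phi> x = 1" "\<And>x. x \<notin> L \<Longrightarrow> \<phi> x = 0"
proof -
  have "\<exists>r>0. cball z (2 * r) \<subseteq> S" if z: "z \<in> K" for z
  proof -
    obtain e where "e > 0" "cball z e \<subseteq> S" using assms z open_contains_cball by blast
    then show ?thesis by (intro exI[of _ "e / 2"]) auto
  qed
  then have "\<forall>z\<in>K. \<exists>r>0. cball z (2 * r) \<subseteq> S" by (rule ballI)
  from bchoice[OF this] obtain r where r: "\<forall>z\<in>K. r z > 0 \<and> cball z (2 * r z) \<subseteq> S" by (elim exE)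
  have "\<exists>\<phi>. Ck_on \<infinity> \<phi> UNIV \<and> (\<forall>x\<in>ball z (r z). \<phi> x = 1) \<and> (\<forall>x. x \<notin> cball z (2 * r z) \<longrightarrow> \<phi> x = 0)"
    if "z \<in> K" for z
    by (rule bump_ball[of "r z" z]) (use r that in auto)
  then have "\<forall>z\<in>K. \<exists>\<phi>. Ck_on \<infinity> \<phi> UNIV \<and> (\<forall>x\<in>ball z (r z). \<phi> x = 1) \<and> (\<forall>x. x \<notin> cball z (2 * r z) \<longrightarrow> \<phi> x = 0)"
    by (rule ballI)
  from bchoice[OF this] obtain h where h: "\<forall>z\<in>K. Ck_on \<infinity> (h z) UNIV \<and> (\<forall>x\<in>ball z (r z). h z x = 1) \<and>
    (\<forall>x. x \<notin> cball z (2 * r z) \<longrightarrow> h z x = 0)" by (elim exE)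
  have cov: "K \<subseteq> (\<Union>z\<in>K. ball z (r z))" using r by force
  obtain F where F: "F \<subseteq> K" "finite F" "K \<subseteq> (\<Union>z\<in>F. ball z (r z))"
    by (rule compactE_image[OF assms(2) _ cov]) auto
  define \<phi> where "\<phi> x = 1 - (\<Prod>z\<in>F. 1 - h z x)" for x
  show thesis
  proof (rule that[of \<phi> "\<Union>z\<in>F. ball z (r z)" "\<Union>z\<in>F. cball z (2 * r z)"])
    show "Ck_on \<infinity> \<phi> UNIV" unfolding \<phi>_def by (intro Ck_on_intros open_UNIV) (use h F in auto)
    show "(\<Union>z\<in>F. ball z (r z)) \<subseteq> (\<Union>z\<in>F. cball z (2 * r z))"
    proof (rule UN_mono[OF subset_refl])
      fix z assume "z \<in> F"
      then have "r z > 0" using r F(1) by blast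
      then show "ball z (r z) \<subseteq> cball z (2 * r z)" by (auto simp: subset_iff)
    qed
    show "(\<Union>z\<in>F. cball z (2 * r z)) \<subseteq> S" using r F(1) by blast
    show "\<phi> x = 1" if x: "x \<in> (\<Union>z\<in>F. ball z (r z))" for x
    proof -
      obtain z where "z \<in> F" "x \<in> ball z (r z)" using x by blast
      then have "\<exists>z\<in>F. 1 - h z x = 0" using h F(1) by (intro bexI[of _ z]) auto
      then show ?thesis using F(2) by (simp add: \<phi>_def)
    qed
    show "\<phi> x = 0" if "x \<notin> (\<Union>z\<in>F. cball z (2 * r z))" for x
    proof -
      have "\<forall>z\<in>F. 1 - h z x = 1" using that h F(1) by auto
      then show ?thesis by (simp add: \<phi>_def)
    qed
  qed (use F in \<open>auto intro!: compact_UN\<close>)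
qed

section \<open>Charts and Jacobians\<close>

abbreviation img :: "('a, 'n::finite) chart \<Rightarrow> (real^'n) set" where
  "img c \<equiv> snd c ` fst c"

lemma chart_inv_in: "x \<in> img c \<Longrightarrow> chart_inv c x \<in> fst c"
  unfolding chart_inv_def by (rule inv_into_into)

lemma snd_chart_inv: "x \<in> img c \<Longrightarrow> snd c (chart_inv c x) = x"
  unfolding chart_inv_def by (rule f_inv_into_f)

context
  fixes M :: "('a, 'n::finite) mfd"
  assumes M: "smooth_manifold M"
begin

lemma chart: "c \<in> atlas M \<Longrightarrow> is_chart (mtop M) c" using M by (simp add: smooth_manifold_def)

lemma open_img: "c \<in> atlas M \<Longrightarrow> open (img c)" using chart by (auto simp: is_chart_def)

lemma openin_chart: "c \<in> atlas M \<Longrightarrow> openin (mtop M) (fst c)" using chart by (auto simp: is_chart_def)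

lemma chart_topspace: "c \<in> atlas M \<Longrightarrow> topspace (subtopology (mtop M) (fst c)) = fst c"
  by (rule topspace_subtopology_subset[OF openin_subset[OF openin_chart]])

lemma chart_inj: "c \<in> atlas M \<Longrightarrow> inj_on (snd c) (fst c)"
  using homeomorphic_imp_injective_map[of "subtopology (mtop M) (fst c)" "top_of_set (img c)" "snd c"]
    chart[of c] chart_topspace[of c] by (simp add: is_chart_def)

lemma chart_inv_snd: "c \<in> atlas M \<Longrightarrow> p \<in> fst c \<Longrightarrow> chart_inv c (snd c p) = p"
  by (simp add: chart_inv_def inv_into_f_f chart_inj)

lemma open_snd_image:
  assumes "c \<in> atlas M" "openin (mtop M) U" shows "open (snd c ` (fst c \<inter> U))"
proof -
  have "homeomorphic_map (subtopology (mtop M) (fst c)) (top_of_set (img c)) (snd c)"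
    using chart[OF assms(1)] by (simp add: is_chart_def)
  then have "open_map (subtopology (mtop M) (fst c)) (top_of_set (img c)) (snd c)"
    by (rule homeomorphic_imp_open_map)
  moreover have "openin (subtopology (mtop M) (fst c)) (fst c \<inter> U)"
    using assms(2) by (auto simp: openin_subtopology Int_commute)
  ultimately have "openin (top_of_set (img c)) (snd c ` (fst c \<inter> U))" unfolding open_map_def by blast
  then show ?thesis using open_img[OF assms(1)] openin_open_trans by blast
qed

lemma open_overlap: "c \<in> atlas M \<Longrightarrow> c' \<in> atlas M \<Longrightarrow> open (snd c ` (fst c \<inter> fst c'))"
  by (simp add: open_snd_image openin_chart)

lemma chart_inv_continuous:
  assumes "c \<in> atlas M" shows "continuous_map (top_of_set (img c)) (subtopology (mtop M) (fst c)) (chart_inv c)"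
proof -
  have h: "homeomorphic_map (subtopology (mtop M) (fst c)) (top_of_set (img c)) (snd c)"
    using chart[OF assms] by (simp add: is_chart_def)
  then obtain g where g: "homeomorphic_maps (subtopology (mtop M) (fst c)) (top_of_set (img c)) (snd c) g"
    using homeomorphic_map_maps by blast
  then have gc: "continuous_map (top_of_set (img c)) (subtopology (mtop M) (fst c)) g"
    and gi: "\<forall>p\<in>fst c. g (snd c p) = p"
    unfolding homeomorphic_maps_def chart_topspace[OF assms] by auto
  have "continuous_map (top_of_set (img c)) (subtopology (mtop M) (fst c)) (chart_inv c)"
  proof (rule continuous_map_eq[OF gc])
    fix x assume "x \<in> topspace (top_of_set (img c))"
    then have "x \<in> img c" by simp
    then show "g x = chart_inv c x" using gi chart_inv_in[of x c] snd_chart_inv[of x c] by fastforce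
  qed
  then show ?thesis .
qed

lemma compact_chart_inv:
  assumes "c \<in> atlas M" "compact L" "L \<subseteq> img c"
  shows "compactin (mtop M) (chart_inv c ` L)"
proof -
  have "compactin (top_of_set (img c)) L" using assms by (simp add: compactin_subtopology)
  then have "compactin (subtopology (mtop M) (fst c)) (chart_inv c ` L)"
    using image_compactin chart_inv_continuous[OF assms(1)] by blast
  then show ?thesis by (simp add: compactin_subtopology)
qed

lemma compact_snd_image:
  assumes "c \<in> atlas M" "compactin (mtop M) K" "K \<subseteq> fst c" shows "compact (snd c ` K)"
proof -
  have "homeomorphic_map (subtopology (mtop M) (fst c)) (top_of_set (img c)) (snd c)"
    using chart[OF assms(1)] by (simp add: is_chart_def)
  then have "continuous_map (subtopology (mtop M) (fst c)) (top_of_set (img c)) (snd c)"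
    by (rule homeomorphic_imp_continuous_map)
  moreover have "compactin (subtopology (mtop M) (fst c)) K" using assms by (simp add: compactin_subtopology)
  ultimately have "compactin (top_of_set (img c)) (snd c ` K)" using image_compactin by blast
  then show ?thesis by (simp add: compactin_subtopology)
qed

lemma closedin_chart_inv:
  assumes "c \<in> atlas M" "compact L" "L \<subseteq> img c"
  shows "closedin (mtop M) (chart_inv c ` L)"
  using compactin_imp_closedin compact_chart_inv[OF assms] M unfolding smooth_manifold_def by blast

abbreviation (input) transit :: "('a, 'n) chart \<Rightarrow> ('a, 'n) chart \<Rightarrow> real^'n \<Rightarrow> real^'n" where
  "transit c c' \<equiv> \<lambda>x. snd c' (chart_inv c x)"

lemma trans_smooth:
  "c \<in> atlas M \<Longrightarrow> c' \<in> atlas M \<Longrightarrow> Ck_on \<infinity> (\<lambda>x. transit c c' x $ i) (snd c ` (fst c \<inter> fst c'))"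
  using M by (simp add: smooth_manifold_def smooth_transition_def)

lemma trans_image:
  assumes "c \<in> atlas M" shows "transit c c' ` (snd c ` (fst c \<inter> fst c')) = snd c' ` (fst c' \<inter> fst c)"
proof -
  have "transit c c' (snd c p) = snd c' p" if "p \<in> fst c" for p using chart_inv_snd[OF assms that] by simp
  then have "transit c c' ` snd c ` (fst c \<inter> fst c') = snd c' ` (fst c \<inter> fst c')"
    unfolding image_image by (intro image_cong) auto
  then show ?thesis by (simp add: Int_commute)
qed

lemma jac_smooth:
  assumes "c \<in> atlas M" "c' \<in> atlas M"
  shows "Ck_on \<infinity> (\<lambda>x. jac c c' (chart_inv c x) i j) (snd c ` (fst c \<inter> fst c'))"
proof -
  have "jac c c' (chart_inv c x) i j = partial j (\<lambda>x. transit c c' x $ i) x" if "x \<in> snd c ` (fst c \<inter> fst c')" for x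
    using that by (auto simp: jac_def chart_inv_snd[OF assms(1)])
  then show ?thesis
    using smooth_partial[OF trans_smooth[OF assms] open_overlap[OF assms], of j i]
      Ck_on_congI[OF open_overlap[OF assms], of \<infinity> "partial j (\<lambda>x. transit c c' x $ i)"] by simp
qed

lemma jac_smooth':
  assumes "c \<in> atlas M" "c' \<in> atlas M"
  shows "Ck_on \<infinity> (\<lambda>x. jac c c' (chart_inv c' x) i j) (snd c' ` (fst c' \<inter> fst c))"
proof -
  have "Ck_on \<infinity> (\<lambda>x. jac c c' (chart_inv c (transit c' c x)) i j) (snd c' ` (fst c' \<inter> fst c))"
    by (rule smooth_compose[OF open_overlap[OF assms(2,1)] open_overlap[OF assms(1,2)] trans_smooth[OF assms(2,1)] _
        jac_smooth[OF assms]]) (simp add: trans_image[OF assms(2)])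
  moreover have "chart_inv c (transit c' c x) = chart_inv c' x" if "x \<in> snd c' ` (fst c' \<inter> fst c)" for x
    using that by (auto simp: chart_inv_snd assms)
  ultimately show ?thesis
    using Ck_on_congI[OF open_overlap[OF assms(2,1)], of \<infinity> "\<lambda>x. jac c c' (chart_inv c (transit c' c x)) i j"] by simp
qed

lemma jac_chain:
  assumes "c \<in> atlas M" "c' \<in> atlas M" "c'' \<in> atlas M" "p \<in> fst c" "p \<in> fst c'" "p \<in> fst c''"
  shows "jac c c'' p i j = (\<Sum>k\<in>UNIV. jac c' c'' p i k * jac c c' p k j)"
proof -
  define O1 where "O1 = snd c ` (fst c \<inter> (fst c' \<inter> fst c''))"
  have O1: "open O1" unfolding O1_def using assms by (intro open_snd_image openin_Int openin_chart)
  have x: "snd c p \<in> O1" using assms by (auto simp: O1_def)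
  have T: "transit c c' (snd c p) = snd c' p" using chart_inv_snd[OF assms(1,4)] by simp
  have "jac c c'' p i j = partial j (\<lambda>y. transit c' c'' (transit c c' y) $ i) (snd c p)"
    unfolding jac_def
    by (rule partial_cong[OF O1 x]) (auto simp: O1_def chart_inv_snd assms)
  also have "\<dots> = (\<Sum>k\<in>UNIV. partial k (\<lambda>y. transit c' c'' y $ i) (transit c c' (snd c p)) * partial j (\<lambda>y. transit c c' y $ k) (snd c p))"
  proof (rule partial_compose)
    show "(\<lambda>y. transit c c' y $ k) differentiable (at (snd c p))" for k
      using assms by (intro smooth_imp_differentiable[OF trans_smooth open_overlap]) auto
    show "(\<lambda>y. transit c' c'' y $ i) differentiable (at (transit c c' (snd c p)))"
      unfolding T using assms by (intro smooth_imp_differentiable[OF trans_smooth open_overlap]) auto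
  qed
  finally show ?thesis unfolding T jac_def .
qed

lemma jac_self:
  assumes "c \<in> atlas M" "p \<in> fst c" shows "jac c c p i j = (if i = j then 1 else 0)"
proof -
  have "partial j (\<lambda>x. transit c c x $ i) (snd c p) = partial j (\<lambda>x. x $ i) (snd c p)"
    using assms by (intro partial_cong[OF open_img[OF assms(1)]]) (auto simp: snd_chart_inv)
  then show ?thesis by (simp add: jac_def partial_component eq_commute)
qed

lemma jac_inverse:
  assumes "c \<in> atlas M" "c' \<in> atlas M" "p \<in> fst c" "p \<in> fst c'"
  shows "(\<Sum>k\<in>UNIV. jac c' c p i k * jac c c' p k j) = (if i = j then 1 else 0)"
  using jac_chain[OF assms(1,2,1,3,4,3)] jac_self[OF assms(1,3)] by simp

end

section \<open>Tensor fields supported in a chart domain\<close>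

lemma length_0_lists: "{I. length I = 0} = {[]}" by auto

lemma finite_lists_length: "finite {I :: 'n::finite list. length I = r}"
  using finite_lists_length_eq[of "UNIV :: 'n set" r] by simp

lemma finite_lists_length_le': "finite {I :: 'n::finite list. length I \<le> r}"
  using finite_lists_length_le[of "UNIV :: 'n set" r] by simp

lemma sum_lists_Suc:
  fixes f :: "'n::finite list \<Rightarrow> 'b::comm_monoid_add"
  shows "(\<Sum>I | length I = Suc r. f I) = (\<Sum>i\<in>UNIV. \<Sum>I | length I = r. f (i # I))"
proof -
  have eq: "{I :: 'n list. length I = Suc r} = (\<lambda>(i, I). i # I) ` (UNIV \<times> {I. length I = r})"
    by (auto simp: length_Suc_conv)
  have inj: "inj_on (\<lambda>(i, I). i # I) (UNIV \<times> {I :: 'n list. length I = r})"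
    by (auto simp: inj_on_def)
  show ?thesis unfolding eq sum.reindex[OF inj] by (simp add: sum.cartesian_product split_def)
qed

lemma sum_lists_1:
  fixes f :: "'n::finite list \<Rightarrow> 'b::comm_monoid_add"
  shows "(\<Sum>I | length I = Suc 0. f I) = (\<Sum>i\<in>UNIV. f [i])"
  unfolding sum_lists_Suc length_0_lists by simp

lemma prod_sum_lists:
  fixes F :: "nat \<Rightarrow> 'n::finite \<Rightarrow> real"
  shows "(\<Sum>I | length I = r. \<Prod>m<r. F m (I ! m)) = (\<Prod>m<r. \<Sum>k\<in>UNIV. F m k)"
proof (induction r arbitrary: F)
  case 0
  then show ?case by (simp add: length_0_lists)
next
  case (Suc r)
  have "(\<Sum>I | length I = Suc r. \<Prod>m<Suc r. F m (I ! m)) =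
    (\<Sum>i\<in>UNIV. F 0 i * (\<Sum>I | length I = r. \<Prod>m<r. F (Suc m) (I ! m)))"
    unfolding sum_lists_Suc by (simp add: prod.lessThan_Suc_shift sum_distrib_left del: prod.lessThan_Suc)
  also have "\<dots> = (\<Prod>m<Suc r. \<Sum>k\<in>UNIV. F m k)"
    unfolding Suc.IH[of "\<lambda>m. F (Suc m)"] by (simp add: prod.lessThan_Suc_shift sum_distrib_right del: prod.lessThan_Suc)
  finally show ?case .
qed

text \<open>The field \<open>f \<partial>\<^sub>A \<otimes> dx\<^sup>B\<close> for the coordinates \<open>x\<close> of the chart \<open>c\<close>, continued by \<open>0\<close> outside the
  domain of \<open>c\<close>. It is a smooth field if \<open>f\<close> is smooth and vanishes outside a compact subset of the
  image of \<open>c\<close>.\<close>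

definition chart_field :: "('a, 'n::finite) mfd \<Rightarrow> nat \<Rightarrow> nat \<Rightarrow> ('a, 'n) chart \<Rightarrow> 'n list \<Rightarrow> 'n list \<Rightarrow>
    (real^'n \<Rightarrow> real) \<Rightarrow> ('a, 'n) tfield" where
  "chart_field M r s c A B f = fld M r s (\<lambda>c' p I J.
     if p \<in> fst c then (\<Prod>m<r. jac c c' p (I ! m) (A ! m)) * (\<Prod>m<s. jac c' c p (B ! m) (J ! m)) * f (snd c p)
     else 0)"

context
  fixes M :: "('a, 'n::finite) mfd"
  assumes M: "smooth_manifold M"
begin

lemma is_tensor_chart_field:
  assumes c: "c \<in> atlas M"
  shows "is_tensor M r s (chart_field M r s c A B f)"
  unfolding is_tensor_def
proof (intro conjI ballI allI impI)
  show "chart_field M r s c A B f c' p I J = 0"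
    if "\<not> (c' \<in> atlas M \<and> p \<in> fst c' \<and> length I = r \<and> length J = s)" for c' p I J
    using that by (auto simp: chart_field_def fld_def)
  fix c1 c2 p and I' J' :: "'n list"
  assume c1: "c1 \<in> atlas M" and c2: "c2 \<in> atlas M" and p: "p \<in> fst c1 \<inter> fst c2"
    and l: "length I' = r \<and> length J' = s"
  show "chart_field M r s c A B f c2 p I' J' =
     (\<Sum>I | length I = r. \<Sum>J | length J = s.
        (\<Prod>m<r. jac c1 c2 p (I' ! m) (I ! m)) * (\<Prod>m<s. jac c2 c1 p (J ! m) (J' ! m)) *
        chart_field M r s c A B f c1 p I J)"
  proof (cases "p \<in> fst c")
    case False
    then have "chart_field M r s c A B f d p I J = 0" for d I J by (simp add: chart_field_def fld_def)
    then show ?thesis by simp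
  next
    case True
    have 1: "(\<Prod>m<r. jac c c2 p (I' ! m) (A ! m)) =
        (\<Sum>I | length I = r. (\<Prod>m<r. jac c1 c2 p (I' ! m) (I ! m)) * (\<Prod>m<r. jac c c1 p (I ! m) (A ! m)))"
      unfolding prod.distrib[symmetric] prod_sum_lists[of "\<lambda>m k. jac c1 c2 p (I' ! m) k * jac c c1 p k (A ! m)"]
      using p True by (simp add: jac_chain[OF M c c1 c2])
    have 2: "(\<Prod>m<s. jac c2 c p (B ! m) (J' ! m)) =
        (\<Sum>J | length J = s. (\<Prod>m<s. jac c2 c1 p (J ! m) (J' ! m)) * (\<Prod>m<s. jac c1 c p (B ! m) (J ! m)))"
      unfolding prod.distrib[symmetric] prod_sum_lists[of "\<lambda>m k. jac c2 c1 p k (J' ! m) * jac c1 c p (B ! m) k"]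
      using p True by (simp add: jac_chain[OF M c2 c1 c] mult.commute)
    have "chart_field M r s c A B f c2 p I' J' =
        (\<Prod>m<r. jac c c2 p (I' ! m) (A ! m)) * (\<Prod>m<s. jac c2 c p (B ! m) (J' ! m)) * f (snd c p)"
      using True c2 p l by (simp add: chart_field_def fld_def)
    also have "\<dots> = (\<Sum>I | length I = r. \<Sum>J | length J = s.
        (\<Prod>m<r. jac c1 c2 p (I' ! m) (I ! m)) * (\<Prod>m<s. jac c2 c1 p (J ! m) (J' ! m)) *
        ((\<Prod>m<r. jac c c1 p (I ! m) (A ! m)) * (\<Prod>m<s. jac c1 c p (B ! m) (J ! m)) * f (snd c p)))"
      unfolding 1 2 sum_product sum_distrib_right
      by (intro sum.cong refl) (simp add: sum_distrib_left ac_simps)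
    also have "\<dots> = (\<Sum>I | length I = r. \<Sum>J | length J = s.
        (\<Prod>m<r. jac c1 c2 p (I' ! m) (I ! m)) * (\<Prod>m<s. jac c2 c1 p (J ! m) (J' ! m)) *
        chart_field M r s c A B f c1 p I J)"
      using True c1 p by (intro sum.cong refl) (simp add: chart_field_def fld_def)
    finally show ?thesis .
  qed
qed

text \<open>Extension by zero from a chart domain: the preimage of the compact set \<open>L\<close> is closed in the
  whole manifold because the manifold is a Hausdorff space.\<close>

lemma smooth_extend_zero:
  assumes c: "c \<in> atlas M" and c': "c' \<in> atlas M" and L: "compact L" "L \<subseteq> img c"
    and h: "Ck_on \<infinity> h (snd c' ` (fst c' \<inter> fst c))"
    and z: "\<And>p. p \<in> fst c' \<Longrightarrow> p \<in> fst c \<Longrightarrow> snd c p \<notin> L \<Longrightarrow> h (snd c' p) = 0"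
  shows "Ck_on \<infinity> (\<lambda>x. if chart_inv c' x \<in> fst c then h x else 0) (img c')"
proof (rule Ck_on_local)
  let ?h = "\<lambda>x. if chart_inv c' x \<in> fst c then h x else 0"
  fix x assume "x \<in> img c'"
  then obtain p where p: "p \<in> fst c'" "x = snd c' p" by blast
  show "\<exists>U. open U \<and> x \<in> U \<and> Ck_on \<infinity> ?h U"
  proof (cases "p \<in> fst c")
    case True
    let ?U = "snd c' ` (fst c' \<inter> fst c)"
    have oU: "open ?U" by (rule open_overlap[OF M c' c])
    have "h y = ?h y" if "y \<in> ?U" for y using that by (auto simp: chart_inv_snd[OF M c'])
    then have "Ck_on \<infinity> ?h ?U" by (rule Ck_on_congI[OF oU h])
    moreover have "x \<in> ?U" using True p by blast
    ultimately show ?thesis using oU by blast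
  next
    case False
    let ?U = "snd c' ` (fst c' \<inter> (topspace (mtop M) - chart_inv c ` L))"
    have oU: "open ?U" using closedin_chart_inv[OF M c L] by (intro open_snd_image[OF M c']) blast
    have "chart_inv c ` L \<subseteq> fst c" using L(2) chart_inv_in[of _ c] by blast
    then have "p \<notin> chart_inv c ` L" using False by blast
    moreover have "p \<in> topspace (mtop M)" using openin_subset[OF openin_chart[OF M c']] p by blast
    ultimately have xU: "x \<in> ?U" using p by blast
    have "0 = ?h y" if y: "y \<in> ?U" for y
    proof -
      obtain q where q: "q \<in> fst c'" "q \<notin> chart_inv c ` L" "y = snd c' q" using y by blast
      show ?thesis
      proof (cases "q \<in> fst c")
        case True
        then have "snd c q \<notin> L" using q(2) chart_inv_snd[OF M c True] by (metis image_eqI)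
        then show ?thesis using z[OF q(1) True] q chart_inv_snd[OF M c' q(1)] by simp
      next
        case False
        then show ?thesis using q chart_inv_snd[OF M c' q(1)] by simp
      qed
    qed
    then have "Ck_on \<infinity> ?h ?U" by (rule Ck_on_congI[OF oU Ck_on_const])
    then show ?thesis using oU xU by blast
  qed
qed

lemma smooth_in_overlap:
  assumes c: "c \<in> atlas M" and c': "c' \<in> atlas M" and f: "Ck_on \<infinity> f (img c)"
  shows "Ck_on \<infinity> (\<lambda>x. f (transit c' c x)) (snd c' ` (fst c' \<inter> fst c))"
proof (rule smooth_compose[OF open_overlap[OF M c' c] open_img[OF M c] trans_smooth[OF M c' c] _ f])
  show "transit c' c ` (snd c' ` (fst c' \<inter> fst c)) \<subseteq> img c" unfolding trans_image[OF M c'] by blast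
qed

lemma smooth_jac_prods:
  assumes c: "c \<in> atlas M" and c': "c' \<in> atlas M"
  shows "Ck_on \<infinity> (\<lambda>x. (\<Prod>m<r::nat. jac c c' (chart_inv c' x) (I ! m) (A ! m)) *
    (\<Prod>m<s::nat. jac c' c (chart_inv c' x) (B ! m) (J ! m))) (snd c' ` (fst c' \<inter> fst c))"
  using c c' by (intro Ck_on_mult Ck_on_prod open_overlap[OF M] jac_smooth[OF M] jac_smooth'[OF M])

lemma Ck_tensor_chart_field:
  assumes c: "c \<in> atlas M" and L: "compact L" "L \<subseteq> img c"
    and f: "Ck_on \<infinity> f (img c)" and z: "\<And>x. x \<in> img c \<Longrightarrow> x \<notin> L \<Longrightarrow> f x = 0"
  shows "Ck_tensor M \<infinity> r s (chart_field M r s c A B f)"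
  unfolding Ck_tensor_def
proof (intro conjI ballI allI is_tensor_chart_field[OF c])
  fix c' I J assume c': "c' \<in> atlas M"
  show "Ck_on \<infinity> (comp_in c' (chart_field M r s c A B f) I J) (img c')"
  proof (cases "length I = r \<and> length J = s")
    case False
    then have "comp_in c' (chart_field M r s c A B f) I J = (\<lambda>x. 0)"
      by (auto simp: comp_in_def chart_field_def fld_def)
    then show ?thesis by (simp add: Ck_on_const)
  next
    case True
    define h where "h x = ((\<Prod>m<r. jac c c' (chart_inv c' x) (I ! m) (A ! m)) *
      (\<Prod>m<s. jac c' c (chart_inv c' x) (B ! m) (J ! m))) * f (transit c' c x)" for x
    have "Ck_on \<infinity> h (snd c' ` (fst c' \<inter> fst c))"
      unfolding h_def using open_overlap[OF M c' c] smooth_jac_prods[OF c c'] smooth_in_overlap[OF c c' f] by (rule Ck_on_mult)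
    then have "Ck_on \<infinity> (\<lambda>x. if chart_inv c' x \<in> fst c then h x else 0) (img c')"
      by (rule smooth_extend_zero[OF c c' L]) (use z in \<open>simp add: h_def chart_inv_snd[OF M c']\<close>)
    then show ?thesis
      by (rule Ck_on_congI[OF open_img[OF M c']])
        (use True c' chart_inv_in[of _ c'] in \<open>simp add: comp_in_def chart_field_def fld_def h_def\<close>)
  qed
qed

section \<open>Linear differential operators in charts\<close>

text \<open>Operators on smooth \<open>(r,s)\<close>-tensor fields with values in functions on the open set \<open>W\<close> of the
  image of the chart \<open>c\<close> that are given there by a linear differential operator of order \<open>m\<close>.\<close>

definition ldo :: "('a, 'n) chart \<Rightarrow> (real^'n) set \<Rightarrow> nat \<Rightarrow> nat \<Rightarrow> nat \<Rightarrow> (('a, 'n) tfield \<Rightarrow> real^'n \<Rightarrow> real) \<Rightarrow> bool" where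
  "ldo c W r s m F \<longleftrightarrow> (\<exists>a. (\<forall>z. Ck_on \<infinity> (a z) W) \<and>
     (\<forall>t. Ck_tensor M \<infinity> r s t \<longrightarrow> (\<forall>x\<in>W. F t x =
       (\<Sum>z\<in>{\<alpha>. length \<alpha> \<le> m} \<times> {I. length I = r} \<times> {J. length J = s}.
          a z x * partials (fst z) (comp_in c t (fst (snd z)) (snd (snd z))) x))))"

abbreviation idx :: "nat \<Rightarrow> nat \<Rightarrow> nat \<Rightarrow> ('n list \<times> 'n list \<times> 'n list) set" where
  "idx r s m \<equiv> {\<alpha>. length \<alpha> \<le> m} \<times> {I. length I = r} \<times> {J. length J = s}"

lemma sum_idx:
  "(\<Sum>z\<in>idx r s m. F z) = (\<Sum>\<alpha> | length \<alpha> \<le> m. \<Sum>I | length I = r. \<Sum>J | length J = s. F (\<alpha>, I, J))"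
  by (simp add: sum.cartesian_product split_def)

lemma finite_idx: "finite (idx r s m)"
  by (intro finite_cartesian_product finite_lists_length finite_lists_length_le')

lemma ldo_elem:
  assumes "z \<in> idx r s m" "Ck_on \<infinity> b W"
  shows "ldo c W r s m (\<lambda>t x. b x * partials (fst z) (comp_in c t (fst (snd z)) (snd (snd z))) x)"
  unfolding ldo_def
proof (rule exI[of _ "\<lambda>y. if y = z then b else (\<lambda>x. 0)"], intro conjI allI impI ballI)
  show "Ck_on \<infinity> (if y = z then b else (\<lambda>x. 0)) W" for y using assms(2) by (simp add: Ck_on_const)
  fix t x
  have "(\<Sum>y\<in>idx r s m. (if y = z then b else (\<lambda>x. 0)) x * partials (fst y) (comp_in c t (fst (snd y)) (snd (snd y))) x)
     = (\<Sum>y\<in>idx r s m. if y = z then b x * partials (fst y) (comp_in c t (fst (snd y)) (snd (snd y))) x else 0)"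
    by (intro sum.cong) auto
  also have "\<dots> = b x * partials (fst z) (comp_in c t (fst (snd z)) (snd (snd z))) x"
    using assms(1) finite_idx by simp
  finally show "b x * partials (fst z) (comp_in c t (fst (snd z)) (snd (snd z))) x =
    (\<Sum>y\<in>idx r s m. (if y = z then b else (\<lambda>x. 0)) x * partials (fst y) (comp_in c t (fst (snd y)) (snd (snd y))) x)" ..
qed

lemma ldo_cong:
  assumes "ldo c W r s m F" "\<And>t x. Ck_tensor M \<infinity> r s t \<Longrightarrow> x \<in> W \<Longrightarrow> G t x = F t x"
  shows "ldo c W r s m G"
proof -
  obtain a where a: "\<forall>z. Ck_on \<infinity> (a z) W" "\<forall>t. Ck_tensor M \<infinity> r s t \<longrightarrow> (\<forall>x\<in>W. F t x =
       (\<Sum>z\<in>idx r s m. a z x * partials (fst z) (comp_in c t (fst (snd z)) (snd (snd z))) x))"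
    using assms(1) unfolding ldo_def by blast
  show ?thesis unfolding ldo_def
    by (intro exI[of _ a] conjI a(1) allI impI ballI) (use a(2) assms(2) in simp)
qed

lemma ldo_mult:
  assumes "open W" "ldo c W r s m F" "Ck_on \<infinity> b W"
  shows "ldo c W r s m (\<lambda>t x. b x * F t x)"
proof -
  obtain a where a: "\<forall>z. Ck_on \<infinity> (a z) W" "\<forall>t. Ck_tensor M \<infinity> r s t \<longrightarrow> (\<forall>x\<in>W. F t x =
       (\<Sum>z\<in>idx r s m. a z x * partials (fst z) (comp_in c t (fst (snd z)) (snd (snd z))) x))"
    using assms(2) unfolding ldo_def by blast
  show ?thesis unfolding ldo_def
    by (rule exI[of _ "\<lambda>z x. b x * a z x"])
      (use a assms in \<open>auto intro!: Ck_on_mult simp: sum_distrib_left mult.assoc\<close>)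
qed

lemma ldo_add:
  assumes "open W" "ldo c W r s m F" "ldo c W r s m G"
  shows "ldo c W r s m (\<lambda>t x. F t x + G t x)"
proof -
  obtain a where a: "\<forall>z. Ck_on \<infinity> (a z) W" "\<forall>t. Ck_tensor M \<infinity> r s t \<longrightarrow> (\<forall>x\<in>W. F t x =
       (\<Sum>z\<in>idx r s m. a z x * partials (fst z) (comp_in c t (fst (snd z)) (snd (snd z))) x))"
    using assms(2) unfolding ldo_def by blast
  obtain b where b: "\<forall>z. Ck_on \<infinity> (b z) W" "\<forall>t. Ck_tensor M \<infinity> r s t \<longrightarrow> (\<forall>x\<in>W. G t x =
       (\<Sum>z\<in>idx r s m. b z x * partials (fst z) (comp_in c t (fst (snd z)) (snd (snd z))) x))"
    using assms(3) unfolding ldo_def by blast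
  show ?thesis unfolding ldo_def
    by (rule exI[of _ "\<lambda>z x. a z x + b z x"])
      (use a b assms in \<open>auto intro!: Ck_on_add simp: sum.distrib[symmetric] distrib_right\<close>)
qed

lemma ldo_zero: "ldo c W r s m (\<lambda>t x. 0)"
  unfolding ldo_def by (rule exI[of _ "\<lambda>z x. 0"]) (simp add: Ck_on_const)

lemma ldo_sum:
  assumes "open W" "finite A" "\<And>i. i \<in> A \<Longrightarrow> ldo c W r s m (F i)"
  shows "ldo c W r s m (\<lambda>t x. \<Sum>i\<in>A. F i t x)"
  using assms(2,3) by (induction A rule: finite_induct) (auto intro: ldo_zero ldo_add assms(1))

lemma ldo_partial:
  assumes c: "c \<in> atlas M" and W: "open W" "W \<subseteq> img c" and F: "ldo c W r s m F"
  shows "ldo c W r s (Suc m) (\<lambda>t. partial j (F t))"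
proof -
  let ?D = "\<lambda>z t. partials (fst z) (comp_in c t (fst (snd z)) (snd (snd z)))"
  obtain a where a: "\<forall>z. Ck_on \<infinity> (a z) W" "\<forall>t. Ck_tensor M \<infinity> r s t \<longrightarrow> (\<forall>x\<in>W. F t x =
       (\<Sum>z\<in>idx r s m. a z x * ?D z t x))"
    using F unfolding ldo_def by blast
  have "ldo c W r s (Suc m) (\<lambda>t x. \<Sum>z\<in>idx r s m. partial j (a z) x * ?D z t x + a z x * ?D (j # fst z, snd z) t x)"
  proof (intro ldo_sum ldo_add W finite_idx)
    fix z assume z: "z \<in> idx r s m"
    show "ldo c W r s (Suc m) (\<lambda>t x. partial j (a z) x * ?D z t x)"
      using z a W by (intro ldo_elem smooth_partial) auto
    show "ldo c W r s (Suc m) (\<lambda>t x. a z x * ?D (j # fst z, snd z) t x)"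
      using z a W by (intro ldo_elem) auto
  qed
  then show ?thesis
  proof (rule ldo_cong)
    fix t x assume t: "Ck_tensor M \<infinity> r s t" and x: "x \<in> W"
    have D: "Ck_on \<infinity> (?D z t) W" for z
      using t c by (intro Ck_on_subset[OF _ W(2)] smooth_partials open_img[OF M]) (auto simp: Ck_tensor_def)
    have "partial j (F t) x = partial j (\<lambda>x. \<Sum>z\<in>idx r s m. a z x * ?D z t x) x"
      by (rule partial_cong[OF W(1) x]) (use a t in blast)
    also have "\<dots> = (\<Sum>z\<in>idx r s m. partial j (\<lambda>x. a z x * ?D z t x) x)"
      using a(1) D W(1) x by (intro partial_sum finite_idx smooth_imp_differentiable[where S = W] Ck_on_mult) auto
    also have "\<dots> = (\<Sum>z\<in>idx r s m. partial j (a z) x * ?D z t x + a z x * ?D (j # fst z, snd z) t x)"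
    proof (intro sum.cong refl)
      fix z
      show "partial j (\<lambda>x. a z x * ?D z t x) x = partial j (a z) x * ?D z t x + a z x * ?D (j # fst z, snd z) t x"
        using partial_mult[OF smooth_imp_differentiable[OF a(1)[rule_format, of z] W(1) x] smooth_imp_differentiable[OF D[of z] W(1) x], of j]
        by (simp add: partials_Cons)
    qed
    finally show "partial j (F t) x = (\<Sum>z\<in>idx r s m. partial j (a z) x * ?D z t x + a z x * ?D (j # fst z, snd z) t x)" .
  qed
qed

text \<open>The chain rule for derivatives of arbitrary order, by induction: the \<open>i\<close>-th coordinate derivative
  in \<open>c\<close> is the combination of the coordinate derivatives in \<open>c'\<close> whose coefficients are the entries
  \<open>j i\<close> of the Jacobian from \<open>c\<close> to \<open>c'\<close>.\<close>

lemma ldo_change_chart: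
  assumes c: "c \<in> atlas M" and c': "c' \<in> atlas M" and len: "length A = r" "length B = s"
  shows "ldo c' (snd c' ` (fst c' \<inter> fst c)) r s (length \<alpha>) (\<lambda>t x. partials \<alpha> (comp_in c t A B) (transit c' c x))"
proof (induction \<alpha>)
  let ?W = "snd c' ` (fst c' \<inter> fst c)"
  have W: "open ?W" "?W \<subseteq> img c'" using open_overlap[OF M c' c] by auto
  {
    case Nil
    have "ldo c' ?W r s 0 (\<lambda>t x. \<Sum>z\<in>idx r s 0.
       ((\<Prod>m<r. jac c' c (chart_inv c' x) (A ! m) (fst (snd z) ! m)) * (\<Prod>m<s. jac c c' (chart_inv c' x) (snd (snd z) ! m) (B ! m)))
       * partials (fst z) (comp_in c' t (fst (snd z)) (snd (snd z))) x)"
      using c c' by (intro ldo_sum ldo_elem W finite_idx Ck_on_mult Ck_on_prod jac_smooth[OF M] jac_smooth'[OF M])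
    then have "ldo c' ?W r s 0 (\<lambda>t x. comp_in c t A B (transit c' c x))"
    proof (rule ldo_cong)
      fix t x assume t: "Ck_tensor M \<infinity> r s t" and "x \<in> ?W"
      then obtain p where p: "p \<in> fst c'" "p \<in> fst c" "x = snd c' p" by blast
      have "comp_in c t A B (transit c' c x) = t c p A B"
        using p by (simp add: comp_in_def chart_inv_snd[OF M] c c')
      also have "\<dots> = (\<Sum>I | length I = r. \<Sum>J | length J = s.
          (\<Prod>m<r. jac c' c p (A ! m) (I ! m)) * (\<Prod>m<s. jac c c' p (J ! m) (B ! m)) * t c' p I J)"
        using t c c' p len unfolding Ck_tensor_def is_tensor_def by blast
      also have "\<dots> = (\<Sum>z\<in>idx r s 0.
       ((\<Prod>m<r. jac c' c (chart_inv c' x) (A ! m) (fst (snd z) ! m)) * (\<Prod>m<s. jac c c' (chart_inv c' x) (snd (snd z) ! m) (B ! m)))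
       * partials (fst z) (comp_in c' t (fst (snd z)) (snd (snd z))) x)"
      proof -
        have 0: "{\<alpha> :: 'n list. length \<alpha> \<le> 0} = {[]}" by auto
        show ?thesis unfolding sum_idx unfolding 0 using p by (simp add: comp_in_def chart_inv_snd[OF M] c')
      qed
      finally show "comp_in c t A B (transit c' c x) = \<dots>" .
    qed
    then show ?case by simp
  next
    case (Cons i \<alpha>)
    have "ldo c' ?W r s (Suc (length \<alpha>)) (\<lambda>t x. \<Sum>j\<in>UNIV. jac c c' (chart_inv c' x) j i *
        partial j (\<lambda>x. partials \<alpha> (comp_in c t A B) (transit c' c x)) x)"
      using Cons c c' by (intro ldo_sum ldo_mult W finite ldo_partial jac_smooth'[OF M])
    then have "ldo c' ?W r s (Suc (length \<alpha>)) (\<lambda>t x. partials (i # \<alpha>) (comp_in c t A B) (transit c' c x))"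
    proof (rule ldo_cong)
      fix t x assume t: "Ck_tensor M \<infinity> r s t" and "x \<in> ?W"
      then obtain p where p: "p \<in> fst c'" "p \<in> fst c" "x = snd c' p" by blast
      let ?h = "partials \<alpha> (comp_in c t A B)"
      have h: "Ck_on \<infinity> ?h (img c)"
        using t c by (intro smooth_partials open_img[OF M]) (auto simp: Ck_tensor_def)
      have T: "transit c' c x = snd c p" using p by (simp add: chart_inv_snd[OF M c'])
      have "partial j (\<lambda>x. ?h (transit c' c x)) x = (\<Sum>k\<in>UNIV. partial k ?h (transit c' c x) * jac c' c p k j)" for j
      proof -
        have "partial j (\<lambda>x. ?h (transit c' c x)) x =
            (\<Sum>k\<in>UNIV. partial k ?h (transit c' c x) * partial j (\<lambda>y. transit c' c y $ k) x)"
        proof (rule partial_compose)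
          show "(\<lambda>y. transit c' c y $ k) differentiable (at x)" for k
            using \<open>x \<in> ?W\<close> W(1) by (intro smooth_imp_differentiable[OF trans_smooth[OF M c' c]])
          show "?h differentiable (at (transit c' c x))"
            unfolding T using p by (intro smooth_imp_differentiable[OF h open_img[OF M c]]) auto
        qed
        then show ?thesis using p by (simp add: jac_def)
      qed
      then have "(\<Sum>j\<in>UNIV. jac c c' (chart_inv c' x) j i * partial j (\<lambda>x. ?h (transit c' c x)) x)
         = (\<Sum>j\<in>UNIV. \<Sum>k\<in>UNIV. partial k ?h (transit c' c x) * (jac c' c p k j * jac c c' p j i))"
        using p by (simp add: chart_inv_snd[OF M c'] sum_distrib_left ac_simps)
      also have "\<dots> = (\<Sum>k\<in>UNIV. partial k ?h (transit c' c x) * (\<Sum>j\<in>UNIV. jac c' c p k j * jac c c' p j i))"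
        by (subst sum.swap) (simp add: sum_distrib_left)
      also have "\<dots> = partial i ?h (transit c' c x)"
        using p by (simp add: jac_inverse[OF M c c'] if_distrib cong: if_cong)
      finally show "partials (i # \<alpha>) (comp_in c t A B) (transit c' c x) =
        (\<Sum>j\<in>UNIV. jac c c' (chart_inv c' x) j i * partial j (\<lambda>x. ?h (transit c' c x)) x)"
        by (simp add: partials_Cons)
    qed
    then show ?case by simp
  }
qed

text \<open>For a cutoff function \<open>f\<close> this is the operator that extracts one derivative of one component of
  a tensor field in one chart. It is a differential operator in every other chart because its
  coefficients there, which are supported in the overlap of the charts, extend by zero.\<close>

lemma lin_diff_op_cutoff:
  assumes c: "c \<in> atlas M" and L: "compact L" "L \<subseteq> img c" and len: "length A = r" "length B = s"
    and f: "Ck_on \<infinity> f UNIV" and z: "\<And>x. x \<notin> L \<Longrightarrow> f x = 0"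
  shows "lin_diff_op M r s (\<lambda>t. chart_field M r s c A B (\<lambda>x. f x * partials \<alpha> (comp_in c t A B) x))"
  unfolding lin_diff_op_def
proof (intro conjI allI impI)
  have fS: "Ck_on \<infinity> f (img c)" using f by (rule Ck_on_subset) simp
  show "Ck_tensor M \<infinity> r s (chart_field M r s c A B (\<lambda>x. f x * partials \<alpha> (comp_in c t A B) x))"
    if "Ck_tensor M \<infinity> r s t" for t
    using that fS c by (intro Ck_tensor_chart_field[OF c L] Ck_on_mult smooth_partials open_img[OF M])
      (auto simp: Ck_tensor_def z)
  show "\<exists>m. \<forall>c'\<in>atlas M. \<exists>a. (\<forall>\<alpha> I J I' J'. Ck_on \<infinity> (a \<alpha> I J I' J') (img c')) \<and>
     (\<forall>t. Ck_tensor M \<infinity> r s t \<longrightarrow> (\<forall>p\<in>fst c'. \<forall>I J. length I = r \<and> length J = s \<longrightarrow>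
        chart_field M r s c A B (\<lambda>x. f x * partials \<alpha> (comp_in c t A B) x) c' p I J =
          (\<Sum>\<alpha> | length \<alpha> \<le> m. \<Sum>I' | length I' = r. \<Sum>J' | length J' = s.
             a \<alpha> I J I' J' (snd c' p) * partials \<alpha> (comp_in c' t I' J') (snd c' p))))"
  proof (intro exI[of _ "length \<alpha>"] ballI)
    fix c' assume c': "c' \<in> atlas M"
    let ?W = "snd c' ` (fst c' \<inter> fst c)"
    obtain a where a: "\<forall>z. Ck_on \<infinity> (a z) ?W" "\<forall>t. Ck_tensor M \<infinity> r s t \<longrightarrow> (\<forall>x\<in>?W. partials \<alpha> (comp_in c t A B) (transit c' c x) =
       (\<Sum>z\<in>idx r s (length \<alpha>). a z x * partials (fst z) (comp_in c' t (fst (snd z)) (snd (snd z))) x))"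
      using ldo_change_chart[OF c c' len, of \<alpha>] unfolding ldo_def by blast
    define j where "j I J x = (\<Prod>m<r. jac c c' (chart_inv c' x) (I ! m) (A ! m)) *
      (\<Prod>m<s. jac c' c (chart_inv c' x) (B ! m) (J ! m))" for I J x
    define b where "b \<beta> I J I' J' x = (if chart_inv c' x \<in> fst c then
      j I J x * (f (transit c' c x) * a (\<beta>, I', J') x) else 0)" for \<beta> I J I' J' x
    have bs: "Ck_on \<infinity> (b \<beta> I J I' J') (img c')" for \<beta> I J I' J'
    proof -
      have "Ck_on \<infinity> (\<lambda>x. j I J x * (f (transit c' c x) * a (\<beta>, I', J') x)) ?W"
        unfolding j_def by (rule Ck_on_mult[OF open_overlap[OF M c' c] smooth_jac_prods[OF c c']
          Ck_on_mult[OF open_overlap[OF M c' c] smooth_in_overlap[OF c c' fS] a(1)[rule_format]]])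
      then have "Ck_on \<infinity> (\<lambda>x. if chart_inv c' x \<in> fst c then j I J x * (f (transit c' c x) * a (\<beta>, I', J') x) else 0) (img c')"
        by (rule smooth_extend_zero[OF c c' L]) (use z in \<open>simp add: chart_inv_snd[OF M c']\<close>)
      then show ?thesis unfolding b_def[abs_def] .
    qed
    have "chart_field M r s c A B (\<lambda>x. f x * partials \<alpha> (comp_in c t A B) x) c' p I J =
          (\<Sum>\<beta> | length \<beta> \<le> length \<alpha>. \<Sum>I' | length I' = r. \<Sum>J' | length J' = s.
             b \<beta> I J I' J' (snd c' p) * partials \<beta> (comp_in c' t I' J') (snd c' p))"
      if t: "Ck_tensor M \<infinity> r s t" and p: "p \<in> fst c'" and l: "length I = r \<and> length J = s" for t p I J
    proof (cases "p \<in> fst c")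
      case False
      then show ?thesis using c' p l by (simp add: chart_field_def fld_def b_def chart_inv_snd[OF M c'])
    next
      case True
      have x: "snd c' p \<in> ?W" using p True by blast
      have "partials \<alpha> (comp_in c t A B) (snd c p) = partials \<alpha> (comp_in c t A B) (transit c' c (snd c' p))"
        using p by (simp add: chart_inv_snd[OF M c'])
      also have "\<dots> = (\<Sum>z\<in>idx r s (length \<alpha>). a z (snd c' p) * partials (fst z) (comp_in c' t (fst (snd z)) (snd (snd z))) (snd c' p))"
        using a(2) t x by blast
      also have "\<dots> = (\<Sum>\<beta> | length \<beta> \<le> length \<alpha>. \<Sum>I' | length I' = r. \<Sum>J' | length J' = s.
             a (\<beta>, I', J') (snd c' p) * partials \<beta> (comp_in c' t I' J') (snd c' p))"
        unfolding sum_idx by simp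
      finally have eq: "partials \<alpha> (comp_in c t A B) (snd c p) = (\<Sum>\<beta> | length \<beta> \<le> length \<alpha>. \<Sum>I' | length I' = r. \<Sum>J' | length J' = s.
             a (\<beta>, I', J') (snd c' p) * partials \<beta> (comp_in c' t I' J') (snd c' p))" .
      have "chart_field M r s c A B (\<lambda>x. f x * partials \<alpha> (comp_in c t A B) x) c' p I J =
        j I J (snd c' p) * (f (snd c p) * partials \<alpha> (comp_in c t A B) (snd c p))"
        using True c' p l by (simp add: chart_field_def fld_def j_def chart_inv_snd[OF M c'])
      also have "\<dots> = (\<Sum>\<beta> | length \<beta> \<le> length \<alpha>. \<Sum>I' | length I' = r. \<Sum>J' | length J' = s.
             b \<beta> I J I' J' (snd c' p) * partials \<beta> (comp_in c' t I' J') (snd c' p))"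
        unfolding eq b_def using True p by (simp add: chart_inv_snd[OF M c'] sum_distrib_left mult.assoc)
      finally show ?thesis .
    qed
    then show "\<exists>a. (\<forall>\<alpha> I J I' J'. Ck_on \<infinity> (a \<alpha> I J I' J') (img c')) \<and>
     (\<forall>t. Ck_tensor M \<infinity> r s t \<longrightarrow> (\<forall>p\<in>fst c'. \<forall>I J. length I = r \<and> length J = s \<longrightarrow>
        chart_field M r s c A B (\<lambda>x. f x * partials \<alpha> (comp_in c t A B) x) c' p I J =
          (\<Sum>\<beta> | length \<beta> \<le> length \<alpha>. \<Sum>I' | length I' = r. \<Sum>J' | length J' = s.
             a \<beta> I J I' J' (snd c' p) * partials \<beta> (comp_in c' t I' J') (snd c' p))))"
      by (intro exI[of _ b] conjI allI bs) blast
  qed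
qed

lemma chart_field_self:
  assumes c: "c \<in> atlas M" and p: "p \<in> fst c" and len: "length I = r" "length J = s" "length A = r" "length B = s"
  shows "chart_field M r s c A B f c p I J = (if I = A \<and> J = B then f (snd c p) else 0)"
proof -
  have P: "(\<Prod>m<k. if I ! m = A ! m then 1 else 0) = (if I = A then 1 else (0::real))"
    if l: "length I = k" "length A = k" for I A :: "'n list" and k
  proof (cases "I = A")
    case False
    then obtain m where m: "m < k" "I ! m \<noteq> A ! m" using l nth_equalityI[of I A] by auto
    then have "(\<Prod>m<k. if I ! m = A ! m then 1 else 0) = (0::real)"
      by (intro prod_zero bexI[of _ m]) auto
    then show ?thesis using False by simp
  qed simp
  have "chart_field M r s c A B f c p I J =
    (\<Prod>m<r. if I ! m = A ! m then 1 else 0) * (\<Prod>m<s. if B ! m = J ! m then 1 else 0) * f (snd c p)"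
    using c p len by (simp add: chart_field_def fld_def jac_self[OF M c p])
  then show ?thesis unfolding P[OF len(1,3)] P[OF len(4,2)] by simp
qed

end

section \<open>Moderate and negligible nets of tensor fields in charts\<close>

lemma sup_mod_abs: "sup_mod S u \<Longrightarrow> sup_mod S (\<lambda>\<epsilon> x. \<bar>u \<epsilon> x\<bar>)"
  by (simp add: sup_mod_def)

lemma sup_negl_abs: "sup_negl S u \<Longrightarrow> sup_negl S (\<lambda>\<epsilon> x. \<bar>u \<epsilon> x\<bar>)"
  by (simp add: sup_negl_def)

lemma sup_mod_sum:
  assumes "\<And>a. a \<in> A \<Longrightarrow> sup_mod S (\<lambda>\<epsilon>. f a \<epsilon>)"
  shows "sup_mod S (\<lambda>\<epsilon> x. \<Sum>a\<in>A. f a \<epsilon> x)"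
  using assms
  by (induction A rule: infinite_finite_induct) (auto intro: sup_mod_fixed sup_mod_add)

lemma sup_negl_sum:
  assumes "\<And>a. a \<in> A \<Longrightarrow> sup_negl S (\<lambda>\<epsilon>. f a \<epsilon>)"
  shows "sup_negl S (\<lambda>\<epsilon> x. \<Sum>a\<in>A. f a \<epsilon> x)"
  using assms
  by (induction A rule: infinite_finite_induct) (auto intro: sup_negl_zero sup_negl_add)

abbreviation cnet :: "('a, 'n::finite) chart \<Rightarrow> ('a, 'n) tnet \<Rightarrow> 'n list \<Rightarrow> 'n list \<Rightarrow> real \<Rightarrow> real^'n \<Rightarrow> real" where
  "cnet c u I J \<equiv> \<lambda>\<epsilon>. comp_in c (u \<epsilon>) I J"

context
  fixes M :: "('a, 'n::finite) mfd"
  assumes M: "smooth_manifold M"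
begin

lemma is_tensor_zero:
  "is_tensor M r s t \<Longrightarrow> \<not> (c \<in> atlas M \<and> p \<in> fst c \<and> length I = r \<and> length J = s) \<Longrightarrow> t c p I J = 0"
  unfolding is_tensor_def by blast

lemma mod_nets_tensor: "u \<in> mod_nets M r s \<Longrightarrow> \<epsilon> \<in> {0<..1} \<Longrightarrow> Ck_tensor M \<infinity> r s (u \<epsilon>)"
  by (simp add: mod_nets_def)

lemma mod_nets_is_tensor: "u \<in> mod_nets M r s \<Longrightarrow> \<epsilon> \<in> {0<..1} \<Longrightarrow> is_tensor M r s (u \<epsilon>)"
  using mod_nets_tensor unfolding Ck_tensor_def by blast

text \<open>Where the cutoff function equals \<open>1\<close>, the cutoff operator returns the derivative itself.\<close>

lemma mod_nets_sup_mod: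
  assumes u: "u \<in> mod_nets M r s" and c: "c \<in> atlas M" and len: "length A = r" "length B = s"
  shows "sup_mod (img c) (\<lambda>\<epsilon>. partials \<alpha> (comp_in c (u \<epsilon>) A B))"
  unfolding sup_mod_def
proof (intro allI impI)
  fix K assume K: "compact K \<and> K \<subseteq> img c"
  then obtain f U L where f: "Ck_on \<infinity> f UNIV" "open U" "K \<subseteq> U" "compact L" "L \<subseteq> img c"
    "\<And>x. x \<in> U \<Longrightarrow> f x = 1" "\<And>x. x \<notin> L \<Longrightarrow> f x = 0"
    using bump_compact[OF open_img[OF M c], of K] by metis
  define P where "P t = chart_field M r s c A B (\<lambda>x. f x * partials \<alpha> (comp_in c t A B) x)" for t
  have P: "lin_diff_op M r s P"
    unfolding P_def by (rule lin_diff_op_cutoff[OF M c f(4,5) len f(1) f(7)])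
  have "compactin (mtop M) (chart_inv c ` K)" "chart_inv c ` K \<subseteq> fst c"
    using compact_chart_inv[OF M c] K chart_inv_in[of _ c] by auto
  then obtain N where "bigO_on c (chart_inv c ` K) (\<lambda>\<epsilon>. P (u \<epsilon>)) (\<lambda>\<epsilon>. (1 / \<epsilon>) ^ N)"
    using u P c unfolding mod_nets_def by blast
  then obtain C where C: "\<forall>\<^sub>F \<epsilon> in at_right 0. \<forall>p\<in>chart_inv c ` K. \<forall>I J. \<bar>P (u \<epsilon>) c p I J\<bar> \<le> C * (1 / \<epsilon>) ^ N"
    unfolding bigO_on_def by blast
  have eq: "P (u \<epsilon>) c (chart_inv c x) A B = partials \<alpha> (comp_in c (u \<epsilon>) A B) x" if "x \<in> K" for \<epsilon> x
  proof -
    have "x \<in> img c" "f x = 1" using that K f by auto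
    then show ?thesis
      unfolding P_def using chart_field_self[OF M c chart_inv_in[of x c] len len] by (simp add: snd_chart_inv)
  qed
  have "\<forall>\<^sub>F \<epsilon> in at_right 0. \<forall>x\<in>K. \<bar>partials \<alpha> (comp_in c (u \<epsilon>) A B) x\<bar> \<le> C * (1 / \<epsilon>) ^ N"
    using C
  proof eventually_elim
    case (elim \<epsilon>)
    then show ?case using eq by (metis image_eqI)
  qed
  then show "\<exists>N C. \<forall>\<^sub>F \<epsilon> in at_right 0. \<forall>x\<in>K. \<bar>partials \<alpha> (comp_in c (u \<epsilon>) A B) x\<bar> \<le> C * (1 / \<epsilon>) ^ N"
    by blast
qed

lemma mod_nets_modnet:
  assumes u: "u \<in> mod_nets M r s" and c: "c \<in> atlas M"
  shows "modnet (img c) (cnet c u A B)"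
proof (cases "length A = r \<and> length B = s")
  case True
  have "smoothnet (img c) (cnet c u A B)"
    using mod_nets_tensor[OF u] c by (simp add: smoothnet_def Ck_tensor_def)
  then show ?thesis unfolding modnet_def using mod_nets_sup_mod[OF u c] True by blast
next
  case False
  have "0 = cnet c u A B \<epsilon> x" if "\<epsilon> \<in> {0<..1}" for \<epsilon> x
    using is_tensor_zero[OF mod_nets_is_tensor[OF u that], of c "chart_inv c x" A B] False by (simp add: comp_in_def)
  then show ?thesis by (rule modnet_cong[OF open_img[OF M c] _ modnet_const[OF open_img[OF M c], of 0]])
qed

lemma lin_diff_op_tensor: "lin_diff_op M r s P \<Longrightarrow> Ck_tensor M \<infinity> r s t \<Longrightarrow> is_tensor M r s (P t)"
  unfolding lin_diff_op_def Ck_tensor_def by blast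

text \<open>Conversely, a differential operator is a finite combination of partial derivatives of components,
  with coefficients that are bounded on compact sets.\<close>

lemma mod_netsI:
  assumes t: "\<And>\<epsilon>. \<epsilon> \<in> {0<..1} \<Longrightarrow> is_tensor M r s (u \<epsilon>)"
    and m: "\<And>c I J. c \<in> atlas M \<Longrightarrow> length I = r \<Longrightarrow> length J = s \<Longrightarrow> modnet (img c) (cnet c u I J)"
  shows "u \<in> mod_nets M r s"
proof -
  have T: "Ck_tensor M \<infinity> r s (u \<epsilon>)" if e: "\<epsilon> \<in> {0<..1}" for \<epsilon>
    unfolding Ck_tensor_def
  proof (intro conjI t[OF e] ballI allI)
    fix c I J assume c: "c \<in> atlas M"
    show "Ck_on \<infinity> (comp_in c (u \<epsilon>) I J) (img c)"
    proof (cases "length I = r \<and> length J = s")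
      case True
      then show ?thesis using m[OF c] e unfolding modnet_def smoothnet_def by blast
    next
      case False
      then have "comp_in c (u \<epsilon>) I J = (\<lambda>x. 0)" using is_tensor_zero[OF t[OF e]] by (auto simp: comp_in_def)
      then show ?thesis by (simp add: Ck_on_const)
    qed
  qed
  have "\<exists>N. bigO_on c K (\<lambda>\<epsilon>. P (u \<epsilon>)) (\<lambda>\<epsilon>. (1 / \<epsilon>) ^ N)"
    if P: "lin_diff_op M r s P" and c: "c \<in> atlas M" and K: "compactin (mtop M) K" "K \<subseteq> fst c" for P c K
  proof -
    obtain k where "\<forall>c\<in>atlas M. \<exists>a. (\<forall>\<alpha> I J I' J'. Ck_on \<infinity> (a \<alpha> I J I' J') (img c)) \<and>
        (\<forall>t. Ck_tensor M \<infinity> r s t \<longrightarrow> (\<forall>p\<in>fst c. \<forall>I J. length I = r \<and> length J = s \<longrightarrow>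
         P t c p I J = (\<Sum>\<alpha> | length \<alpha> \<le> k. \<Sum>I' | length I' = r. \<Sum>J' | length J' = s.
                  a \<alpha> I J I' J' (snd c p) * partials \<alpha> (comp_in c t I' J') (snd c p))))"
      using P[unfolded lin_diff_op_def, THEN conjunct2] by (elim exE)
    from bspec[OF this c] obtain a where a': "(\<forall>\<alpha> I J I' J'. Ck_on \<infinity> (a \<alpha> I J I' J') (img c)) \<and>
        (\<forall>t. Ck_tensor M \<infinity> r s t \<longrightarrow> (\<forall>p\<in>fst c. \<forall>I J. length I = r \<and> length J = s \<longrightarrow>
         P t c p I J = (\<Sum>\<alpha> | length \<alpha> \<le> k. \<Sum>I' | length I' = r. \<Sum>J' | length J' = s.
                  a \<alpha> I J I' J' (snd c p) * partials \<alpha> (comp_in c t I' J') (snd c p))))"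
      by (elim exE)
    have a: "\<And>\<alpha> I J I' J'. Ck_on \<infinity> (a \<alpha> I J I' J') (img c)"
      "\<And>t p I J. Ck_tensor M \<infinity> r s t \<Longrightarrow> p \<in> fst c \<Longrightarrow> length I = r \<and> length J = s \<Longrightarrow>
         P t c p I J = (\<Sum>\<alpha> | length \<alpha> \<le> k. \<Sum>I' | length I' = r. \<Sum>J' | length J' = s.
                  a \<alpha> I J I' J' (snd c p) * partials \<alpha> (comp_in c t I' J') (snd c p))"
      using a' by simp_all
    define F where "F I J \<epsilon> x = (\<Sum>\<alpha> | length \<alpha> \<le> k. \<Sum>I' | length I' = r. \<Sum>J' | length J' = s.
                  a \<alpha> I J I' J' x * partials \<alpha> (comp_in c (u \<epsilon>) I' J') x)" for I J \<epsilon> x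
    have "sup_mod (img c) (F I J)" for I J
      unfolding F_def
    proof (intro sup_mod_sum)
      fix \<alpha> I' J' :: "'n list" assume "I' \<in> {I'. length I' = r}" "J' \<in> {J'. length J' = s}"
      then have "sup_mod (img c) (\<lambda>\<epsilon>. partials \<alpha> (comp_in c (u \<epsilon>) I' J'))"
        using m[OF c, of I' J'] unfolding modnet_def by blast
      then show "sup_mod (img c) (\<lambda>\<epsilon> x. a \<alpha> I J I' J' x * partials \<alpha> (comp_in c (u \<epsilon>) I' J') x)"
        by (rule sup_mod_mult[OF sup_mod_fixed[OF Ck_on_imp_continuous[OF a(1)]]])
    qed
    then have "sup_mod (img c) (\<lambda>\<epsilon> x. \<Sum>I | length I = r. \<Sum>J | length J = s. \<bar>F I J \<epsilon> x\<bar>)"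
      by (intro sup_mod_sum sup_mod_abs)
    moreover have "compact (snd c ` K)" "snd c ` K \<subseteq> img c" using compact_snd_image[OF M c K] K by auto
    ultimately obtain N C where C: "\<forall>\<^sub>F \<epsilon> in at_right 0. \<forall>x\<in>snd c ` K.
        \<bar>\<Sum>I | length I = r. \<Sum>J | length J = s. \<bar>F I J \<epsilon> x\<bar>\<bar> \<le> C * (1 / \<epsilon>) ^ N"
      unfolding sup_mod_def by meson
    have "\<forall>\<^sub>F \<epsilon> in at_right 0. \<forall>p\<in>K. \<forall>I J. \<bar>P (u \<epsilon>) c p I J\<bar> \<le> C * (1 / \<epsilon>) ^ N"
      using C eventually_unit
    proof eventually_elim
      case (elim \<epsilon>)
      then have e: "\<epsilon> \<in> {0<..1}" by simp
      show ?case
      proof (intro ballI allI)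
        fix p I J assume p: "p \<in> K"
        have B: "(\<Sum>I | length I = r. \<Sum>J | length J = s. \<bar>F I J \<epsilon> (snd c p)\<bar>) \<le> C * (1 / \<epsilon>) ^ N"
          by (rule order_trans[OF abs_ge_self bspec[OF elim(1) imageI[OF p]]])
        show "\<bar>P (u \<epsilon>) c p I J\<bar> \<le> C * (1 / \<epsilon>) ^ N"
        proof (cases "length I = r \<and> length J = s")
          case True
          have "\<bar>P (u \<epsilon>) c p I J\<bar> = \<bar>F I J \<epsilon> (snd c p)\<bar>"
            using a(2)[OF T[OF e] _ True] p K by (auto simp: F_def)
          also have "\<dots> \<le> (\<Sum>J | length J = s. \<bar>F I J \<epsilon> (snd c p)\<bar>)"
            using True by (intro member_le_sum) (auto simp: finite_lists_length)
          also have "\<dots> \<le> (\<Sum>I | length I = r. \<Sum>J | length J = s. \<bar>F I J \<epsilon> (snd c p)\<bar>)"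
            using True by (intro member_le_sum[where f = "\<lambda>I. \<Sum>J | length J = s. \<bar>F I J \<epsilon> (snd c p)\<bar>"])
              (auto simp: finite_lists_length sum_nonneg)
          finally show ?thesis using B by linarith
        next
          case False
          then have "P (u \<epsilon>) c p I J = 0" using is_tensor_zero[OF lin_diff_op_tensor[OF P T[OF e]]] by blast
          moreover have "0 \<le> (\<Sum>I | length I = r. \<Sum>J | length J = s. \<bar>F I J \<epsilon> (snd c p)\<bar>)"
            by (intro sum_nonneg) simp
          ultimately show ?thesis using B by linarith
        qed
      qed
    qed
    then show ?thesis unfolding bigO_on_def by blast
  qed
  with T show ?thesis unfolding mod_nets_def by blast
qed

lemma negl_nets_neglnet:
  assumes u: "u \<in> negl_nets M r s" and c: "c \<in> atlas M"
  shows "neglnet (img c) (cnet c u A B)"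
  unfolding neglnet_def
proof
  show "modnet (img c) (cnet c u A B)" using u c unfolding negl_nets_def by (blast intro: mod_nets_modnet)
  show "sup_negl (img c) (cnet c u A B)" unfolding sup_negl_def
  proof (intro allI impI)
    fix K and m :: nat assume K: "compact K \<and> K \<subseteq> img c"
    have "compactin (mtop M) (chart_inv c ` K)" "chart_inv c ` K \<subseteq> fst c"
      using compact_chart_inv[OF M c] K chart_inv_in[of _ c] by auto
    then have "bigO_on c (chart_inv c ` K) u (\<lambda>\<epsilon>. \<epsilon> ^ m)"
      using u c unfolding negl_nets_def by blast
    then obtain C where C: "\<forall>\<^sub>F \<epsilon> in at_right 0. \<forall>p\<in>chart_inv c ` K. \<forall>I J. \<bar>u \<epsilon> c p I J\<bar> \<le> C * \<epsilon> ^ m"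
      unfolding bigO_on_def by blast
    then have "\<forall>\<^sub>F \<epsilon> in at_right 0. \<forall>x\<in>K. \<bar>cnet c u A B \<epsilon> x\<bar> \<le> C * \<epsilon> ^ m"
      by eventually_elim (simp add: comp_in_def)
    then show "\<exists>C. \<forall>\<^sub>F \<epsilon> in at_right 0. \<forall>x\<in>K. \<bar>cnet c u A B \<epsilon> x\<bar> \<le> C * \<epsilon> ^ m" by blast
  qed
qed

lemma negl_netsI:
  assumes t: "\<And>\<epsilon>. \<epsilon> \<in> {0<..1} \<Longrightarrow> is_tensor M r s (u \<epsilon>)"
    and m: "\<And>c I J. c \<in> atlas M \<Longrightarrow> length I = r \<Longrightarrow> length J = s \<Longrightarrow> neglnet (img c) (cnet c u I J)"
  shows "u \<in> negl_nets M r s"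
  unfolding negl_nets_def
proof (intro CollectI conjI allI impI)
  show "u \<in> mod_nets M r s" by (rule mod_netsI[OF t]) (auto intro: neglnet_modnet m)
  fix c K and k :: nat assume cK: "c \<in> atlas M \<and> compactin (mtop M) K \<and> K \<subseteq> fst c"
  then have c: "c \<in> atlas M" and K: "compactin (mtop M) K" "K \<subseteq> fst c" by auto
  have "sup_negl (img c) (\<lambda>\<epsilon> x. \<Sum>I | length I = r. \<Sum>J | length J = s. \<bar>cnet c u I J \<epsilon> x\<bar>)"
    by (intro sup_negl_sum sup_negl_abs neglnet_sup m c) auto
  moreover have "compact (snd c ` K)" "snd c ` K \<subseteq> img c" using compact_snd_image[OF M c K] K by auto
  ultimately obtain C where C: "\<forall>\<^sub>F \<epsilon> in at_right 0. \<forall>x\<in>snd c ` K.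
      \<bar>\<Sum>I | length I = r. \<Sum>J | length J = s. \<bar>cnet c u I J \<epsilon> x\<bar>\<bar> \<le> C * \<epsilon> ^ k"
    unfolding sup_negl_def by meson
  have "\<forall>\<^sub>F \<epsilon> in at_right 0. \<forall>p\<in>K. \<forall>I J. \<bar>u \<epsilon> c p I J\<bar> \<le> C * \<epsilon> ^ k"
    using C eventually_unit
  proof eventually_elim
    case (elim \<epsilon>)
    then have e: "\<epsilon> \<in> {0<..1}" by simp
    show ?case
    proof (intro ballI allI)
      fix p I J assume p: "p \<in> K"
      have B: "(\<Sum>I | length I = r. \<Sum>J | length J = s. \<bar>cnet c u I J \<epsilon> (snd c p)\<bar>) \<le> C * \<epsilon> ^ k"
        by (rule order_trans[OF abs_ge_self bspec[OF elim(1) imageI[OF p]]])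
      show "\<bar>u \<epsilon> c p I J\<bar> \<le> C * \<epsilon> ^ k"
      proof (cases "length I = r \<and> length J = s")
        case True
        have "\<bar>u \<epsilon> c p I J\<bar> = \<bar>cnet c u I J \<epsilon> (snd c p)\<bar>"
          using p K by (auto simp: comp_in_def chart_inv_snd[OF M c])
        also have "\<dots> \<le> (\<Sum>J | length J = s. \<bar>cnet c u I J \<epsilon> (snd c p)\<bar>)"
          using True by (intro member_le_sum) (auto simp: finite_lists_length)
        also have "\<dots> \<le> (\<Sum>I | length I = r. \<Sum>J | length J = s. \<bar>cnet c u I J \<epsilon> (snd c p)\<bar>)"
          using True by (intro member_le_sum[where f = "\<lambda>I. \<Sum>J | length J = s. \<bar>cnet c u I J \<epsilon> (snd c p)\<bar>"])
            (auto simp: finite_lists_length sum_nonneg)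
        finally show ?thesis using B by linarith
      next
        case False
        then have "u \<epsilon> c p I J = 0" using is_tensor_zero[OF t[OF e]] by blast
        moreover have "0 \<le> (\<Sum>I | length I = r. \<Sum>J | length J = s. \<bar>cnet c u I J \<epsilon> (snd c p)\<bar>)"
          by (intro sum_nonneg) simp
        ultimately show ?thesis using B by linarith
      qed
    qed
  qed
  then show "bigO_on c K u (\<lambda>\<epsilon>. \<epsilon> ^ k)" unfolding bigO_on_def by blast
qed

end

section \<open>Equality up to negligible nets\<close>

text \<open>Both nets are required to be moderate, which makes this relation compatible with products.\<close>

definition negl_eq :: "(real^'n::finite) set \<Rightarrow> (real \<Rightarrow> real^'n \<Rightarrow> real) \<Rightarrow> (real \<Rightarrow> real^'n \<Rightarrow> real) \<Rightarrow> bool" where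
  "negl_eq S u v \<longleftrightarrow> modnet S u \<and> modnet S v \<and> neglnet S (\<lambda>\<epsilon> x. u \<epsilon> x - v \<epsilon> x)"

lemma negl_eq_refl: "open S \<Longrightarrow> modnet S u \<Longrightarrow> negl_eq S u u"
  by (simp add: negl_eq_def neglnet_zero)

lemma negl_eq_modnet: "negl_eq S u v \<Longrightarrow> modnet S u" "negl_eq S u v \<Longrightarrow> modnet S v"
  by (simp_all add: negl_eq_def)

lemma negl_eqI:
  "open S \<Longrightarrow> modnet S u \<Longrightarrow> (\<And>\<epsilon> x. \<epsilon> \<in> {0<..1} \<Longrightarrow> x \<in> S \<Longrightarrow> u \<epsilon> x = v \<epsilon> x) \<Longrightarrow> negl_eq S u v"
proof -
  assume S: "open S" and u: "modnet S u" and eq: "\<And>\<epsilon> x. \<epsilon> \<in> {0<..1} \<Longrightarrow> x \<in> S \<Longrightarrow> u \<epsilon> x = v \<epsilon> x"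
  have "modnet S v" by (rule modnet_cong[OF S eq u])
  moreover have "neglnet S (\<lambda>\<epsilon> x. u \<epsilon> x - v \<epsilon> x)"
    by (rule neglnet_cong[OF S _ neglnet_zero[OF S]]) (use eq in simp)
  ultimately show ?thesis using u by (simp add: negl_eq_def)
qed

lemma negl_eq_sym:
  assumes "open S" "negl_eq S u v" shows "negl_eq S v u"
  using assms neglnet_cmult[OF assms(1), of "\<lambda>\<epsilon> x. u \<epsilon> x - v \<epsilon> x" "-1"] by (simp add: negl_eq_def)

lemma negl_eq_trans:
  assumes "open S" "negl_eq S u v" "negl_eq S v w" shows "negl_eq S u w"
  using assms neglnet_add[OF assms(1), of "\<lambda>\<epsilon> x. u \<epsilon> x - v \<epsilon> x" "\<lambda>\<epsilon> x. v \<epsilon> x - w \<epsilon> x"] by (simp add: negl_eq_def)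

lemma negl_eq_subset: "negl_eq S u v \<Longrightarrow> T \<subseteq> S \<Longrightarrow> negl_eq T u v"
  unfolding negl_eq_def by (blast intro: modnet_subset neglnet_subset)

lemma negl_eq_add:
  assumes "open S" "negl_eq S u u'" "negl_eq S v v'"
  shows "negl_eq S (\<lambda>\<epsilon> x. u \<epsilon> x + v \<epsilon> x) (\<lambda>\<epsilon> x. u' \<epsilon> x + v' \<epsilon> x)"
  using assms neglnet_add[OF assms(1), of "\<lambda>\<epsilon> x. u \<epsilon> x - u' \<epsilon> x" "\<lambda>\<epsilon> x. v \<epsilon> x - v' \<epsilon> x"]
  by (simp add: negl_eq_def modnet_add algebra_simps)

lemma negl_eq_mult:
  assumes "open S" "negl_eq S u u'" "negl_eq S v v'"
  shows "negl_eq S (\<lambda>\<epsilon> x. u \<epsilon> x * v \<epsilon> x) (\<lambda>\<epsilon> x. u' \<epsilon> x * v' \<epsilon> x)"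
proof -
  have "neglnet S (\<lambda>\<epsilon> x. (u \<epsilon> x - u' \<epsilon> x) * v \<epsilon> x + u' \<epsilon> x * (v \<epsilon> x - v' \<epsilon> x))"
    using assms unfolding negl_eq_def by (intro neglnet_add neglnet_mult neglnet_mult2) auto
  then show ?thesis using assms by (simp add: negl_eq_def modnet_mult algebra_simps)
qed

lemma negl_eq_const: "open S \<Longrightarrow> negl_eq S (\<lambda>\<epsilon> x. a) (\<lambda>\<epsilon> x. a)"
  by (simp add: negl_eq_refl modnet_const)

lemma negl_eq_cmult: "open S \<Longrightarrow> negl_eq S u u' \<Longrightarrow> negl_eq S (\<lambda>\<epsilon> x. a * u \<epsilon> x) (\<lambda>\<epsilon> x. a * u' \<epsilon> x)"
  by (intro negl_eq_mult negl_eq_const)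

lemma negl_eq_diff:
  assumes "open S" "negl_eq S u u'" "negl_eq S v v'"
  shows "negl_eq S (\<lambda>\<epsilon> x. u \<epsilon> x - v \<epsilon> x) (\<lambda>\<epsilon> x. u' \<epsilon> x - v' \<epsilon> x)"
  using negl_eq_add[OF assms(1,2) negl_eq_cmult[OF assms(1,3), of "-1"]] by simp

lemma negl_eq_sum:
  assumes "open S" "\<And>a. a \<in> A \<Longrightarrow> negl_eq S (\<lambda>\<epsilon>. u a \<epsilon>) (\<lambda>\<epsilon>. v a \<epsilon>)"
  shows "negl_eq S (\<lambda>\<epsilon> x. \<Sum>a\<in>A. u a \<epsilon> x) (\<lambda>\<epsilon> x. \<Sum>a\<in>A. v a \<epsilon> x)"
  using assms(2)
  by (induction A rule: infinite_finite_induct) (auto intro: negl_eq_const negl_eq_add assms(1))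

lemma negl_eq_partial:
  assumes S: "open S" and "negl_eq S u v"
  shows "negl_eq S (\<lambda>\<epsilon>. partial i (u \<epsilon>)) (\<lambda>\<epsilon>. partial i (v \<epsilon>))"
proof -
  have uv: "modnet S u" "modnet S v" "neglnet S (\<lambda>\<epsilon> x. u \<epsilon> x - v \<epsilon> x)"
    using assms(2) by (simp_all add: negl_eq_def)
  have eq: "partial i (\<lambda>x. u \<epsilon> x - v \<epsilon> x) x = partial i (u \<epsilon>) x - partial i (v \<epsilon>) x"
    if e: "\<epsilon> \<in> {0<..1}" and x: "x \<in> S" for \<epsilon> x
  proof -
    have "Ck_on \<infinity> (u \<epsilon>) S" "Ck_on \<infinity> (v \<epsilon>) S"
      using uv(1,2) e by (simp_all add: modnet_def smoothnet_def)
    then show ?thesis by (intro partial_diff smooth_imp_differentiable[OF _ S x])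
  qed
  have "neglnet S (\<lambda>\<epsilon> x. partial i (u \<epsilon>) x - partial i (v \<epsilon>) x)"
    by (rule neglnet_cong[OF S eq neglnet_partial[OF S uv(3)]])
  then show ?thesis using assms by (simp add: negl_eq_def modnet_partial)
qed

lemma negl_eq_cong:
  assumes "open S" "negl_eq S u v" "\<And>\<epsilon> x. \<epsilon> \<in> {0<..1} \<Longrightarrow> x \<in> S \<Longrightarrow> u \<epsilon> x = u' \<epsilon> x"
    "\<And>\<epsilon> x. \<epsilon> \<in> {0<..1} \<Longrightarrow> x \<in> S \<Longrightarrow> v \<epsilon> x = v' \<epsilon> x"
  shows "negl_eq S u' v'"
proof -
  have "negl_eq S u u'" by (rule negl_eqI[OF assms(1) negl_eq_modnet(1)[OF assms(2)] assms(3)])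
  moreover have "negl_eq S v v'" by (rule negl_eqI[OF assms(1) negl_eq_modnet(2)[OF assms(2)] assms(4)])
  ultimately show ?thesis
    using negl_eq_trans[OF assms(1) negl_eq_trans[OF assms(1) negl_eq_sym[OF assms(1)] assms(2)]] by blast
qed

lemma negl_eq_conv:
  "open S \<Longrightarrow> negl_eq S u v \<Longrightarrow> conv n S v f \<Longrightarrow> conv n S u f"
  unfolding negl_eq_def by (blast intro: conv_negl_diff modnet_smoothnet)

section \<open>Algebra of tensor fields\<close>

lemma length_1_conv: "length I = Suc 0 \<longleftrightarrow> (\<exists>i. I = [i])"
  by (auto simp: length_Suc_conv)

lemma length_2_conv: "length I = 2 \<longleftrightarrow> (\<exists>i j. I = [i, j])"
  by (auto simp: length_Suc_conv numeral_2_eq_2)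

text \<open>Contraction of an upper with a lower index, in two charts with Jacobians \<open>P\<close> and \<open>Q\<close>.\<close>

lemma contract_inverse:
  fixes P Q :: "'n::finite \<Rightarrow> 'n \<Rightarrow> real"
  assumes "\<And>k l. (\<Sum>i\<in>UNIV. Q l i * P i k) = (if l = k then 1 else 0)"
  shows "(\<Sum>i\<in>UNIV. \<Sum>k\<in>UNIV. \<Sum>l\<in>UNIV. P i k * Q l i * F k l) = (\<Sum>k\<in>UNIV. F k k)"
proof -
  have "(\<Sum>i\<in>UNIV. \<Sum>k\<in>UNIV. \<Sum>l\<in>UNIV. P i k * Q l i * F k l) = (\<Sum>k\<in>UNIV. \<Sum>i\<in>UNIV. \<Sum>l\<in>UNIV. P i k * Q l i * F k l)"
    by (rule sum.swap)
  also have "\<dots> = (\<Sum>k\<in>UNIV. \<Sum>l\<in>UNIV. \<Sum>i\<in>UNIV. P i k * Q l i * F k l)"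
    by (rule sum.cong[OF refl sum.swap])
  also have "\<dots> = (\<Sum>k\<in>UNIV. \<Sum>l\<in>UNIV. (\<Sum>i\<in>UNIV. Q l i * P i k) * F k l)"
    by (simp add: sum_distrib_left mult.commute mult.left_commute)
  also have "\<dots> = (\<Sum>k\<in>UNIV. F k k)" by (simp add: assms if_distrib if_distribR cong: if_cong)
  finally show ?thesis .
qed

lemma comp_in_tsub: "comp_in c (tsub t u) I J = (\<lambda>x. comp_in c t I J x - comp_in c u I J x)"
  by (simp add: comp_in_def tsub_def)

lemma comp_in_tadd: "comp_in c (tadd t u) I J = (\<lambda>x. comp_in c t I J x + comp_in c u I J x)"
  by (simp add: comp_in_def tadd_def)

lemma comp_in_einstein:
  "comp_in c (einstein Ric S g) I J = (\<lambda>x. comp_in c Ric I J x - 1 / 2 * (comp_in c S [] [] x * comp_in c g I J x))"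
  by (simp add: comp_in_def einstein_def tsub_def tscale_def fmul_def)

context
  fixes M :: "('a, 'n::finite) mfd"
  assumes M: "smooth_manifold M"
begin

lemma is_tensor_lincomb:
  assumes t: "is_tensor M r s t" and u: "is_tensor M r s u"
  shows "is_tensor M r s (\<lambda>c p I J. a * t c p I J + b * u c p I J)"
  unfolding is_tensor_def
proof (intro conjI ballI allI impI)
  show "a * t c p I J + b * u c p I J = 0"
    if "\<not> (c \<in> atlas M \<and> p \<in> fst c \<and> length I = r \<and> length J = s)" for c p I J
    using is_tensor_zero[OF M t that] is_tensor_zero[OF M u that] by simp
  fix c c' p and I' J' :: "'n list" assume c: "c \<in> atlas M" "c' \<in> atlas M" "p \<in> fst c \<inter> fst c'" "length I' = r \<and> length J' = s"
  let ?w = "\<lambda>I J. (\<Prod>m<r. jac c c' p (I' ! m) (I ! m)) * (\<Prod>m<s. jac c' c p (J ! m) (J' ! m))"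
  have 1: "t c' p I' J' = (\<Sum>I | length I = r. \<Sum>J | length J = s. ?w I J * t c p I J)"
    "u c' p I' J' = (\<Sum>I | length I = r. \<Sum>J | length J = s. ?w I J * u c p I J)"
    using t u c unfolding is_tensor_def by blast+
  have 2: "?w I J * (a * t c p I J + b * u c p I J) = a * (?w I J * t c p I J) + b * (?w I J * u c p I J)" for I J
    by (simp add: distrib_left mult.left_commute)
  show "a * t c' p I' J' + b * u c' p I' J' =
     (\<Sum>I | length I = r. \<Sum>J | length J = s. ?w I J * (a * t c p I J + b * u c p I J))"
    unfolding 1 2 sum.distrib by (simp only: sum_distrib_left)
qed

lemma is_tensor_tsub: "is_tensor M r s t \<Longrightarrow> is_tensor M r s u \<Longrightarrow> is_tensor M r s (tsub t u)"
  using is_tensor_lincomb[of r s t u 1 "-1"] by (simp add: tsub_def)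

lemma is_tensor_tadd: "is_tensor M r s t \<Longrightarrow> is_tensor M r s u \<Longrightarrow> is_tensor M r s (tadd t u)"
  using is_tensor_lincomb[of r s t u 1 1] by (simp add: tadd_def)

lemma is_tensor_tscale: "is_tensor M r s t \<Longrightarrow> is_tensor M r s (tscale a t)"
  using is_tensor_lincomb[of r s t t a 0] by (simp add: tscale_def)

lemma tensor_00:
  assumes "is_tensor M 0 0 t" "c \<in> atlas M" "c' \<in> atlas M" "p \<in> fst c" "p \<in> fst c'"
  shows "t c' p [] [] = t c p [] []"
proof -
  have "t c' p [] [] = (\<Sum>I | length I = 0. \<Sum>J | length J = 0.
     (\<Prod>m<0. jac c c' p ([] ! m) (I ! m)) * (\<Prod>m<0. jac c' c p (J ! m) ([] ! m)) * t c p I J)"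
    using assms unfolding is_tensor_def by blast
  then show ?thesis unfolding length_0_lists by simp
qed

lemma tensor_10:
  assumes "is_tensor M 1 0 t" "c \<in> atlas M" "c' \<in> atlas M" "p \<in> fst c" "p \<in> fst c'"
  shows "t c' p [i] [] = (\<Sum>k\<in>UNIV. jac c c' p i k * t c p [k] [])"
proof -
  have "t c' p [i] [] = (\<Sum>I | length I = 1. \<Sum>J | length J = 0.
     (\<Prod>m<1. jac c c' p ([i] ! m) (I ! m)) * (\<Prod>m<0. jac c' c p (J ! m) ([] ! m)) * t c p I J)"
    using assms(2-5) assms(1)[unfolded is_tensor_def, THEN conjunct2, rule_format, of c c' p "[i]" "[]"] by simp
  then show ?thesis unfolding length_0_lists One_nat_def sum_lists_1 by simp
qed

lemma tensor_02:
  assumes "is_tensor M 0 2 t" "c \<in> atlas M" "c' \<in> atlas M" "p \<in> fst c" "p \<in> fst c'"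
  shows "t c' p [] [i, j] = (\<Sum>k\<in>UNIV. \<Sum>l\<in>UNIV. jac c' c p k i * jac c' c p l j * t c p [] [k, l])"
proof -
  have "t c' p [] [i, j] = (\<Sum>I | length I = 0. \<Sum>J | length J = 2.
     (\<Prod>m<0. jac c c' p ([] ! m) (I ! m)) * (\<Prod>m<2. jac c' c p (J ! m) ([i, j] ! m)) * t c p I J)"
    using assms(2-5) assms(1)[unfolded is_tensor_def, THEN conjunct2, rule_format, of c c' p "[]" "[i, j]"] by simp
  then show ?thesis unfolding length_0_lists numeral_2_eq_2 sum_lists_Suc by simp
qed

lemma tensor_20:
  assumes "is_tensor M 2 0 t" "c \<in> atlas M" "c' \<in> atlas M" "p \<in> fst c" "p \<in> fst c'"
  shows "t c' p [i, j] [] = (\<Sum>k\<in>UNIV. \<Sum>l\<in>UNIV. jac c c' p i k * jac c c' p j l * t c p [k, l] [])"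
proof -
  have "t c' p [i, j] [] = (\<Sum>I | length I = 2. \<Sum>J | length J = 0.
     (\<Prod>m<2. jac c c' p ([i, j] ! m) (I ! m)) * (\<Prod>m<0. jac c' c p (J ! m) ([] ! m)) * t c p I J)"
    using assms(2-5) assms(1)[unfolded is_tensor_def, THEN conjunct2, rule_format, of c c' p "[i, j]" "[]"] by simp
  then show ?thesis unfolding length_0_lists numeral_2_eq_2 sum_lists_Suc by simp
qed

lemma tensor_13:
  assumes "is_tensor M 1 3 t" "c \<in> atlas M" "c' \<in> atlas M" "p \<in> fst c" "p \<in> fst c'"
  shows "t c' p [d] [e, a, b] = (\<Sum>d'\<in>UNIV. \<Sum>e'\<in>UNIV. \<Sum>a'\<in>UNIV. \<Sum>b'\<in>UNIV.
    jac c c' p d d' * (jac c' c p e' e * jac c' c p a' a * jac c' c p b' b) * t c p [d'] [e', a', b'])"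
proof -
  have "t c' p [d] [e, a, b] = (\<Sum>I | length I = 1. \<Sum>J | length J = 3.
     (\<Prod>m<1. jac c c' p ([d] ! m) (I ! m)) * (\<Prod>m<3. jac c' c p (J ! m) ([e, a, b] ! m)) * t c p I J)"
    using assms(2-5) assms(1)[unfolded is_tensor_def, THEN conjunct2, rule_format, of c c' p "[d]" "[e, a, b]"] by simp
  then show ?thesis
    unfolding length_0_lists numeral_3_eq_3 One_nat_def sum_lists_Suc by (simp add: length_0_lists)
qed

lemma is_tensor_fld_00:
  assumes "\<And>c c' p. c \<in> atlas M \<Longrightarrow> c' \<in> atlas M \<Longrightarrow> p \<in> fst c \<Longrightarrow> p \<in> fst c' \<Longrightarrow> f c' p [] [] = f c p [] []"
  shows "is_tensor M 0 0 (fld M 0 0 f)"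
  unfolding is_tensor_def
proof (intro conjI ballI allI impI)
  fix c c' p and I' J' :: "'n list" assume c: "c \<in> atlas M" "c' \<in> atlas M" "p \<in> fst c \<inter> fst c'" "length I' = 0 \<and> length J' = 0"
  show "fld M 0 0 f c' p I' J' = (\<Sum>I | length I = 0. \<Sum>J | length J = 0.
     (\<Prod>m<0. jac c c' p (I' ! m) (I ! m)) * (\<Prod>m<0. jac c' c p (J ! m) (J' ! m)) * fld M 0 0 f c p I J)"
    unfolding length_0_lists using c assms[of c c' p] by (simp add: fld_def)
qed (auto simp: fld_def)

lemma is_tensor_fld_02:
  assumes "\<And>c c' p i j. c \<in> atlas M \<Longrightarrow> c' \<in> atlas M \<Longrightarrow> p \<in> fst c \<Longrightarrow> p \<in> fst c' \<Longrightarrow>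
    f c' p [] [i, j] = (\<Sum>k\<in>UNIV. \<Sum>l\<in>UNIV. jac c' c p k i * jac c' c p l j * f c p [] [k, l])"
  shows "is_tensor M 0 2 (fld M 0 2 f)"
  unfolding is_tensor_def
proof (intro conjI ballI allI impI)
  fix c c' p and I' J' :: "'n list" assume c: "c \<in> atlas M" "c' \<in> atlas M" "p \<in> fst c \<inter> fst c'" "length I' = 0 \<and> length J' = 2"
  then obtain i j where J': "I' = []" "J' = [i, j]" by (auto simp: length_2_conv)
  have "fld M 0 2 f c' p I' J' = (\<Sum>k\<in>UNIV. \<Sum>l\<in>UNIV. jac c' c p k i * jac c' c p l j * fld M 0 2 f c p [] [k, l])"
    using c J' assms[of c c' p i j] by (simp add: fld_def)
  then show "fld M 0 2 f c' p I' J' = (\<Sum>I | length I = 0. \<Sum>J | length J = 2.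
     (\<Prod>m<0. jac c c' p (I' ! m) (I ! m)) * (\<Prod>m<2. jac c' c p (J ! m) (J' ! m)) * fld M 0 2 f c p I J)"
    unfolding J' length_0_lists numeral_2_eq_2 sum_lists_Suc by simp
qed (auto simp: fld_def)

lemma is_tensor_metric_app:
  assumes g: "is_tensor M 0 2 g" and y: "is_tensor M 1 0 y" and z: "is_tensor M 1 0 z"
  shows "is_tensor M 0 0 (metric_app M g y z)"
  unfolding metric_app_def
proof (rule is_tensor_fld_00)
  fix c c' p assume c: "c \<in> atlas M" "c' \<in> atlas M" "p \<in> fst c" "p \<in> fst c'"
  let ?P = "jac c c' p" and ?Q = "jac c' c p"
  have inv: "(\<Sum>i\<in>UNIV. ?Q l i * ?P i k) = (if l = k then 1 else 0)" for k l
    using jac_inverse[OF M c] .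
  have "(\<Sum>i\<in>UNIV. \<Sum>j\<in>UNIV. g c' p [] [i, j] * y c' p [i] [] * z c' p [j] [])
    = (\<Sum>i\<in>UNIV. \<Sum>k\<in>UNIV. \<Sum>k'\<in>UNIV. ?P i k * ?Q k' i * (y c p [k] [] *
        (\<Sum>j\<in>UNIV. \<Sum>l\<in>UNIV. \<Sum>l'\<in>UNIV. ?P j l * ?Q l' j * (z c p [l] [] * g c p [] [k', l']))))"
  proof (rule sum.cong[OF refl])
    fix i
    have "(\<Sum>j\<in>UNIV. g c' p [] [i, j] * y c' p [i] [] * z c' p [j] []) =
      (\<Sum>j\<in>UNIV. \<Sum>k\<in>UNIV. \<Sum>k'\<in>UNIV. \<Sum>l\<in>UNIV. \<Sum>l'\<in>UNIV. ?P i k * ?Q k' i * y c p [k] [] * (?P j l * ?Q l' j * (z c p [l] [] * g c p [] [k', l'])))"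
      (is "_ = sum ?R UNIV")
    proof (rule sum.cong[OF refl])
      fix j
      have "g c' p [] [i, j] * y c' p [i] [] * z c' p [j] [] =
        (\<Sum>k'\<in>UNIV. \<Sum>l'\<in>UNIV. ?Q k' i * ?Q l' j * g c p [] [k', l']) * (\<Sum>k\<in>UNIV. ?P i k * y c p [k] []) * (\<Sum>l\<in>UNIV. ?P j l * z c p [l] [])"
        by (simp only: tensor_02[OF g c] tensor_10[OF y c] tensor_10[OF z c])
      also have "\<dots> = (\<Sum>k\<in>UNIV. ?P i k * y c p [k] []) * ((\<Sum>k'\<in>UNIV. \<Sum>l'\<in>UNIV. ?Q k' i * ?Q l' j * g c p [] [k', l']) * (\<Sum>l\<in>UNIV. ?P j l * z c p [l] []))"
        by (simp only: ac_simps)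
      also have "(\<Sum>k'\<in>UNIV. \<Sum>l'\<in>UNIV. ?Q k' i * ?Q l' j * g c p [] [k', l']) * (\<Sum>l\<in>UNIV. ?P j l * z c p [l] [])
        = (\<Sum>k'\<in>UNIV. \<Sum>l'\<in>UNIV. \<Sum>l\<in>UNIV. ?Q k' i * ?Q l' j * g c p [] [k', l'] * (?P j l * z c p [l] []))"
        by (subst sum_distrib_right) (simp only: sum_product)
      also have "(\<Sum>k\<in>UNIV. ?P i k * y c p [k] []) * (\<Sum>k'\<in>UNIV. \<Sum>l'\<in>UNIV. \<Sum>l\<in>UNIV. ?Q k' i * ?Q l' j * g c p [] [k', l'] * (?P j l * z c p [l] []))
        = (\<Sum>k\<in>UNIV. \<Sum>k'\<in>UNIV. ?P i k * y c p [k] [] * (\<Sum>l'\<in>UNIV. \<Sum>l\<in>UNIV. ?Q k' i * ?Q l' j * g c p [] [k', l'] * (?P j l * z c p [l] [])))"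
        by (rule sum_product)
      also have "\<dots> = (\<Sum>k\<in>UNIV. \<Sum>k'\<in>UNIV. (\<Sum>l'\<in>UNIV. \<Sum>l\<in>UNIV. ?P i k * y c p [k] [] * (?Q k' i * ?Q l' j * g c p [] [k', l'] * (?P j l * z c p [l] []))))"
        by (simp only: sum_distrib_left)
      also have "\<dots> = (\<Sum>k\<in>UNIV. \<Sum>k'\<in>UNIV. (\<Sum>l\<in>UNIV. \<Sum>l'\<in>UNIV. ?P i k * y c p [k] [] * (?Q k' i * ?Q l' j * g c p [] [k', l'] * (?P j l * z c p [l] []))))"
        by (rule sum.cong[OF refl], rule sum.cong[OF refl], rule sum.swap)
      also have "\<dots> = ?R j" by (simp only: ac_simps)
      finally show "g c' p [] [i, j] * y c' p [i] [] * z c' p [j] [] = ?R j" .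
    qed
    also have "\<dots> = (\<Sum>k\<in>UNIV. \<Sum>j\<in>UNIV. \<Sum>k'\<in>UNIV. \<Sum>l\<in>UNIV. \<Sum>l'\<in>UNIV. ?P i k * ?Q k' i * y c p [k] [] * (?P j l * ?Q l' j * (z c p [l] [] * g c p [] [k', l'])))"
      by (rule sum.swap)
    also have "\<dots> = (\<Sum>k\<in>UNIV. \<Sum>k'\<in>UNIV. \<Sum>j\<in>UNIV. \<Sum>l\<in>UNIV. \<Sum>l'\<in>UNIV. ?P i k * ?Q k' i * y c p [k] [] * (?P j l * ?Q l' j * (z c p [l] [] * g c p [] [k', l'])))"
      by (rule sum.cong[OF refl], rule sum.swap)
    finally show "(\<Sum>j\<in>UNIV. g c' p [] [i, j] * y c' p [i] [] * z c' p [j] []) = (\<Sum>k\<in>UNIV. \<Sum>k'\<in>UNIV. ?P i k * ?Q k' i * (y c p [k] [] *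
        (\<Sum>j\<in>UNIV. \<Sum>l\<in>UNIV. \<Sum>l'\<in>UNIV. ?P j l * ?Q l' j * (z c p [l] [] * g c p [] [k', l']))))"
      by (simp only: sum_distrib_left mult.assoc)
  qed
  also have "\<dots> = (\<Sum>k\<in>UNIV. y c p [k] [] * (\<Sum>l\<in>UNIV. z c p [l] [] * g c p [] [k, l]))"
    by (simp only: contract_inverse[where P = ?P and Q = ?Q, OF inv])
  finally show "(\<Sum>i\<in>UNIV. \<Sum>j\<in>UNIV. g c' p [] [i, j] * y c' p [i] [] * z c' p [j] [])
     = (\<Sum>i\<in>UNIV. \<Sum>j\<in>UNIV. g c p [] [i, j] * y c p [i] [] * z c p [j] [])"
    by (simp add: sum_distrib_left ac_simps)
qed

lemma is_tensor_full_contract: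
  assumes h: "is_tensor M 2 0 h" and g: "is_tensor M 0 2 g"
  shows "is_tensor M 0 0 (full_contract M h g)"
  unfolding full_contract_def
proof (rule is_tensor_fld_00)
  fix c c' p assume c: "c \<in> atlas M" "c' \<in> atlas M" "p \<in> fst c" "p \<in> fst c'"
  let ?P = "jac c c' p" and ?Q = "jac c' c p"
  have inv: "(\<Sum>i\<in>UNIV. ?Q l i * ?P i k) = (if l = k then 1 else 0)" for k l
    using jac_inverse[OF M c] .
  have "(\<Sum>i\<in>UNIV. \<Sum>j\<in>UNIV. h c' p [i, j] [] * g c' p [] [i, j])
    = (\<Sum>i\<in>UNIV. \<Sum>k\<in>UNIV. \<Sum>k'\<in>UNIV. ?P i k * ?Q k' i *
        (\<Sum>j\<in>UNIV. \<Sum>l\<in>UNIV. \<Sum>l'\<in>UNIV. ?P j l * ?Q l' j * (h c p [k, l] [] * g c p [] [k', l'])))"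
  proof (rule sum.cong[OF refl])
    fix i
    have "(\<Sum>j\<in>UNIV. h c' p [i, j] [] * g c' p [] [i, j]) =
      (\<Sum>j\<in>UNIV. \<Sum>k\<in>UNIV. \<Sum>k'\<in>UNIV. \<Sum>l\<in>UNIV. \<Sum>l'\<in>UNIV. ?P i k * ?Q k' i * (?P j l * ?Q l' j * (h c p [k, l] [] * g c p [] [k', l'])))"
      (is "_ = sum ?R UNIV")
    proof (rule sum.cong[OF refl])
      fix j
      have "h c' p [i, j] [] * g c' p [] [i, j] =
        (\<Sum>k\<in>UNIV. \<Sum>l\<in>UNIV. ?P i k * ?P j l * h c p [k, l] []) * (\<Sum>k'\<in>UNIV. \<Sum>l'\<in>UNIV. ?Q k' i * ?Q l' j * g c p [] [k', l'])"
        by (simp only: tensor_02[OF g c] tensor_20[OF h c])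
      also have "\<dots> = (\<Sum>k\<in>UNIV. \<Sum>k'\<in>UNIV. (\<Sum>l\<in>UNIV. ?P i k * ?P j l * h c p [k, l] []) * (\<Sum>l'\<in>UNIV. ?Q k' i * ?Q l' j * g c p [] [k', l']))"
        by (rule sum_product)
      also have "\<dots> = (\<Sum>k\<in>UNIV. \<Sum>k'\<in>UNIV. \<Sum>l\<in>UNIV. \<Sum>l'\<in>UNIV. (?P i k * ?P j l * h c p [k, l] []) * (?Q k' i * ?Q l' j * g c p [] [k', l']))"
        by (simp only: sum_product)
      also have "\<dots> = ?R j" by (simp only: ac_simps)
      finally show "h c' p [i, j] [] * g c' p [] [i, j] = ?R j" .
    qed
    also have "\<dots> = (\<Sum>k\<in>UNIV. \<Sum>j\<in>UNIV. \<Sum>k'\<in>UNIV. \<Sum>l\<in>UNIV. \<Sum>l'\<in>UNIV. ?P i k * ?Q k' i * (?P j l * ?Q l' j * (h c p [k, l] [] * g c p [] [k', l'])))"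
      by (rule sum.swap)
    also have "\<dots> = (\<Sum>k\<in>UNIV. \<Sum>k'\<in>UNIV. \<Sum>j\<in>UNIV. \<Sum>l\<in>UNIV. \<Sum>l'\<in>UNIV. ?P i k * ?Q k' i * (?P j l * ?Q l' j * (h c p [k, l] [] * g c p [] [k', l'])))"
      by (rule sum.cong[OF refl], rule sum.swap)
    finally show "(\<Sum>j\<in>UNIV. h c' p [i, j] [] * g c' p [] [i, j]) = (\<Sum>k\<in>UNIV. \<Sum>k'\<in>UNIV. ?P i k * ?Q k' i *
        (\<Sum>j\<in>UNIV. \<Sum>l\<in>UNIV. \<Sum>l'\<in>UNIV. ?P j l * ?Q l' j * (h c p [k, l] [] * g c p [] [k', l'])))"
      by (simp only: sum_distrib_left)
  qed
  also have "\<dots> = (\<Sum>i\<in>UNIV. \<Sum>j\<in>UNIV. h c p [i, j] [] * g c p [] [i, j])"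
    by (simp only: contract_inverse[where P = ?P and Q = ?Q, OF inv])
  finally show "(\<Sum>i\<in>UNIV. \<Sum>j\<in>UNIV. h c' p [i, j] [] * g c' p [] [i, j])
     = (\<Sum>i\<in>UNIV. \<Sum>j\<in>UNIV. h c p [i, j] [] * g c p [] [i, j])" .
qed

lemma is_tensor_ricci:
  assumes R: "is_tensor M 1 3 R"
  shows "is_tensor M 0 2 (ricci M R)"
  unfolding ricci_def
proof (rule is_tensor_fld_02)
  fix c c' p i j assume c: "c \<in> atlas M" "c' \<in> atlas M" "p \<in> fst c" "p \<in> fst c'"
  let ?P = "jac c c' p" and ?Q = "jac c' c p"
  have inv: "(\<Sum>i\<in>UNIV. ?Q l i * ?P i k) = (if l = k then 1 else 0)" for k l
    using jac_inverse[OF M c] .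
  have "(\<Sum>d\<in>UNIV. R c' p [d] [d, i, j]) = (\<Sum>d\<in>UNIV. \<Sum>d'\<in>UNIV. \<Sum>e'\<in>UNIV. ?P d d' * ?Q e' d *
      (\<Sum>k\<in>UNIV. \<Sum>l\<in>UNIV. ?Q k i * ?Q l j * R c p [d'] [e', k, l]))"
    unfolding tensor_13[OF R c] by (simp only: sum_distrib_left mult.assoc)
  also have "\<dots> = (\<Sum>d\<in>UNIV. \<Sum>k\<in>UNIV. \<Sum>l\<in>UNIV. ?Q k i * ?Q l j * R c p [d] [d, k, l])"
    by (simp only: contract_inverse[where P = ?P and Q = ?Q, OF inv])
  also have "\<dots> = (\<Sum>k\<in>UNIV. \<Sum>d\<in>UNIV. \<Sum>l\<in>UNIV. ?Q k i * ?Q l j * R c p [d] [d, k, l])"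
    by (rule sum.swap)
  also have "\<dots> = (\<Sum>k\<in>UNIV. \<Sum>l\<in>UNIV. \<Sum>d\<in>UNIV. ?Q k i * ?Q l j * R c p [d] [d, k, l])"
    by (rule sum.cong[OF refl], rule sum.swap)
  finally show "(\<Sum>d\<in>UNIV. R c' p [d] [d, i, j]) = (\<Sum>k\<in>UNIV. \<Sum>l\<in>UNIV. ?Q k i * ?Q l j * (\<Sum>d\<in>UNIV. R c p [d] [d, k, l]))"
    by (simp only: sum_distrib_left)
qed

lemma is_tensor_fmul:
  assumes f: "is_tensor M 0 0 f" and t: "is_tensor M r s t"
  shows "is_tensor M r s (fmul f t)"
  unfolding is_tensor_def fmul_def
proof (intro conjI ballI allI impI)
  show "f c p [] [] * t c p I J = 0"
    if "\<not> (c \<in> atlas M \<and> p \<in> fst c \<and> length I = r \<and> length J = s)" for c p I J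
    using is_tensor_zero[OF M t that] by simp
  fix c c' p and I' J' :: "'n list" assume c: "c \<in> atlas M" "c' \<in> atlas M" "p \<in> fst c \<inter> fst c'" "length I' = r \<and> length J' = s"
  have 1: "t c' p I' J' = (\<Sum>I | length I = r. \<Sum>J | length J = s.
      (\<Prod>m<r. jac c c' p (I' ! m) (I ! m)) * (\<Prod>m<s. jac c' c p (J ! m) (J' ! m)) * t c p I J)"
    using t c unfolding is_tensor_def by blast
  have 2: "f c' p [] [] = f c p [] []" using tensor_00[OF f] c by blast
  show "f c' p [] [] * t c' p I' J' = (\<Sum>I | length I = r. \<Sum>J | length J = s.
      (\<Prod>m<r. jac c c' p (I' ! m) (I ! m)) * (\<Prod>m<s. jac c' c p (J ! m) (J' ! m)) * (f c p [] [] * t c p I J))"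
    unfolding 1 2 sum_distrib_left by (simp only: mult.left_commute)
qed

lemma is_tensor_einstein:
  "is_tensor M 0 2 Ric \<Longrightarrow> is_tensor M 0 0 S \<Longrightarrow> is_tensor M 0 2 g \<Longrightarrow> is_tensor M 0 2 (einstein Ric S g)"
  unfolding einstein_def by (intro is_tensor_tsub is_tensor_tscale is_tensor_fmul)

lemma comp_in_ricci:
  "c \<in> atlas M \<Longrightarrow> x \<in> img c \<Longrightarrow> comp_in c (ricci M R) [] [a, b] x = (\<Sum>k\<in>UNIV. comp_in c R [k] [k, a, b] x)"
  using chart_inv_in[of x c] by (simp add: comp_in_def ricci_def fld_def)

lemma comp_in_full_contract:
  "c \<in> atlas M \<Longrightarrow> x \<in> img c \<Longrightarrow> comp_in c (full_contract M h g) [] [] x =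
    (\<Sum>a\<in>UNIV. \<Sum>b\<in>UNIV. comp_in c h [a, b] [] x * comp_in c g [] [a, b] x)"
  using chart_inv_in[of x c] by (simp add: comp_in_def full_contract_def fld_def)

lemma comp_in_metric_app:
  "c \<in> atlas M \<Longrightarrow> x \<in> img c \<Longrightarrow> comp_in c (metric_app M g y z) [] [] x =
    (\<Sum>i\<in>UNIV. \<Sum>j\<in>UNIV. comp_in c g [] [i, j] x * comp_in c y [i] [] x * comp_in c z [j] [] x)"
  using chart_inv_in[of x c] by (simp add: comp_in_def metric_app_def fld_def)

lemma comp_in_vaction:
  "c \<in> atlas M \<Longrightarrow> x \<in> img c \<Longrightarrow> comp_in c (vaction M y f) [] [] x =
    (\<Sum>i\<in>UNIV. comp_in c y [i] [] x * partial i (comp_in c f [] []) x)"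
  using chart_inv_in[of x c] snd_chart_inv[of x c] 
  unfolding comp_in_def[of c y] comp_in_def[of c "vaction M y f"] by (simp add: vaction_def fld_def coord_deriv_def)

lemma comp_in_bracket:
  assumes "c \<in> atlas M" "x \<in> img c"
  shows "comp_in c (bracket M y z) [i] [] x =
    (\<Sum>j\<in>UNIV. comp_in c y [j] [] x * partial j (comp_in c z [i] []) x - comp_in c z [j] [] x * partial j (comp_in c y [i] []) x)"
proof -
  have "comp_in c (bracket M y z) [i] [] x = bracket M y z c (chart_inv c x) [i] []" by (simp add: comp_in_def)
  also have "\<dots> = (\<Sum>j\<in>UNIV. y c (chart_inv c x) [j] [] * partial j (comp_in c z [i] []) x
      - z c (chart_inv c x) [j] [] * partial j (comp_in c y [i] []) x)"
    using assms chart_inv_in[of x c] snd_chart_inv[of x c] by (simp add: bracket_def fld_def coord_deriv_def)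
  finally show ?thesis by (simp add: fun_cong[OF comp_in_def[of c _ "[_]" "[]"]])
qed

lemma comp_in_curv_app:
  "c \<in> atlas M \<Longrightarrow> x \<in> img c \<Longrightarrow> comp_in c (curv_app M R u v w) [d] [] x =
    (\<Sum>i\<in>UNIV. \<Sum>j\<in>UNIV. \<Sum>k\<in>UNIV. comp_in c R [d] [i, j, k] x * comp_in c u [i] [] x * comp_in c v [j] [] x * comp_in c w [k] [] x)"
  using chart_inv_in[of x c] by (simp add: comp_in_def curv_app_def fld_def)

section \<open>Classes of nets\<close>

lemma net_rel_iff:
  "(u, v) \<in> net_rel M r s \<longleftrightarrow> u \<in> mod_nets M r s \<and> v \<in> mod_nets M r s \<and>
     (\<forall>c\<in>atlas M. \<forall>I J. negl_eq (img c) (cnet c u I J) (cnet c v I J))" (is "?L \<longleftrightarrow> ?R")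
proof
  assume L: ?L
  then have uv: "u \<in> mod_nets M r s" "v \<in> mod_nets M r s" and n: "(\<lambda>\<epsilon>. tsub (u \<epsilon>) (v \<epsilon>)) \<in> negl_nets M r s"
    by (auto simp: net_rel_def)
  have "negl_eq (img c) (cnet c u I J) (cnet c v I J)" if c: "c \<in> atlas M" for c I J
    using negl_nets_neglnet[OF M n c, of I J] mod_nets_modnet[OF M uv(1) c] mod_nets_modnet[OF M uv(2) c]
    by (simp add: negl_eq_def comp_in_tsub)
  with uv show ?R by blast
next
  assume R: ?R
  have "(\<lambda>\<epsilon>. tsub (u \<epsilon>) (v \<epsilon>)) \<in> negl_nets M r s"
  proof (rule negl_netsI[OF M])
    show "is_tensor M r s (tsub (u \<epsilon>) (v \<epsilon>))" if "\<epsilon> \<in> {0<..1}" for \<epsilon>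
      using R mod_nets_is_tensor[OF M _ that] by (intro is_tensor_tsub) auto
    show "neglnet (img c) (\<lambda>\<epsilon>. comp_in c (tsub (u \<epsilon>) (v \<epsilon>)) I J)" if "c \<in> atlas M" for c I J
      using R that by (simp add: negl_eq_def comp_in_tsub)
  qed
  with R show ?L by (simp add: net_rel_def)
qed

lemma net_relI:
  assumes u: "\<And>\<epsilon>. \<epsilon> \<in> {0<..1} \<Longrightarrow> is_tensor M r s (u \<epsilon>)" and v: "\<And>\<epsilon>. \<epsilon> \<in> {0<..1} \<Longrightarrow> is_tensor M r s (v \<epsilon>)"
    and n: "\<And>c I J. c \<in> atlas M \<Longrightarrow> length I = r \<Longrightarrow> length J = s \<Longrightarrow> negl_eq (img c) (cnet c u I J) (cnet c v I J)"
  shows "(u, v) \<in> net_rel M r s"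
proof -
  have um: "u \<in> mod_nets M r s" by (rule mod_netsI[OF M u]) (auto intro: negl_eq_modnet(1) n)
  have vm: "v \<in> mod_nets M r s" by (rule mod_netsI[OF M v]) (auto intro: negl_eq_modnet(2) n)
  have "(\<lambda>\<epsilon>. tsub (u \<epsilon>) (v \<epsilon>)) \<in> negl_nets M r s"
  proof (rule negl_netsI[OF M])
    show "is_tensor M r s (tsub (u \<epsilon>) (v \<epsilon>))" if "\<epsilon> \<in> {0<..1}" for \<epsilon>
      using u v that by (intro is_tensor_tsub) auto
    show "neglnet (img c) (\<lambda>\<epsilon>. comp_in c (tsub (u \<epsilon>) (v \<epsilon>)) I J)"
      if "c \<in> atlas M" "length I = r" "length J = s" for c I J
      using n[OF that] by (simp add: negl_eq_def comp_in_tsub)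
  qed
  with um vm show ?thesis by (simp add: net_rel_def)
qed

lemma equiv_net_rel: "equiv (mod_nets M r s) (net_rel M r s)"
proof (rule equivI)
  show "net_rel M r s \<subseteq> mod_nets M r s \<times> mod_nets M r s" by (auto simp: net_rel_def)
  show "refl_on (mod_nets M r s) (net_rel M r s)"
    unfolding refl_on_def by (auto simp: net_rel_iff intro!: negl_eq_refl open_img[OF M] mod_nets_modnet[OF M])
  show "sym (net_rel M r s)"
  proof (rule symI)
    fix u v assume "(u, v) \<in> net_rel M r s"
    then show "(v, u) \<in> net_rel M r s"
      unfolding net_rel_iff by (auto intro: negl_eq_sym[OF open_img[OF M]])
  qed
  show "trans (net_rel M r s)"
  proof (rule transI)
    fix u v w assume "(u, v) \<in> net_rel M r s" "(v, w) \<in> net_rel M r s"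
    then have uvw: "u \<in> mod_nets M r s" "w \<in> mod_nets M r s"
      "\<forall>c\<in>atlas M. \<forall>I J. negl_eq (img c) (cnet c u I J) (cnet c v I J)"
      "\<forall>c\<in>atlas M. \<forall>I J. negl_eq (img c) (cnet c v I J) (cnet c w I J)"
      by (simp_all add: net_rel_iff)
    have "negl_eq (img c) (cnet c u I J) (cnet c w I J)" if "c \<in> atlas M" for c I J
    proof (rule negl_eq_trans[OF open_img[OF M that]])
      show "negl_eq (img c) (cnet c u I J) (cnet c v I J)" using uvw(3) that by simp
      show "negl_eq (img c) (cnet c v I J) (cnet c w I J)" using uvw(4) that by simp
    qed
    with uvw show "(u, w) \<in> net_rel M r s" by (simp add: net_rel_iff)
  qed
qed

lemma gen_mod_nets: "A \<in> gen_tensors M r s \<Longrightarrow> u \<in> A \<Longrightarrow> u \<in> mod_nets M r s"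
  unfolding gen_tensors_def using in_quotient_imp_subset[OF equiv_net_rel] by blast

lemma gen_nonempty: "A \<in> gen_tensors M r s \<Longrightarrow> \<exists>u. u \<in> A"
  unfolding gen_tensors_def using in_quotient_imp_non_empty[OF equiv_net_rel] by blast

lemma gen_net_rel: "A \<in> gen_tensors M r s \<Longrightarrow> u \<in> A \<Longrightarrow> v \<in> A \<Longrightarrow> (u, v) \<in> net_rel M r s"
  unfolding gen_tensors_def using in_quotient_imp_in_rel[OF equiv_net_rel, of A r s u v] by simp

lemma gen_negl_eq:
  "A \<in> gen_tensors M r s \<Longrightarrow> u \<in> A \<Longrightarrow> v \<in> A \<Longrightarrow> c \<in> atlas M \<Longrightarrow> negl_eq (img c) (cnet c u I J) (cnet c v I J)"
  using gen_net_rel[of A r s u v] by (simp add: net_rel_iff)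

lemma net_class_gen: "u \<in> mod_nets M r s \<Longrightarrow> net_class M r s u \<in> gen_tensors M r s"
  by (simp add: net_class_def gen_tensors_def quotientI)

lemma net_class_self: "u \<in> mod_nets M r s \<Longrightarrow> u \<in> net_class M r s u"
  using equiv_class_self[OF equiv_net_rel] by (simp add: net_class_def)

lemma net_class_eq: "(u, v) \<in> net_rel M r s \<Longrightarrow> net_class M r s u = net_class M r s v"
  using equiv_class_eq[OF equiv_net_rel] by (simp add: net_class_def)

lemma net_classD: "v \<in> net_class M r s u \<Longrightarrow> (u, v) \<in> net_rel M r s"
  by (simp add: net_class_def)

lemma net_rel_mod: "(u, v) \<in> net_rel M r s \<Longrightarrow> u \<in> mod_nets M r s" "(u, v) \<in> net_rel M r s \<Longrightarrow> v \<in> mod_nets M r s"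
  by (simp_all add: net_rel_def)

lemma glift1_eq:
  assumes "u \<in> A" "\<And>u'. u' \<in> A \<Longrightarrow> ((\<lambda>\<epsilon>. F (u' \<epsilon>)), (\<lambda>\<epsilon>. F (u \<epsilon>))) \<in> net_rel M r s"
  shows "glift1 M r s F A = net_class M r s (\<lambda>\<epsilon>. F (u \<epsilon>))"
  unfolding glift1_def using assms(1) net_class_eq[OF assms(2)] by blast

lemma glift2_eq:
  assumes "u \<in> A" "v \<in> B"
    "\<And>u' v'. u' \<in> A \<Longrightarrow> v' \<in> B \<Longrightarrow> ((\<lambda>\<epsilon>. F (u' \<epsilon>) (v' \<epsilon>)), (\<lambda>\<epsilon>. F (u \<epsilon>) (v \<epsilon>))) \<in> net_rel M r s"
  shows "glift2 M r s F A B = net_class M r s (\<lambda>\<epsilon>. F (u \<epsilon>) (v \<epsilon>))"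
  unfolding glift2_def using assms(1,2) net_class_eq[OF assms(3)] by blast

lemma glift3_eq:
  assumes "u \<in> A" "v \<in> B" "w \<in> E"
    "\<And>u' v' w'. u' \<in> A \<Longrightarrow> v' \<in> B \<Longrightarrow> w' \<in> E \<Longrightarrow>
      ((\<lambda>\<epsilon>. F (u' \<epsilon>) (v' \<epsilon>) (w' \<epsilon>)), (\<lambda>\<epsilon>. F (u \<epsilon>) (v \<epsilon>) (w \<epsilon>))) \<in> net_rel M r s"
  shows "glift3 M r s F A B E = net_class M r s (\<lambda>\<epsilon>. F (u \<epsilon>) (v \<epsilon>) (w \<epsilon>))"
  unfolding glift3_def using assms(1-3) net_class_eq[OF assms(4)] by blast

lemma glift2_mem:
  "u \<in> A \<Longrightarrow> v \<in> B \<Longrightarrow> (\<lambda>\<epsilon>. F (u \<epsilon>) (v \<epsilon>)) \<in> mod_nets M r s \<Longrightarrow> (\<lambda>\<epsilon>. F (u \<epsilon>) (v \<epsilon>)) \<in> glift2 M r s F A B"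
  unfolding glift2_def using net_class_self[of "\<lambda>\<epsilon>. F (u \<epsilon>) (v \<epsilon>)" r s] by blast

lemma glift3_mem:
  "u \<in> A \<Longrightarrow> v \<in> B \<Longrightarrow> w \<in> E \<Longrightarrow> (\<lambda>\<epsilon>. F (u \<epsilon>) (v \<epsilon>) (w \<epsilon>)) \<in> mod_nets M r s \<Longrightarrow>
    (\<lambda>\<epsilon>. F (u \<epsilon>) (v \<epsilon>) (w \<epsilon>)) \<in> glift3 M r s F A B E"
  unfolding glift3_def using net_class_self[of "\<lambda>\<epsilon>. F (u \<epsilon>) (v \<epsilon>) (w \<epsilon>)" r s] by blast

lemma glift2D:
  "w \<in> glift2 M r s F A B \<Longrightarrow> \<exists>u\<in>A. \<exists>v\<in>B. ((\<lambda>\<epsilon>. F (u \<epsilon>) (v \<epsilon>)), w) \<in> net_rel M r s"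
  unfolding glift2_def by (auto dest: net_classD)

lemma glift3D:
  "w \<in> glift3 M r s F A B E \<Longrightarrow> \<exists>u\<in>A. \<exists>v\<in>B. \<exists>t\<in>E. ((\<lambda>\<epsilon>. F (u \<epsilon>) (v \<epsilon>) (t \<epsilon>)), w) \<in> net_rel M r s"
  unfolding glift3_def by (auto dest: net_classD)

lemma tsub_net_rel:
  assumes "(u, u') \<in> net_rel M r s" "(v, v') \<in> net_rel M r s"
  shows "((\<lambda>\<epsilon>. tsub (u \<epsilon>) (v \<epsilon>)), (\<lambda>\<epsilon>. tsub (u' \<epsilon>) (v' \<epsilon>))) \<in> net_rel M r s"
proof (rule net_relI)
  show "is_tensor M r s (tsub (u \<epsilon>) (v \<epsilon>))" "is_tensor M r s (tsub (u' \<epsilon>) (v' \<epsilon>))" if "\<epsilon> \<in> {0<..1}" for \<epsilon>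
    using mod_nets_is_tensor[OF M net_rel_mod(1)[OF assms(1)] that] mod_nets_is_tensor[OF M net_rel_mod(2)[OF assms(1)] that]
      mod_nets_is_tensor[OF M net_rel_mod(1)[OF assms(2)] that] mod_nets_is_tensor[OF M net_rel_mod(2)[OF assms(2)] that]
    by (simp_all add: is_tensor_tsub)
  show "negl_eq (img c) (\<lambda>\<epsilon>. comp_in c (tsub (u \<epsilon>) (v \<epsilon>)) I J) (\<lambda>\<epsilon>. comp_in c (tsub (u' \<epsilon>) (v' \<epsilon>)) I J)"
    if "c \<in> atlas M" for c I J
    unfolding comp_in_tsub using assms that by (intro negl_eq_diff open_img[OF M]) (simp_all add: net_rel_iff)
qed

lemma glift2_tsub:
  assumes "A \<in> gen_tensors M r s" "B \<in> gen_tensors M r s" "u \<in> A" "v \<in> B"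
  shows "glift2 M r s tsub A B = net_class M r s (\<lambda>\<epsilon>. tsub (u \<epsilon>) (v \<epsilon>))"
    "(\<lambda>\<epsilon>. tsub (u \<epsilon>) (v \<epsilon>)) \<in> mod_nets M r s"
proof -
  show "glift2 M r s tsub A B = net_class M r s (\<lambda>\<epsilon>. tsub (u \<epsilon>) (v \<epsilon>))"
    using assms by (intro glift2_eq tsub_net_rel gen_net_rel) auto
  show "(\<lambda>\<epsilon>. tsub (u \<epsilon>) (v \<epsilon>)) \<in> mod_nets M r s"
    by (rule net_rel_mod(1)[OF tsub_net_rel[OF gen_net_rel[OF assms(1,3,3)] gen_net_rel[OF assms(2,4,4)]]])
qed

lemma glift2_tsub_gen:
  assumes "A \<in> gen_tensors M r s" "B \<in> gen_tensors M r s"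
  shows "glift2 M r s tsub A B \<in> gen_tensors M r s"
proof -
  obtain u v where "u \<in> A" "v \<in> B" using assms gen_nonempty by blast
  then show ?thesis using glift2_tsub[OF assms, of u v] net_class_gen[of "\<lambda>\<epsilon>. tsub (u \<epsilon>) (v \<epsilon>)" r s] by simp
qed

end

section \<open>The Koszul formula and the curvature at a point\<close>

lemma bilinear_swap:
  fixes g :: "'n::finite \<Rightarrow> 'n \<Rightarrow> real"
  assumes "\<And>i j. g i j = g j i"
  shows "(\<Sum>i\<in>UNIV. \<Sum>j\<in>UNIV. g i j * a i * b j) = (\<Sum>i\<in>UNIV. \<Sum>j\<in>UNIV. g i j * b i * a j)"
  by (subst sum.swap) (simp add: assms ac_simps)

text \<open>The Koszul formula with defects, at one point, for the vector fields \<open>x\<close>, \<open>y\<close> and the \<open>l\<close>-th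
  coordinate field \<open>e\<close>. Here \<open>dg\<close>, \<open>dx\<close>, \<open>dy\<close> are the values of first derivatives, \<open>p\<close>, \<open>p'\<close>, \<open>q\<close>,
  \<open>q'\<close>, \<open>r\<close>, \<open>r'\<close> stand for \<open>D\<^sub>x y\<close>, \<open>D\<^sub>y x\<close>, \<open>D\<^sub>x e\<close>, \<open>D\<^sub>e x\<close>, \<open>D\<^sub>y e\<close>, \<open>D\<^sub>e y\<close>, the numbers \<open>A1\<close>, \<open>A2\<close>,
  \<open>A3\<close> are the defects of the compatibility with the metric for the three cyclic arrangements of
  the fields, and \<open>T1\<close>, \<open>T2\<close>, \<open>T3\<close> are the defects of torsion-freeness.\<close>

lemma koszul_pointwise:
  fixes g :: "'n::finite \<Rightarrow> 'n \<Rightarrow> real" and dg :: "'n \<Rightarrow> 'n \<Rightarrow> 'n \<Rightarrow> real"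
  assumes g: "\<And>i j. g i j = g j i" and dg: "\<And>k i j. dg k i j = dg k j i"
    and A1: "A1 = (\<Sum>i\<in>UNIV. x i * (\<Sum>j\<in>UNIV. dg i j l * y j + g j l * dy i j))
       - ((\<Sum>j\<in>UNIV. g j l * p j) + (\<Sum>j\<in>UNIV. \<Sum>k\<in>UNIV. g j k * y j * q k))"
    and A2: "A2 = (\<Sum>i\<in>UNIV. y i * (\<Sum>k\<in>UNIV. dg i l k * x k + g l k * dx i k))
       - ((\<Sum>j\<in>UNIV. \<Sum>k\<in>UNIV. g j k * r j * x k) + (\<Sum>k\<in>UNIV. g l k * p' k))"
    and A3: "A3 = (\<Sum>i\<in>UNIV. \<Sum>j\<in>UNIV. dg l i j * x i * y j + g i j * dx l i * y j + g i j * x i * dy l j)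
       - ((\<Sum>j\<in>UNIV. \<Sum>k\<in>UNIV. g j k * q' j * y k) + (\<Sum>j\<in>UNIV. \<Sum>k\<in>UNIV. g j k * x j * r' k))"
    and T1: "\<And>m. T1 m = (\<Sum>j\<in>UNIV. x j * dy j m - y j * dx j m) - (p m - p' m)"
    and T2: "\<And>m. T2 m = - dx l m - (q m - q' m)"
    and T3: "\<And>m. T3 m = - dy l m - (r m - r' m)"
  shows "2 * (\<Sum>n\<in>UNIV. g n l * (p n - (\<Sum>i\<in>UNIV. x i * dy i n)))
      - (\<Sum>i\<in>UNIV. \<Sum>j\<in>UNIV. (dg i j l + dg j i l - dg l i j) * x i * y j)
    = A3 - A1 - A2 - (\<Sum>n\<in>UNIV. g n l * T1 n) + (\<Sum>i\<in>UNIV. \<Sum>j\<in>UNIV. g i j * T2 i * y j)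
      + (\<Sum>i\<in>UNIV. \<Sum>j\<in>UNIV. g i j * T3 i * x j)"
proof -
  define G where "G a b = (\<Sum>i\<in>UNIV. \<Sum>j\<in>UNIV. g i j * a i * b j)" for a b
  define P where "P a = (\<Sum>n\<in>UNIV. g n l * a n)" for a
  define a1 where "a1 = (\<Sum>i\<in>UNIV. \<Sum>j\<in>UNIV. dg i j l * x i * y j)"
  define a2 where "a2 = (\<Sum>i\<in>UNIV. \<Sum>j\<in>UNIV. dg j i l * x i * y j)"
  define a3 where "a3 = (\<Sum>i\<in>UNIV. \<Sum>j\<in>UNIV. dg l i j * x i * y j)"
  define XY where "XY = P (\<lambda>n. \<Sum>i\<in>UNIV. x i * dy i n)"
  define YX where "YX = P (\<lambda>n. \<Sum>i\<in>UNIV. y i * dx i n)"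
  have Gs: "G a b = G b a" for a b unfolding G_def by (rule bilinear_swap[OF g])
  have 1: "A1 = a1 + XY - P p - G y q"
  proof -
    have "(\<Sum>i\<in>UNIV. x i * (\<Sum>j\<in>UNIV. dg i j l * y j + g j l * dy i j))
       = a1 + (\<Sum>i\<in>UNIV. \<Sum>j\<in>UNIV. g j l * (x i * dy i j))"
      by (simp add: a1_def sum.distrib sum_distrib_left distrib_left ac_simps)
    also have "(\<Sum>i\<in>UNIV. \<Sum>j\<in>UNIV. g j l * (x i * dy i j)) = XY"
      by (subst sum.swap) (simp add: XY_def P_def sum_distrib_left)
    finally show ?thesis unfolding A1 by (simp add: P_def G_def)
  qed
  have 2: "A2 = a2 + YX - G r x - P p'"
  proof -
    have "(\<Sum>i\<in>UNIV. y i * (\<Sum>k\<in>UNIV. dg i l k * x k + g l k * dx i k))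
       = (\<Sum>i\<in>UNIV. \<Sum>k\<in>UNIV. dg i l k * x k * y i) + (\<Sum>i\<in>UNIV. \<Sum>k\<in>UNIV. g l k * (y i * dx i k))"
      by (simp add: sum.distrib sum_distrib_left distrib_left ac_simps)
    also have "(\<Sum>i\<in>UNIV. \<Sum>k\<in>UNIV. g l k * (y i * dx i k)) = YX"
      by (subst sum.swap) (simp add: YX_def P_def sum_distrib_left g[of l])
    also have "(\<Sum>i\<in>UNIV. \<Sum>k\<in>UNIV. dg i l k * x k * y i) = a2"
      by (subst sum.swap) (simp add: a2_def dg[of _ l])
    finally show ?thesis unfolding A2 by (simp add: P_def G_def g[of l])
  qed
  have 3: "A3 = a3 + G (dx l) y + G x (dy l) - G q' y - G x r'"
    unfolding A3 by (simp add: a3_def G_def sum.distrib)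
  have 4: "(\<Sum>n\<in>UNIV. g n l * T1 n) = XY - YX - P p + P p'"
    unfolding T1 XY_def YX_def P_def by (simp add: sum_subtractf right_diff_distrib)
  have 5: "(\<Sum>i\<in>UNIV. \<Sum>j\<in>UNIV. g i j * T2 i * y j) = - G (dx l) y - G q y + G q' y"
    unfolding T2 G_def by (simp add: sum_subtractf sum_negf right_diff_distrib left_diff_distrib)
  have 6: "(\<Sum>i\<in>UNIV. \<Sum>j\<in>UNIV. g i j * T3 i * x j) = - G (dy l) x - G r x + G r' x"
    unfolding T3 G_def by (simp add: sum_subtractf sum_negf right_diff_distrib left_diff_distrib)
  have 7: "(\<Sum>n\<in>UNIV. g n l * (p n - (\<Sum>i\<in>UNIV. x i * dy i n))) = P p - XY"
    unfolding XY_def P_def by (simp add: sum_subtractf right_diff_distrib)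
  have 8: "(\<Sum>i\<in>UNIV. \<Sum>j\<in>UNIV. (dg i j l + dg j i l - dg l i j) * x i * y j) = a1 + a2 - a3"
    unfolding a1_def a2_def a3_def by (simp add: sum.distrib sum_subtractf distrib_right left_diff_distrib)
  show ?thesis unfolding 1 2 3 4 5 6 7 8 Gs[of y q] Gs[of x "dy l"] Gs[of x r'] by (simp add: algebra_simps)
qed

text \<open>The Christoffel symbols \<open>\<Gamma>\<^sup>m\<^sub>i\<^sub>j\<close> for an inverse \<open>h\<close> of the metric, with \<open>dg k i j\<close> in the role of
  \<open>\<partial>\<^sub>k g\<^sub>i\<^sub>j\<close>.\<close>

definition christ :: "('n::finite \<Rightarrow> 'n \<Rightarrow> real) \<Rightarrow> ('n \<Rightarrow> 'n \<Rightarrow> 'n \<Rightarrow> real) \<Rightarrow> 'n \<Rightarrow> 'n \<Rightarrow> 'n \<Rightarrow> real" where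
  "christ h dg m i j = 1 / 2 * (\<Sum>l\<in>UNIV. h m l * (dg i j l + dg j i l - dg l i j))"

text \<open>Raising the index in the Koszul formula. The last sum is the error that arises if \<open>h\<close> inverts \<open>g\<close>
  only approximately; \<open>X\<close> is the derivative of the components of \<open>y\<close> in the direction of \<open>x\<close>.\<close>

lemma connection_pointwise:
  fixes g h :: "'n::finite \<Rightarrow> 'n \<Rightarrow> real"
  assumes K: "\<And>l. K l = 2 * (\<Sum>n\<in>UNIV. g n l * (p n - X n))
      - (\<Sum>i\<in>UNIV. \<Sum>j\<in>UNIV. (dg i j l + dg j i l - dg l i j) * x i * y j)"
  shows "p m - (X m + (\<Sum>i\<in>UNIV. \<Sum>j\<in>UNIV. christ h dg m i j * x i * y j)) =
    1 / 2 * (\<Sum>l\<in>UNIV. h m l * K l)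
    - (\<Sum>n\<in>UNIV. ((\<Sum>l\<in>UNIV. h m l * g n l) - (if n = m then 1 else 0)) * (p n - X n))"
proof -
  have "(\<Sum>l\<in>UNIV. h m l * (\<Sum>n\<in>UNIV. g n l * (p n - X n))) = (\<Sum>l\<in>UNIV. \<Sum>n\<in>UNIV. h m l * g n l * (p n - X n))"
    by (simp add: sum_distrib_left mult.assoc)
  also have "\<dots> = (\<Sum>n\<in>UNIV. (\<Sum>l\<in>UNIV. h m l * g n l) * (p n - X n))"
    by (subst sum.swap) (simp add: sum_distrib_right)
  finally have 1: "(\<Sum>l\<in>UNIV. h m l * (\<Sum>n\<in>UNIV. g n l * (p n - X n))) = (\<Sum>n\<in>UNIV. (\<Sum>l\<in>UNIV. h m l * g n l) * (p n - X n))" .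
  have "(\<Sum>l\<in>UNIV. h m l * (\<Sum>i\<in>UNIV. \<Sum>j\<in>UNIV. (dg i j l + dg j i l - dg l i j) * x i * y j))
     = (\<Sum>l\<in>UNIV. \<Sum>i\<in>UNIV. \<Sum>j\<in>UNIV. h m l * (dg i j l + dg j i l - dg l i j) * x i * y j)"
    by (simp add: sum_distrib_left mult.assoc)
  also have "\<dots> = (\<Sum>i\<in>UNIV. \<Sum>l\<in>UNIV. \<Sum>j\<in>UNIV. h m l * (dg i j l + dg j i l - dg l i j) * x i * y j)"
    by (rule sum.swap)
  also have "\<dots> = (\<Sum>i\<in>UNIV. \<Sum>j\<in>UNIV. \<Sum>l\<in>UNIV. h m l * (dg i j l + dg j i l - dg l i j) * x i * y j)"
    by (rule sum.cong[OF refl sum.swap])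
  also have "\<dots> = 2 * (\<Sum>i\<in>UNIV. \<Sum>j\<in>UNIV. christ h dg m i j * x i * y j)"
    by (simp add: christ_def sum_distrib_left sum_distrib_right)
  finally have 2: "(\<Sum>l\<in>UNIV. h m l * (\<Sum>i\<in>UNIV. \<Sum>j\<in>UNIV. (dg i j l + dg j i l - dg l i j) * x i * y j))
     = 2 * (\<Sum>i\<in>UNIV. \<Sum>j\<in>UNIV. christ h dg m i j * x i * y j)" .
  have "(\<Sum>l\<in>UNIV. h m l * K l) = 2 * (\<Sum>l\<in>UNIV. h m l * (\<Sum>n\<in>UNIV. g n l * (p n - X n)))
     - (\<Sum>l\<in>UNIV. h m l * (\<Sum>i\<in>UNIV. \<Sum>j\<in>UNIV. (dg i j l + dg j i l - dg l i j) * x i * y j))"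
    unfolding K by (simp add: right_diff_distrib sum_subtractf sum_distrib_left mult.left_commute)
  also have "\<dots> = 2 * (\<Sum>n\<in>UNIV. (\<Sum>l\<in>UNIV. h m l * g n l) * (p n - X n)) - 2 * (\<Sum>i\<in>UNIV. \<Sum>j\<in>UNIV. christ h dg m i j * x i * y j)"
    unfolding 1 2 ..
  finally have "1 / 2 * (\<Sum>l\<in>UNIV. h m l * K l) = (\<Sum>n\<in>UNIV. (\<Sum>l\<in>UNIV. h m l * g n l) * (p n - X n))
     - (\<Sum>i\<in>UNIV. \<Sum>j\<in>UNIV. christ h dg m i j * x i * y j)" by simp
  moreover have "(\<Sum>n\<in>UNIV. ((\<Sum>l\<in>UNIV. h m l * g n l) - (if n = m then 1 else 0)) * (p n - X n))
     = (\<Sum>n\<in>UNIV. (\<Sum>l\<in>UNIV. h m l * g n l) * (p n - X n)) - (p m - X m)"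
  proof -
    have "(\<Sum>n\<in>UNIV. ((\<Sum>l\<in>UNIV. h m l * g n l) - (if n = m then 1 else 0)) * (p n - X n))
      = (\<Sum>n\<in>UNIV. (\<Sum>l\<in>UNIV. h m l * g n l) * (p n - X n) - (if n = m then p n - X n else 0))"
      by (intro sum.cong refl) (auto simp: left_diff_distrib)
    then show ?thesis by (simp add: sum_subtractf)
  qed
  ultimately show ?thesis by linarith
qed

section \<open>Test fields\<close>

lemma sup_negl_exhaust:
  assumes "\<And>K. compact K \<Longrightarrow> K \<subseteq> S \<Longrightarrow> \<exists>U. K \<subseteq> U \<and> sup_negl U u"
  shows "sup_negl S u"
  unfolding sup_negl_def
proof (intro allI impI)
  fix K and m :: nat assume K: "compact K \<and> K \<subseteq> S"
  then obtain U where "K \<subseteq> U" "sup_negl U u" using assms by blast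
  then show "\<exists>C. \<forall>\<^sub>F \<epsilon> in at_right 0. \<forall>x\<in>K. \<bar>u \<epsilon> x\<bar> \<le> C * \<epsilon> ^ m"
    using K unfolding sup_negl_def by blast
qed

lemma negl_eq_exhaust:
  assumes u: "modnet S u" and v: "modnet S v" and S: "open S"
    and e: "\<And>K. compact K \<Longrightarrow> K \<subseteq> S \<Longrightarrow> \<exists>U. K \<subseteq> U \<and> negl_eq U u v"
  shows "negl_eq S u v"
proof -
  have "sup_negl S (\<lambda>\<epsilon> x. u \<epsilon> x - v \<epsilon> x)"
  proof (rule sup_negl_exhaust)
    fix K :: "(real^'a) set" assume "compact K" "K \<subseteq> S"
    then obtain U where "K \<subseteq> U" "negl_eq U u v" using e by blast
    then show "\<exists>U. K \<subseteq> U \<and> sup_negl U (\<lambda>\<epsilon> x. u \<epsilon> x - v \<epsilon> x)"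
      unfolding negl_eq_def by (blast intro: neglnet_sup)
  qed
  then show ?thesis using modnet_diff[OF S u v] u v by (simp add: negl_eq_def neglnet_def)
qed

context
  fixes M :: "('a, 'n::finite) mfd"
  assumes M: "smooth_manifold M"
begin

text \<open>The axioms of a connection speak about global vector fields only. These fields coincide with the
  coordinate fields on a neighbourhood of \<open>K\<close>.\<close>

lemma test_fields:
  assumes c: "c \<in> atlas M" and K: "compact K" "K \<subseteq> img c"
  obtains e U L where "open U" "K \<subseteq> U" "U \<subseteq> L" "compact L" "L \<subseteq> img c"
    "\<And>l. Ck_tensor M \<infinity> 1 0 (e l)"
    "\<And>l m x. x \<in> U \<Longrightarrow> comp_in c (e l) [m] [] x = (if m = l then 1 else 0)"
proof -
  obtain f U L where f: "Ck_on \<infinity> f UNIV" "open U" "K \<subseteq> U" "U \<subseteq> L" "compact L" "L \<subseteq> img c"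
    "\<And>x. x \<in> U \<Longrightarrow> f x = 1" "\<And>x. x \<notin> L \<Longrightarrow> f x = 0"
    using bump_compact[OF open_img[OF M c] K] by metis
  have "Ck_tensor M \<infinity> 1 0 (chart_field M 1 0 c [l] [] f)" for l
    using f by (intro Ck_tensor_chart_field[OF M c]) (auto intro: Ck_on_subset)
  moreover have "comp_in c (chart_field M 1 0 c [l] [] f) [m] [] x = (if m = l then 1 else 0)" if "x \<in> U" for l m x
  proof -
    have "x \<in> img c" using that f by blast
    then show ?thesis using f(7)[OF that]
      by (simp add: comp_in_def chart_field_self[OF M c chart_inv_in] snd_chart_inv)
  qed
  ultimately show thesis using that[of U L "\<lambda>l. chart_field M 1 0 c [l] [] f"] f by blast
qed

lemma mod_nets_fixed: "Ck_tensor M \<infinity> r s t \<Longrightarrow> (\<lambda>\<epsilon>. t) \<in> mod_nets M r s"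
  by (rule mod_netsI[OF M]) (auto simp: Ck_tensor_def intro: modnet_fixed open_img[OF M])

lemma relatively_compact_open_chart:
  assumes c: "c \<in> atlas M" and U: "open U" "U \<subseteq> L" and L: "compact L" "L \<subseteq> img c"
  shows "relatively_compact_open (mtop M) (chart_inv c ` U)"
  unfolding relatively_compact_open_def
proof
  have "homeomorphic_map (subtopology (mtop M) (fst c)) (top_of_set (img c)) (snd c)"
    using chart[OF M c] by (simp add: is_chart_def)
  then have "continuous_map (subtopology (mtop M) (fst c)) (top_of_set (img c)) (snd c)"
    by (rule homeomorphic_imp_continuous_map)
  moreover have "openin (top_of_set (img c)) U" using U L by (auto simp: openin_open)
  ultimately have "openin (subtopology (mtop M) (fst c)) {p \<in> topspace (subtopology (mtop M) (fst c)). snd c p \<in> U}"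
    by (rule openin_continuous_map_preimage)
  then have "openin (mtop M) {p \<in> fst c. snd c p \<in> U}"
    unfolding chart_topspace[OF M c] using openin_trans_full openin_chart[OF M c] by blast
  moreover have "{p \<in> fst c. snd c p \<in> U} = chart_inv c ` U"
  proof (intro equalityI subsetI)
    fix p assume "p \<in> {p \<in> fst c. snd c p \<in> U}"
    then show "p \<in> chart_inv c ` U" using chart_inv_snd[OF M c, of p] by (metis (mono_tags) image_eqI mem_Collect_eq)
  next
    fix p assume "p \<in> chart_inv c ` U"
    then obtain x where x: "x \<in> U" "p = chart_inv c x" by blast
    then have "x \<in> img c" using U L by blast
    then show "p \<in> {p \<in> fst c. snd c p \<in> U}" using x chart_inv_in[of x c] snd_chart_inv[of x c] by simp
  qed
  ultimately show "openin (mtop M) (chart_inv c ` U)" by simp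
  have "mtop M closure_of (chart_inv c ` U) \<subseteq> chart_inv c ` L"
    using U(2) by (intro closure_of_minimal image_mono closedin_chart_inv[OF M c L])
  then show "compactin (mtop M) (mtop M closure_of chart_inv c ` U)"
    using compact_chart_inv[OF M c L] closed_compactin closedin_closure_of by metis
qed

section \<open>The generalized Levi-Civita connection in a chart\<close>

lemma gen_connection_gen:
  assumes "gen_levi_civita M gh Dh" "\<xi> \<in> gen_tensors M 1 0" "\<eta> \<in> gen_tensors M 1 0"
  shows "Dh \<xi> \<eta> \<in> gen_tensors M 1 0"
  using assms(1)[unfolded gen_levi_civita_def Let_def, THEN conjunct1] assms(2,3) by blast

lemma gen_connection_bracket:
  assumes "gen_levi_civita M gh Dh" "\<xi> \<in> gen_tensors M 1 0" "\<eta> \<in> gen_tensors M 1 0"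
  shows "glift2 M 1 0 (bracket M) \<xi> \<eta> = glift2 M 1 0 tsub (Dh \<xi> \<eta>) (Dh \<eta> \<xi>)"
  using assms(1)[unfolded gen_levi_civita_def Let_def, THEN conjunct2, THEN conjunct2, THEN conjunct2, THEN conjunct2, THEN conjunct2, THEN conjunct2, THEN conjunct1] assms(2,3) by blast

lemma gen_connection_metric:
  assumes "gen_levi_civita M gh Dh" "\<xi> \<in> gen_tensors M 1 0" "\<eta> \<in> gen_tensors M 1 0" "\<zeta> \<in> gen_tensors M 1 0"
  shows "glift2 M 0 0 (vaction M) \<xi> (glift3 M 0 0 (metric_app M) gh \<eta> \<zeta>) =
      glift2 M 0 0 tadd (glift3 M 0 0 (metric_app M) gh (Dh \<xi> \<eta>) \<zeta>) (glift3 M 0 0 (metric_app M) gh \<eta> (Dh \<xi> \<zeta>))"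
  using assms(1)[unfolded gen_levi_civita_def Let_def, THEN conjunct2, THEN conjunct2, THEN conjunct2, THEN conjunct2, THEN conjunct2, THEN conjunct2, THEN conjunct2] assms(2-4) by blast

text \<open>Both sides of an identity between classes are unions over representatives. One side is easily
  seen to contain a given net; membership in the other side then produces representatives.\<close>

lemma gen_torsion:
  assumes V: "gen_levi_civita M gh Dh" and "\<xi> \<in> gen_tensors M 1 0" "\<eta> \<in> gen_tensors M 1 0"
    and x: "x \<in> \<xi>" and y: "y \<in> \<eta>" and p: "p \<in> Dh \<xi> \<eta>" and p': "p' \<in> Dh \<eta> \<xi>" and c: "c \<in> atlas M"
  shows "negl_eq (img c)
    (\<lambda>\<epsilon> z. \<Sum>j\<in>UNIV. comp_in c (x \<epsilon>) [j] [] z * partial j (comp_in c (y \<epsilon>) [m] []) z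
                    - comp_in c (y \<epsilon>) [j] [] z * partial j (comp_in c (x \<epsilon>) [m] []) z)
    (\<lambda>\<epsilon> z. comp_in c (p \<epsilon>) [m] [] z - comp_in c (p' \<epsilon>) [m] [] z)"
proof -
  note D = gen_connection_gen[OF V assms(2,3)] gen_connection_gen[OF V assms(3,2)]
  note eq = gen_connection_bracket[OF V assms(2,3)]
  have "(\<lambda>\<epsilon>. tsub (p \<epsilon>) (p' \<epsilon>)) \<in> glift2 M 1 0 (bracket M) \<xi> \<eta>"
    unfolding eq using glift2_tsub[OF M D p p'] net_class_self[OF M] by simp
  then obtain x' y' where x': "x' \<in> \<xi>" and y': "y' \<in> \<eta>"
    and r: "((\<lambda>\<epsilon>. bracket M (x' \<epsilon>) (y' \<epsilon>)), (\<lambda>\<epsilon>. tsub (p \<epsilon>) (p' \<epsilon>))) \<in> net_rel M 1 0"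
    using glift2D[OF M] by blast
  note o = open_img[OF M c]
  have "negl_eq (img c) (\<lambda>\<epsilon>. comp_in c (bracket M (x' \<epsilon>) (y' \<epsilon>)) [m] []) (\<lambda>\<epsilon>. comp_in c (tsub (p \<epsilon>) (p' \<epsilon>)) [m] [])"
    using r c by (simp add: net_rel_iff[OF M])
  then have 1: "negl_eq (img c) 
    (\<lambda>\<epsilon> z. \<Sum>j\<in>UNIV. comp_in c (x' \<epsilon>) [j] [] z * partial j (comp_in c (y' \<epsilon>) [m] []) z
                    - comp_in c (y' \<epsilon>) [j] [] z * partial j (comp_in c (x' \<epsilon>) [m] []) z)
    (\<lambda>\<epsilon> z. comp_in c (p \<epsilon>) [m] [] z - comp_in c (p' \<epsilon>) [m] [] z)"
    by (rule negl_eq_cong[OF o]) (simp_all add: comp_in_bracket[OF M c] comp_in_tsub)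
  have 2: "negl_eq (img c)
    (\<lambda>\<epsilon> z. \<Sum>j\<in>UNIV. comp_in c (x \<epsilon>) [j] [] z * partial j (comp_in c (y \<epsilon>) [m] []) z
                    - comp_in c (y \<epsilon>) [j] [] z * partial j (comp_in c (x \<epsilon>) [m] []) z)
    (\<lambda>\<epsilon> z. \<Sum>j\<in>UNIV. comp_in c (x' \<epsilon>) [j] [] z * partial j (comp_in c (y' \<epsilon>) [m] []) z
                    - comp_in c (y' \<epsilon>) [j] [] z * partial j (comp_in c (x' \<epsilon>) [m] []) z)"
    by (intro negl_eq_sum negl_eq_diff negl_eq_mult negl_eq_partial o
        gen_negl_eq[OF M assms(2) x x' c] gen_negl_eq[OF M assms(3) y y' c])
  show ?thesis by (rule negl_eq_trans[OF o 2 1])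
qed

text \<open>A class operation contains the value at given representatives only if that value is a moderate
  net of tensor fields.\<close>

lemma metric_app_net:
  assumes g: "gh \<in> gen_tensors M 0 2" and e: "\<eta> \<in> gen_tensors M 1 0" and z: "\<zeta> \<in> gen_tensors M 1 0"
    and "u \<in> gh" "y \<in> \<eta>" "t \<in> \<zeta>"
  shows "(\<lambda>\<epsilon>. metric_app M (u \<epsilon>) (y \<epsilon>) (t \<epsilon>)) \<in> mod_nets M 0 0"
proof (rule mod_netsI[OF M])
  have m: "u \<in> mod_nets M 0 2" "y \<in> mod_nets M 1 0" "t \<in> mod_nets M 1 0"
    using assms gen_mod_nets[OF M] by blast+
  show "is_tensor M 0 0 (metric_app M (u \<epsilon>) (y \<epsilon>) (t \<epsilon>))" if "\<epsilon> \<in> {0<..1}" for \<epsilon>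
    using m that by (intro is_tensor_metric_app[OF M] mod_nets_is_tensor[OF M])
  fix c and I J :: "'n list" assume c: "c \<in> atlas M" and l: "length I = 0" "length J = 0"
  have IJ: "I = []" "J = []" using l by auto
  note o = open_img[OF M c]
  have "modnet (img c) (\<lambda>\<epsilon> x. \<Sum>i\<in>UNIV. \<Sum>j\<in>UNIV. comp_in c (u \<epsilon>) [] [i, j] x * comp_in c (y \<epsilon>) [i] [] x * comp_in c (t \<epsilon>) [j] [] x)"
    by (intro modnet_sum modnet_mult mod_nets_modnet[OF M m(1) c] mod_nets_modnet[OF M m(2) c] mod_nets_modnet[OF M m(3) c] o)
  then show "modnet (img c) (\<lambda>\<epsilon>. comp_in c (metric_app M (u \<epsilon>) (y \<epsilon>) (t \<epsilon>)) I J)"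
    unfolding IJ by (rule modnet_cong[OF o, rotated]) (simp add: comp_in_metric_app[OF M c])
qed

lemma gen_compat:
  assumes V: "gen_levi_civita M gh Dh" and g: "gh \<in> gen_tensors M 0 2"
    and xi: "\<xi> \<in> gen_tensors M 1 0" and eta: "\<eta> \<in> gen_tensors M 1 0" and zeta: "\<zeta> \<in> gen_tensors M 1 0"
    and u: "u \<in> gh" and x: "x \<in> \<xi>" and y: "y \<in> \<eta>" and t: "t \<in> \<zeta>"
    and p: "p \<in> Dh \<xi> \<eta>" and q: "q \<in> Dh \<xi> \<zeta>" and c: "c \<in> atlas M"
  shows "negl_eq (img c)
    (\<lambda>\<epsilon> z. \<Sum>i\<in>UNIV. comp_in c (x \<epsilon>) [i] [] z * partial i (\<lambda>z. \<Sum>j\<in>UNIV. \<Sum>k\<in>UNIV.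
       comp_in c (u \<epsilon>) [] [j, k] z * comp_in c (y \<epsilon>) [j] [] z * comp_in c (t \<epsilon>) [k] [] z) z)
    (\<lambda>\<epsilon> z. (\<Sum>j\<in>UNIV. \<Sum>k\<in>UNIV. comp_in c (u \<epsilon>) [] [j, k] z * comp_in c (p \<epsilon>) [j] [] z * comp_in c (t \<epsilon>) [k] [] z)
        + (\<Sum>j\<in>UNIV. \<Sum>k\<in>UNIV. comp_in c (u \<epsilon>) [] [j, k] z * comp_in c (y \<epsilon>) [j] [] z * comp_in c (q \<epsilon>) [k] [] z))"
proof -
  note o = open_img[OF M c]
  note D = gen_connection_gen[OF V xi eta] gen_connection_gen[OF V xi zeta]
  note eq = gen_connection_metric[OF V xi eta zeta]
  let ?R = "\<lambda>\<epsilon>. tadd (metric_app M (u \<epsilon>) (p \<epsilon>) (t \<epsilon>)) (metric_app M (u \<epsilon>) (y \<epsilon>) (q \<epsilon>))"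
  have m1: "(\<lambda>\<epsilon>. metric_app M (u \<epsilon>) (p \<epsilon>) (t \<epsilon>)) \<in> mod_nets M 0 0"
    by (rule metric_app_net[OF g D(1) zeta u p t])
  have m2: "(\<lambda>\<epsilon>. metric_app M (u \<epsilon>) (y \<epsilon>) (q \<epsilon>)) \<in> mod_nets M 0 0"
    by (rule metric_app_net[OF g eta D(2) u y q])
  have m: "?R \<in> mod_nets M 0 0"
  proof (rule mod_netsI[OF M])
    show "is_tensor M 0 0 (?R \<epsilon>)" if "\<epsilon> \<in> {0<..1}" for \<epsilon>
      by (rule is_tensor_tadd[OF M mod_nets_is_tensor[OF M m1 that] mod_nets_is_tensor[OF M m2 that]])
    show "modnet (img c) (cnet c ?R I J)" if "c \<in> atlas M" for c I J
      unfolding comp_in_tadd by (rule modnet_add[OF open_img[OF M that] mod_nets_modnet[OF M m1 that] mod_nets_modnet[OF M m2 that]])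
  qed
  have "?R \<in> glift2 M 0 0 (vaction M) \<xi> (glift3 M 0 0 (metric_app M) gh \<eta> \<zeta>)"
    unfolding eq
    using glift2_mem[OF M, where F = tadd, OF glift3_mem[OF M u p t, where F = "metric_app M", OF m1]
        glift3_mem[OF M u y q, where F = "metric_app M", OF m2] m] .
  then obtain x' f where x': "x' \<in> \<xi>" and f: "f \<in> glift3 M 0 0 (metric_app M) gh \<eta> \<zeta>"
    and r: "((\<lambda>\<epsilon>. vaction M (x' \<epsilon>) (f \<epsilon>)), ?R) \<in> net_rel M 0 0"
    using glift2D[OF M] by blast
  obtain u' y' t' where u': "u' \<in> gh" and y': "y' \<in> \<eta>" and t': "t' \<in> \<zeta>"
    and r': "((\<lambda>\<epsilon>. metric_app M (u' \<epsilon>) (y' \<epsilon>) (t' \<epsilon>)), f) \<in> net_rel M 0 0"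
    using glift3D[OF M f] by blast
  have "negl_eq (img c) (\<lambda>\<epsilon>. comp_in c (metric_app M (u' \<epsilon>) (y' \<epsilon>) (t' \<epsilon>)) [] []) (cnet c f [] [])"
    using r' c by (simp add: net_rel_iff[OF M])
  then have 1: "negl_eq (img c) (\<lambda>\<epsilon> z. \<Sum>j\<in>UNIV. \<Sum>k\<in>UNIV. comp_in c (u' \<epsilon>) [] [j, k] z * comp_in c (y' \<epsilon>) [j] [] z * comp_in c (t' \<epsilon>) [k] [] z) (cnet c f [] [])"
    by (rule negl_eq_cong[OF o]) (simp_all add: comp_in_metric_app[OF M c])
  have 2: "negl_eq (img c) (\<lambda>\<epsilon> z. \<Sum>j\<in>UNIV. \<Sum>k\<in>UNIV. comp_in c (u \<epsilon>) [] [j, k] z * comp_in c (y \<epsilon>) [j] [] z * comp_in c (t \<epsilon>) [k] [] z)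
     (\<lambda>\<epsilon> z. \<Sum>j\<in>UNIV. \<Sum>k\<in>UNIV. comp_in c (u' \<epsilon>) [] [j, k] z * comp_in c (y' \<epsilon>) [j] [] z * comp_in c (t' \<epsilon>) [k] [] z)"
    by (intro negl_eq_sum negl_eq_mult o gen_negl_eq[OF M g u u' c] gen_negl_eq[OF M eta y y' c] gen_negl_eq[OF M zeta t t' c])
  have 3: "negl_eq (img c)
    (\<lambda>\<epsilon> z. \<Sum>i\<in>UNIV. comp_in c (x \<epsilon>) [i] [] z * partial i (\<lambda>z. \<Sum>j\<in>UNIV. \<Sum>k\<in>UNIV.
       comp_in c (u \<epsilon>) [] [j, k] z * comp_in c (y \<epsilon>) [j] [] z * comp_in c (t \<epsilon>) [k] [] z) z)
    (\<lambda>\<epsilon> z. \<Sum>i\<in>UNIV. comp_in c (x' \<epsilon>) [i] [] z * partial i (comp_in c (f \<epsilon>) [] []) z)"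
    by (intro negl_eq_sum negl_eq_mult o gen_negl_eq[OF M xi x x' c] negl_eq_partial[OF o negl_eq_trans[OF o 2 1]])
  have "negl_eq (img c) (\<lambda>\<epsilon>. comp_in c (vaction M (x' \<epsilon>) (f \<epsilon>)) [] []) (cnet c ?R [] [])"
    using r c by (simp add: net_rel_iff[OF M])
  then have 4: "negl_eq (img c) (\<lambda>\<epsilon> z. \<Sum>i\<in>UNIV. comp_in c (x' \<epsilon>) [i] [] z * partial i (comp_in c (f \<epsilon>) [] []) z)
    (\<lambda>\<epsilon> z. (\<Sum>j\<in>UNIV. \<Sum>k\<in>UNIV. comp_in c (u \<epsilon>) [] [j, k] z * comp_in c (p \<epsilon>) [j] [] z * comp_in c (t \<epsilon>) [k] [] z)
        + (\<Sum>j\<in>UNIV. \<Sum>k\<in>UNIV. comp_in c (u \<epsilon>) [] [j, k] z * comp_in c (y \<epsilon>) [j] [] z * comp_in c (q \<epsilon>) [k] [] z))"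
    by (rule negl_eq_cong[OF o]) (simp_all add: comp_in_vaction[OF M c] comp_in_tadd comp_in_metric_app[OF M c])
  show ?thesis by (rule negl_eq_trans[OF o 3 4])
qed

end

text \<open>The Koszul formula with the defects in the form in which they arise from the axioms, that is,
  before the derivatives of products are expanded; \<open>e\<close> is the test field.\<close>

lemma koszul_test:
  fixes u :: "'n::finite \<Rightarrow> 'n \<Rightarrow> real^'n \<Rightarrow> real" and x y e :: "'n \<Rightarrow> real^'n \<Rightarrow> real"
  assumes U: "open U" "z \<in> U"
    and du: "\<And>i j. u i j differentiable (at z)" and dx: "\<And>i. x i differentiable (at z)"
    and dy: "\<And>i. y i differentiable (at z)"
    and sym: "\<And>i j w. w \<in> U \<Longrightarrow> u i j w = u j i w"
    and e: "\<And>k w. w \<in> U \<Longrightarrow> e k w = (if k = l then 1 else 0)"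
    and A1: "A1 = (\<Sum>i\<in>UNIV. x i z * partial i (\<lambda>w. \<Sum>j\<in>UNIV. \<Sum>k\<in>UNIV. u j k w * y j w * e k w) z)
       - ((\<Sum>j\<in>UNIV. \<Sum>k\<in>UNIV. u j k z * p j * e k z) + (\<Sum>j\<in>UNIV. \<Sum>k\<in>UNIV. u j k z * y j z * q k))"
    and A2: "A2 = (\<Sum>i\<in>UNIV. y i z * partial i (\<lambda>w. \<Sum>j\<in>UNIV. \<Sum>k\<in>UNIV. u j k w * e j w * x k w) z)
       - ((\<Sum>j\<in>UNIV. \<Sum>k\<in>UNIV. u j k z * r j * x k z) + (\<Sum>j\<in>UNIV. \<Sum>k\<in>UNIV. u j k z * e j z * p' k))"
    and A3: "A3 = (\<Sum>i\<in>UNIV. e i z * partial i (\<lambda>w. \<Sum>j\<in>UNIV. \<Sum>k\<in>UNIV. u j k w * x j w * y k w) z)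
       - ((\<Sum>j\<in>UNIV. \<Sum>k\<in>UNIV. u j k z * q' j * y k z) + (\<Sum>j\<in>UNIV. \<Sum>k\<in>UNIV. u j k z * x j z * r' k))"
    and T1: "\<And>m. T1 m = (\<Sum>j\<in>UNIV. x j z * partial j (y m) z - y j z * partial j (x m) z) - (p m - p' m)"
    and T2: "\<And>m. T2 m = (\<Sum>j\<in>UNIV. x j z * partial j (e m) z - e j z * partial j (x m) z) - (q m - q' m)"
    and T3: "\<And>m. T3 m = (\<Sum>j\<in>UNIV. y j z * partial j (e m) z - e j z * partial j (y m) z) - (r m - r' m)"
  shows "2 * (\<Sum>n\<in>UNIV. u n l z * (p n - (\<Sum>i\<in>UNIV. x i z * partial i (y n) z)))
      - (\<Sum>i\<in>UNIV. \<Sum>j\<in>UNIV. (partial i (u j l) z + partial j (u i l) z - partial l (u i j) z) * x i z * y j z)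
    = A3 - A1 - A2 - (\<Sum>n\<in>UNIV. u n l z * T1 n) + (\<Sum>i\<in>UNIV. \<Sum>j\<in>UNIV. u i j z * T2 i * y j z)
      + (\<Sum>i\<in>UNIV. \<Sum>j\<in>UNIV. u i j z * T3 i * x j z)"
proof (rule koszul_pointwise[where g = "\<lambda>i j. u i j z" and dg = "\<lambda>k i j. partial k (u i j) z" and x = "\<lambda>i. x i z"
      and y = "\<lambda>i. y i z" and dx = "\<lambda>i j. partial i (x j) z" and dy = "\<lambda>i j. partial i (y j) z"
      and p = p and p' = p' and q = q and q' = q' and r = r and r' = r'])
  show "u i j z = u j i z" for i j using sym[OF U(2)] .
  show "partial k (u i j) z = partial k (u j i) z" for k i j by (rule partial_cong[OF U]) (rule sym)
  have 1: "partial i (\<lambda>w. \<Sum>j\<in>UNIV. \<Sum>k\<in>UNIV. u j k w * y j w * e k w) z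
      = (\<Sum>j\<in>UNIV. partial i (u j l) z * y j z + u j l z * partial i (y j) z)" for i
  proof -
    have "partial i (\<lambda>w. \<Sum>j\<in>UNIV. \<Sum>k\<in>UNIV. u j k w * y j w * e k w) z = partial i (\<lambda>w. \<Sum>j\<in>UNIV. u j l w * y j w) z"
      by (rule partial_cong[OF U]) (simp add: e if_distrib cong: if_cong)
    also have "\<dots> = (\<Sum>j\<in>UNIV. partial i (\<lambda>w. u j l w * y j w) z)"
      by (intro partial_sum differentiable_mult du dy finite)
    finally show ?thesis by (simp add: partial_mult[OF du dy])
  qed
  have 2: "partial i (\<lambda>w. \<Sum>j\<in>UNIV. \<Sum>k\<in>UNIV. u j k w * e j w * x k w) z
      = (\<Sum>k\<in>UNIV. partial i (u l k) z * x k z + u l k z * partial i (x k) z)" for i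
  proof -
    have "partial i (\<lambda>w. \<Sum>j\<in>UNIV. \<Sum>k\<in>UNIV. u j k w * e j w * x k w) z = partial i (\<lambda>w. \<Sum>k\<in>UNIV. u l k w * x k w) z"
      by (rule partial_cong[OF U], subst sum.swap) (simp add: e if_distrib if_distribR cong: if_cong)
    also have "\<dots> = (\<Sum>k\<in>UNIV. partial i (\<lambda>w. u l k w * x k w) z)"
      by (intro partial_sum differentiable_mult du dx finite)
    finally show ?thesis by (simp add: partial_mult[OF du dx])
  qed
  have 3: "partial i (\<lambda>w. \<Sum>j\<in>UNIV. \<Sum>k\<in>UNIV. u j k w * x j w * y k w) z
      = (\<Sum>j\<in>UNIV. \<Sum>k\<in>UNIV. partial i (u j k) z * x j z * y k z + u j k z * partial i (x j) z * y k z + u j k z * x j z * partial i (y k) z)" for i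
  proof -
    have "partial i (\<lambda>w. \<Sum>j\<in>UNIV. \<Sum>k\<in>UNIV. u j k w * x j w * y k w) z = (\<Sum>j\<in>UNIV. partial i (\<lambda>w. \<Sum>k\<in>UNIV. u j k w * x j w * y k w) z)"
      by (intro partial_sum differentiable_sum differentiable_mult ballI du dx dy finite)
    also have "\<dots> = (\<Sum>j\<in>UNIV. \<Sum>k\<in>UNIV. partial i (\<lambda>w. u j k w * x j w * y k w) z)"
      by (intro sum.cong refl partial_sum differentiable_mult du dx dy finite)
    finally show ?thesis
      by (simp add: partial_mult[OF differentiable_mult[OF du dx] dy] partial_mult[OF du dx] distrib_right)
  qed
  have ez: "e k z = (if k = l then 1 else 0)" for k by (rule e[OF U(2)])
  have de: "partial i (e k) z = 0" for i k
  proof -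
    have "partial i (e k) z = partial i (\<lambda>w. if k = l then 1 else 0) z" by (rule partial_cong[OF U]) (rule e)
    then show ?thesis by (simp add: partial_const)
  qed
  show "A1 = (\<Sum>i\<in>UNIV. x i z * (\<Sum>j\<in>UNIV. partial i (u j l) z * y j z + u j l z * partial i (y j) z))
       - ((\<Sum>j\<in>UNIV. u j l z * p j) + (\<Sum>j\<in>UNIV. \<Sum>k\<in>UNIV. u j k z * y j z * q k))"
    unfolding A1 1 ez by (simp add: if_distrib cong: if_cong)
  show "A2 = (\<Sum>i\<in>UNIV. y i z * (\<Sum>k\<in>UNIV. partial i (u l k) z * x k z + u l k z * partial i (x k) z))
       - ((\<Sum>j\<in>UNIV. \<Sum>k\<in>UNIV. u j k z * r j * x k z) + (\<Sum>k\<in>UNIV. u l k z * p' k))"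
  proof -
    have "(\<Sum>j\<in>UNIV. \<Sum>k\<in>UNIV. u j k z * e j z * p' k) = (\<Sum>k\<in>UNIV. u l k z * p' k)"
      by (subst sum.swap) (simp add: ez if_distrib if_distribR cong: if_cong)
    then show ?thesis unfolding A2 2 by simp
  qed
  show "A3 = (\<Sum>i\<in>UNIV. \<Sum>j\<in>UNIV. partial l (u i j) z * x i z * y j z + u i j z * partial l (x i) z * y j z + u i j z * x i z * partial l (y j) z)
       - ((\<Sum>j\<in>UNIV. \<Sum>k\<in>UNIV. u j k z * q' j * y k z) + (\<Sum>j\<in>UNIV. \<Sum>k\<in>UNIV. u j k z * x j z * r' k))"
    unfolding A3 3 ez by (simp add: if_distrib if_distribR cong: if_cong)
  show "T1 m = (\<Sum>j\<in>UNIV. x j z * partial j (y m) z - y j z * partial j (x m) z) - (p m - p' m)" for m by (rule T1)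
  show "T2 m = - partial l (x m) z - (q m - q' m)" for m
    unfolding T2 de ez by (simp add: if_distrib if_distribR sum_negf cong: if_cong)
  show "T3 m = - partial l (y m) z - (r m - r' m)" for m
    unfolding T3 de ez by (simp add: if_distrib if_distribR sum_negf cong: if_cong)
qed

definition christoffel :: "('a, 'n::finite) chart \<Rightarrow> ('a, 'n) tfield \<Rightarrow> ('a, 'n) tfield \<Rightarrow> 'n \<Rightarrow> 'n \<Rightarrow> 'n \<Rightarrow> real^'n \<Rightarrow> real" where
  "christoffel c h g m i j = (\<lambda>x. christ (\<lambda>a b. comp_in c h [a, b] [] x) (\<lambda>k a b. partial k (comp_in c g [] [a, b]) x) m i j)"

text \<open>The component \<open>R\<^sub>a\<^sub>b\<^sub>e\<^sup>d\<close> for the sign convention \<open>R\<^sub>\<xi>\<^sub>,\<^sub>\<eta> = D\<^bsub>[\<xi>,\<eta>]\<^esub> - [D\<^sub>\<xi>, D\<^sub>\<eta>]\<close>; the bracket of coordinate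
  fields is zero.\<close>

definition riemann :: "('a, 'n::finite) chart \<Rightarrow> ('a, 'n) tfield \<Rightarrow> ('a, 'n) tfield \<Rightarrow> 'n \<Rightarrow> 'n \<Rightarrow> 'n \<Rightarrow> 'n \<Rightarrow> real^'n \<Rightarrow> real" where
  "riemann c h g d a b e = (\<lambda>x.
     (partial b (christoffel c h g d a e) x + (\<Sum>m\<in>UNIV. christoffel c h g d b m x * christoffel c h g m a e x))
   - (partial a (christoffel c h g d b e) x + (\<Sum>m\<in>UNIV. christoffel c h g d a m x * christoffel c h g m b e x)))"

context
  fixes M :: "('a, 'n::finite) mfd"
  assumes M: "smooth_manifold M"
begin

lemma gen_metric_symmetric_rep:
  assumes G: "gen_metric M gh" and c: "c \<in> atlas M" and U: "open U" "U \<subseteq> L" and L: "compact L" "L \<subseteq> img c"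
  obtains u where "u \<in> gh" "\<forall>\<^sub>F \<epsilon> in at_right 0. \<forall>x\<in>U. \<forall>i j. comp_in c (u \<epsilon>) [] [i, j] x = comp_in c (u \<epsilon>) [] [j, i] x"
proof -
  let ?V = "chart_inv c ` U"
  have "\<exists>u\<in>gh. \<exists>\<epsilon>0>0. \<forall>\<epsilon>. 0 < \<epsilon> \<and> \<epsilon> \<le> 1 \<and> \<epsilon> < \<epsilon>0 \<longrightarrow> pseudo_metric_on M ?V (u \<epsilon>)"
    using G[unfolded gen_metric_def, THEN conjunct2, THEN conjunct2, THEN conjunct1]
      relatively_compact_open_chart[OF M c U L] by blast
  then obtain u \<epsilon>0 where u: "u \<in> gh" "\<epsilon>0 > 0" "\<And>\<epsilon>. 0 < \<epsilon> \<and> \<epsilon> \<le> 1 \<and> \<epsilon> < \<epsilon>0 \<Longrightarrow> pseudo_metric_on M ?V (u \<epsilon>)"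
    by blast
  have "\<forall>\<^sub>F \<epsilon> in at_right 0. \<forall>x\<in>U. \<forall>i j. comp_in c (u \<epsilon>) [] [i, j] x = comp_in c (u \<epsilon>) [] [j, i] x"
    using eventually_small[OF u(2)]
  proof eventually_elim
    case (elim \<epsilon>)
    show ?case
    proof (intro ballI allI)
      fix x i j assume x: "x \<in> U"
      then have "x \<in> img c" using U L by blast
      then have "chart_inv c x \<in> fst c \<inter> ?V" using x chart_inv_in[of x c] by blast
      then show "comp_in c (u \<epsilon>) [] [i, j] x = comp_in c (u \<epsilon>) [] [j, i] x"
        using u(3)[OF elim] c unfolding pseudo_metric_on_def comp_in_def by blast
    qed
  qed
  with u(1) show thesis by (rule that)
qed

lemma gen_metric_gen: "gen_metric M gh \<Longrightarrow> gh \<in> gen_tensors M 0 2"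
  by (simp add: gen_metric_def)

text \<open>Exact symmetry is available for suitable representatives, on relatively compact sets and for small
  parameters. Any other representative differs from these by a negligible net.\<close>

lemma gen_metric_symmetric:
  assumes G: "gen_metric M gh" and c: "c \<in> atlas M" and u: "u \<in> gh"
  shows "negl_eq (img c) (cnet c u [] [i, j]) (cnet c u [] [j, i])"
proof (rule negl_eq_exhaust[OF _ _ open_img[OF M c]])
  note g = gen_metric_gen[OF G]
  show "modnet (img c) (cnet c u [] [i, j])" "modnet (img c) (cnet c u [] [j, i])"
    by (rule mod_nets_modnet[OF M gen_mod_nets[OF M g u] c])+
  fix K assume "compact K" "K \<subseteq> img c"
  then obtain f U L where UL: "open U" "K \<subseteq> U" "U \<subseteq> L" "compact L" "L \<subseteq> img c"
    using bump_compact[OF open_img[OF M c], of K] by metis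
  obtain u' where u': "u' \<in> gh" "\<forall>\<^sub>F \<epsilon> in at_right 0. \<forall>x\<in>U. \<forall>i j. comp_in c (u' \<epsilon>) [] [i, j] x = comp_in c (u' \<epsilon>) [] [j, i] x"
    by (rule gen_metric_symmetric_rep[OF G c UL(1,3,4,5)])
  have sub: "U \<subseteq> img c" using UL by blast
  have m: "modnet U (cnet c u' [] [a, b])" for a b
    by (rule modnet_subset[OF mod_nets_modnet[OF M gen_mod_nets[OF M g u'(1)] c] sub])
  have "sup_negl U (\<lambda>\<epsilon> x. cnet c u' [] [i, j] \<epsilon> x - cnet c u' [] [j, i] \<epsilon> x)"
    by (rule sup_negl_cong[OF _ sup_negl_zero]) (use u'(2) in \<open>auto elim!: eventually_mono\<close>)
  then have 2: "negl_eq U (cnet c u' [] [i, j]) (cnet c u' [] [j, i])"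
    unfolding negl_eq_def neglnet_def using m modnet_diff[OF UL(1) m m] by blast
  have 1: "negl_eq U (cnet c u [] [a, b]) (cnet c u' [] [a, b])" for a b
    by (rule negl_eq_subset[OF gen_negl_eq[OF M g u u'(1) c] sub])
  have "negl_eq U (cnet c u [] [i, j]) (cnet c u [] [j, i])"
    by (rule negl_eq_trans[OF UL(1) negl_eq_trans[OF UL(1) 1 2] negl_eq_sym[OF UL(1) 1]])
  then show "\<exists>U. K \<subseteq> U \<and> negl_eq U (cnet c u [] [i, j]) (cnet c u [] [j, i])" using UL by blast
qed

text \<open>The left-hand side of the Koszul formula is linear in the metric, so it changes by a negligible
  net if the representative \<open>u\<close> is replaced by one that is symmetric near a given compact set.
  For the latter all defects are negligible.\<close>

lemma gen_koszul:
  assumes V: "gen_levi_civita M gh Dh" and G: "gen_metric M gh"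
    and xi: "\<xi> \<in> gen_tensors M 1 0" and eta: "\<eta> \<in> gen_tensors M 1 0"
    and u: "u \<in> gh" and x: "x \<in> \<xi>" and y: "y \<in> \<eta>" and p: "p \<in> Dh \<xi> \<eta>" and c: "c \<in> atlas M"
  shows "neglnet (img c) (\<lambda>\<epsilon> z. 2 * (\<Sum>n\<in>UNIV. comp_in c (u \<epsilon>) [] [n, l] z * (comp_in c (p \<epsilon>) [n] [] z
        - (\<Sum>i\<in>UNIV. comp_in c (x \<epsilon>) [i] [] z * partial i (comp_in c (y \<epsilon>) [n] []) z)))
      - (\<Sum>i\<in>UNIV. \<Sum>j\<in>UNIV. (partial i (comp_in c (u \<epsilon>) [] [j, l]) z + partial j (comp_in c (u \<epsilon>) [] [i, l]) z
          - partial l (comp_in c (u \<epsilon>) [] [i, j]) z) * comp_in c (x \<epsilon>) [i] [] z * comp_in c (y \<epsilon>) [j] [] z))"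
    (is "neglnet _ (?k u)")
proof -
  note g = gen_metric_gen[OF G]
  note o = open_img[OF M c]
  have D: "Dh \<xi> \<eta> \<in> gen_tensors M 1 0" by (rule gen_connection_gen[OF M V xi eta])
  have eq: "negl_eq (img c) (?k u1) (?k u2)" if u1: "u1 \<in> gh" and u2: "u2 \<in> gh" for u1 u2
    by (intro negl_eq_diff negl_eq_add negl_eq_sum negl_eq_mult negl_eq_const negl_eq_partial o gen_negl_eq[OF M g u1 u2 c]
      gen_negl_eq[OF M xi x x c] gen_negl_eq[OF M eta y y c] gen_negl_eq[OF M D p p c])
  have "sup_negl (img c) (?k u)"
  proof (rule sup_negl_exhaust)
    fix K assume "compact K" "K \<subseteq> img c"
    then obtain e U L where UL: "open U" "K \<subseteq> U" "U \<subseteq> L" "compact L" "L \<subseteq> img c"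
      and et: "\<And>l. Ck_tensor M \<infinity> 1 0 (e l)"
      and e: "\<And>l m x. x \<in> U \<Longrightarrow> comp_in c (e l) [m] [] x = (if m = l then 1 else 0)"
      using test_fields[OF M c, of K] by metis
    have sub: "U \<subseteq> img c" using UL by blast
    obtain u' where u': "u' \<in> gh" and sym: "\<forall>\<^sub>F \<epsilon> in at_right 0. \<forall>x\<in>U. \<forall>i j. comp_in c (u' \<epsilon>) [] [i, j] x = comp_in c (u' \<epsilon>) [] [j, i] x"
      by (rule gen_metric_symmetric_rep[OF G c UL(1,3,4,5)])
    define t where "t = (\<lambda>\<epsilon>::real. e l)"
    define \<zeta> where "\<zeta> = net_class M 1 0 t"
    have tm: "t \<in> mod_nets M 1 0" unfolding t_def by (rule mod_nets_fixed[OF M et])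
    have zeta: "\<zeta> \<in> gen_tensors M 1 0" unfolding \<zeta>_def by (rule net_class_gen[OF M tm])
    have t: "t \<in> \<zeta>" unfolding \<zeta>_def by (rule net_class_self[OF M tm])
    note DD = gen_connection_gen[OF M V]
    obtain q where q: "q \<in> Dh \<xi> \<zeta>" using gen_nonempty[OF M DD[OF xi zeta]] by blast
    obtain q' where q': "q' \<in> Dh \<zeta> \<xi>" using gen_nonempty[OF M DD[OF zeta xi]] by blast
    obtain r where r: "r \<in> Dh \<eta> \<zeta>" using gen_nonempty[OF M DD[OF eta zeta]] by blast
    obtain r' where r': "r' \<in> Dh \<zeta> \<eta>" using gen_nonempty[OF M DD[OF zeta eta]] by blast
    obtain p' where p': "p' \<in> Dh \<eta> \<xi>" using gen_nonempty[OF M DD[OF eta xi]] by blast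
    have N: "neglnet U (\<lambda>\<epsilon> x. f \<epsilon> x - h \<epsilon> x)" if "negl_eq (img c) f h" for f h
      using negl_eq_subset[OF that sub] by (simp add: negl_eq_def)
    note n = N[OF gen_compat[OF M V g xi eta zeta u' x y t p q c]]
      N[OF gen_compat[OF M V g eta zeta xi u' y t x r p' c]]
      N[OF gen_compat[OF M V g zeta xi eta u' t x y q' r' c]]
      N[OF gen_torsion[OF M V xi eta x y p p' c]]
      N[OF gen_torsion[OF M V xi zeta x t q q' c]]
      N[OF gen_torsion[OF M V eta zeta y t r r' c]]
    define A1 where "A1 \<epsilon> z = (\<Sum>i\<in>UNIV. comp_in c (x \<epsilon>) [i] [] z * partial i (\<lambda>z. \<Sum>j\<in>UNIV. \<Sum>k\<in>UNIV.
         comp_in c (u' \<epsilon>) [] [j, k] z * comp_in c (y \<epsilon>) [j] [] z * comp_in c (t \<epsilon>) [k] [] z) z)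
      - ((\<Sum>j\<in>UNIV. \<Sum>k\<in>UNIV. comp_in c (u' \<epsilon>) [] [j, k] z * comp_in c (p \<epsilon>) [j] [] z * comp_in c (t \<epsilon>) [k] [] z)
        + (\<Sum>j\<in>UNIV. \<Sum>k\<in>UNIV. comp_in c (u' \<epsilon>) [] [j, k] z * comp_in c (y \<epsilon>) [j] [] z * comp_in c (q \<epsilon>) [k] [] z))" for \<epsilon> z
    define A2 where "A2 \<epsilon> z = (\<Sum>i\<in>UNIV. comp_in c (y \<epsilon>) [i] [] z * partial i (\<lambda>z. \<Sum>j\<in>UNIV. \<Sum>k\<in>UNIV.
         comp_in c (u' \<epsilon>) [] [j, k] z * comp_in c (t \<epsilon>) [j] [] z * comp_in c (x \<epsilon>) [k] [] z) z)
      - ((\<Sum>j\<in>UNIV. \<Sum>k\<in>UNIV. comp_in c (u' \<epsilon>) [] [j, k] z * comp_in c (r \<epsilon>) [j] [] z * comp_in c (x \<epsilon>) [k] [] z)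
        + (\<Sum>j\<in>UNIV. \<Sum>k\<in>UNIV. comp_in c (u' \<epsilon>) [] [j, k] z * comp_in c (t \<epsilon>) [j] [] z * comp_in c (p' \<epsilon>) [k] [] z))" for \<epsilon> z
    define A3 where "A3 \<epsilon> z = (\<Sum>i\<in>UNIV. comp_in c (t \<epsilon>) [i] [] z * partial i (\<lambda>z. \<Sum>j\<in>UNIV. \<Sum>k\<in>UNIV.
         comp_in c (u' \<epsilon>) [] [j, k] z * comp_in c (x \<epsilon>) [j] [] z * comp_in c (y \<epsilon>) [k] [] z) z)
      - ((\<Sum>j\<in>UNIV. \<Sum>k\<in>UNIV. comp_in c (u' \<epsilon>) [] [j, k] z * comp_in c (q' \<epsilon>) [j] [] z * comp_in c (y \<epsilon>) [k] [] z)
        + (\<Sum>j\<in>UNIV. \<Sum>k\<in>UNIV. comp_in c (u' \<epsilon>) [] [j, k] z * comp_in c (x \<epsilon>) [j] [] z * comp_in c (r' \<epsilon>) [k] [] z))" for \<epsilon> z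
    define T where "T v w a b m \<epsilon> z = (\<Sum>j\<in>UNIV. comp_in c (v \<epsilon>) [j] [] z * partial j (comp_in c (w \<epsilon>) [m] []) z
          - comp_in c (w \<epsilon>) [j] [] z * partial j (comp_in c (v \<epsilon>) [m] []) z)
        - (comp_in c (a \<epsilon>) [m] [] z - comp_in c (b \<epsilon>) [m] [] z)" for v w a b :: "('a, 'n) tnet" and m \<epsilon> z
    have nA: "neglnet U A1" "neglnet U A2" "neglnet U A3" using n(1-3) unfolding A1_def A2_def A3_def .
    have nT: "neglnet U (T x y p p' m)" "neglnet U (T x t q q' m)" "neglnet U (T y t r r' m)" for m
      using n(4-6) unfolding T_def .
    have mm: "modnet U (cnet c w I J)" if "w \<in> A" "A \<in> gen_tensors M r0 s0" for w A r0 s0 I J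
      by (rule modnet_subset[OF mod_nets_modnet[OF M gen_mod_nets[OF M that(2,1)] c] sub])
    note mu = mm[OF u' g] and mx = mm[OF x xi] and my = mm[OF y eta]
    have "neglnet U (\<lambda>\<epsilon> z. A3 \<epsilon> z - A1 \<epsilon> z - A2 \<epsilon> z - (\<Sum>n\<in>UNIV. comp_in c (u' \<epsilon>) [] [n, l] z * T x y p p' n \<epsilon> z)
      + (\<Sum>i\<in>UNIV. \<Sum>j\<in>UNIV. comp_in c (u' \<epsilon>) [] [i, j] z * T x t q q' i \<epsilon> z * comp_in c (y \<epsilon>) [j] [] z)
      + (\<Sum>i\<in>UNIV. \<Sum>j\<in>UNIV. comp_in c (u' \<epsilon>) [] [i, j] z * T y t r r' i \<epsilon> z * comp_in c (x \<epsilon>) [j] [] z))" (is "neglnet U ?E")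
      by (intro neglnet_add neglnet_diff neglnet_sum UL(1) nA neglnet_mult2[OF UL(1) mu nT(1)]
          neglnet_mult[OF UL(1) neglnet_mult2[OF UL(1) mu nT(2)] my] neglnet_mult[OF UL(1) neglnet_mult2[OF UL(1) mu nT(3)] mx])
    then have E: "sup_negl U ?E" by (rule neglnet_sup)
    have "\<forall>\<^sub>F \<epsilon> in at_right 0. \<forall>z\<in>U. ?E \<epsilon> z = ?k u' \<epsilon> z"
      using sym eventually_unit
    proof eventually_elim
      case (elim \<epsilon>)
      then have e1: "\<epsilon> \<in> {0<..1}" by simp
      show ?case
      proof
        fix z assume z: "z \<in> U"
        have d: "comp_in c (w \<epsilon>) I J differentiable (at z)" if "w \<in> A" "A \<in> gen_tensors M r0 s0" for w A r0 s0 I J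
          using mm[OF that] e1 z unfolding modnet_def smoothnet_def
          by (intro smooth_imp_differentiable[OF _ UL(1)]) auto
        show "?E \<epsilon> z = ?k u' \<epsilon> z"
        proof (rule koszul_test[OF UL(1) z, where u = "\<lambda>i j. comp_in c (u' \<epsilon>) [] [i, j]" and x = "\<lambda>i. comp_in c (x \<epsilon>) [i] []"
            and y = "\<lambda>i. comp_in c (y \<epsilon>) [i] []" and e = "\<lambda>i. comp_in c (t \<epsilon>) [i] []" and p = "\<lambda>i. comp_in c (p \<epsilon>) [i] [] z"
            and q = "\<lambda>i. comp_in c (q \<epsilon>) [i] [] z" and r = "\<lambda>i. comp_in c (r \<epsilon>) [i] [] z" and p' = "\<lambda>i. comp_in c (p' \<epsilon>) [i] [] z"
            and q' = "\<lambda>i. comp_in c (q' \<epsilon>) [i] [] z" and r' = "\<lambda>i. comp_in c (r' \<epsilon>) [i] [] z"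
            and ?A1.0 = "A1 \<epsilon> z" and ?A2.0 = "A2 \<epsilon> z" and ?A3.0 = "A3 \<epsilon> z"
            and ?T1.0 = "\<lambda>m. T x y p p' m \<epsilon> z" and ?T2.0 = "\<lambda>m. T x t q q' m \<epsilon> z" and ?T3.0 = "\<lambda>m. T y t r r' m \<epsilon> z", symmetric])
          show "comp_in c (u' \<epsilon>) [] [i, j] differentiable (at z)" for i j by (rule d[OF u' g])
          show "comp_in c (x \<epsilon>) [i] [] differentiable (at z)" for i by (rule d[OF x xi])
          show "comp_in c (y \<epsilon>) [i] [] differentiable (at z)" for i by (rule d[OF y eta])
          show "comp_in c (u' \<epsilon>) [] [i, j] w = comp_in c (u' \<epsilon>) [] [j, i] w" if "w \<in> U" for i j w
            using elim(1) that by blast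
          show "comp_in c (t \<epsilon>) [k] [] w = (if k = l then 1 else 0)" if "w \<in> U" for k w
            using e[OF that] by (simp add: t_def)
        qed (rule A1_def A2_def A3_def T_def)+
      qed
    qed
    then have s: "sup_negl U (?k u')" using E by (rule sup_negl_cong)
    have "sup_negl U (\<lambda>\<epsilon> z. (?k u \<epsilon> z - ?k u' \<epsilon> z) + ?k u' \<epsilon> z)"
      by (rule sup_negl_add[OF neglnet_sup[OF N[OF eq[OF u u']]] s])
    then have "sup_negl U (?k u)" by simp
    then show "\<exists>U. K \<subseteq> U \<and> sup_negl U (?k u)" using UL(2) by blast
  qed
  then show ?thesis using eq[OF u u] unfolding neglnet_def negl_eq_def by blast
qed

end

lemma sum_delta_left:
  fixes F :: "'n::finite \<Rightarrow> real"
  shows "(\<Sum>k\<in>UNIV. (if k = i then 1 else 0) * F k) = F i"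
proof -
  have "(\<Sum>k\<in>UNIV. (if k = i then 1 else 0) * F k) = (\<Sum>k\<in>UNIV. if k = i then F k else 0)"
    by (rule sum.cong) auto
  then show ?thesis by simp
qed

lemma sum_delta_right:
  fixes F :: "'n::finite \<Rightarrow> real"
  shows "(\<Sum>k\<in>UNIV. F k * (if k = i then 1 else 0)) = F i"
  using sum_delta_left[of i F] by (simp only: mult.commute)

lemma sum_delta_middle:
  fixes F G :: "'n::finite \<Rightarrow> real"
  shows "(\<Sum>k\<in>UNIV. F k * (if k = i then 1 else 0) * G k) = F i * G i"
  using sum_delta_left[of i "\<lambda>k. F k * G k"] by (simp only: mult.commute mult.left_commute mult.assoc)

lemma matrix_inv_mult:
  fixes A :: "real^'n^'n::finite"
  assumes "invertible A" shows "matrix_inv A ** A = mat 1" "A ** matrix_inv A = mat 1"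
  using someI_ex[OF assms[unfolded invertible_def]] unfolding matrix_inv_def by blast+

context
  fixes M :: "('a, 'n::finite) mfd"
  assumes M: "smooth_manifold M"
begin

lemma gen_inv_metric_gen: "gen_inv_metric M gh hh \<Longrightarrow> hh \<in> gen_tensors M 2 0"
  by (simp add: gen_inv_metric_def)

text \<open>The inverse matrices exist on each compact set for small parameters only, where they are close to
  \<open>v\<close>. The products of \<open>u\<close> and \<open>v\<close>, in contrast, are moderate nets on the whole chart, and whether
  they differ from the identity by a negligible net is decided on compact sets.\<close>

lemma gen_inverse_rep:
  assumes g: "gh \<in> gen_tensors M 0 2" and H: "gen_inv_metric M gh hh" and c: "c \<in> atlas M"
  obtains u v where "u \<in> gh" "v \<in> hh"
    "\<forall>m n. negl_eq (img c) (\<lambda>\<epsilon> x. \<Sum>l\<in>UNIV. comp_in c (v \<epsilon>) [m, l] [] x * comp_in c (u \<epsilon>) [] [l, n] x) (\<lambda>\<epsilon> x. if m = n then 1 else 0)"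
    "\<forall>m n. negl_eq (img c) (\<lambda>\<epsilon> x. \<Sum>l\<in>UNIV. comp_in c (u \<epsilon>) [] [m, l] x * comp_in c (v \<epsilon>) [l, n] [] x) (\<lambda>\<epsilon> x. if m = n then 1 else 0)"
proof -
  note h = gen_inv_metric_gen[OF H] and o = open_img[OF M c]
  obtain u v where u: "u \<in> gh" and v: "v \<in> hh"
    and *: "\<forall>c K. c \<in> atlas M \<and> compactin (mtop M) K \<and> K \<subseteq> fst c \<longrightarrow>
        (\<forall>m::nat. \<exists>C. \<forall>\<^sub>F \<epsilon> in at_right 0. \<forall>p\<in>K. invertible (gmat (u \<epsilon>) c p) \<and>
           (\<forall>i j. \<bar>v \<epsilon> c p [i, j] [] - matrix_inv (gmat (u \<epsilon>) c p) $ i $ j\<bar> \<le> C * \<epsilon> ^ m))"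
    using H unfolding gen_inv_metric_def by blast
  define iv where "iv \<epsilon> x = matrix_inv (gmat (u \<epsilon>) c (chart_inv c x))" for \<epsilon> x
  define w where "w i j \<epsilon> x = comp_in c (v \<epsilon>) [i, j] [] x - iv \<epsilon> x $ i $ j" for i j \<epsilon> x
  have mu: "modnet (img c) (cnet c u [] [a, b])" for a b by (rule mod_nets_modnet[OF M gen_mod_nets[OF M g u] c])
  have mv: "modnet (img c) (cnet c v [a, b] [])" for a b by (rule mod_nets_modnet[OF M gen_mod_nets[OF M h v] c])
  let ?L = "\<lambda>m n \<epsilon> x. \<Sum>l\<in>UNIV. comp_in c (v \<epsilon>) [m, l] [] x * comp_in c (u \<epsilon>) [] [l, n] x"
  let ?R = "\<lambda>m n \<epsilon> x. \<Sum>l\<in>UNIV. comp_in c (u \<epsilon>) [] [m, l] x * comp_in c (v \<epsilon>) [l, n] [] x"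
  let ?d = "\<lambda>m n. if m = n then 1 else (0::real)"
  have sup: "\<exists>U. K \<subseteq> U \<and> sup_negl U (\<lambda>\<epsilon> x. ?L m n \<epsilon> x - ?d m n)" "\<exists>U. K \<subseteq> U \<and> sup_negl U (\<lambda>\<epsilon> x. ?R m n \<epsilon> x - ?d m n)"
    if K: "compact K" "K \<subseteq> img c" for K m n
  proof -
    have KM: "compactin (mtop M) (chart_inv c ` K)" "chart_inv c ` K \<subseteq> fst c"
      using compact_chart_inv[OF M c] K chart_inv_in[of _ c] by auto
    note ** = *[rule_format, OF conjI[OF c conjI[OF KM]]]
    have w: "sup_negl K (w i j)" for i j
      unfolding sup_negl_def
    proof (intro allI impI)
      fix K' and k :: nat assume K': "compact K' \<and> K' \<subseteq> K"
      obtain C where "\<forall>\<^sub>F \<epsilon> in at_right 0. \<forall>p\<in>chart_inv c ` K. invertible (gmat (u \<epsilon>) c p) \<and>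
           (\<forall>i j. \<bar>v \<epsilon> c p [i, j] [] - matrix_inv (gmat (u \<epsilon>) c p) $ i $ j\<bar> \<le> C * \<epsilon> ^ k)"
        using **[of k] by blast
      then have "\<forall>\<^sub>F \<epsilon> in at_right 0. \<forall>x\<in>K'. \<bar>w i j \<epsilon> x\<bar> \<le> C * \<epsilon> ^ k"
        by eventually_elim (use K' in \<open>auto simp: w_def iv_def comp_in_def\<close>)
      then show "\<exists>C. \<forall>\<^sub>F \<epsilon> in at_right 0. \<forall>x\<in>K'. \<bar>w i j \<epsilon> x\<bar> \<le> C * \<epsilon> ^ k" by blast
    qed
    have s: "sup_negl K (\<lambda>\<epsilon> x. \<Sum>l\<in>UNIV. w m l \<epsilon> x * comp_in c (u \<epsilon>) [] [l, n] x)"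
      "sup_negl K (\<lambda>\<epsilon> x. \<Sum>l\<in>UNIV. w l n \<epsilon> x * comp_in c (u \<epsilon>) [] [m, l] x)"
      by (intro sup_negl_sum sup_negl_mult w sup_mod_subset[OF modnet_sup[OF mu] K(2)])+
    obtain C where "\<forall>\<^sub>F \<epsilon> in at_right 0. \<forall>p\<in>chart_inv c ` K. invertible (gmat (u \<epsilon>) c p) \<and>
         (\<forall>i j. \<bar>v \<epsilon> c p [i, j] [] - matrix_inv (gmat (u \<epsilon>) c p) $ i $ j\<bar> \<le> C * \<epsilon> ^ 0)"
      using **[of 0] by blast
    then have ev: "\<forall>\<^sub>F \<epsilon> in at_right 0. \<forall>x\<in>K. (\<Sum>l\<in>UNIV. w m l \<epsilon> x * comp_in c (u \<epsilon>) [] [l, n] x) = ?L m n \<epsilon> x - ?d m n \<and>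
      (\<Sum>l\<in>UNIV. w l n \<epsilon> x * comp_in c (u \<epsilon>) [] [m, l] x) = ?R m n \<epsilon> x - ?d m n"
    proof eventually_elim
      case (elim \<epsilon>)
      show ?case
      proof
        fix x assume "x \<in> K"
        then have "invertible (gmat (u \<epsilon>) c (chart_inv c x))" using elim by blast
        note I = matrix_inv_mult[OF this, folded iv_def]
        have "(iv \<epsilon> x ** gmat (u \<epsilon>) c (chart_inv c x)) $ m $ n = (mat 1 :: real^'n^'n) $ m $ n"
          "(gmat (u \<epsilon>) c (chart_inv c x) ** iv \<epsilon> x) $ m $ n = (mat 1 :: real^'n^'n) $ m $ n"
          unfolding I by simp_all
        then have "(\<Sum>l\<in>UNIV. iv \<epsilon> x $ m $ l * comp_in c (u \<epsilon>) [] [l, n] x) = ?d m n"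
          "(\<Sum>l\<in>UNIV. iv \<epsilon> x $ l $ n * comp_in c (u \<epsilon>) [] [m, l] x) = ?d m n"
          by (simp_all add: matrix_matrix_mult_def mat_def gmat_def comp_in_def mult.commute)
        then show "(\<Sum>l\<in>UNIV. w m l \<epsilon> x * comp_in c (u \<epsilon>) [] [l, n] x) = ?L m n \<epsilon> x - ?d m n \<and>
          (\<Sum>l\<in>UNIV. w l n \<epsilon> x * comp_in c (u \<epsilon>) [] [m, l] x) = ?R m n \<epsilon> x - ?d m n"
          unfolding w_def left_diff_distrib sum_subtractf by (simp add: mult.commute)
      qed
    qed
    have "sup_negl K (\<lambda>\<epsilon> x. ?L m n \<epsilon> x - ?d m n)"
      by (rule sup_negl_cong[OF _ s(1)]) (use ev in \<open>auto elim!: eventually_mono\<close>)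
    moreover have "sup_negl K (\<lambda>\<epsilon> x. ?R m n \<epsilon> x - ?d m n)"
      by (rule sup_negl_cong[OF _ s(2)]) (use ev in \<open>auto elim!: eventually_mono\<close>)
    ultimately show "\<exists>U. K \<subseteq> U \<and> sup_negl U (\<lambda>\<epsilon> x. ?L m n \<epsilon> x - ?d m n)" "\<exists>U. K \<subseteq> U \<and> sup_negl U (\<lambda>\<epsilon> x. ?R m n \<epsilon> x - ?d m n)"
      by blast+
  qed
  have mL: "modnet (img c) (?L m n)" and mR: "modnet (img c) (?R m n)" for m n
    by (intro modnet_sum modnet_mult o mu mv)+
  have "negl_eq (img c) (?L m n) (\<lambda>\<epsilon> x. ?d m n)" for m n
    unfolding negl_eq_def neglnet_def
    by (intro conjI mL modnet_diff[OF o mL modnet_const[OF o]] modnet_const[OF o] sup_negl_exhaust sup(1))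
  moreover have "negl_eq (img c) (?R m n) (\<lambda>\<epsilon> x. ?d m n)" for m n
    unfolding negl_eq_def neglnet_def
    by (intro conjI mR modnet_diff[OF o mR modnet_const[OF o]] modnet_const[OF o] sup_negl_exhaust sup(2))
  ultimately show thesis using that[OF u v] by blast
qed

lemma gen_inverse:
  assumes G: "gen_metric M gh" and H: "gen_inv_metric M gh hh" and c: "c \<in> atlas M" and u: "u \<in> gh" and v: "v \<in> hh"
  shows "negl_eq (img c) (\<lambda>\<epsilon> x. \<Sum>l\<in>UNIV. comp_in c (v \<epsilon>) [m, l] [] x * comp_in c (u \<epsilon>) [] [n, l] x)
      (\<lambda>\<epsilon> x. if n = m then 1 else 0)" (is ?L)
    and "negl_eq (img c) (\<lambda>\<epsilon> x. \<Sum>l\<in>UNIV. comp_in c (u \<epsilon>) [] [l, m] x * comp_in c (v \<epsilon>) [l, n] [] x)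
      (\<lambda>\<epsilon> x. if m = n then 1 else 0)" (is ?R)
proof -
  note g = gen_metric_gen[OF M G] and h = gen_inv_metric_gen[OF H] and o = open_img[OF M c]
  obtain u0 v0 where u0: "u0 \<in> gh" and v0: "v0 \<in> hh"
    and 1: "\<forall>m n. negl_eq (img c) (\<lambda>\<epsilon> x. \<Sum>l\<in>UNIV. comp_in c (v0 \<epsilon>) [m, l] [] x * comp_in c (u0 \<epsilon>) [] [l, n] x) (\<lambda>\<epsilon> x. if m = n then 1 else 0)"
    and 2: "\<forall>m n. negl_eq (img c) (\<lambda>\<epsilon> x. \<Sum>l\<in>UNIV. comp_in c (u0 \<epsilon>) [] [m, l] x * comp_in c (v0 \<epsilon>) [l, n] [] x) (\<lambda>\<epsilon> x. if m = n then 1 else 0)"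
    by (rule gen_inverse_rep[OF g H c])
  have s: "negl_eq (img c) (cnet c u [] [i, j]) (cnet c u0 [] [j, i])" for i j
    by (rule negl_eq_trans[OF o gen_metric_symmetric[OF M G c u, of i j] gen_negl_eq[OF M g u u0 c, of "[]" "[j, i]"]])
  have "negl_eq (img c) (\<lambda>\<epsilon> x. \<Sum>l\<in>UNIV. comp_in c (v \<epsilon>) [m, l] [] x * comp_in c (u \<epsilon>) [] [n, l] x)
    (\<lambda>\<epsilon> x. \<Sum>l\<in>UNIV. comp_in c (v0 \<epsilon>) [m, l] [] x * comp_in c (u0 \<epsilon>) [] [l, n] x)"
    by (intro negl_eq_sum negl_eq_mult o gen_negl_eq[OF M h v v0 c] s)
  from negl_eq_trans[OF o this 1[rule_format]] show ?L by (simp only: eq_commute[of m n])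
  have "negl_eq (img c) (\<lambda>\<epsilon> x. \<Sum>l\<in>UNIV. comp_in c (u \<epsilon>) [] [l, m] x * comp_in c (v \<epsilon>) [l, n] [] x)
    (\<lambda>\<epsilon> x. \<Sum>l\<in>UNIV. comp_in c (u0 \<epsilon>) [] [m, l] x * comp_in c (v0 \<epsilon>) [l, n] [] x)"
    by (intro negl_eq_sum negl_eq_mult o gen_negl_eq[OF M h v v0 c] s)
  from negl_eq_trans[OF o this 2[rule_format]] show ?R .
qed

lemma gen_christoffel_modnet:
  assumes "gh \<in> gen_tensors M 0 2" "hh \<in> gen_tensors M 2 0" "u \<in> gh" "v \<in> hh" and c: "c \<in> atlas M"
  shows "modnet (img c) (\<lambda>\<epsilon>. christoffel c (v \<epsilon>) (u \<epsilon>) m i j)"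
proof -
  note o = open_img[OF M c]
  have mu: "modnet (img c) (cnet c u [] J)" for J by (rule mod_nets_modnet[OF M gen_mod_nets[OF M assms(1,3)] c])
  have mv: "modnet (img c) (cnet c v I [])" for I by (rule mod_nets_modnet[OF M gen_mod_nets[OF M assms(2,4)] c])
  show ?thesis unfolding christoffel_def christ_def
    by (intro modnet_mult modnet_const modnet_sum modnet_add modnet_diff modnet_partial o mu mv)
qed

text \<open>The Koszul formula determines the connection after the index is raised with a representative of
  the inverse metric, which inverts the metric up to negligible nets.\<close>

lemma gen_connection:
  assumes V: "gen_levi_civita M gh Dh" and G: "gen_metric M gh" and H: "gen_inv_metric M gh hh"
    and xi: "\<xi> \<in> gen_tensors M 1 0" and eta: "\<eta> \<in> gen_tensors M 1 0"
    and u: "u \<in> gh" and v: "v \<in> hh" and x: "x \<in> \<xi>" and y: "y \<in> \<eta>" and p: "p \<in> Dh \<xi> \<eta>" and c: "c \<in> atlas M"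
  shows "negl_eq (img c) (cnet c p [m] [])
    (\<lambda>\<epsilon> z. (\<Sum>i\<in>UNIV. comp_in c (x \<epsilon>) [i] [] z * partial i (comp_in c (y \<epsilon>) [m] []) z) +
      (\<Sum>i\<in>UNIV. \<Sum>j\<in>UNIV. christoffel c (v \<epsilon>) (u \<epsilon>) m i j z * comp_in c (x \<epsilon>) [i] [] z * comp_in c (y \<epsilon>) [j] [] z))"
    (is "negl_eq _ _ ?f")
proof -
  note g = gen_metric_gen[OF M G] and h = gen_inv_metric_gen[OF H] and o = open_img[OF M c]
  have D: "Dh \<xi> \<eta> \<in> gen_tensors M 1 0" by (rule gen_connection_gen[OF M V xi eta])
  have mm: "modnet (img c) (cnet c w I J)" if "w \<in> A" "A \<in> gen_tensors M r s" for w A r s I J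
    by (rule mod_nets_modnet[OF M gen_mod_nets[OF M that(2,1)] c])
  note mu = mm[OF u g] and mx = mm[OF x xi] and my = mm[OF y eta] and mp = mm[OF p D] and mv = mm[OF v h]
  define X where "X n \<epsilon> z = (\<Sum>i\<in>UNIV. comp_in c (x \<epsilon>) [i] [] z * partial i (comp_in c (y \<epsilon>) [n] []) z)" for n \<epsilon> z
  define K where "K l \<epsilon> z = 2 * (\<Sum>n\<in>UNIV. comp_in c (u \<epsilon>) [] [n, l] z * (comp_in c (p \<epsilon>) [n] [] z - X n \<epsilon> z))
      - (\<Sum>i\<in>UNIV. \<Sum>j\<in>UNIV. (partial i (comp_in c (u \<epsilon>) [] [j, l]) z + partial j (comp_in c (u \<epsilon>) [] [i, l]) z
          - partial l (comp_in c (u \<epsilon>) [] [i, j]) z) * comp_in c (x \<epsilon>) [i] [] z * comp_in c (y \<epsilon>) [j] [] z)" for l \<epsilon> z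
  have K: "neglnet (img c) (K l)" for l
    using gen_koszul[OF M V G xi eta u x y p c] unfolding K_def X_def .
  have mX: "modnet (img c) (X n)" for n
    unfolding X_def by (intro modnet_sum modnet_mult modnet_partial o mx my)
  define d where "d n \<epsilon> z = (\<Sum>l\<in>UNIV. comp_in c (v \<epsilon>) [m, l] [] z * comp_in c (u \<epsilon>) [] [n, l] z) - (if n = m then 1 else 0)" for n \<epsilon> z
  have d: "neglnet (img c) (d n)" for n
    using gen_inverse(1)[OF G H c u v, of m n] unfolding negl_eq_def d_def by blast
  have "neglnet (img c) (\<lambda>\<epsilon> z. 1 / 2 * (\<Sum>l\<in>UNIV. comp_in c (v \<epsilon>) [m, l] [] z * K l \<epsilon> z)
      - (\<Sum>n\<in>UNIV. d n \<epsilon> z * (comp_in c (p \<epsilon>) [n] [] z - X n \<epsilon> z)))"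
    by (intro neglnet_diff neglnet_mult2[OF o modnet_const[OF o]] neglnet_sum neglnet_mult2[OF o mv K]
      neglnet_mult[OF o d] modnet_diff o mp mX)
  then have "neglnet (img c) (\<lambda>\<epsilon> z. comp_in c (p \<epsilon>) [m] [] z - ?f \<epsilon> z)"
  proof (rule neglnet_cong[OF o, rotated])
    fix \<epsilon> z
    show "1 / 2 * (\<Sum>l\<in>UNIV. comp_in c (v \<epsilon>) [m, l] [] z * K l \<epsilon> z)
      - (\<Sum>n\<in>UNIV. d n \<epsilon> z * (comp_in c (p \<epsilon>) [n] [] z - X n \<epsilon> z)) = comp_in c (p \<epsilon>) [m] [] z - ?f \<epsilon> z"
      unfolding d_def christoffel_def X_def[of m, symmetric]
      by (rule connection_pointwise[symmetric]) (simp add: K_def)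
  qed
  moreover have "modnet (img c) ?f"
    by (intro modnet_add modnet_sum modnet_mult modnet_partial o mx my gen_christoffel_modnet[OF g h u v c])
  ultimately show ?thesis using mp by (simp add: negl_eq_def)
qed

text \<open>On an open subset of the chart the vector fields may be replaced by nets that agree with them up
  to negligible nets there; in this form the formula can be applied to coordinate fields and
  iterated.\<close>

lemma gen_connection_congruence:
  assumes V: "gen_levi_civita M gh Dh" and G: "gen_metric M gh" and H: "gen_inv_metric M gh hh"
    and xi: "\<xi> \<in> gen_tensors M 1 0" and eta: "\<eta> \<in> gen_tensors M 1 0"
    and u: "u \<in> gh" and v: "v \<in> hh" and x: "x \<in> \<xi>" and y: "y \<in> \<eta>" and p: "p \<in> Dh \<xi> \<eta>" and c: "c \<in> atlas M"
    and U: "open U" "U \<subseteq> img c" and x': "\<And>i. negl_eq U (cnet c x [i] []) (x' i)" and y': "\<And>i. negl_eq U (cnet c y [i] []) (y' i)"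
  shows "negl_eq U (cnet c p [m] [])
    (\<lambda>\<epsilon> z. (\<Sum>i\<in>UNIV. x' i \<epsilon> z * partial i (y' m \<epsilon>) z) +
      (\<Sum>i\<in>UNIV. \<Sum>j\<in>UNIV. christoffel c (v \<epsilon>) (u \<epsilon>) m i j z * x' i \<epsilon> z * y' j \<epsilon> z))"
proof -
  have m: "negl_eq U (\<lambda>\<epsilon>. christoffel c (v \<epsilon>) (u \<epsilon>) m i j) (\<lambda>\<epsilon>. christoffel c (v \<epsilon>) (u \<epsilon>) m i j)" for i j
    by (rule negl_eq_refl[OF U(1) modnet_subset[OF gen_christoffel_modnet[OF gen_metric_gen[OF M G] gen_inv_metric_gen[OF H] u v c] U(2)]])
  show ?thesis
    by (rule negl_eq_trans[OF U(1) negl_eq_subset[OF gen_connection[OF V G H xi eta u v x y p c] U(2)]])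
      (intro negl_eq_add negl_eq_sum negl_eq_mult negl_eq_partial U(1) x' y' m)
qed

lemma gen_curvature_tensorD:
  assumes "gen_curvature_tensor M Dh Rh"
  shows "Rh \<in> gen_tensors M 1 3"
    "\<xi> \<in> gen_tensors M 1 0 \<Longrightarrow> \<eta> \<in> gen_tensors M 1 0 \<Longrightarrow> \<zeta> \<in> gen_tensors M 1 0 \<Longrightarrow> gcurv_app M Rh \<xi> \<eta> \<zeta> =
          glift2 M 1 0 tsub (Dh (glift2 M 1 0 (bracket M) \<xi> \<eta>) \<zeta>)
            (glift2 M 1 0 tsub (Dh \<xi> (Dh \<eta> \<zeta>)) (Dh \<eta> (Dh \<xi> \<zeta>)))"
  using assms unfolding gen_curvature_tensor_def by blast+

lemma gcurv_appD:
  "w \<in> gcurv_app M A X Y Z \<Longrightarrow> \<exists>R\<in>A. \<exists>\<xi>\<in>X. \<exists>\<eta>\<in>Y. \<exists>\<zeta>\<in>Z.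
     ((\<lambda>\<epsilon>. curv_app M (R \<epsilon>) (\<xi> \<epsilon>) (\<eta> \<epsilon>) (\<zeta> \<epsilon>)), w) \<in> net_rel M 1 0"
  unfolding gcurv_app_def UN_iff by (elim bexE, intro bexI, rule net_classD[OF M])

text \<open>The curvature identity is evaluated on test fields. Near the compact set their bracket vanishes,
  and the iterated covariant derivatives are computed from \<open>gen_connection_congruence\<close>.\<close>

lemma gen_curvature:
  assumes V: "gen_levi_civita M gh Dh" and G: "gen_metric M gh" and H: "gen_inv_metric M gh hh"
    and R: "gen_curvature_tensor M Dh Rh" and u: "u \<in> gh" and v: "v \<in> hh" and rho: "\<rho> \<in> Rh" and c: "c \<in> atlas M"
  shows "negl_eq (img c) (cnet c \<rho> [d] [a, b, e]) (\<lambda>\<epsilon>. riemann c (v \<epsilon>) (u \<epsilon>) d a b e)"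
proof (rule negl_eq_exhaust[OF _ _ open_img[OF M c]])
  note g = gen_metric_gen[OF M G] and h = gen_inv_metric_gen[OF H] and Rg = gen_curvature_tensorD(1)[OF R]
  let ?G = "\<lambda>m i j \<epsilon>. christoffel c (v \<epsilon>) (u \<epsilon>) m i j"
  have mG: "modnet (img c) (?G m i j)" for m i j by (rule gen_christoffel_modnet[OF g h u v c])
  show "modnet (img c) (cnet c \<rho> [d] [a, b, e])" by (rule mod_nets_modnet[OF M gen_mod_nets[OF M Rg rho] c])
  show "modnet (img c) (\<lambda>\<epsilon>. riemann c (v \<epsilon>) (u \<epsilon>) d a b e)"
    unfolding riemann_def by (intro modnet_diff modnet_add modnet_sum modnet_mult modnet_partial open_img[OF M c] mG)
  fix K assume "compact K" "K \<subseteq> img c"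
  then obtain f U L where UL: "open U" "K \<subseteq> U" "U \<subseteq> L" "compact L" "L \<subseteq> img c"
      and ft: "\<And>l. Ck_tensor M \<infinity> 1 0 (f l)"
      and f: "\<And>l m x. x \<in> U \<Longrightarrow> comp_in c (f l) [m] [] x = (if m = l then 1 else 0)"
    using test_fields[OF M c, of K] by metis
  have sub: "U \<subseteq> img c" using UL by blast
  define t where "t l = (\<lambda>\<epsilon>::real. f l)" for l
  define E where "E l = net_class M 1 0 (t l)" for l
  have tm: "t l \<in> mod_nets M 1 0" for l unfolding t_def by (rule mod_nets_fixed[OF M ft])
  have E: "E l \<in> gen_tensors M 1 0" for l unfolding E_def by (rule net_class_gen[OF M tm])
  have t: "t l \<in> E l" for l unfolding E_def by (rule net_class_self[OF M tm])
  have tU: "negl_eq U (cnet c (t l) [i] []) (\<lambda>\<epsilon> z. if i = l then 1 else 0)" for l i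
    by (rule negl_eqI[OF UL(1) modnet_subset[OF mod_nets_modnet[OF M tm c] sub]]) (simp add: t_def f)
  have eU: "negl_eq U (cnet c w [i] []) (\<lambda>\<epsilon> z. if i = l then 1 else 0)" if "w \<in> E l" for w l i
    by (rule negl_eq_trans[OF UL(1) negl_eq_subset[OF gen_negl_eq[OF M E that t c] sub] tU])
  have mGU: "modnet U (?G m i j)" for m i j by (rule modnet_subset[OF mG sub])
  note DD = gen_connection_gen[OF M V]
  have D2: "\<exists>w. w \<in> Dh (E i) (E j)" for i j using gen_nonempty[OF M DD[OF E E]] .
  define W where "W i j = (SOME w. w \<in> Dh (E i) (E j))" for i j
  have W: "W i j \<in> Dh (E i) (E j)" for i j unfolding W_def by (rule someI_ex[OF D2])
  have WU: "negl_eq U (cnet c (W i j) [m] []) (?G m i j)" for i j m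
  proof -
    have "negl_eq U (cnet c (W i j) [m] []) (\<lambda>\<epsilon> z. (\<Sum>k\<in>UNIV. (if k = i then 1 else 0) * partial k (\<lambda>z. if m = j then 1 else 0) z) +
      (\<Sum>k\<in>UNIV. \<Sum>l\<in>UNIV. ?G m k l \<epsilon> z * (if k = i then 1 else 0) * (if l = j then 1 else 0)))"
      by (rule gen_connection_congruence[OF V G H E E u v t t W c UL(1) sub tU tU])
    moreover have "(\<Sum>k\<in>UNIV. \<Sum>l\<in>UNIV. ?G m k l \<epsilon> z * (if k = i then 1 else 0) * (if l = j then 1 else 0)) = ?G m i j \<epsilon> z" for \<epsilon> z
      unfolding sum_delta_right ..
    ultimately show ?thesis
      by (simp only: partial_const mult_zero_right sum.neutral_const add_0_left)
  qed
  have D3: "\<exists>w. w \<in> Dh (E i) (Dh (E j) (E l))" for i j l using gen_nonempty[OF M DD[OF E DD[OF E E]]] .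
  define Z where "Z i j l = (SOME w. w \<in> Dh (E i) (Dh (E j) (E l)))" for i j l
  have Z: "Z i j l \<in> Dh (E i) (Dh (E j) (E l))" for i j l unfolding Z_def by (rule someI_ex[OF D3])
  have ZU: "negl_eq U (cnet c (Z i j l) [d] []) (\<lambda>\<epsilon> z. partial i (?G d j l \<epsilon>) z + (\<Sum>m\<in>UNIV. ?G d i m \<epsilon> z * ?G m j l \<epsilon> z))" for i j l
  proof -
    have "negl_eq U (cnet c (Z i j l) [d] []) (\<lambda>\<epsilon> z. (\<Sum>k\<in>UNIV. (if k = i then 1 else 0) * partial k (?G d j l \<epsilon>) z) +
      (\<Sum>k\<in>UNIV. \<Sum>m\<in>UNIV. ?G d k m \<epsilon> z * (if k = i then 1 else 0) * ?G m j l \<epsilon> z))"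
      by (rule gen_connection_congruence[OF V G H E DD[OF E E] u v t W Z c UL(1) sub tU WU])
    moreover have "(\<Sum>k\<in>UNIV. \<Sum>m\<in>UNIV. ?G d k m \<epsilon> z * (if k = i then 1 else 0) * ?G m j l \<epsilon> z) = (\<Sum>m\<in>UNIV. ?G d i m \<epsilon> z * ?G m j l \<epsilon> z)" for \<epsilon> z
      by (subst sum.swap) (simp only: sum_delta_middle)
    ultimately show ?thesis by (simp only: sum_delta_left)
  qed
  define B where "B = glift2 M 1 0 (bracket M) (E a) (E b)"
  have Bg: "B \<in> gen_tensors M 1 0"
    unfolding B_def gen_connection_bracket[OF M V E E] by (rule glift2_tsub_gen[OF M DD[OF E E] DD[OF E E]])
  obtain \<beta> where beta: "\<beta> \<in> B" using gen_nonempty[OF M Bg] by blast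
  have bU: "negl_eq U (cnet c \<beta> [m] []) (\<lambda>\<epsilon> z. 0)" for m
  proof -
    obtain x' y' where x': "x' \<in> E a" and y': "y' \<in> E b" and r: "((\<lambda>\<epsilon>. bracket M (x' \<epsilon>) (y' \<epsilon>)), \<beta>) \<in> net_rel M 1 0"
      using glift2D[OF M beta[unfolded B_def]] by blast
    have "negl_eq U (\<lambda>\<epsilon>. comp_in c (bracket M (x' \<epsilon>) (y' \<epsilon>)) [m] []) (cnet c \<beta> [m] [])"
      by (rule negl_eq_subset[OF _ sub]) (use r c in \<open>simp add: net_rel_iff[OF M]\<close>)
    then have 1: "negl_eq U (\<lambda>\<epsilon> z. \<Sum>j\<in>UNIV. comp_in c (x' \<epsilon>) [j] [] z * partial j (comp_in c (y' \<epsilon>) [m] []) z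
                    - comp_in c (y' \<epsilon>) [j] [] z * partial j (comp_in c (x' \<epsilon>) [m] []) z) (cnet c \<beta> [m] [])"
      by (rule negl_eq_cong[OF UL(1)]) (use sub in \<open>auto simp: comp_in_bracket[OF M c]\<close>)
    have "negl_eq U (\<lambda>\<epsilon> z. \<Sum>j\<in>UNIV. comp_in c (x' \<epsilon>) [j] [] z * partial j (comp_in c (y' \<epsilon>) [m] []) z
                    - comp_in c (y' \<epsilon>) [j] [] z * partial j (comp_in c (x' \<epsilon>) [m] []) z)
       (\<lambda>\<epsilon> z. \<Sum>j\<in>UNIV. (if j = a then 1 else 0) * partial j (\<lambda>z. if m = b then 1 else 0) z
                    - (if j = b then 1 else 0) * partial j (\<lambda>z. if m = a then 1 else 0) z)"
      by (intro negl_eq_sum negl_eq_diff negl_eq_mult negl_eq_partial UL(1) eU x' y')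
    then have "negl_eq U (\<lambda>\<epsilon> z. \<Sum>j\<in>UNIV. comp_in c (x' \<epsilon>) [j] [] z * partial j (comp_in c (y' \<epsilon>) [m] []) z
                    - comp_in c (y' \<epsilon>) [j] [] z * partial j (comp_in c (x' \<epsilon>) [m] []) z) (\<lambda>\<epsilon> z. 0)"
      by (simp add: partial_const)
    then show ?thesis by (rule negl_eq_trans[OF UL(1) negl_eq_sym[OF UL(1) 1]])
  qed
  obtain \<omega> where w: "\<omega> \<in> Dh B (E e)" using gen_nonempty[OF M DD[OF Bg E]] by blast
  have wU: "negl_eq U (cnet c \<omega> [d] []) (\<lambda>\<epsilon> z. 0)"
    using gen_connection_congruence[OF V G H Bg E u v beta t w c UL(1) sub bU tU, of d] by simp
  let ?S = "\<lambda>\<epsilon>. tsub (\<omega> \<epsilon>) (tsub (Z a b e \<epsilon>) (Z b a e \<epsilon>))"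
  note Dg = DD[OF E DD[OF E E]]
  have in2: "(\<lambda>\<epsilon>. tsub (Z a b e \<epsilon>) (Z b a e \<epsilon>)) \<in> glift2 M 1 0 tsub (Dh (E a) (Dh (E b) (E e))) (Dh (E b) (Dh (E a) (E e)))"
    using glift2_tsub[OF M Dg Dg Z Z, of a b e b a e] net_class_self[OF M] by simp
  have "?S \<in> gcurv_app M Rh (E a) (E b) (E e)"
    unfolding gen_curvature_tensorD(2)[OF R E E E] B_def[symmetric]
    using glift2_tsub[OF M DD[OF Bg E] glift2_tsub_gen[OF M Dg Dg] w in2] net_class_self[OF M] by simp
  then obtain \<rho>' x' y' z' where rho': "\<rho>' \<in> Rh" and x': "x' \<in> E a" and y': "y' \<in> E b" and z': "z' \<in> E e"
    and r: "((\<lambda>\<epsilon>. curv_app M (\<rho>' \<epsilon>) (x' \<epsilon>) (y' \<epsilon>) (z' \<epsilon>)), ?S) \<in> net_rel M 1 0"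
    using gcurv_appD by blast
  have "negl_eq U (\<lambda>\<epsilon>. comp_in c (curv_app M (\<rho>' \<epsilon>) (x' \<epsilon>) (y' \<epsilon>) (z' \<epsilon>)) [d] []) (cnet c ?S [d] [])"
    by (rule negl_eq_subset[OF _ sub]) (use r c in \<open>simp add: net_rel_iff[OF M]\<close>)
  then have 1: "negl_eq U (\<lambda>\<epsilon> z. \<Sum>i\<in>UNIV. \<Sum>j\<in>UNIV. \<Sum>k\<in>UNIV. comp_in c (\<rho>' \<epsilon>) [d] [i, j, k] z * comp_in c (x' \<epsilon>) [i] [] z * comp_in c (y' \<epsilon>) [j] [] z * comp_in c (z' \<epsilon>) [k] [] z)
     (\<lambda>\<epsilon> z. comp_in c (\<omega> \<epsilon>) [d] [] z - (comp_in c (Z a b e \<epsilon>) [d] [] z - comp_in c (Z b a e \<epsilon>) [d] [] z))"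
    by (rule negl_eq_cong[OF UL(1)]) (use sub in \<open>auto simp: comp_in_curv_app[OF M c] comp_in_tsub\<close>)
  have "negl_eq U (\<lambda>\<epsilon> z. \<Sum>i\<in>UNIV. \<Sum>j\<in>UNIV. \<Sum>k\<in>UNIV. comp_in c (\<rho>' \<epsilon>) [d] [i, j, k] z * comp_in c (x' \<epsilon>) [i] [] z * comp_in c (y' \<epsilon>) [j] [] z * comp_in c (z' \<epsilon>) [k] [] z)
     (\<lambda>\<epsilon> z. \<Sum>i\<in>UNIV. \<Sum>j\<in>UNIV. \<Sum>k\<in>UNIV. comp_in c (\<rho> \<epsilon>) [d] [i, j, k] z * (if i = a then 1 else 0) * (if j = b then 1 else 0) * (if k = e then 1 else 0))"
    by (intro negl_eq_sum negl_eq_mult UL(1) eU x' y' z' negl_eq_subset[OF gen_negl_eq[OF M Rg rho' rho c] sub])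
  moreover have "(\<Sum>i\<in>UNIV. \<Sum>j\<in>UNIV. \<Sum>k\<in>UNIV. comp_in c (\<rho> \<epsilon>) [d] [i, j, k] z * (if i = a then 1 else 0) * (if j = b then 1 else 0) * (if k = e then 1 else 0))
      = comp_in c (\<rho> \<epsilon>) [d] [a, b, e] z" for \<epsilon> z
    unfolding sum_delta_right ..
  ultimately have 2: "negl_eq U (\<lambda>\<epsilon> z. \<Sum>i\<in>UNIV. \<Sum>j\<in>UNIV. \<Sum>k\<in>UNIV. comp_in c (\<rho>' \<epsilon>) [d] [i, j, k] z * comp_in c (x' \<epsilon>) [i] [] z * comp_in c (y' \<epsilon>) [j] [] z * comp_in c (z' \<epsilon>) [k] [] z)
     (cnet c \<rho> [d] [a, b, e])" by simp
  have "negl_eq U (\<lambda>\<epsilon> z. comp_in c (\<omega> \<epsilon>) [d] [] z - (comp_in c (Z a b e \<epsilon>) [d] [] z - comp_in c (Z b a e \<epsilon>) [d] [] z))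
    (\<lambda>\<epsilon> z. 0 - ((partial a (?G d b e \<epsilon>) z + (\<Sum>m\<in>UNIV. ?G d a m \<epsilon> z * ?G m b e \<epsilon> z))
       - (partial b (?G d a e \<epsilon>) z + (\<Sum>m\<in>UNIV. ?G d b m \<epsilon> z * ?G m a e \<epsilon> z))))"
    by (intro negl_eq_diff UL(1) wU ZU)
  then have 3: "negl_eq U (\<lambda>\<epsilon> z. comp_in c (\<omega> \<epsilon>) [d] [] z - (comp_in c (Z a b e \<epsilon>) [d] [] z - comp_in c (Z b a e \<epsilon>) [d] [] z))
    (\<lambda>\<epsilon>. riemann c (v \<epsilon>) (u \<epsilon>) d a b e)"
    by (simp add: riemann_def)
  have "negl_eq U (cnet c \<rho> [d] [a, b, e]) (\<lambda>\<epsilon>. riemann c (v \<epsilon>) (u \<epsilon>) d a b e)"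
    by (rule negl_eq_trans[OF UL(1) negl_eq_sym[OF UL(1) 2] negl_eq_trans[OF UL(1) 1 3]])
  then show "\<exists>U. K \<subseteq> U \<and> negl_eq U (cnet c \<rho> [d] [a, b, e]) (\<lambda>\<epsilon>. riemann c (v \<epsilon>) (u \<epsilon>) d a b e)"
    using UL(2) by blast
qed

end

section \<open>Convergence of the inverse metric\<close>

lemma matrix_inv_entry:
  fixes A :: "real^'n^'n::finite"
  assumes "invertible A"
  shows "matrix_inv A $ k $ a = det (\<chi> i j. if j = k then (if i = a then 1 else 0) else A $ i $ j) / det A"
proof -
  have d: "det A \<noteq> 0" using assms invertible_det_nz by blast
  have "A *v column a (matrix_inv A) = column a (A ** matrix_inv A)"
    by (simp add: vec_eq_iff column_def matrix_vector_mult_def matrix_matrix_mult_def)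
  also have "\<dots> = (\<chi> i. if i = a then 1 else 0)"
    by (simp add: matrix_inv_mult(2)[OF assms] vec_eq_iff column_def mat_def)
  finally have "column a (matrix_inv A) = (\<chi> k. det (\<chi> i j. if j = k then (\<chi> i. if i = a then 1 else 0) $ i else A $ i $ j) / det A)"
    using cramer[OF d] by blast
  then have "column a (matrix_inv A) $ k = (\<chi> k. det (\<chi> i j. if j = k then (\<chi> i. if i = a then 1 else 0) $ i else A $ i $ j) / det A) $ k"
    by simp
  then show ?thesis by (simp add: column_def cong: if_cong)
qed

lemma continuous_on_det:
  fixes A :: "'b::topological_space \<Rightarrow> real^'n^'n::finite"
  assumes "\<And>i j. continuous_on S (\<lambda>x. A x $ i $ j)"
  shows "continuous_on S (\<lambda>x. det (A x))"
  unfolding det_def by (intro continuous_on_sum continuous_on_mult continuous_on_prod continuous_on_const assms)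

lemma continuous_on_matrix_inv:
  fixes A :: "'b::topological_space \<Rightarrow> real^'n^'n::finite"
  assumes c: "\<And>i j. continuous_on S (\<lambda>x. A x $ i $ j)" and i: "\<And>x. x \<in> S \<Longrightarrow> invertible (A x)"
  shows "continuous_on S (\<lambda>x. matrix_inv (A x) $ k $ a)"
proof -
  have "continuous_on S (\<lambda>x. if j = k then (if i = a then 1 else 0) else A x $ i $ j)" for i j
    by (cases "j = k") (auto intro: c)
  then have "continuous_on S (\<lambda>x. det (\<chi> i j. if j = k then (if i = a then 1 else 0) else A x $ i $ j) / det (A x))"
    using i by (intro continuous_on_divide continuous_on_det c) (auto simp: invertible_det_nz)
  then show ?thesis by (rule continuous_on_eq) (simp add: matrix_inv_entry[OF i])
qed

text \<open>In matrix notation, with \<open>g\<close> and \<open>g0\<close> transposed, \<open>v - h = r - (v - h) (g - g0) h\<close> where \<open>r\<close> is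
  small if \<open>v g\<close> is close to the identity and \<open>g\<close> is close to \<open>g0\<close>. If \<open>g - g0\<close> is small compared
  with \<open>h\<close>, the last term is absorbed by the left-hand side. The fourth power of the dimension comes
  from bounding every matrix entry by the sum of the absolute values of all entries.\<close>

lemma inverse_perturbation:
  fixes v g g0 h :: "'n::finite \<Rightarrow> 'n \<Rightarrow> real"
  assumes h: "\<And>l a. (\<Sum>n\<in>UNIV. g0 n l * h n a) = (if l = a then 1 else 0)"
    and r: "\<And>m a. r m a = (\<Sum>n\<in>UNIV. ((\<Sum>l\<in>UNIV. v m l * g n l) - (if n = m then 1 else 0)) * h n a)
        - (\<Sum>n\<in>UNIV. \<Sum>l\<in>UNIV. h m l * (g n l - g0 n l) * h n a)"
    and E: "E = (\<Sum>n\<in>UNIV. \<Sum>l\<in>UNIV. \<bar>g n l - g0 n l\<bar>)" and B: "B = (\<Sum>n\<in>UNIV. \<Sum>l\<in>UNIV. \<bar>h n l\<bar>)"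
    and small: "real CARD('n) ^ 4 * (E * B) \<le> 1 / 2"
  shows "\<bar>v m a - h m a\<bar> \<le> 2 * (\<Sum>m\<in>UNIV. \<Sum>a\<in>UNIV. \<bar>r m a\<bar>)"
proof -
  define W where "W = (\<Sum>m\<in>UNIV. \<Sum>a\<in>UNIV. \<bar>v m a - h m a\<bar>)"
  have mem: "\<bar>f i j\<bar> \<le> (\<Sum>m\<in>UNIV. \<Sum>a\<in>UNIV. \<bar>f m a\<bar>)" for f :: "'n \<Rightarrow> 'n \<Rightarrow> real" and i j
  proof -
    have "\<bar>f i j\<bar> \<le> (\<Sum>a\<in>UNIV. \<bar>f i a\<bar>)" by (intro member_le_sum) auto
    also have "\<dots> \<le> (\<Sum>m\<in>UNIV. \<Sum>a\<in>UNIV. \<bar>f m a\<bar>)"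
      by (intro member_le_sum[where f = "\<lambda>m. \<Sum>a\<in>UNIV. \<bar>f m a\<bar>"]) (auto intro: sum_nonneg)
    finally show ?thesis .
  qed
  have id: "v m a - h m a = r m a - (\<Sum>n\<in>UNIV. \<Sum>l\<in>UNIV. (v m l - h m l) * (g n l - g0 n l) * h n a)" for m a
  proof -
    have "(\<Sum>n\<in>UNIV. (\<Sum>l\<in>UNIV. v m l * g0 n l) * h n a) = (\<Sum>l\<in>UNIV. \<Sum>n\<in>UNIV. v m l * (g0 n l * h n a))"
      by (subst sum.swap) (simp add: sum_distrib_right mult.assoc)
    also have "\<dots> = v m a"
      unfolding sum_distrib_left[symmetric] h by (rule sum_delta_right[of "\<lambda>l. v m l" a])
    finally have 1: "(\<Sum>n\<in>UNIV. (\<Sum>l\<in>UNIV. v m l * g0 n l) * h n a) = v m a" .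
    have "(\<Sum>n\<in>UNIV. (if n = m then 1 else 0) * h n a) = h m a" by (rule sum_delta_left)
    then have "r m a = (\<Sum>n\<in>UNIV. (\<Sum>l\<in>UNIV. v m l * g n l) * h n a) - h m a
        - (\<Sum>n\<in>UNIV. \<Sum>l\<in>UNIV. h m l * (g n l - g0 n l) * h n a)"
      unfolding r left_diff_distrib[of "sum _ _"] sum_subtractf by simp
    moreover have "(\<Sum>n\<in>UNIV. \<Sum>l\<in>UNIV. (v m l - h m l) * (g n l - g0 n l) * h n a)
      = (\<Sum>n\<in>UNIV. (\<Sum>l\<in>UNIV. v m l * g n l) * h n a) - (\<Sum>n\<in>UNIV. (\<Sum>l\<in>UNIV. v m l * g0 n l) * h n a)
        - (\<Sum>n\<in>UNIV. \<Sum>l\<in>UNIV. h m l * (g n l - g0 n l) * h n a)"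
      unfolding sum_distrib_right sum_subtractf[symmetric] by (intro sum.cong refl) (simp add: algebra_simps)
    ultimately show ?thesis using 1 by linarith
  qed
  have W: "\<bar>v m a - h m a\<bar> \<le> \<bar>r m a\<bar> + real CARD('n) ^ 2 * (W * E * B)" for m a
  proof -
    have "\<bar>\<Sum>n\<in>UNIV. \<Sum>l\<in>UNIV. (v m l - h m l) * (g n l - g0 n l) * h n a\<bar>
      \<le> (\<Sum>n\<in>UNIV. \<Sum>l\<in>UNIV. \<bar>(v m l - h m l) * (g n l - g0 n l) * h n a\<bar>)"
      by (intro order_trans[OF sum_abs] sum_mono sum_abs)
    also have "\<dots> \<le> (\<Sum>n::'n\<in>UNIV. \<Sum>l::'n\<in>UNIV. W * E * B)"
      unfolding abs_mult W_def E B
      by (intro sum_mono mult_mono mem mem[of "\<lambda>i j. v i j - h i j"] mem[of "\<lambda>i j. g i j - g0 i j"] mult_nonneg_nonneg sum_nonneg) auto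
    also have "\<dots> = real CARD('n) ^ 2 * (W * E * B)" by (simp add: power2_eq_square)
    finally show ?thesis using id[of m a] by linarith
  qed
  have "W \<le> (\<Sum>m\<in>UNIV. \<Sum>a\<in>UNIV. \<bar>r m a\<bar> + real CARD('n) ^ 2 * (W * E * B))"
    unfolding W_def by (intro sum_mono W[unfolded W_def])
  also have "\<dots> = (\<Sum>m\<in>UNIV. \<Sum>a\<in>UNIV. \<bar>r m a\<bar>) + W * (real CARD('n) ^ 4 * (E * B))"
    by (simp add: sum.distrib power4_eq_xxxx power2_eq_square)
  also have "\<dots> \<le> (\<Sum>m\<in>UNIV. \<Sum>a\<in>UNIV. \<bar>r m a\<bar>) + W * (1 / 2)"
    using small by (intro add_left_mono mult_left_mono) (auto simp: W_def intro!: sum_nonneg)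
  finally have "W \<le> 2 * (\<Sum>m\<in>UNIV. \<Sum>a\<in>UNIV. \<bar>r m a\<bar>)" by simp
  then show ?thesis using mem[of "\<lambda>i j. v i j - h i j" m a] unfolding W_def by linarith
qed

lemma unif_conv_sum:
  assumes "\<And>a. a \<in> A \<Longrightarrow> unif_conv S (\<lambda>\<epsilon>. u a \<epsilon>) (f a)"
  shows "unif_conv S (\<lambda>\<epsilon> x. \<Sum>a\<in>A. u a \<epsilon> x) (\<lambda>x. \<Sum>a\<in>A. f a x)"
  using assms
  by (induction A rule: infinite_finite_induct)
    (simp_all add: unif_conv_def uniform_limit_const uniform_limit_add)

lemma unif_conv_abs: "unif_conv S u f \<Longrightarrow> unif_conv S (\<lambda>\<epsilon> x. \<bar>u \<epsilon> x\<bar>) (\<lambda>x. \<bar>f x\<bar>)"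
  unfolding unif_conv_def real_norm_def[symmetric] by (blast intro: uniform_limit_norm)

lemma unif_conv_fixed: "unif_conv S (\<lambda>\<epsilon>. f) f"
  by (simp add: unif_conv_def uniform_limit_const)

lemma unif_conv_diff:
  "unif_conv S u f \<Longrightarrow> unif_conv S v g \<Longrightarrow> unif_conv S (\<lambda>\<epsilon> x. u \<epsilon> x - v \<epsilon> x) (\<lambda>x. f x - g x)"
  unfolding unif_conv_def by (auto intro: uniform_limit_minus)

text \<open>The distance of \<open>v\<close> from the inverse \<open>h\<close> of the limit is bounded by \<open>inverse_perturbation\<close>, once
  \<open>g - g0\<close> is small; the bound involves quantities that tend to \<open>0\<close> and the bounded function \<open>h\<close>.\<close>

lemma unif_conv_inverse:
  fixes v g :: "'n::finite \<Rightarrow> 'n \<Rightarrow> real \<Rightarrow> real^'m::finite \<Rightarrow> real" and g0 h :: "'n \<Rightarrow> 'n \<Rightarrow> real^'m \<Rightarrow> real"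
  assumes h: "\<And>l a x. x \<in> S \<Longrightarrow> (\<Sum>n\<in>UNIV. g0 n l x * h n a x) = (if l = a then 1 else 0)"
    and hc: "\<And>i j. continuous_on S (h i j)" and g: "\<And>i j. unif_conv S (g i j) (g0 i j)"
    and d: "\<And>m n. unif_conv S (\<lambda>\<epsilon> x. (\<Sum>l\<in>UNIV. v m l \<epsilon> x * g n l \<epsilon> x) - (if n = m then 1 else 0)) (\<lambda>x. 0)"
  shows "unif_conv S (v m a) (h m a)"
  unfolding unif_conv_def
proof (intro allI impI uniform_limitI)
  fix K and e :: real assume K: "compact K \<and> K \<subseteq> S" and e: "e > 0"
  define r where "r m a \<epsilon> x = (\<Sum>n\<in>UNIV. ((\<Sum>l\<in>UNIV. v m l \<epsilon> x * g n l \<epsilon> x) - (if n = m then 1 else 0)) * h n a x)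
        - (\<Sum>n\<in>UNIV. \<Sum>l\<in>UNIV. h m l x * (g n l \<epsilon> x - g0 n l x) * h n a x)" for m a \<epsilon> x
  define E where "E \<epsilon> x = (\<Sum>n\<in>UNIV. \<Sum>l\<in>UNIV. \<bar>g n l \<epsilon> x - g0 n l x\<bar>)" for \<epsilon> x
  define B where "B x = (\<Sum>n\<in>UNIV. \<Sum>l\<in>UNIV. \<bar>h n l x\<bar>)" for x
  have z: "unif_conv S (\<lambda>\<epsilon> x. g n l \<epsilon> x - g0 n l x) (\<lambda>x. 0)" for n l
    using unif_conv_diff[OF g unif_conv_fixed, of n l "g0 n l"] by simp
  have rz: "unif_conv S (r m a) (\<lambda>x. 0)" for m a
  proof -
    have "unif_conv S (r m a) (\<lambda>x. (\<Sum>n::'n\<in>UNIV. 0 * h n a x) - (\<Sum>n::'n\<in>UNIV. \<Sum>l::'n\<in>UNIV. h m l x * 0 * h n a x))"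
      unfolding r_def by (intro unif_conv_diff unif_conv_sum unif_conv_mult d z unif_conv_fixed hc continuous_on_const continuous_on_mult)
    then show ?thesis by simp
  qed
  have "unif_conv S (\<lambda>\<epsilon> x. \<Sum>m\<in>UNIV. \<Sum>a\<in>UNIV. \<bar>r m a \<epsilon> x\<bar>) (\<lambda>x. \<Sum>m::'n\<in>UNIV. \<Sum>a::'n\<in>UNIV. \<bar>0\<bar>)"
    by (intro unif_conv_sum unif_conv_abs rz)
  then have R: "uniform_limit K (\<lambda>\<epsilon> x. \<Sum>m\<in>UNIV. \<Sum>a\<in>UNIV. \<bar>r m a \<epsilon> x\<bar>) (\<lambda>x. 0) (at_right 0)"
    using K unfolding unif_conv_def by simp
  have "unif_conv S (\<lambda>\<epsilon> x. E \<epsilon> x * B x) (\<lambda>x. (\<Sum>n::'n\<in>UNIV. \<Sum>l::'n\<in>UNIV. \<bar>0\<bar>) * B x)"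
    unfolding E_def B_def
    by (intro unif_conv_mult unif_conv_sum unif_conv_abs z unif_conv_fixed continuous_on_sum continuous_on_rabs continuous_on_const hc)
  then have EB: "uniform_limit K (\<lambda>\<epsilon> x. E \<epsilon> x * B x) (\<lambda>x. 0) (at_right 0)"
    using K unfolding unif_conv_def by simp
  define N where "N = real CARD('n) ^ 4"
  have N: "N > 0" by (simp add: N_def)
  have "\<forall>\<^sub>F \<epsilon> in at_right 0. \<forall>x\<in>K. dist (\<Sum>m\<in>UNIV. \<Sum>a\<in>UNIV. \<bar>r m a \<epsilon> x\<bar>) 0 < e / 2"
    using e by (intro uniform_limitD[OF R]) simp
  moreover have "\<forall>\<^sub>F \<epsilon> in at_right 0. \<forall>x\<in>K. dist (E \<epsilon> x * B x) 0 < 1 / (2 * N)"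
    using N by (intro uniform_limitD[OF EB]) simp
  ultimately show "\<forall>\<^sub>F \<epsilon> in at_right 0. \<forall>x\<in>K. dist (v m a \<epsilon> x) (h m a x) < e"
  proof eventually_elim
    case (elim \<epsilon>)
    show ?case
    proof
      fix x assume x: "x \<in> K"
      then have xS: "x \<in> S" using K by blast
      have "E \<epsilon> x * B x < 1 / (2 * N)" using elim(2) x by (auto simp: dist_real_def)
      then have "N * (E \<epsilon> x * B x) \<le> 1 / 2" using N by (simp add: field_simps)
      then have "\<bar>v m a \<epsilon> x - h m a x\<bar> \<le> 2 * (\<Sum>m\<in>UNIV. \<Sum>a\<in>UNIV. \<bar>r m a \<epsilon> x\<bar>)"
        unfolding N_def
        by (rule inverse_perturbation[where ?g0.0 = "\<lambda>i j. g0 i j x" and h = "\<lambda>i j. h i j x" and v = "\<lambda>i j. v i j \<epsilon> x"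
            and g = "\<lambda>i j. g i j \<epsilon> x" and r = "\<lambda>i j. r i j \<epsilon> x", OF h[OF xS] r_def E_def B_def])
      also have "\<dots> < e" using elim(1) x by (auto simp: dist_real_def)
      finally show "dist (v m a \<epsilon> x) (h m a x) < e" by (simp add: dist_real_def)
    qed
  qed
qed

lemma symmetric_nondegenerate_invertible:
  fixes A :: "real^'n^'n::finite"
  assumes s: "\<And>i j. A $ i $ j = A $ j $ i" and n: "\<And>v. (\<forall>w. v \<bullet> (A *v w) = 0) \<Longrightarrow> v = 0"
  shows "invertible A"
proof -
  have "transpose A = A" by (simp add: transpose_def vec_eq_iff s)
  then have t: "v \<bullet> (A *v w) = (A *v v) \<bullet> w" for v w
    by (metis dot_lmul_matrix vector_transpose_matrix)
  have "v = 0" if "A *v v = 0" for v by (rule n) (simp add: t that)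
  then have "\<exists>B. B ** A = mat 1" using matrix_left_invertible_ker[of A] by blast
  then show ?thesis using invertible_left_inverse by blast
qed

context
  fixes M :: "('a, 'n::finite) mfd"
  assumes M: "smooth_manifold M"
begin

lemma Ck_metric_pointwise:
  assumes g: "Ck_metric M k g" and c: "c \<in> atlas M" and x: "x \<in> img c"
  shows "comp_in c g [] [i, j] x = comp_in c g [] [j, i] x" "invertible (gmat g c (chart_inv c x))"
proof -
  have "chart_inv c x \<in> fst c \<inter> topspace (mtop M)"
    using chart_inv_in[OF x] openin_subset[OF openin_chart[OF M c]] by blast
  then have *: "\<forall>i j. g c (chart_inv c x) [] [i, j] = g c (chart_inv c x) [] [j, i]"
    "\<forall>v. (\<forall>w. v \<bullet> (gmat g c (chart_inv c x) *v w) = 0) \<longrightarrow> v = 0"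
    using g c unfolding Ck_metric_def pseudo_metric_on_def by blast+
  show "comp_in c g [] [i, j] x = comp_in c g [] [j, i] x" using *(1) by (simp add: comp_in_def)
  show "invertible (gmat g c (chart_inv c x))"
    by (rule symmetric_nondegenerate_invertible) (use * in \<open>auto simp: gmat_def\<close>)
qed

lemma comp_in_inv_metric:
  "c \<in> atlas M \<Longrightarrow> x \<in> img c \<Longrightarrow> comp_in c (inv_metric M g) [i, j] [] x = matrix_inv (gmat g c (chart_inv c x)) $ i $ j"
  using chart_inv_in[of x c] by (simp add: comp_in_def inv_metric_def fld_def)

lemma inv_metric_inverse:
  assumes g: "Ck_metric M k g" and c: "c \<in> atlas M" and x: "x \<in> img c"
  shows "(\<Sum>l\<in>UNIV. comp_in c (inv_metric M g) [m, l] [] x * comp_in c g [] [n, l] x) = (if n = m then 1 else 0)"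
    "(\<Sum>n\<in>UNIV. comp_in c g [] [n, l] x * comp_in c (inv_metric M g) [n, a] [] x) = (if l = a then 1 else 0)"
proof -
  let ?G = "gmat g c (chart_inv c x)"
  note I = matrix_inv_mult[OF Ck_metric_pointwise(2)[OF g c x]]
  note s = Ck_metric_pointwise(1)[OF g c x]
  have "(matrix_inv ?G ** ?G) $ m $ n = (mat 1 :: real^'n^'n) $ m $ n" unfolding I ..
  then show "(\<Sum>l\<in>UNIV. comp_in c (inv_metric M g) [m, l] [] x * comp_in c g [] [n, l] x) = (if n = m then 1 else 0)"
    unfolding comp_in_inv_metric[OF c x] s[of n]
    by (auto simp: matrix_matrix_mult_def mat_def gmat_def comp_in_def)
  have "(?G ** matrix_inv ?G) $ l $ a = (mat 1 :: real^'n^'n) $ l $ a" unfolding I ..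
  then show "(\<Sum>n\<in>UNIV. comp_in c g [] [n, l] x * comp_in c (inv_metric M g) [n, a] [] x) = (if l = a then 1 else 0)"
    unfolding comp_in_inv_metric[OF c x] s[of _ l]
    by (auto simp: matrix_matrix_mult_def mat_def gmat_def comp_in_def)
qed

lemma associated_conv:
  assumes A: "associated M k r s A t"
  obtains u where "u \<in> A" "\<And>c I J n. c \<in> atlas M \<Longrightarrow> length I = r \<Longrightarrow> length J = s \<Longrightarrow> enat n \<le> k \<Longrightarrow>
    conv n (img c) (cnet c u I J) (comp_in c t I J)"
proof -
  obtain u where u: "u \<in> A" and U: "\<forall>c\<in>atlas M. \<forall>\<alpha> I J K.
        enat (length \<alpha>) \<le> k \<and> length I = r \<and> length J = s \<and>
        compactin (mtop M) K \<and> K \<subseteq> fst c \<longrightarrow>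
        uniform_limit (snd c ` K) (\<lambda>\<epsilon>. partials \<alpha> (comp_in c (u \<epsilon>) I J))
          (partials \<alpha> (comp_in c t I J)) (at_right 0)"
    using A unfolding associated_def by blast
  have "conv n (img c) (cnet c u I J) (comp_in c t I J)"
    if c: "c \<in> atlas M" and l: "length I = r" "length J = s" and n: "enat n \<le> k" for c I J n
    unfolding conv_def unif_conv_def
  proof (intro conjI allI impI)
    have "Ck_tensor M k r s t" using A unfolding associated_def by blast
    then show "Ck_on (enat n) (comp_in c t I J) (img c)"
      using Ck_on_mono[OF _ n] c unfolding Ck_tensor_def by blast
    fix \<alpha> :: "'n list" and K assume a: "length \<alpha> \<le> n" and K: "compact K \<and> K \<subseteq> img c"
    have KM: "compactin (mtop M) (chart_inv c ` K)" "chart_inv c ` K \<subseteq> fst c"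
      using compact_chart_inv[OF M c] K chart_inv_in[of _ c] by auto
    have "snd c ` (chart_inv c ` K) = K"
      unfolding image_image using K snd_chart_inv[of _ c] by force
    moreover have "enat (length \<alpha>) \<le> k" using a n by (meson enat_ord_simps(1) order_trans)
    ultimately show "uniform_limit K (\<lambda>\<epsilon>. partials \<alpha> (comp_in c (u \<epsilon>) I J)) (partials \<alpha> (comp_in c t I J)) (at_right 0)"
      using bspec[OF U c, THEN spec, THEN spec, THEN spec, THEN spec, of \<alpha> I J "chart_inv c ` K"] KM l by simp
  qed
  with u show thesis by (rule that)
qed

text \<open>The derivative of the inverse is \<open>\<partial>v = - v (\<partial>u) v\<close> up to negligible nets. If \<open>v\<close> converges in
  \<open>C\<^sup>n\<close>, then so does the right-hand side, hence \<open>v\<close> converges in \<open>C\<^bsup>n+1\<^esup>\<close>. The differentiability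
  of the inverse of \<open>g\<close> is obtained along the way.\<close>

lemma conv_inv_metric:
  assumes G: "gen_metric M gh" and H: "gen_inv_metric M gh hh" and g: "Ck_metric M k g" and u: "u \<in> gh" and v: "v \<in> hh"
    and C: "\<And>c i j n. c \<in> atlas M \<Longrightarrow> enat n \<le> k \<Longrightarrow> conv n (img c) (cnet c u [] [i, j]) (comp_in c g [] [i, j])"
    and c: "c \<in> atlas M"
  shows "enat n \<le> k \<Longrightarrow> conv n (img c) (cnet c v [m, a] []) (comp_in c (inv_metric M g) [m, a] [])"
proof (induction n arbitrary: m a)
  note gg = gen_metric_gen[OF M G] and hg = gen_inv_metric_gen[OF M H] and o = open_img[OF M c]
  have mu: "modnet (img c) (cnet c u [] [i, j])" for i j by (rule mod_nets_modnet[OF M gen_mod_nets[OF M gg u] c])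
  have mv: "modnet (img c) (cnet c v [i, j] [])" for i j by (rule mod_nets_modnet[OF M gen_mod_nets[OF M hg v] c])
  have gc: "continuous_on (img c) (comp_in c g [] [i, j])" for i j
    using g c unfolding Ck_metric_def Ck_tensor_def by (blast intro: Ck_on_imp_continuous)
  have "continuous_on (img c) (\<lambda>x. matrix_inv (gmat g c (chart_inv c x)) $ i $ j)" for i j
    by (rule continuous_on_matrix_inv[OF _ Ck_metric_pointwise(2)[OF g c]])
      (use gc in \<open>simp add: gmat_def comp_in_def\<close>)
  then have hc: "continuous_on (img c) (comp_in c (inv_metric M g) [i, j] [])" for i j
    by (rule continuous_on_eq) (simp add: comp_in_inv_metric[OF c])
  have U: "unif_conv (img c) (cnet c v [m, a] []) (comp_in c (inv_metric M g) [m, a] [])" for m a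
  proof (rule unif_conv_inverse[where g = "\<lambda>i j. cnet c u [] [i, j]" and ?g0.0 = "\<lambda>i j. comp_in c g [] [i, j]"
        and v = "\<lambda>i j. cnet c v [i, j] []" and h = "\<lambda>i j. comp_in c (inv_metric M g) [i, j] []"])
    show "unif_conv (img c) (cnet c u [] [i, j]) (comp_in c g [] [i, j])" for i j
      using C[OF c, of 0 i j] by (simp add: zero_enat_def[symmetric] conv_0)
    show "unif_conv (img c) (\<lambda>\<epsilon> x. (\<Sum>l\<in>UNIV. cnet c v [m, l] [] \<epsilon> x * cnet c u [] [n, l] \<epsilon> x) - (if n = m then 1 else 0)) (\<lambda>x. 0)" for m n
      using gen_inverse(1)[OF M G H c u v, of m n] unfolding negl_eq_def by (blast intro: unif_conv_negl neglnet_sup)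
  qed (use inv_metric_inverse(2)[OF g c] hc in auto)
  {
    case 0
    show ?case using U hc by (simp add: conv_0)
  next
    case (Suc n)
    have n: "enat n \<le> k" using Suc.prems by (meson Suc_ile_eq order_less_imp_le)
    note IH = Suc.IH[OF n]
    show ?case
    proof (rule conv_SucI[OF o modnet_smoothnet[OF mv] U])
      fix i
      define F where "F \<epsilon> x = (\<Sum>q\<in>UNIV. (- 1) * (\<Sum>l\<in>UNIV. comp_in c (v \<epsilon>) [m, l] [] x * partial i (comp_in c (u \<epsilon>) [] [q, l]) x) * comp_in c (v \<epsilon>) [q, a] [] x)" for \<epsilon> x
      \<comment> \<open>Differentiate the relation between \<open>u\<close> and its left inverse, then multiply with the right inverse.\<close>
      have d: "negl_eq (img c) (\<lambda>\<epsilon> x. \<Sum>l\<in>UNIV. partial i (comp_in c (v \<epsilon>) [m, l] []) x * comp_in c (u \<epsilon>) [] [q, l] x)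
         (\<lambda>\<epsilon> x. (- 1) * (\<Sum>l\<in>UNIV. comp_in c (v \<epsilon>) [m, l] [] x * partial i (comp_in c (u \<epsilon>) [] [q, l]) x))" for q
      proof -
        let ?p = "\<lambda>\<epsilon> x. \<Sum>l\<in>UNIV. partial i (comp_in c (v \<epsilon>) [m, l] []) x * comp_in c (u \<epsilon>) [] [q, l] x"
        let ?q = "\<lambda>\<epsilon> x. \<Sum>l\<in>UNIV. comp_in c (v \<epsilon>) [m, l] [] x * partial i (comp_in c (u \<epsilon>) [] [q, l]) x"
        have mp: "modnet (img c) ?p" and mq: "modnet (img c) ?q"
          by (intro modnet_sum modnet_mult modnet_partial o mu mv)+
        have "negl_eq (img c) (\<lambda>\<epsilon>. partial i (\<lambda>x. \<Sum>l\<in>UNIV. comp_in c (v \<epsilon>) [m, l] [] x * comp_in c (u \<epsilon>) [] [q, l] x)) (\<lambda>\<epsilon>. partial i (\<lambda>x. if q = m then 1 else 0))"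
          by (rule negl_eq_partial[OF o gen_inverse(1)[OF M G H c u v]])
        then have "negl_eq (img c) (\<lambda>\<epsilon> x. ?p \<epsilon> x + ?q \<epsilon> x) (\<lambda>\<epsilon> x. 0)"
        proof (rule negl_eq_cong[OF o])
          fix \<epsilon> :: real and x assume e: "\<epsilon> \<in> {0<..1}" and x: "x \<in> img c"
          have du: "comp_in c (u \<epsilon>) [] [j, l] differentiable (at x)" for j l
            using modnet_smoothnet[OF mu] e unfolding smoothnet_def by (blast intro: smooth_imp_differentiable[OF _ o x])
          have dv: "comp_in c (v \<epsilon>) [j, l] [] differentiable (at x)" for j l
            using modnet_smoothnet[OF mv] e unfolding smoothnet_def by (blast intro: smooth_imp_differentiable[OF _ o x])
          have "partial i (\<lambda>x. \<Sum>l\<in>UNIV. comp_in c (v \<epsilon>) [m, l] [] x * comp_in c (u \<epsilon>) [] [q, l] x) x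
             = (\<Sum>l\<in>UNIV. partial i (\<lambda>x. comp_in c (v \<epsilon>) [m, l] [] x * comp_in c (u \<epsilon>) [] [q, l] x) x)"
            by (intro partial_sum differentiable_mult du dv finite)
          then show "partial i (\<lambda>x. \<Sum>l\<in>UNIV. comp_in c (v \<epsilon>) [m, l] [] x * comp_in c (u \<epsilon>) [] [q, l] x) x = ?p \<epsilon> x + ?q \<epsilon> x"
            by (simp add: partial_mult[OF dv du] sum.distrib)
        qed (simp add: partial_const)
        then have "neglnet (img c) (\<lambda>\<epsilon> x. ?p \<epsilon> x - (- 1) * ?q \<epsilon> x)" by (simp add: negl_eq_def)
        then show ?thesis unfolding negl_eq_def using mp modnet_cmult[OF o mq] by blast
      qed
      have "negl_eq (img c) (\<lambda>\<epsilon> x. \<Sum>q\<in>UNIV. (\<Sum>l\<in>UNIV. partial i (comp_in c (v \<epsilon>) [m, l] []) x * comp_in c (u \<epsilon>) [] [q, l] x) * comp_in c (v \<epsilon>) [q, a] [] x) F"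
        unfolding F_def by (intro negl_eq_sum negl_eq_mult o d negl_eq_refl[OF o mv])
      moreover have "negl_eq (img c) (\<lambda>\<epsilon> x. \<Sum>l\<in>UNIV. partial i (comp_in c (v \<epsilon>) [m, l] []) x * (\<Sum>q\<in>UNIV. comp_in c (u \<epsilon>) [] [q, l] x * comp_in c (v \<epsilon>) [q, a] [] x))
         (\<lambda>\<epsilon> x. \<Sum>l\<in>UNIV. partial i (comp_in c (v \<epsilon>) [m, l] []) x * (if l = a then 1 else 0))"
        by (intro negl_eq_sum negl_eq_mult o negl_eq_refl[OF o modnet_partial[OF o mv]] gen_inverse(2)[OF M G H c u v])
      moreover have "(\<Sum>q\<in>UNIV. (\<Sum>l\<in>UNIV. partial i (comp_in c (v \<epsilon>) [m, l] []) x * comp_in c (u \<epsilon>) [] [q, l] x) * comp_in c (v \<epsilon>) [q, a] [] x)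
        = (\<Sum>l\<in>UNIV. partial i (comp_in c (v \<epsilon>) [m, l] []) x * (\<Sum>q\<in>UNIV. comp_in c (u \<epsilon>) [] [q, l] x * comp_in c (v \<epsilon>) [q, a] [] x))" for \<epsilon> x
        unfolding sum_distrib_left sum_distrib_right by (subst sum.swap) (simp only: mult.assoc)
      ultimately have "negl_eq (img c) (\<lambda>\<epsilon>. partial i (comp_in c (v \<epsilon>) [m, a] [])) F"
        unfolding sum_delta_right by (simp only:) (rule negl_eq_trans[OF o negl_eq_sym[OF o]])
      moreover have "conv n (img c) F (\<lambda>x. \<Sum>q\<in>UNIV. (- 1) * (\<Sum>l\<in>UNIV. comp_in c (inv_metric M g) [m, l] [] x
          * partial i (comp_in c g [] [q, l]) x) * comp_in c (inv_metric M g) [q, a] [] x)"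
        unfolding F_def
        by (intro conv_sum conv_mult conv_const o IH conv_partial[OF o C[OF c Suc.prems]]
          modnet_smoothnet modnet_sum modnet_mult modnet_const modnet_partial mu mv)
      ultimately show "conv n (img c) (\<lambda>\<epsilon>. partial i (comp_in c (v \<epsilon>) [m, a] []))
        (\<lambda>x. \<Sum>q\<in>UNIV. (- 1) * (\<Sum>l\<in>UNIV. comp_in c (inv_metric M g) [m, l] [] x
          * partial i (comp_in c g [] [q, l]) x) * comp_in c (inv_metric M g) [q, a] [] x)"
        by (rule negl_eq_conv[OF o])
    qed
  }
qed

lemma conv_christoffel:
  assumes G: "gh \<in> gen_tensors M 0 2" and H: "hh \<in> gen_tensors M 2 0" and u: "u \<in> gh" and v: "v \<in> hh" and c: "c \<in> atlas M"
    and Cg: "\<And>i j. conv (Suc n) (img c) (cnet c u [] [i, j]) (comp_in c g [] [i, j])"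
    and Ch: "\<And>i j. conv (Suc n) (img c) (cnet c v [i, j] []) (comp_in c h [i, j] [])"
  shows "conv n (img c) (\<lambda>\<epsilon>. christoffel c (v \<epsilon>) (u \<epsilon>) m i j) (christoffel c h g m i j)"
proof -
  note o = open_img[OF M c]
  have mu: "modnet (img c) (cnet c u [] [a, b])" for a b by (rule mod_nets_modnet[OF M gen_mod_nets[OF M G u] c])
  have mv: "modnet (img c) (cnet c v [a, b] [])" for a b by (rule mod_nets_modnet[OF M gen_mod_nets[OF M H v] c])
  show ?thesis unfolding christoffel_def christ_def
    by (intro conv_mult conv_const conv_sum conv_add conv_diff o conv_partial[OF o Cg] conv_mono[OF Ch]
      modnet_smoothnet modnet_sum modnet_mult modnet_const modnet_partial modnet_add modnet_diff mu mv) simp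
qed

lemma conv_riemann:
  assumes G: "gh \<in> gen_tensors M 0 2" and H: "hh \<in> gen_tensors M 2 0" and u: "u \<in> gh" and v: "v \<in> hh" and c: "c \<in> atlas M"
    and Cg: "\<And>i j. conv (Suc (Suc n)) (img c) (cnet c u [] [i, j]) (comp_in c g [] [i, j])"
    and Ch: "\<And>i j. conv (Suc (Suc n)) (img c) (cnet c v [i, j] []) (comp_in c h [i, j] [])"
  shows "conv n (img c) (\<lambda>\<epsilon>. riemann c (v \<epsilon>) (u \<epsilon>) d a b e) (riemann c h g d a b e)"
proof -
  note o = open_img[OF M c]
  have C: "conv (Suc n) (img c) (\<lambda>\<epsilon>. christoffel c (v \<epsilon>) (u \<epsilon>) m i j) (christoffel c h g m i j)" for m i j
    by (rule conv_christoffel[OF G H u v c Cg Ch])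
  have m: "modnet (img c) (\<lambda>\<epsilon>. christoffel c (v \<epsilon>) (u \<epsilon>) m i j)" for m i j
    by (rule gen_christoffel_modnet[OF M G H u v c])
  show ?thesis unfolding riemann_def
    by (intro conv_mult conv_sum conv_add conv_diff o conv_partial[OF o C] conv_mono[OF C]
      modnet_smoothnet modnet_sum modnet_mult modnet_partial modnet_add modnet_diff m) simp_all
qed

end

section \<open>The classical connection and curvature in a chart\<close>

lemma Ck_tensor_mono: "Ck_tensor M l r s t \<Longrightarrow> l' \<le> l \<Longrightarrow> Ck_tensor M l' r s t"
  unfolding Ck_tensor_def by (blast intro: Ck_on_mono)

lemma levi_civita_continuous:
  assumes "levi_civita M g D" "Ck_tensor M 1 1 0 \<xi>" "Ck_tensor M 1 1 0 \<eta>"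
  shows "Ck_tensor M 0 1 0 (D \<xi> \<eta>)"
  using assms(1)[unfolded levi_civita_def Let_def, THEN conjunct1] assms(2,3) by blast

lemma levi_civita_bracket:
  assumes "levi_civita M g D" "Ck_tensor M 1 1 0 \<xi>" "Ck_tensor M 1 1 0 \<eta>"
  shows "bracket M \<xi> \<eta> = tsub (D \<xi> \<eta>) (D \<eta> \<xi>)"
  using assms(1)[unfolded levi_civita_def Let_def, THEN conjunct2, THEN conjunct2, THEN conjunct2, THEN conjunct2, THEN conjunct2, THEN conjunct2, THEN conjunct1] assms(2,3) by blast

lemma levi_civita_metric:
  assumes "levi_civita M g D" "Ck_tensor M 1 1 0 \<xi>" "Ck_tensor M 1 1 0 \<eta>" "Ck_tensor M 1 1 0 \<zeta>"
  shows "vaction M \<xi> (metric_app M g \<eta> \<zeta>) = tadd (metric_app M g (D \<xi> \<eta>) \<zeta>) (metric_app M g \<eta> (D \<xi> \<zeta>))"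
  using assms(1)[unfolded levi_civita_def Let_def, THEN conjunct2, THEN conjunct2, THEN conjunct2, THEN conjunct2, THEN conjunct2, THEN conjunct2, THEN conjunct2] assms(2-4) by blast

context
  fixes M :: "('a, 'n::finite) mfd"
  assumes M: "smooth_manifold M"
begin

lemma classical_torsion:
  assumes V: "levi_civita M g D" and x: "Ck_tensor M 1 1 0 x" and y: "Ck_tensor M 1 1 0 y" and c: "c \<in> atlas M" and z: "z \<in> img c"
  shows "(\<Sum>j\<in>UNIV. comp_in c x [j] [] z * partial j (comp_in c y [m] []) z - comp_in c y [j] [] z * partial j (comp_in c x [m] []) z)
    = comp_in c (D x y) [m] [] z - comp_in c (D y x) [m] [] z"
proof -
  have "comp_in c (bracket M x y) [m] [] z = comp_in c (tsub (D x y) (D y x)) [m] [] z"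
    unfolding levi_civita_bracket[OF V x y] ..
  then show ?thesis by (simp add: comp_in_bracket[OF M c z] comp_in_tsub)
qed

lemma classical_compat:
  assumes V: "levi_civita M g D" and x: "Ck_tensor M 1 1 0 x" and y: "Ck_tensor M 1 1 0 y" and t: "Ck_tensor M 1 1 0 t"
    and c: "c \<in> atlas M" and z: "z \<in> img c"
  shows "(\<Sum>i\<in>UNIV. comp_in c x [i] [] z * partial i (\<lambda>w. \<Sum>j\<in>UNIV. \<Sum>k\<in>UNIV. comp_in c g [] [j, k] w * comp_in c y [j] [] w * comp_in c t [k] [] w) z)
    = (\<Sum>j\<in>UNIV. \<Sum>k\<in>UNIV. comp_in c g [] [j, k] z * comp_in c (D x y) [j] [] z * comp_in c t [k] [] z)
      + (\<Sum>j\<in>UNIV. \<Sum>k\<in>UNIV. comp_in c g [] [j, k] z * comp_in c y [j] [] z * comp_in c (D x t) [k] [] z)"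
proof -
  have "comp_in c (vaction M x (metric_app M g y t)) [] [] z = comp_in c (tadd (metric_app M g (D x y) t) (metric_app M g y (D x t))) [] [] z"
    unfolding levi_civita_metric[OF V x y t] ..
  moreover have "partial i (comp_in c (metric_app M g y t) [] []) z
     = partial i (\<lambda>w. \<Sum>j\<in>UNIV. \<Sum>k\<in>UNIV. comp_in c g [] [j, k] w * comp_in c y [j] [] w * comp_in c t [k] [] w) z" for i
    by (rule partial_cong[OF open_img[OF M c] z]) (rule comp_in_metric_app[OF M c])
  ultimately show ?thesis by (simp add: comp_in_vaction[OF M c z] comp_in_tadd comp_in_metric_app[OF M c z])
qed

text \<open>For a classical connection all defects in the Koszul formula are zero.\<close>

lemma classical_connection:
  assumes V: "levi_civita M g D" and g: "Ck_metric M k g" and k: "1 \<le> k"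
    and x: "Ck_tensor M 1 1 0 x" and y: "Ck_tensor M 1 1 0 y" and c: "c \<in> atlas M" and z: "z \<in> img c"
  shows "comp_in c (D x y) [m] [] z = (\<Sum>i\<in>UNIV. comp_in c x [i] [] z * partial i (comp_in c y [m] []) z) +
      (\<Sum>i\<in>UNIV. \<Sum>j\<in>UNIV. christoffel c (inv_metric M g) g m i j z * comp_in c x [i] [] z * comp_in c y [j] [] z)"
proof -
  note o = open_img[OF M c]
  obtain e U L where UL: "open U" "{z} \<subseteq> U" "U \<subseteq> L" "compact L" "L \<subseteq> img c"
      and et: "\<And>l. Ck_tensor M \<infinity> 1 0 (e l)"
      and e: "\<And>l m x. x \<in> U \<Longrightarrow> comp_in c (e l) [m] [] x = (if m = l then 1 else 0)"
    using test_fields[OF M c, of "{z}"] z by (metis compact_sing empty_subsetI insert_subset)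
  have zU: "z \<in> U" using UL by blast
  have t: "Ck_tensor M 1 1 0 (e l)" for l by (rule Ck_tensor_mono[OF et]) simp
  have d: "comp_in c w I J differentiable (at z)" if "Ck_tensor M k' r s w" "1 \<le> k'" for w k' r s I J
    using that c z unfolding Ck_tensor_def by (intro Ck_on_imp_differentiable[OF _ that(2) o z]) blast
  have gk: "Ck_tensor M k 0 2 g" using g by (simp add: Ck_metric_def)
  define X where "X n = (\<Sum>i\<in>UNIV. comp_in c x [i] [] z * partial i (comp_in c y [n] []) z)" for n
  have K: "0 = 2 * (\<Sum>n\<in>UNIV. comp_in c g [] [n, l] z * (comp_in c (D x y) [n] [] z - X n))
      - (\<Sum>i\<in>UNIV. \<Sum>j\<in>UNIV. (partial i (comp_in c g [] [j, l]) z + partial j (comp_in c g [] [i, l]) z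
          - partial l (comp_in c g [] [i, j]) z) * comp_in c x [i] [] z * comp_in c y [j] [] z)" for l
  proof -
    have "2 * (\<Sum>n\<in>UNIV. comp_in c g [] [n, l] z * (comp_in c (D x y) [n] [] z - (\<Sum>i\<in>UNIV. comp_in c x [i] [] z * partial i (comp_in c y [n] []) z)))
      - (\<Sum>i\<in>UNIV. \<Sum>j\<in>UNIV. (partial i (comp_in c g [] [j, l]) z + partial j (comp_in c g [] [i, l]) z
          - partial l (comp_in c g [] [i, j]) z) * comp_in c x [i] [] z * comp_in c y [j] [] z)
      = 0 - 0 - 0 - (\<Sum>n\<in>UNIV. comp_in c g [] [n, l] z * (0::real)) + (\<Sum>i\<in>UNIV. \<Sum>j\<in>UNIV. comp_in c g [] [i, j] z * 0 * comp_in c y [j] [] z)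
      + (\<Sum>i\<in>UNIV. \<Sum>j\<in>UNIV. comp_in c g [] [i, j] z * 0 * comp_in c x [j] [] z)"
    proof (rule koszul_test[OF UL(1) zU, where u = "\<lambda>i j. comp_in c g [] [i, j]" and x = "\<lambda>i. comp_in c x [i] []"
          and y = "\<lambda>i. comp_in c y [i] []" and e = "\<lambda>i. comp_in c (e l) [i] []" and p = "\<lambda>i. comp_in c (D x y) [i] [] z"
          and q = "\<lambda>i. comp_in c (D x (e l)) [i] [] z" and r = "\<lambda>i. comp_in c (D y (e l)) [i] [] z" and p' = "\<lambda>i. comp_in c (D y x) [i] [] z"
          and q' = "\<lambda>i. comp_in c (D (e l) x) [i] [] z" and r' = "\<lambda>i. comp_in c (D (e l) y) [i] [] z"
          and ?A1.0 = 0 and ?A2.0 = 0 and ?A3.0 = 0 and ?T1.0 = "\<lambda>m. 0" and ?T2.0 = "\<lambda>m. 0" and ?T3.0 = "\<lambda>m. 0"])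
      show "comp_in c g [] [i, j] differentiable (at z)" for i j by (rule d[OF gk k])
      show "comp_in c x [i] [] differentiable (at z)" for i by (rule d[OF x order_refl])
      show "comp_in c y [i] [] differentiable (at z)" for i by (rule d[OF y order_refl])
      show "comp_in c g [] [i, j] w = comp_in c g [] [j, i] w" if "w \<in> U" for i j w
        using that UL by (intro Ck_metric_pointwise(1)[OF M g c]) blast
      show "comp_in c (e l) [i] [] w = (if i = l then 1 else 0)" if "w \<in> U" for i w by (rule e[OF that])
    qed (simp_all only: classical_compat[OF V x y t c z] classical_compat[OF V y t x c z] classical_compat[OF V t x y c z]
        classical_torsion[OF V x y c z] classical_torsion[OF V x t c z] classical_torsion[OF V y t c z] diff_self)
    then show ?thesis by (simp add: X_def)
  qed
  have "comp_in c (D x y) [m] [] z - (X m + (\<Sum>i\<in>UNIV. \<Sum>j\<in>UNIV. christoffel c (inv_metric M g) g m i j z * comp_in c x [i] [] z * comp_in c y [j] [] z))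
    = 1 / 2 * (\<Sum>l\<in>UNIV. comp_in c (inv_metric M g) [m, l] [] z * 0)
    - (\<Sum>n\<in>UNIV. ((\<Sum>l\<in>UNIV. comp_in c (inv_metric M g) [m, l] [] z * comp_in c g [] [n, l] z) - (if n = m then 1 else 0)) * (comp_in c (D x y) [n] [] z - X n))"
    unfolding christoffel_def by (rule connection_pointwise[where K = "\<lambda>l. 0"]) (rule K)
  then show ?thesis by (simp add: inv_metric_inverse(1)[OF M g c z] X_def)
qed

text \<open>The curvature applies the connection to covariant derivatives of smooth fields; the axioms of the
  connection cover these only if they are of class \<open>C\<^sup>1\<close>.\<close>

lemma classical_connection_C1:
  assumes V: "levi_civita M g D" and g: "Ck_metric M k g" and k: "1 \<le> k"
    and G: "\<And>c m i j. c \<in> atlas M \<Longrightarrow> Ck_on 1 (christoffel c (inv_metric M g) g m i j) (img c)"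
    and x: "Ck_tensor M \<infinity> 1 0 x" and y: "Ck_tensor M \<infinity> 1 0 y"
  shows "Ck_tensor M 1 1 0 (D x y)"
  unfolding Ck_tensor_def
proof (intro conjI ballI allI)
  have x1: "Ck_tensor M 1 1 0 x" and y1: "Ck_tensor M 1 1 0 y"
    using x y by (auto intro: Ck_tensor_mono)
  show T: "is_tensor M 1 0 (D x y)"
    using levi_civita_continuous[OF V x1 y1] by (simp add: Ck_tensor_def)
  fix c and I J :: "'n list" assume c: "c \<in> atlas M"
  note o = open_img[OF M c]
  show "Ck_on 1 (comp_in c (D x y) I J) (img c)"
  proof (cases "length I = 1 \<and> length J = 0")
    case False
    then have "comp_in c (D x y) I J = (\<lambda>z. 0)" using is_tensor_zero[OF M T] by (auto simp: comp_in_def)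
    then show ?thesis by (simp add: Ck_on_const)
  next
    case True
    then obtain m where IJ: "I = [m]" "J = []" using length_1_conv[of I] by auto
    have X: "Ck_on 1 (comp_in c x [i] []) (img c)" and Y: "Ck_on 1 (comp_in c y [i] []) (img c)"
      and dY: "Ck_on 1 (partial j (comp_in c y [i] [])) (img c)" for i j
    proof -
      have "Ck_on \<infinity> (comp_in c x [i] []) (img c)" "Ck_on \<infinity> (comp_in c y [i] []) (img c)"
        using x y c unfolding Ck_tensor_def by blast+
      then show "Ck_on 1 (comp_in c x [i] []) (img c)" "Ck_on 1 (comp_in c y [i] []) (img c)"
        "Ck_on 1 (partial j (comp_in c y [i] [])) (img c)"
        by (auto intro: Ck_on_infinity_le smooth_partial[OF _ o])
    qed
    have "Ck_on 1 (\<lambda>z. (\<Sum>i\<in>UNIV. comp_in c x [i] [] z * partial i (comp_in c y [m] []) z) +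
      (\<Sum>i\<in>UNIV. \<Sum>j\<in>UNIV. christoffel c (inv_metric M g) g m i j z * comp_in c x [i] [] z * comp_in c y [j] [] z)) (img c)"
      by (intro Ck_on_add Ck_on_sum Ck_on_mult o X Y dY G[OF c])
    then show ?thesis unfolding IJ
      by (rule Ck_on_congI[OF o]) (rule classical_connection[OF V g k x1 y1 c, symmetric])
  qed
qed

lemma classical_curvature:
  assumes V: "levi_civita M g D" and g: "Ck_metric M k g" and k: "1 \<le> k"
    and G: "\<And>c m i j. c \<in> atlas M \<Longrightarrow> Ck_on 1 (christoffel c (inv_metric M g) g m i j) (img c)"
    and R: "curvature_tensor M D R" and c: "c \<in> atlas M" and z: "z \<in> img c"
  shows "comp_in c R [d] [a, b, e] z = riemann c (inv_metric M g) g d a b e z"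
proof -
  note o = open_img[OF M c]
  obtain f U L where UL: "open U" "{z} \<subseteq> U" "U \<subseteq> L" "compact L" "L \<subseteq> img c"
      and ft: "\<And>l. Ck_tensor M \<infinity> 1 0 (f l)"
      and f: "\<And>l m x. x \<in> U \<Longrightarrow> comp_in c (f l) [m] [] x = (if m = l then 1 else 0)"
    using test_fields[OF M c, of "{z}"] z by (metis compact_sing empty_subsetI insert_subset)
  have zU: "z \<in> U" and sub: "U \<subseteq> img c" using UL by auto
  let ?G = "christoffel c (inv_metric M g) g"
  have t: "Ck_tensor M 1 1 0 (f l)" for l by (rule Ck_tensor_mono[OF ft]) simp
  have D1: "Ck_tensor M 1 1 0 (D (f i) (f j))" for i j
    by (rule classical_connection_C1[OF V g k G ft ft])
  have df: "partial i (comp_in c (f l) [m] []) w = 0" if w: "w \<in> U" for i l m w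
  proof -
    have "partial i (comp_in c (f l) [m] []) w = partial i (\<lambda>w. if m = l then 1 else 0) w"
      by (rule partial_cong[OF UL(1) w]) (rule f)
    then show ?thesis by (simp add: partial_const)
  qed
  have W: "comp_in c (D (f i) (f j)) [m] [] w = ?G m i j w" if w: "w \<in> U" for i j m w
  proof -
    have "w \<in> img c" using w sub by blast
    from classical_connection[OF V g k t t c this, of i j m] show ?thesis
      unfolding df[OF w] f[OF w] sum_delta_right by simp
  qed
  have Z: "comp_in c (D (f i) (D (f j) (f l))) [d] [] z = partial i (?G d j l) z + (\<Sum>m\<in>UNIV. ?G d i m z * ?G m j l z)" for i j l
  proof -
    have "partial n (comp_in c (D (f j) (f l)) [d] []) z = partial n (?G d j l) z" for n
      by (rule partial_cong[OF UL(1) zU]) (rule W)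
    moreover have "(\<Sum>n\<in>UNIV. \<Sum>m\<in>UNIV. ?G d n m z * (if n = i then 1 else 0) * ?G m j l z) = (\<Sum>m\<in>UNIV. ?G d i m z * ?G m j l z)"
      by (subst sum.swap) (simp only: sum_delta_middle)
    ultimately show ?thesis
      using classical_connection[OF V g k t D1 c z, of i j l d] by (simp only: W[OF zU] f[OF zU] sum_delta_left)
  qed
  have br: "bracket M (f a) (f b) = tsub (D (f a) (f b)) (D (f b) (f a))" by (rule levi_civita_bracket[OF V t t])
  have B1: "Ck_tensor M 1 1 0 (bracket M (f a) (f b))"
    unfolding br Ck_tensor_def comp_in_tsub
  proof (intro conjI ballI allI)
    show "is_tensor M 1 0 (tsub (D (f a) (f b)) (D (f b) (f a)))"
      using D1 unfolding Ck_tensor_def by (intro is_tensor_tsub[OF M]) simp_all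
    show "Ck_on 1 (\<lambda>x. comp_in c (D (f a) (f b)) I J x - comp_in c (D (f b) (f a)) I J x) (img c)"
      if "c \<in> atlas M" for c I J
      using D1 that unfolding Ck_tensor_def by (intro Ck_on_diff open_img[OF M that]) simp_all
  qed
  have B: "comp_in c (bracket M (f a) (f b)) [m] [] z = 0" for m
    by (simp add: comp_in_bracket[OF M c z] df[OF zU])
  have w: "comp_in c (D (bracket M (f a) (f b)) (f e)) [d] [] z = 0"
    using classical_connection[OF V g k B1 t c z, of e d] by (simp add: B)
  have "curv_app M R (f a) (f b) (f e) = tsub (D (bracket M (f a) (f b)) (f e)) (tsub (D (f a) (D (f b) (f e))) (D (f b) (D (f a) (f e))))"
    using R ft unfolding curvature_tensor_def by blast
  then have "comp_in c (curv_app M R (f a) (f b) (f e)) [d] [] z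
    = 0 - (comp_in c (D (f a) (D (f b) (f e))) [d] [] z - comp_in c (D (f b) (D (f a) (f e))) [d] [] z)"
    by (simp add: comp_in_tsub w)
  then show ?thesis
    unfolding comp_in_curv_app[OF M c z] f[OF zU] sum_delta_right Z by (simp add: riemann_def)
qed

section \<open>Convergence of curvature\<close>

text \<open>The transformation law of the components holds for each parameter and passes to the pointwise
  limit, so the limit is a tensor field.\<close>

lemma associatedI:
  assumes A: "A \<in> gen_tensors M r s" and w: "w \<in> A"
    and z: "\<And>c p I J. \<not> (c \<in> atlas M \<and> p \<in> fst c \<and> length I = r \<and> length J = s) \<Longrightarrow> t c p I J = 0"
    and C: "\<And>c I J n. c \<in> atlas M \<Longrightarrow> length I = r \<Longrightarrow> length J = s \<Longrightarrow> enat n \<le> l \<Longrightarrow>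
      conv n (img c) (cnet c w I J) (comp_in c t I J)"
  shows "associated M l r s A t"
  unfolding associated_def
proof (intro conjI A bexI[OF _ w] ballI allI impI)
  have wm: "w \<in> mod_nets M r s" by (rule gen_mod_nets[OF M A w])
  have lim: "((\<lambda>\<epsilon>. w \<epsilon> c p I J) \<longlongrightarrow> t c p I J) (at_right 0)"
    if c: "c \<in> atlas M" and p: "p \<in> fst c" and l: "length I = r" "length J = s" for c p I J
  proof -
    have u: "unif_conv (img c) (cnet c w I J) (comp_in c t I J)"
      using C[OF c l, of 0] by (simp add: zero_enat_def[symmetric] conv_0)
    have "uniform_limit {snd c p} (cnet c w I J) (comp_in c t I J) (at_right 0)"
      by (rule u[unfolded unif_conv_def, rule_format]) (use p in simp)
    then show ?thesis by (simp add: comp_in_def chart_inv_snd[OF M c p])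
  qed
  have T: "is_tensor M r s t"
    unfolding is_tensor_def
  proof (intro conjI allI impI ballI)
    fix c c' p and I' J' :: "'n list" assume c: "c \<in> atlas M" "c' \<in> atlas M" "p \<in> fst c \<inter> fst c'" "length I' = r \<and> length J' = s"
    let ?S = "\<lambda>t. \<Sum>I | length I = r. \<Sum>J | length J = s.
      (\<Prod>m<r. jac c c' p (I' ! m) (I ! m)) * (\<Prod>m<s. jac c' c p (J ! m) (J' ! m)) * t c p I J"
    have "((\<lambda>\<epsilon>. ?S (w \<epsilon>)) \<longlongrightarrow> ?S t) (at_right 0)"
      using c by (intro tendsto_sum tendsto_mult tendsto_const lim) auto
    moreover have "\<forall>\<^sub>F \<epsilon> in at_right 0. ?S (w \<epsilon>) = w \<epsilon> c' p I' J'"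
    proof (rule eventually_on_unit)
      fix \<epsilon> :: real assume "\<epsilon> \<in> {0<..1}"
      from mod_nets_is_tensor[OF M wm this] show "?S (w \<epsilon>) = w \<epsilon> c' p I' J'"
        unfolding is_tensor_def using c by simp
    qed
    ultimately have "((\<lambda>\<epsilon>. w \<epsilon> c' p I' J') \<longlongrightarrow> ?S t) (at_right 0)"
      by (rule Lim_transform_eventually)
    moreover have "((\<lambda>\<epsilon>. w \<epsilon> c' p I' J') \<longlongrightarrow> t c' p I' J') (at_right 0)" using c by (intro lim) auto
    ultimately show "t c' p I' J' = ?S t" using tendsto_unique[OF trivial_limit_at_right_real] by blast
  qed (rule z)
  show "Ck_tensor M l r s t"
    unfolding Ck_tensor_def
  proof (intro conjI T ballI allI)
    fix c and I J :: "'n list" assume c: "c \<in> atlas M"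
    show "Ck_on l (comp_in c t I J) (img c)"
    proof (cases "length I = r \<and> length J = s")
      case True
      then show ?thesis unfolding Ck_on_iff_nat[of l] using C[OF c] conv_Ck_on by blast
    next
      case False
      then have "comp_in c t I J = (\<lambda>x. 0)" using z by (auto simp: comp_in_def)
      then show ?thesis by (simp add: Ck_on_const)
    qed
  qed
  fix c and \<alpha> I J :: "'n list" and K
  assume c: "c \<in> atlas M" and a: "enat (length \<alpha>) \<le> l \<and> length I = r \<and> length J = s \<and> compactin (mtop M) K \<and> K \<subseteq> fst c"
  have "conv (length \<alpha>) (img c) (cnet c w I J) (comp_in c t I J)" using a by (intro C[OF c]) auto
  then have u: "unif_conv (img c) (\<lambda>\<epsilon>. partials \<alpha> (comp_in c (w \<epsilon>) I J)) (partials \<alpha> (comp_in c t I J))"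
    unfolding conv_def by simp
  show "uniform_limit (snd c ` K) (\<lambda>\<epsilon>. partials \<alpha> (comp_in c (w \<epsilon>) I J)) (partials \<alpha> (comp_in c t I J)) (at_right 0)"
    by (rule u[unfolded unif_conv_def, rule_format]) (use a compact_snd_image[OF M c] in auto)
qed

lemma ricci_net_rel:
  assumes r: "(u, v) \<in> net_rel M 1 3"
  shows "((\<lambda>\<epsilon>. ricci M (u \<epsilon>)), (\<lambda>\<epsilon>. ricci M (v \<epsilon>))) \<in> net_rel M 0 2"
proof (rule net_relI[OF M])
  note m = net_rel_mod[OF M r]
  show "is_tensor M 0 2 (ricci M (u \<epsilon>))" "is_tensor M 0 2 (ricci M (v \<epsilon>))" if "\<epsilon> \<in> {0<..1}" for \<epsilon>
    using mod_nets_is_tensor[OF M m(1) that] mod_nets_is_tensor[OF M m(2) that] by (simp_all add: is_tensor_ricci[OF M])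
  fix c and I J :: "'n list" assume c: "c \<in> atlas M" and l: "length I = 0" "length J = 2"
  then obtain a b where IJ: "I = []" "J = [a, b]" using length_2_conv[of J] by auto
  note o = open_img[OF M c]
  have "negl_eq (img c) (\<lambda>\<epsilon> x. \<Sum>k\<in>UNIV. comp_in c (u \<epsilon>) [k] [k, a, b] x) (\<lambda>\<epsilon> x. \<Sum>k\<in>UNIV. comp_in c (v \<epsilon>) [k] [k, a, b] x)"
    using r c by (intro negl_eq_sum o) (simp add: net_rel_iff[OF M])
  then show "negl_eq (img c) (\<lambda>\<epsilon>. comp_in c (ricci M (u \<epsilon>)) I J) (\<lambda>\<epsilon>. comp_in c (ricci M (v \<epsilon>)) I J)"
    unfolding IJ by (rule negl_eq_cong[OF o]) (simp_all add: comp_in_ricci[OF M c])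
qed

lemma full_contract_net_rel:
  assumes h: "(h, h') \<in> net_rel M 2 0" and r: "(u, v) \<in> net_rel M 0 2"
  shows "((\<lambda>\<epsilon>. full_contract M (h \<epsilon>) (u \<epsilon>)), (\<lambda>\<epsilon>. full_contract M (h' \<epsilon>) (v \<epsilon>))) \<in> net_rel M 0 0"
proof (rule net_relI[OF M])
  note m = net_rel_mod[OF M r] and n = net_rel_mod[OF M h]
  show "is_tensor M 0 0 (full_contract M (h \<epsilon>) (u \<epsilon>))" "is_tensor M 0 0 (full_contract M (h' \<epsilon>) (v \<epsilon>))" if "\<epsilon> \<in> {0<..1}" for \<epsilon>
    using mod_nets_is_tensor[OF M m(1) that] mod_nets_is_tensor[OF M m(2) that]
      mod_nets_is_tensor[OF M n(1) that] mod_nets_is_tensor[OF M n(2) that] by (simp_all add: is_tensor_full_contract[OF M])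
  fix c and I J :: "'n list" assume c: "c \<in> atlas M" and l: "length I = 0" "length J = 0"
  then have IJ: "I = []" "J = []" by auto
  note o = open_img[OF M c]
  have "negl_eq (img c) (\<lambda>\<epsilon> x. \<Sum>a\<in>UNIV. \<Sum>b\<in>UNIV. comp_in c (h \<epsilon>) [a, b] [] x * comp_in c (u \<epsilon>) [] [a, b] x)
    (\<lambda>\<epsilon> x. \<Sum>a\<in>UNIV. \<Sum>b\<in>UNIV. comp_in c (h' \<epsilon>) [a, b] [] x * comp_in c (v \<epsilon>) [] [a, b] x)"
    using r h c by (intro negl_eq_sum negl_eq_mult o) (simp_all add: net_rel_iff[OF M])
  then show "negl_eq (img c) (\<lambda>\<epsilon>. comp_in c (full_contract M (h \<epsilon>) (u \<epsilon>)) I J) (\<lambda>\<epsilon>. comp_in c (full_contract M (h' \<epsilon>) (v \<epsilon>)) I J)"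
    unfolding IJ by (rule negl_eq_cong[OF o]) (simp_all add: comp_in_full_contract[OF M c])
qed

lemma einstein_net_rel:
  assumes r: "(u, u') \<in> net_rel M 0 2" and s: "(v, v') \<in> net_rel M 0 0" and g: "(w, w') \<in> net_rel M 0 2"
  shows "((\<lambda>\<epsilon>. einstein (u \<epsilon>) (v \<epsilon>) (w \<epsilon>)), (\<lambda>\<epsilon>. einstein (u' \<epsilon>) (v' \<epsilon>) (w' \<epsilon>))) \<in> net_rel M 0 2"
proof (rule net_relI[OF M])
  note m = net_rel_mod[OF M r] and n = net_rel_mod[OF M s] and q = net_rel_mod[OF M g]
  show "is_tensor M 0 2 (einstein (u \<epsilon>) (v \<epsilon>) (w \<epsilon>))" "is_tensor M 0 2 (einstein (u' \<epsilon>) (v' \<epsilon>) (w' \<epsilon>))" if "\<epsilon> \<in> {0<..1}" for \<epsilon>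
    using mod_nets_is_tensor[OF M m(1) that] mod_nets_is_tensor[OF M m(2) that] mod_nets_is_tensor[OF M n(1) that]
      mod_nets_is_tensor[OF M n(2) that] mod_nets_is_tensor[OF M q(1) that] mod_nets_is_tensor[OF M q(2) that]
    by (simp_all add: is_tensor_einstein[OF M])
  fix c and I J :: "'n list" assume c: "c \<in> atlas M"
  show "negl_eq (img c) (\<lambda>\<epsilon>. comp_in c (einstein (u \<epsilon>) (v \<epsilon>) (w \<epsilon>)) I J) (\<lambda>\<epsilon>. comp_in c (einstein (u' \<epsilon>) (v' \<epsilon>) (w' \<epsilon>)) I J)"
    unfolding comp_in_einstein using r s g c
    by (intro negl_eq_diff negl_eq_cmult negl_eq_mult open_img[OF M c]) (simp_all add: net_rel_iff[OF M])
qed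

end

theorem theorem6p2:
  fixes M :: "('a, 'n::finite) mfd" and k :: enat
    and gh hh Rh :: "('a, 'n) tnet set" and g R :: "('a, 'n) tfield"
    and Dh :: "('a, 'n) tnet set \<Rightarrow> ('a, 'n) tnet set \<Rightarrow> ('a, 'n) tnet set"
    and D :: "('a, 'n) tfield \<Rightarrow> ('a, 'n) tfield \<Rightarrow> ('a, 'n) tfield"
  assumes "smooth_manifold M" and "2 \<le> k"
    and "gen_metric M gh"
    and "Ck_metric M k g" and "associated M k 0 2 gh g"
    and "gen_inv_metric M gh hh"
    and "gen_levi_civita M gh Dh" and "gen_curvature_tensor M Dh Rh"
    and "levi_civita M g D" and "curvature_tensor M D R"
  shows "associated M (k - 2) 1 3 Rh R \<and>
    associated M (k - 2) 0 2 (gen_ricci M Rh) (ricci M R) \<and>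
    associated M (k - 2) 0 0 (gen_scalar_curvature M hh Rh) (scalar_curvature M g R) \<and>
    associated M (k - 2) 0 2 (gen_einstein M gh hh Rh) (einstein_tensor M g R)"
proof -
  note M = assms(1) and k = assms(2) and G = assms(3) and g = assms(4) and H = assms(6) and V = assms(7) and Rh = assms(8)
    and v = assms(9) and R = assms(10)
  note gg = gen_metric_gen[OF M G] and hg = gen_inv_metric_gen[OF M H] and Rg = gen_curvature_tensorD(1)[OF M Rh]
  define h where "h = inv_metric M g"
  obtain u where u: "u \<in> gh" and "\<And>c I J n. c \<in> atlas M \<Longrightarrow> length I = 0 \<Longrightarrow> length J = 2 \<Longrightarrow> enat n \<le> k \<Longrightarrow>
    conv n (img c) (cnet c u I J) (comp_in c g I J)"
    using associated_conv[OF M assms(5)] by blast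
  then have Cg: "conv n (img c) (cnet c u [] [i, j]) (comp_in c g [] [i, j])" if "c \<in> atlas M" "enat n \<le> k" for c n i j
    using that by simp
  obtain w where w: "w \<in> hh" using gen_nonempty[OF M hg] by blast
  obtain \<rho> where rho: "\<rho> \<in> Rh" using gen_nonempty[OF M Rg] by blast
  have Ch: "conv n (img c) (cnet c w [i, j] []) (comp_in c h [i, j] [])" if "c \<in> atlas M" "enat n \<le> k" for c n i j
    unfolding h_def by (rule conv_inv_metric[OF M G H g u w Cg that])
  have k2: "enat (Suc (Suc n)) \<le> k" if "enat n \<le> k - 2" for n
    using that k by (cases k) (auto simp: numeral_eq_enat)
  have k1: "1 \<le> k" using k by (cases k) (auto simp: numeral_eq_enat one_enat_def)
  have k2': "enat (Suc (Suc 0)) \<le> k" using k by (cases k) (auto simp: numeral_eq_enat)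
  have Gam: "Ck_on 1 (christoffel c (inv_metric M g) g m i j) (img c)" if c: "c \<in> atlas M" for c m i j
    using conv_Ck_on[OF conv_christoffel[OF M gg hg u w c Cg[OF c k2'] Ch[OF c k2'], of m i j]]
    by (simp add: h_def one_enat_def)
  have o: "open (img c)" if "c \<in> atlas M" for c by (rule open_img[OF M that])
  have CR: "conv n (img c) (cnet c \<rho> [d] [a, b, e]) (comp_in c R [d] [a, b, e])" if c: "c \<in> atlas M" and n: "enat n \<le> k - 2" for c n d a b e
  proof (rule conv_cong[OF o[OF c] refl])
    show "conv n (img c) (cnet c \<rho> [d] [a, b, e]) (riemann c h g d a b e)"
      by (rule negl_eq_conv[OF o[OF c] gen_curvature[OF M V G H Rh u w rho c]
            conv_riemann[OF M gg hg u w c Cg[OF c k2[OF n]] Ch[OF c k2[OF n]]]])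
    show "riemann c h g d a b e x = comp_in c R [d] [a, b, e] x" if "x \<in> img c" for x
      unfolding h_def by (rule classical_curvature[OF M v g k1 Gam R c that, symmetric])
  qed
  have sm: "smoothnet (img c) (cnet c y I J)" if "y \<in> mod_nets M r s" "c \<in> atlas M" for y c I J r s
    by (rule modnet_smoothnet[OF mod_nets_modnet[OF M that]])
  note rhom = gen_mod_nets[OF M Rg rho] and wm = gen_mod_nets[OF M hg w] and um = gen_mod_nets[OF M gg u]
  have Rt: "is_tensor M 1 3 R" using R by (simp add: curvature_tensor_def)
  have 1: "associated M (k - 2) 1 3 Rh R"
  proof (rule associatedI[OF M Rg rho])
    show "R c p I J = 0" if "\<not> (c \<in> atlas M \<and> p \<in> fst c \<and> length I = 1 \<and> length J = 3)" for c p I J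
      by (rule is_tensor_zero[OF M Rt that])
    show "conv n (img c) (cnet c \<rho> I J) (comp_in c R I J)"
      if c: "c \<in> atlas M" and l: "length I = 1" "length J = 3" and n: "enat n \<le> k - 2" for c I J n
    proof -
      obtain d where "I = [d]" using l(1) length_1_conv[of I] by auto
      moreover obtain a b e where "J = [a, b, e]" using l(2) by (auto simp: numeral_3_eq_3 length_Suc_conv)
      ultimately show ?thesis using CR[OF c n] by simp
    qed
  qed
  let ?ric = "\<lambda>\<epsilon>. ricci M (\<rho> \<epsilon>)"
  have ric: "gen_ricci M Rh = net_class M 0 2 ?ric"
    unfolding gen_ricci_def by (rule glift1_eq[OF M rho]) (rule ricci_net_rel[OF M gen_net_rel[OF M Rg _ rho]])
  have ricm: "?ric \<in> mod_nets M 0 2" by (rule net_rel_mod(1)[OF M ricci_net_rel[OF M gen_net_rel[OF M Rg rho rho]]])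
  have ricg: "gen_ricci M Rh \<in> gen_tensors M 0 2" unfolding ric by (rule net_class_gen[OF M ricm])
  have ricin: "?ric \<in> gen_ricci M Rh" unfolding ric by (rule net_class_self[OF M ricm])
  have Cric: "conv n (img c) (cnet c ?ric [] [a, b]) (comp_in c (ricci M R) [] [a, b])" if c: "c \<in> atlas M" and n: "enat n \<le> k - 2" for c n a b
  proof (rule conv_cong[OF o[OF c]])
    show "conv n (img c) (\<lambda>\<epsilon> x. \<Sum>k\<in>UNIV. comp_in c (\<rho> \<epsilon>) [k] [k, a, b] x) (\<lambda>x. \<Sum>k\<in>UNIV. comp_in c R [k] [k, a, b] x)"
      by (intro conv_sum o[OF c] sm[OF rhom c] CR[OF c n])
  qed (simp_all add: comp_in_ricci[OF M c])
  have 2: "associated M (k - 2) 0 2 (gen_ricci M Rh) (ricci M R)"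
  proof (rule associatedI[OF M ricg ricin])
    show "ricci M R c p I J = 0" if "\<not> (c \<in> atlas M \<and> p \<in> fst c \<and> length I = 0 \<and> length J = 2)" for c p I J
      using that by (auto simp: ricci_def fld_def)
    show "conv n (img c) (cnet c ?ric I J) (comp_in c (ricci M R) I J)"
      if c: "c \<in> atlas M" and l: "length I = 0" "length J = 2" and n: "enat n \<le> k - 2" for c I J n
      using l length_2_conv[of J] Cric[OF c n] by auto
  qed
  let ?sc = "\<lambda>\<epsilon>. full_contract M (w \<epsilon>) (?ric \<epsilon>)"
  have sc: "gen_scalar_curvature M hh Rh = net_class M 0 0 ?sc"
    unfolding gen_scalar_curvature_def
    by (rule glift2_eq[OF M w ricin]) (rule full_contract_net_rel[OF M gen_net_rel[OF M hg _ w] gen_net_rel[OF M ricg _ ricin]])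
  have scm: "?sc \<in> mod_nets M 0 0"
    by (rule net_rel_mod(1)[OF M full_contract_net_rel[OF M gen_net_rel[OF M hg w w] gen_net_rel[OF M ricg ricin ricin]]])
  have scg: "gen_scalar_curvature M hh Rh \<in> gen_tensors M 0 0" unfolding sc by (rule net_class_gen[OF M scm])
  have scin: "?sc \<in> gen_scalar_curvature M hh Rh" unfolding sc by (rule net_class_self[OF M scm])
  have Csc: "conv n (img c) (cnet c ?sc [] []) (comp_in c (scalar_curvature M g R) [] [])" if c: "c \<in> atlas M" and n: "enat n \<le> k - 2" for c n
  proof (rule conv_cong[OF o[OF c]])
    have nk: "enat n \<le> k" using k2[OF n] by (cases k) auto
    show "conv n (img c) (\<lambda>\<epsilon> x. \<Sum>a\<in>UNIV. \<Sum>b\<in>UNIV. comp_in c (w \<epsilon>) [a, b] [] x * comp_in c (?ric \<epsilon>) [] [a, b] x)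
      (\<lambda>x. \<Sum>a\<in>UNIV. \<Sum>b\<in>UNIV. comp_in c h [a, b] [] x * comp_in c (ricci M R) [] [a, b] x)"
      by (intro conv_sum conv_mult smoothnet_sum smoothnet_mult o[OF c] sm[OF wm c] sm[OF ricm c] Ch[OF c nk] Cric[OF c n])
  qed (simp_all add: comp_in_full_contract[OF M c] scalar_curvature_def h_def)
  have 3: "associated M (k - 2) 0 0 (gen_scalar_curvature M hh Rh) (scalar_curvature M g R)"
  proof (rule associatedI[OF M scg scin])
    show "scalar_curvature M g R c p I J = 0" if "\<not> (c \<in> atlas M \<and> p \<in> fst c \<and> length I = 0 \<and> length J = 0)" for c p I J
      using that by (auto simp: scalar_curvature_def full_contract_def fld_def)
    show "conv n (img c) (cnet c ?sc I J) (comp_in c (scalar_curvature M g R) I J)"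
      if c: "c \<in> atlas M" and l: "length I = 0" "length J = 0" and n: "enat n \<le> k - 2" for c I J n
      using l Csc[OF c n] by simp
  qed
  let ?ein = "\<lambda>\<epsilon>. einstein (?ric \<epsilon>) (?sc \<epsilon>) (u \<epsilon>)"
  have ein: "gen_einstein M gh hh Rh = net_class M 0 2 ?ein"
    unfolding gen_einstein_def
    by (rule glift3_eq[OF M ricin scin u])
      (rule einstein_net_rel[OF M gen_net_rel[OF M ricg _ ricin] gen_net_rel[OF M scg _ scin] gen_net_rel[OF M gg _ u]])
  have einm: "?ein \<in> mod_nets M 0 2"
    by (rule net_rel_mod(1)[OF M einstein_net_rel[OF M gen_net_rel[OF M ricg ricin ricin] gen_net_rel[OF M scg scin scin] gen_net_rel[OF M gg u u]]])
  have 4: "associated M (k - 2) 0 2 (gen_einstein M gh hh Rh) (einstein_tensor M g R)"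
    unfolding ein
  proof (rule associatedI[OF M net_class_gen[OF M einm] net_class_self[OF M einm]])
    have gt: "is_tensor M 0 2 g" using g by (simp add: Ck_metric_def Ck_tensor_def)
    show "einstein_tensor M g R c p I J = 0" if "\<not> (c \<in> atlas M \<and> p \<in> fst c \<and> length I = 0 \<and> length J = 2)" for c p I J
    proof -
      have "g c p I J = 0" by (rule is_tensor_zero[OF M gt that])
      moreover have "ricci M R c p I J = 0" using that by (auto simp: ricci_def fld_def)
      ultimately show ?thesis by (simp add: einstein_tensor_def einstein_def tsub_def tscale_def fmul_def)
    qed
    show "conv n (img c) (cnet c ?ein I J) (comp_in c (einstein_tensor M g R) I J)"
      if c: "c \<in> atlas M" and l: "length I = 0" "length J = 2" and n: "enat n \<le> k - 2" for c I J n
    proof -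
      have nk: "enat n \<le> k" using k2[OF n] by (cases k) auto
      obtain a b where IJ: "I = []" "J = [a, b]" using l length_2_conv[of J] by auto
      show ?thesis unfolding IJ einstein_tensor_def comp_in_einstein
        by (intro conv_diff conv_cmult conv_mult smoothnet_mult smoothnet_const o[OF c] sm[OF ricm c] sm[OF scm c] sm[OF um c]
          Cric[OF c n] Csc[OF c n] Cg[OF c nk])
    qed
  qed
  from 1 2 3 4 show ?thesis by blast
qed

end
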